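(* Let $(R,\mathfrak{m})$ be a commutative Noetherian local ring, let $\mathfrak{a},J$ be ideals of $R$, let $M$ be a non-zero finitely generated $R$-module and let $t\geq 1$ be an integer. The following statements are equivalent: (1) $\check{\mathfrak{F}}^i_{\mathfrak{a},\mathfrak{m},J}(M)=0$ for all $i\geq t$; (2) $\check{\mathfrak{F}}^i_{\mathfrak{a},\mathfrak{m},J}(M)$ is finitely generated for all $i\geq t$; (3) $\check{\mathfrak{F}}^i_{\mathfrak{a},\mathfrak{m},J}(R/\mathfrak{p})=0$ for all $i\geq t$ and all $\mathfrak{p}\in\mathrm{Supp}\, M$; (4) $\check{\mathfrak{F}}^i_{\mathfrak{a},\mathfrak{m},J}(R/\mathfrak{p})$ is finitely generated for all $i\geq t$ and all $\mathfrak{p}\in\mathrm{Supp}\, M$.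
   Context: For $x\in R$ and an ideal $J$, let $R_{x,J}$ be the localization of $R$ at the multiplicative set $\{x^n+j : n\ge 0,\ j\in J\}$. For $\underline{x}=x_1,\dots,x_r$ let $\check{C}_{\underline{x},J}=\bigotimes_{k=1}^r (0\to R\to R_{x_k,J}\to 0)$, with $R$ in degree $0$ in each factor (for $J=0$ this is the usual Čech complex). For ideals $\mathfrak{a},I,J$ and an $R$-module $M$, choose $\underline{x}$ with $\mathrm{Rad}(\underline{x}R)=\mathrm{Rad}(I)$ and set $\check{\mathfrak{F}}^i_{\mathfrak{a},I,J}(M):=H^i(\varprojlim_n(\check{C}_{\underline{x},J}\otimes_R M/\mathfrak{a}^nM))$, the $i$th Čech-formal local cohomology module of $M$ with respect to $(I,J)$; here $I=\mathfrak{m}$. *)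

theory Defs
  imports "HOL-Algebra.Module" "HOL-Algebra.Ideal_Product" "HOL-Algebra.Ring_Divisibility"
begin

text \<open>
  Modules are records of the library type \<open>module\<close>; its ring fields \<open>mult\<close> and \<open>one\<close> play no
  role for a module and are left unspecified in the constructions below.
\<close>

section \<open>Rings and ideals\<close>

definition local_ring :: "('a, 'm) ring_scheme \<Rightarrow> 'a set \<Rightarrow> bool" where
  "local_ring R \<mm> \<longleftrightarrow> cring R \<and> maximalideal \<mm> R \<and> (\<forall>I. maximalideal I R \<longrightarrow> I = \<mm>)"

definition radical :: "('a, 'm) ring_scheme \<Rightarrow> 'a set \<Rightarrow> 'a set" where
  "radical R I = {x \<in> carrier R. \<exists>n::nat. x [^]\<^bsub>R\<^esub> n \<in> I}"

definition regular_module :: "('a, 'm) ring_scheme \<Rightarrow> ('a, 'a) module" where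
  "regular_module R =
     \<lparr>carrier = carrier R, monoid.mult = monoid.mult R, one = \<one>\<^bsub>R\<^esub>, ring.zero = \<zero>\<^bsub>R\<^esub>,
      add = add R, smult = monoid.mult R\<rparr>"


section \<open>Submodules, quotients, direct sums, inverse limits\<close>

definition submodule_gen ::
  "('a, 'm) ring_scheme \<Rightarrow> ('a, 'b) module \<Rightarrow> 'b set \<Rightarrow> 'b set" where
  "submodule_gen R M A = \<Inter>{H. submodule H R M \<and> A \<subseteq> H}"

definition fin_gen_module :: "('a, 'm) ring_scheme \<Rightarrow> ('a, 'b) module \<Rightarrow> bool" where
  "fin_gen_module R M \<longleftrightarrow>
     (\<exists>A. finite A \<and> A \<subseteq> carrier M \<and> submodule_gen R M A = carrier M)"

definition trivial_module :: "('a, 'b) module \<Rightarrow> bool" where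
  "trivial_module M \<longleftrightarrow> carrier M = {\<zero>\<^bsub>M\<^esub>}"

definition quot_module :: "('a, 'b) module \<Rightarrow> 'b set \<Rightarrow> ('a, 'b set) module" where
  "quot_module M N =
     \<lparr>carrier = a_rcosets\<^bsub>M\<^esub> N, monoid.mult = undefined, one = undefined, ring.zero = N, add = set_add M,
      smult = (\<lambda>r X. \<Union>x\<in>X. N +>\<^bsub>M\<^esub> (r \<odot>\<^bsub>M\<^esub> x))\<rparr>"

definition direct_sum ::
  "'e set \<Rightarrow> ('e \<Rightarrow> ('a, 'b) module) \<Rightarrow> ('a, 'e \<Rightarrow> 'b) module" where
  "direct_sum E N =
     \<lparr>carrier = {f \<in> (\<Pi>\<^sub>E e\<in>E. carrier (N e)). finite {e \<in> E. f e \<noteq> \<zero>\<^bsub>N e\<^esub>}},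
      monoid.mult = undefined, one = undefined, ring.zero = (\<lambda>e\<in>E. \<zero>\<^bsub>N e\<^esub>),
      add = (\<lambda>f g. \<lambda>e\<in>E. f e \<oplus>\<^bsub>N e\<^esub> g e),
      smult = (\<lambda>r f. \<lambda>e\<in>E. r \<odot>\<^bsub>N e\<^esub> f e)\<rparr>"

definition direct_sum_inj ::
  "'e set \<Rightarrow> ('e \<Rightarrow> ('a, 'b) module) \<Rightarrow> 'e \<Rightarrow> 'b \<Rightarrow> 'e \<Rightarrow> 'b" where
  "direct_sum_inj E N e x = (\<lambda>e'\<in>E. if e' = e then x else \<zero>\<^bsub>N e'\<^esub>)"

definition inverse_limit ::
  "(nat \<Rightarrow> ('a, 'b) module) \<Rightarrow> (nat \<Rightarrow> 'b \<Rightarrow> 'b) \<Rightarrow> ('a, nat \<Rightarrow> 'b) module" where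
  "inverse_limit N \<phi> =
     \<lparr>carrier = {f. \<forall>n. f n \<in> carrier (N n) \<and> \<phi> n (f (Suc n)) = f n},
      monoid.mult = undefined, one = undefined, ring.zero = (\<lambda>n. \<zero>\<^bsub>N n\<^esub>),
      add = (\<lambda>f g n. f n \<oplus>\<^bsub>N n\<^esub> g n),
      smult = (\<lambda>r f n. r \<odot>\<^bsub>N n\<^esub> f n)\<rparr>"

text \<open>Transport of structure along a map that is injective on the carrier.\<close>

definition image_module :: "('b \<Rightarrow> 'c) \<Rightarrow> ('a, 'b) module \<Rightarrow> ('a, 'c) module" where
  "image_module h M =
     \<lparr>carrier = h ` carrier M, monoid.mult = undefined, one = undefined, ring.zero = h \<zero>\<^bsub>M\<^esub>,
      add = (\<lambda>x y. h (inv_into (carrier M) h x \<oplus>\<^bsub>M\<^esub> inv_into (carrier M) h y)),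
      smult = (\<lambda>r x. h (r \<odot>\<^bsub>M\<^esub> inv_into (carrier M) h x))\<rparr>"

definition zero_module :: "'b \<Rightarrow> ('a, 'b) module" where
  "zero_module z =
     \<lparr>carrier = {z}, monoid.mult = undefined, one = undefined, ring.zero = z,
      add = (\<lambda>_ _. z), smult = (\<lambda>_ _. z)\<rparr>"


section \<open>Localization and support\<close>

definition frac_rel ::
  "('a, 'm) ring_scheme \<Rightarrow> 'a set \<Rightarrow> ('a, 'b) module \<Rightarrow> (('b \<times> 'a) \<times> ('b \<times> 'a)) set" where
  "frac_rel R S M =
     {((x, s), (y, t)). x \<in> carrier M \<and> s \<in> S \<and> y \<in> carrier M \<and> t \<in> S \<and>
        (\<exists>u\<in>S. u \<odot>\<^bsub>M\<^esub> (t \<odot>\<^bsub>M\<^esub> x \<ominus>\<^bsub>M\<^esub> s \<odot>\<^bsub>M\<^esub> y) = \<zero>\<^bsub>M\<^esub>)}"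

text \<open>The localization at \<open>S\<close>, considered as an \<open>R\<close>-module.\<close>

definition localization ::
  "('a, 'm) ring_scheme \<Rightarrow> 'a set \<Rightarrow> ('a, 'b) module \<Rightarrow> ('a, ('b \<times> 'a) set) module" where
  "localization R S M =
     \<lparr>carrier = (carrier M \<times> S) // frac_rel R S M, monoid.mult = undefined, one = undefined,
      ring.zero = frac_rel R S M `` {(\<zero>\<^bsub>M\<^esub>, \<one>\<^bsub>R\<^esub>)},
      add = (\<lambda>X Y. \<Union>(x, s)\<in>X. \<Union>(y, t)\<in>Y.
               frac_rel R S M `` {(t \<odot>\<^bsub>M\<^esub> x \<oplus>\<^bsub>M\<^esub> s \<odot>\<^bsub>M\<^esub> y, s \<otimes>\<^bsub>R\<^esub> t)}),
      smult = (\<lambda>r X. \<Union>(x, s)\<in>X. frac_rel R S M `` {(r \<odot>\<^bsub>M\<^esub> x, s)})\<rparr>"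

definition supp :: "('a, 'm) ring_scheme \<Rightarrow> ('a, 'b) module \<Rightarrow> 'a set set" where
  "supp R M =
     {\<pp>. primeideal \<pp> R \<and> \<not> trivial_module (localization R (carrier R - \<pp>) M)}"

definition mult_set :: "('a, 'm) ring_scheme \<Rightarrow> 'a \<Rightarrow> 'a set \<Rightarrow> 'a set" where
  "mult_set R x J = {x [^]\<^bsub>R\<^esub> n \<oplus>\<^bsub>R\<^esub> j | (n::nat) j. j \<in> J}"

abbreviation loc_xJ ::
  "('a, 'm) ring_scheme \<Rightarrow> 'a \<Rightarrow> 'a set \<Rightarrow> ('a, ('a \<times> 'a) set) module" where
  "loc_xJ R x J \<equiv> localization R (mult_set R x J) (regular_module R)"


section \<open>Tensor products\<close>

text \<open>
  A tensor product is the free module on the tuples of elements modulo the (multi)linearity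
  relations.
\<close>

definition free_module :: "('a, 'm) ring_scheme \<Rightarrow> 'x set \<Rightarrow> ('a, 'x \<Rightarrow> 'a) module" where
  "free_module R X =
     \<lparr>carrier = {u. (\<forall>c. u c \<in> carrier R) \<and> {c. u c \<noteq> \<zero>\<^bsub>R\<^esub>} \<subseteq> X \<and> finite {c. u c \<noteq> \<zero>\<^bsub>R\<^esub>}},
      monoid.mult = undefined, one = undefined, ring.zero = (\<lambda>c. \<zero>\<^bsub>R\<^esub>),
      add = (\<lambda>u v c. u c \<oplus>\<^bsub>R\<^esub> v c),
      smult = (\<lambda>r u c. r \<otimes>\<^bsub>R\<^esub> u c)\<rparr>"

definition free_gen :: "('a, 'm) ring_scheme \<Rightarrow> 'x \<Rightarrow> 'x \<Rightarrow> 'a" where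
  "free_gen R c = (\<lambda>c'. if c' = c then \<one>\<^bsub>R\<^esub> else \<zero>\<^bsub>R\<^esub>)"

definition free_lift ::
  "('a, 'm) ring_scheme \<Rightarrow> ('a, 'b) module \<Rightarrow> ('x \<Rightarrow> 'b) \<Rightarrow> ('x \<Rightarrow> 'a) \<Rightarrow> 'b" where
  "free_lift R N \<phi> u = (\<Oplus>\<^bsub>N\<^esub>c\<in>{c. u c \<noteq> \<zero>\<^bsub>R\<^esub>}. u c \<odot>\<^bsub>N\<^esub> \<phi> c)"

text \<open>
  The linear map on a tensor product induced by a (multi)linear map \<open>\<phi>\<close>: the linear extension
  of \<open>\<phi>\<close> is constant on each class, and this constant is the value.
\<close>

definition tensor_lift ::
  "('a, 'm) ring_scheme \<Rightarrow> ('a, 'b) module \<Rightarrow> ('x \<Rightarrow> 'b) \<Rightarrow> ('x \<Rightarrow> 'a) set \<Rightarrow> 'b" where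
  "tensor_lift R N \<phi> X = the_elem (free_lift R N \<phi> ` X)"

definition bilinear_rels ::
  "('a, 'm) ring_scheme \<Rightarrow> ('a, 'b) module \<Rightarrow> ('a, 'c) module \<Rightarrow> ('b \<times> 'c \<Rightarrow> 'a) set" where
  "bilinear_rels R M N =
     (let F = free_module R (carrier M \<times> carrier N); g = free_gen R in
       {g (x \<oplus>\<^bsub>M\<^esub> x', y) \<ominus>\<^bsub>F\<^esub> (g (x, y) \<oplus>\<^bsub>F\<^esub> g (x', y)) | x x' y.
          x \<in> carrier M \<and> x' \<in> carrier M \<and> y \<in> carrier N} \<union>
       {g (x, y \<oplus>\<^bsub>N\<^esub> y') \<ominus>\<^bsub>F\<^esub> (g (x, y) \<oplus>\<^bsub>F\<^esub> g (x, y')) | x y y'.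
          x \<in> carrier M \<and> y \<in> carrier N \<and> y' \<in> carrier N} \<union>
       {g (r \<odot>\<^bsub>M\<^esub> x, y) \<ominus>\<^bsub>F\<^esub> r \<odot>\<^bsub>F\<^esub> g (x, y) | r x y.
          r \<in> carrier R \<and> x \<in> carrier M \<and> y \<in> carrier N} \<union>
       {g (x, r \<odot>\<^bsub>N\<^esub> y) \<ominus>\<^bsub>F\<^esub> r \<odot>\<^bsub>F\<^esub> g (x, y) | r x y.
          r \<in> carrier R \<and> x \<in> carrier M \<and> y \<in> carrier N})"

definition bilinear_kernel ::
  "('a, 'm) ring_scheme \<Rightarrow> ('a, 'b) module \<Rightarrow> ('a, 'c) module \<Rightarrow> ('b \<times> 'c \<Rightarrow> 'a) set" where
  "bilinear_kernel R M N =
     submodule_gen R (free_module R (carrier M \<times> carrier N)) (bilinear_rels R M N)"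

definition tensor ::
  "('a, 'm) ring_scheme \<Rightarrow> ('a, 'b) module \<Rightarrow> ('a, 'c) module \<Rightarrow> ('a, ('b \<times> 'c \<Rightarrow> 'a) set) module"
where
  "tensor R M N =
     quot_module (free_module R (carrier M \<times> carrier N)) (bilinear_kernel R M N)"

definition pure_tensor ::
  "('a, 'm) ring_scheme \<Rightarrow> ('a, 'b) module \<Rightarrow> ('a, 'c) module \<Rightarrow> 'b \<Rightarrow> 'c \<Rightarrow> ('b \<times> 'c \<Rightarrow> 'a) set"
where
  "pure_tensor R M N x y =
     bilinear_kernel R M N +>\<^bsub>free_module R (carrier M \<times> carrier N)\<^esub> free_gen R (x, y)"

text \<open>\<open>tensor_map R M' N' f g\<close> is the map \<open>f \<otimes> g\<close> with values in the tensor product of \<open>M'\<close> and \<open>N'\<close>.\<close>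

definition tensor_map ::
  "('a, 'm) ring_scheme \<Rightarrow> ('a, 'b) module \<Rightarrow> ('a, 'c) module \<Rightarrow>
   ('d \<Rightarrow> 'b) \<Rightarrow> ('e \<Rightarrow> 'c) \<Rightarrow> ('d \<times> 'e \<Rightarrow> 'a) set \<Rightarrow> ('b \<times> 'c \<Rightarrow> 'a) set" where
  "tensor_map R M' N' f g =
     tensor_lift R (tensor R M' N') (\<lambda>(x, y). pure_tensor R M' N' (f x) (g y))"

text \<open>
  The tensor product of a family of modules. The iterated binary product of a list of
  modules of variable length would not have a fixed type.
\<close>

definition multilinear_rels ::
  "('a, 'm) ring_scheme \<Rightarrow> 'k set \<Rightarrow> ('k \<Rightarrow> ('a, 'b) module) \<Rightarrow> (('k \<Rightarrow> 'b) \<Rightarrow> 'a) set" where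
  "multilinear_rels R K N =
     (let F = free_module R (\<Pi>\<^sub>E k\<in>K. carrier (N k)); g = free_gen R in
       {g (c(k := x \<oplus>\<^bsub>N k\<^esub> y)) \<ominus>\<^bsub>F\<^esub> (g (c(k := x)) \<oplus>\<^bsub>F\<^esub> g (c(k := y))) | c k x y.
          c \<in> (\<Pi>\<^sub>E k\<in>K. carrier (N k)) \<and> k \<in> K \<and> x \<in> carrier (N k) \<and> y \<in> carrier (N k)} \<union>
       {g (c(k := r \<odot>\<^bsub>N k\<^esub> x)) \<ominus>\<^bsub>F\<^esub> r \<odot>\<^bsub>F\<^esub> g (c(k := x)) | c k r x.
          c \<in> (\<Pi>\<^sub>E k\<in>K. carrier (N k)) \<and> k \<in> K \<and> r \<in> carrier R \<and> x \<in> carrier (N k)})"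

definition multilinear_kernel ::
  "('a, 'm) ring_scheme \<Rightarrow> 'k set \<Rightarrow> ('k \<Rightarrow> ('a, 'b) module) \<Rightarrow> (('k \<Rightarrow> 'b) \<Rightarrow> 'a) set" where
  "multilinear_kernel R K N =
     submodule_gen R (free_module R (\<Pi>\<^sub>E k\<in>K. carrier (N k))) (multilinear_rels R K N)"

definition tensor_family ::
  "('a, 'm) ring_scheme \<Rightarrow> 'k set \<Rightarrow> ('k \<Rightarrow> ('a, 'b) module) \<Rightarrow> ('a, (('k \<Rightarrow> 'b) \<Rightarrow> 'a) set) module"
where
  "tensor_family R K N =
     quot_module (free_module R (\<Pi>\<^sub>E k\<in>K. carrier (N k))) (multilinear_kernel R K N)"

definition pure_tensor_family ::
  "('a, 'm) ring_scheme \<Rightarrow> 'k set \<Rightarrow> ('k \<Rightarrow> ('a, 'b) module) \<Rightarrow> ('k \<Rightarrow> 'b) \<Rightarrow> (('k \<Rightarrow> 'b) \<Rightarrow> 'a) set"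
where
  "pure_tensor_family R K N c =
     multilinear_kernel R K N +>\<^bsub>free_module R (\<Pi>\<^sub>E k\<in>K. carrier (N k))\<^esub> free_gen R c"


section \<open>Cochain complexes in non-negative degrees\<close>

record ('a, 'b) cochain =
  obj :: "nat \<Rightarrow> ('a, 'b) module"
  diff :: "nat \<Rightarrow> 'b \<Rightarrow> 'b"  \<comment> \<open>\<open>diff C i\<close> maps degree \<open>i\<close> to degree \<open>i + 1\<close>\<close>

definition cocycles :: "('a, 'b) cochain \<Rightarrow> nat \<Rightarrow> 'b set" where
  "cocycles C i = {x \<in> carrier (obj C i). diff C i x = \<zero>\<^bsub>obj C (Suc i)\<^esub>}"

definition coboundaries :: "('a, 'b) cochain \<Rightarrow> nat \<Rightarrow> 'b set" where
  "coboundaries C i =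
     (case i of 0 \<Rightarrow> {\<zero>\<^bsub>obj C 0\<^esub>} | Suc j \<Rightarrow> diff C j ` carrier (obj C j))"

definition cohomology :: "('a, 'b) cochain \<Rightarrow> nat \<Rightarrow> ('a, 'b set) module" where
  "cohomology C i = quot_module ((obj C i)\<lparr>carrier := cocycles C i\<rparr>) (coboundaries C i)"

definition inverse_limit_cochain ::
  "(nat \<Rightarrow> ('a, 'b) cochain) \<Rightarrow> (nat \<Rightarrow> nat \<Rightarrow> 'b \<Rightarrow> 'b) \<Rightarrow> ('a, nat \<Rightarrow> 'b) cochain" where
  "inverse_limit_cochain C \<phi> =
     \<lparr>obj = (\<lambda>i. inverse_limit (\<lambda>n. obj (C n) i) (\<lambda>n. \<phi> n i)),
      diff = (\<lambda>i f n. diff (C n) i (f n))\<rparr>"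

text \<open>The tensor product of a complex with a module placed in degree \<open>0\<close>.\<close>

definition tensor_cochain_module ::
  "('a, 'm) ring_scheme \<Rightarrow> ('a, 'b) cochain \<Rightarrow> ('a, 'c) module \<Rightarrow>
   ('a, ('b \<times> 'c \<Rightarrow> 'a) set) cochain" where
  "tensor_cochain_module R C N =
     \<lparr>obj = (\<lambda>i. tensor R (obj C i) N),
      diff = (\<lambda>i. tensor_map R (obj C (Suc i)) N (diff C i) (\<lambda>y. y))\<rparr>"

text \<open>
  The tensor product of complexes \<open>C 0, \<dots>, C (r - 1)\<close>. Its degree \<open>i\<close> part is the direct sum, over
  the multidegrees \<open>e\<close> of total degree \<open>i\<close>, of the tensor products of the \<open>C k\<close> in degree \<open>e k\<close>;
  the differential follows the Koszul sign rule: it sends the tensor of \<open>c 0, \<dots>, c (r - 1)\<close> in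
  multidegree \<open>e\<close> to the sum over \<open>k\<close> of \<open>(-1)^(e 0 + \<dots> + e (k - 1))\<close> times the tensor obtained
  by applying the differential of \<open>C k\<close> to \<open>c k\<close>.
\<close>

definition multidegrees :: "nat \<Rightarrow> nat \<Rightarrow> (nat \<Rightarrow> nat) set" where
  "multidegrees r i = {e \<in> (\<Pi>\<^sub>E k\<in>{..<r}. UNIV). (\<Sum>k<r. e k) = i}"

definition tensor_part ::
  "('a, 'm) ring_scheme \<Rightarrow> nat \<Rightarrow> (nat \<Rightarrow> ('a, 'b) cochain) \<Rightarrow> (nat \<Rightarrow> nat) \<Rightarrow>
   ('a, ((nat \<Rightarrow> 'b) \<Rightarrow> 'a) set) module" where
  "tensor_part R r C e = tensor_family R {..<r} (\<lambda>k. obj (C k) (e k))"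

definition tensor_cochain_obj ::
  "('a, 'm) ring_scheme \<Rightarrow> nat \<Rightarrow> (nat \<Rightarrow> ('a, 'b) cochain) \<Rightarrow> nat \<Rightarrow>
   ('a, (nat \<Rightarrow> nat) \<Rightarrow> ((nat \<Rightarrow> 'b) \<Rightarrow> 'a) set) module" where
  "tensor_cochain_obj R r C i = direct_sum (multidegrees r i) (tensor_part R r C)"

definition tensor_cochain_diff ::
  "('a, 'm) ring_scheme \<Rightarrow> nat \<Rightarrow> (nat \<Rightarrow> ('a, 'b) cochain) \<Rightarrow> nat \<Rightarrow>
   ((nat \<Rightarrow> nat) \<Rightarrow> ((nat \<Rightarrow> 'b) \<Rightarrow> 'a) set) \<Rightarrow> ((nat \<Rightarrow> nat) \<Rightarrow> ((nat \<Rightarrow> 'b) \<Rightarrow> 'a) set)" where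
  "tensor_cochain_diff R r C i f =
     (let D = tensor_cochain_obj R r C (Suc i) in
       \<Oplus>\<^bsub>D\<^esub>e\<in>multidegrees r i.
         tensor_lift R D
           (\<lambda>c. \<Oplus>\<^bsub>D\<^esub>k\<in>{..<r}.
              (\<ominus>\<^bsub>R\<^esub> \<one>\<^bsub>R\<^esub>) [^]\<^bsub>R\<^esub> (\<Sum>l<k. e l) \<odot>\<^bsub>D\<^esub>
              direct_sum_inj (multidegrees r (Suc i)) (tensor_part R r C) (e(k := Suc (e k)))
                (pure_tensor_family R {..<r} (\<lambda>l. obj (C l) ((e(k := Suc (e k))) l))
                   (c(k := diff (C k) (e k) (c k)))))
           (f e))"

definition tensor_cochain ::
  "('a, 'm) ring_scheme \<Rightarrow> nat \<Rightarrow> (nat \<Rightarrow> ('a, 'b) cochain) \<Rightarrow>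
   ('a, (nat \<Rightarrow> nat) \<Rightarrow> ((nat \<Rightarrow> 'b) \<Rightarrow> 'a) set) cochain" where
  "tensor_cochain R r C =
     \<lparr>obj = tensor_cochain_obj R r C, diff = tensor_cochain_diff R r C\<rparr>"


section \<open>Cech-formal local cohomology\<close>

text \<open>
  The complex \<open>0 \<rightarrow> R \<rightarrow> R_{x,J} \<rightarrow> 0\<close> with \<open>R\<close> in degree \<open>0\<close> and the canonical map as
  differential. The sum type only serves to give all terms the same type.
\<close>

definition cech_factor ::
  "('a, 'm) ring_scheme \<Rightarrow> 'a \<Rightarrow> 'a set \<Rightarrow> ('a, 'a + ('a \<times> 'a) set) cochain" where
  "cech_factor R x J =
     \<lparr>obj = (\<lambda>i. if i = 0 then image_module Inl (regular_module R)
                 else if i = 1 then image_module Inr (loc_xJ R x J)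
                 else zero_module (Inl \<zero>\<^bsub>R\<^esub>)),
      diff = (\<lambda>i z. if i = 0
                 then Inr (frac_rel R (mult_set R x J) (regular_module R) `` {(projl z, \<one>\<^bsub>R\<^esub>)})
                 else Inl \<zero>\<^bsub>R\<^esub>)\<rparr>"

type_synonym 'a cech =
  "(nat \<Rightarrow> nat) \<Rightarrow> ((nat \<Rightarrow> 'a + ('a \<times> 'a) set) \<Rightarrow> 'a) set"

definition cech_complex ::
  "('a, 'm) ring_scheme \<Rightarrow> 'a list \<Rightarrow> 'a set \<Rightarrow> ('a, 'a cech) cochain" where
  "cech_complex R xs J = tensor_cochain R (length xs) (\<lambda>k. cech_factor R (xs ! k) J)"

text \<open>The submodule \<open>\<aa>^n M\<close>; powers of ideals are taken in the library's semiring of ideals.\<close>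

definition ideal_pow_smult ::
  "('a, 'm) ring_scheme \<Rightarrow> 'a set \<Rightarrow> nat \<Rightarrow> ('a, 'b) module \<Rightarrow> 'b set" where
  "ideal_pow_smult R \<aa> n M =
     submodule_gen R M {r \<odot>\<^bsub>M\<^esub> x | r x. r \<in> \<aa> [^]\<^bsub>ideals_set R\<^esub> n \<and> x \<in> carrier M}"

abbreviation quot_pow ::
  "('a, 'm) ring_scheme \<Rightarrow> 'a set \<Rightarrow> ('a, 'b) module \<Rightarrow> nat \<Rightarrow> ('a, 'b set) module" where
  "quot_pow R \<aa> M n \<equiv> quot_module M (ideal_pow_smult R \<aa> n M)"

text \<open>The canonical map \<open>M / \<aa>^(n+1) M \<rightarrow> M / \<aa>^n M\<close>.\<close>

definition quot_pow_proj ::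
  "('a, 'm) ring_scheme \<Rightarrow> 'a set \<Rightarrow> ('a, 'b) module \<Rightarrow> nat \<Rightarrow> 'b set \<Rightarrow> 'b set" where
  "quot_pow_proj R \<aa> M n X = (\<Union>x\<in>X. ideal_pow_smult R \<aa> n M +>\<^bsub>M\<^esub> x)"

definition cech_formal_complex ::
  "('a, 'm) ring_scheme \<Rightarrow> 'a set \<Rightarrow> 'a list \<Rightarrow> 'a set \<Rightarrow> ('a, 'b) module \<Rightarrow>
   ('a, nat \<Rightarrow> ('a cech \<times> 'b set \<Rightarrow> 'a) set) cochain" where
  "cech_formal_complex R \<aa> xs J M =
     inverse_limit_cochain
       (\<lambda>n. tensor_cochain_module R (cech_complex R xs J) (quot_pow R \<aa> M n))
       (\<lambda>n i. tensor_map R (obj (cech_complex R xs J) i) (quot_pow R \<aa> M n)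
                (\<lambda>z. z) (quot_pow_proj R \<aa> M n))"

text \<open>
  The module with respect to \<open>(I, J)\<close> is obtained for any finite sequence \<open>xs\<close> that generates \<open>I\<close>
  up to radical; the choice is kept as an argument.
\<close>

definition generates_up_to_radical ::
  "('a, 'm) ring_scheme \<Rightarrow> 'a list \<Rightarrow> 'a set \<Rightarrow> bool" where
  "generates_up_to_radical R xs I \<longleftrightarrow>
     set xs \<subseteq> carrier R \<and> radical R (Idl\<^bsub>R\<^esub> (set xs)) = radical R I"

definition cech_formal_cohomology ::
  "('a, 'm) ring_scheme \<Rightarrow> 'a set \<Rightarrow> 'a list \<Rightarrow> 'a set \<Rightarrow> nat \<Rightarrow> ('a, 'b) module \<Rightarrow>
   ('a, (nat \<Rightarrow> ('a cech \<times> 'b set \<Rightarrow> 'a) set) set) module" where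
  "cech_formal_cohomology R \<aa> xs J i M = cohomology (cech_formal_complex R \<aa> xs J M) i"

end

theory Submission
  imports Defs
begin

text \<open>
  The terms of the Cech complex in positive degree are finite direct sums of localizations \<open>T\<close> of \<open>R\<close> at
  multiplicative sets that meet \<open>\<mm>\<close>. Tensoring with such a \<open>T\<close> is exact, and by the Artin--Rees lemma
  the inverse limit over the quotients \<open>M / \<aa>^n M\<close> preserves short exact sequences of finitely generated
  modules; so there is a long exact sequence of Cech-formal cohomology. It is zero above the length of
  \<open>xs\<close>, and zero in positive degrees on modules killed by \<open>\<mm>\<close>. Vanishing for the \<open>R / \<pp>\<close>
  passes to \<open>M\<close> along a prime filtration; the other implications are descending inductions on the
  degree. For \<open>\<pp>\<close> maximal with nonzero cohomology of \<open>R / \<pp>\<close> in the current degree, a nonzero map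
  \<open>M \<rightarrow> R / \<pp>\<close> gives a contradiction. If the cohomology of \<open>M\<close> is finitely
  generated and nonzero in the top degree, then so is that of a quotient of \<open>M\<close> minimal with this
  property; by right exactness it is divisible by some \<open>y \<in> \<mm>\<close>, against Nakayama's lemma.
\<close>

section \<open>Module homomorphisms, submodules and quotients\<close>

text \<open>The terms of the complex are nested quotients of free modules, so none of them literally
  is some \<open>S^-1 R\<close>. \<open>is_loc\<close> therefore describes a localization by
  properties of a module with a marked element; these survive finite tensor products, and exactness
  follows by clearing denominators, without an isomorphism to a concrete model. The inverse limit is
  taken after tensoring, so exactness has to be verified through all levels: for \<open>K\<close>
  inside \<open>M\<close> the filtrations by \<open>\<aa>^n K\<close> and by the traces of
  \<open>\<aa>^n M\<close> differ, and only their cofinality links the limits. Right exactness in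
  degree \<open>i\<close> requires vanishing in degree \<open>i + 1\<close> for a kernel over which
  there is no control except its support. Hence finite generation for \<open>M\<close> cannot be
  treated alone: each descending step first passes through the primes of the support, which gives
  vanishing for every submodule of \<open>M\<close>. Positive degree enters because only there does
  every multiplicative set meet \<open>\<mm>\<close>. A module with surviving cohomology is then not
  killed by \<open>\<mm>\<close>, which supplies the element \<open>y\<close>. The length of
  \<open>xs\<close> gives the descending induction its start.\<close>

lemma (in abelian_group) minus_zero_right [simp]: "x \<in> carrier G \<Longrightarrow> x \<ominus> \<zero> = x"
  using add.inv_one by (simp add: a_minus_def a_inv_def)

lemma (in abelian_group) minus_eq_zero_iff:
  "\<lbrakk>x \<in> carrier G; y \<in> carrier G\<rbrakk> \<Longrightarrow> x \<ominus> y = \<zero> \<longleftrightarrow> x = y"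
  by (metis a_minus_def add.inv_closed minus_equality minus_minus r_neg)

definition mod_hom ::
  "('a, 'm) ring_scheme \<Rightarrow> ('a, 'b) module \<Rightarrow> ('a, 'c) module \<Rightarrow> ('b \<Rightarrow> 'c) set" where
  "mod_hom R M N =
     {f \<in> carrier M \<rightarrow> carrier N.
        (\<forall>x\<in>carrier M. \<forall>y\<in>carrier M. f (x \<oplus>\<^bsub>M\<^esub> y) = f x \<oplus>\<^bsub>N\<^esub> f y) \<and>
        (\<forall>r\<in>carrier R. \<forall>x\<in>carrier M. f (r \<odot>\<^bsub>M\<^esub> x) = r \<odot>\<^bsub>N\<^esub> f x)}"

lemma mod_homI:
  assumes "\<And>x. x \<in> carrier M \<Longrightarrow> f x \<in> carrier N"
    and "\<And>x y. \<lbrakk>x \<in> carrier M; y \<in> carrier M\<rbrakk> \<Longrightarrow> f (x \<oplus>\<^bsub>M\<^esub> y) = f x \<oplus>\<^bsub>N\<^esub> f y"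
    and "\<And>r x. \<lbrakk>r \<in> carrier R; x \<in> carrier M\<rbrakk> \<Longrightarrow> f (r \<odot>\<^bsub>M\<^esub> x) = r \<odot>\<^bsub>N\<^esub> f x"
  shows "f \<in> mod_hom R M N"
  using assms by (auto simp: mod_hom_def)

lemma
  assumes "f \<in> mod_hom R M N"
  shows mod_hom_closed: "x \<in> carrier M \<Longrightarrow> f x \<in> carrier N"
    and mod_hom_add: "\<lbrakk>x \<in> carrier M; y \<in> carrier M\<rbrakk> \<Longrightarrow> f (x \<oplus>\<^bsub>M\<^esub> y) = f x \<oplus>\<^bsub>N\<^esub> f y"
    and mod_hom_smult: "\<lbrakk>r \<in> carrier R; x \<in> carrier M\<rbrakk> \<Longrightarrow> f (r \<odot>\<^bsub>M\<^esub> x) = r \<odot>\<^bsub>N\<^esub> f x"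
  using assms by (auto simp: mod_hom_def)

lemma mod_hom_comp:
  "\<lbrakk>f \<in> mod_hom R M N; g \<in> mod_hom R N P\<rbrakk> \<Longrightarrow> (\<lambda>x. g (f x)) \<in> mod_hom R M P"
  by (rule mod_homI) (simp_all add: mod_hom_closed mod_hom_add mod_hom_smult)

lemma mod_hom_id: "(\<lambda>x. x) \<in> mod_hom R M M"
  by (rule mod_homI) simp_all

lemma mod_hom_cong:
  assumes "f \<in> mod_hom R M N" "module R M" "\<And>x. x \<in> carrier M \<Longrightarrow> f x = g x"
  shows "g \<in> mod_hom R M N"
proof -
  interpret module R M by fact
  show ?thesis
    using assms(1) by (intro mod_homI) (simp_all flip: assms(3) add: mod_hom_closed mod_hom_add mod_hom_smult)
qed

lemma
  assumes "f \<in> mod_hom R M N" "module R M" "module R N"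
  shows mod_hom_zero: "f \<zero>\<^bsub>M\<^esub> = \<zero>\<^bsub>N\<^esub>"
    and mod_hom_neg: "x \<in> carrier M \<Longrightarrow> f (\<ominus>\<^bsub>M\<^esub> x) = \<ominus>\<^bsub>N\<^esub> f x"
    and mod_hom_minus: "\<lbrakk>x \<in> carrier M; y \<in> carrier M\<rbrakk> \<Longrightarrow> f (x \<ominus>\<^bsub>M\<^esub> y) = f x \<ominus>\<^bsub>N\<^esub> f y"
proof -
  interpret M: module R M by fact
  interpret N: module R N by fact
  note c = mod_hom_closed[OF assms(1)] and a = mod_hom_add[OF assms(1)]
  show z: "f \<zero>\<^bsub>M\<^esub> = \<zero>\<^bsub>N\<^esub>"
    using a[of "\<zero>\<^bsub>M\<^esub>" "\<zero>\<^bsub>M\<^esub>"] c[of "\<zero>\<^bsub>M\<^esub>"] by (simp add: N.add.r_cancel_one')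
  show n: "f (\<ominus>\<^bsub>M\<^esub> x) = \<ominus>\<^bsub>N\<^esub> f x" if "x \<in> carrier M" for x
    using a[of "\<ominus>\<^bsub>M\<^esub> x" x] c that z by (simp add: M.l_neg N.minus_equality)
  show "f (x \<ominus>\<^bsub>M\<^esub> y) = f x \<ominus>\<^bsub>N\<^esub> f y" if "x \<in> carrier M" "y \<in> carrier M"
    using that by (simp add: a_minus_def a n)
qed

lemma mod_hom_finsum:
  assumes "f \<in> mod_hom R M N" "module R M" "module R N" "finite A" "g \<in> A \<rightarrow> carrier M"
  shows "f (\<Oplus>\<^bsub>M\<^esub>a\<in>A. g a) = (\<Oplus>\<^bsub>N\<^esub>a\<in>A. f (g a))"
proof -
  interpret M: module R M by fact
  interpret N: module R N by fact
  show ?thesis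
    using assms(4,5)
  proof (induction A)
    case empty
    then show ?case by (simp add: mod_hom_zero[OF assms(1-3)])
  next
    case (insert a A)
    then show ?case
      by (simp add: mod_hom_add[OF assms(1)] Pi_def mod_hom_closed[OF assms(1)])
  qed
qed

lemma module_cring: "module R M \<Longrightarrow> cring R"
  by (simp add: module_def)

lemma mod_hom_const_zero: "module R N \<Longrightarrow> (\<lambda>x. \<zero>\<^bsub>N\<^esub>) \<in> mod_hom R M N"
proof -
  assume "module R N"
  then interpret module R N .
  show ?thesis by (rule mod_homI) simp_all
qed

lemma mod_hom_scale:
  assumes "f \<in> mod_hom R M N" "module R N" "r \<in> carrier R"
  shows "(\<lambda>x. r \<odot>\<^bsub>N\<^esub> f x) \<in> mod_hom R M N"
proof -
  interpret module R N by fact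
  show ?thesis
    using assms(1,3)
    by (intro mod_homI)
       (simp_all add: mod_hom_closed mod_hom_add mod_hom_smult smult_r_distr
          R.m_comm flip: smult_assoc1)
qed

lemma mod_hom_sum:
  assumes "finite A" "\<And>a. a \<in> A \<Longrightarrow> f a \<in> mod_hom R M N" "module R N"
  shows "(\<lambda>x. \<Oplus>\<^bsub>N\<^esub>a\<in>A. f a x) \<in> mod_hom R M N"
proof -
  interpret module R N by fact
  show ?thesis
  proof (rule mod_homI)
    fix x y assume x: "x \<in> carrier M" and y: "y \<in> carrier M"
    have "(\<Oplus>\<^bsub>N\<^esub>a\<in>A. f a (x \<oplus>\<^bsub>M\<^esub> y)) = (\<Oplus>\<^bsub>N\<^esub>a\<in>A. f a x \<oplus>\<^bsub>N\<^esub> f a y)"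
      using x y assms(2) by (intro M.finsum_cong') (auto intro: mod_hom_closed mod_hom_add)
    also have "\<dots> = (\<Oplus>\<^bsub>N\<^esub>a\<in>A. f a x) \<oplus>\<^bsub>N\<^esub> (\<Oplus>\<^bsub>N\<^esub>a\<in>A. f a y)"
      using x y assms(2) by (intro M.finsum_addf) (auto intro: mod_hom_closed)
    finally show "(\<Oplus>\<^bsub>N\<^esub>a\<in>A. f a (x \<oplus>\<^bsub>M\<^esub> y)) = \<dots>" .
  next
    fix r x assume r: "r \<in> carrier R" and x: "x \<in> carrier M"
    show "(\<Oplus>\<^bsub>N\<^esub>a\<in>A. f a (r \<odot>\<^bsub>M\<^esub> x)) = r \<odot>\<^bsub>N\<^esub> (\<Oplus>\<^bsub>N\<^esub>a\<in>A. f a x)"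
      using r x assms(1,2)
      by (subst finsum_smult_ldistr) (auto intro!: M.finsum_cong' intro: mod_hom_closed mod_hom_smult)
  qed (use assms(2) in \<open>auto intro!: M.finsum_closed intro: mod_hom_closed\<close>)
qed

text \<open>Every module axiom is an identity between images of elements of \<open>M\<close>, hence
  inherited from \<open>M\<close>. Quotient modules and the transported copies
  \<open>image_module\<close> are both instances.\<close>

lemma module_surj:
  assumes "module R M" and img: "\<pi> ` carrier M = carrier P"
    and z: "\<pi> \<zero>\<^bsub>M\<^esub> = \<zero>\<^bsub>P\<^esub>"
    and a: "\<And>x y. \<lbrakk>x \<in> carrier M; y \<in> carrier M\<rbrakk> \<Longrightarrow> \<pi> x \<oplus>\<^bsub>P\<^esub> \<pi> y = \<pi> (x \<oplus>\<^bsub>M\<^esub> y)"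
    and s: "\<And>r x. \<lbrakk>r \<in> carrier R; x \<in> carrier M\<rbrakk> \<Longrightarrow> r \<odot>\<^bsub>P\<^esub> \<pi> x = \<pi> (r \<odot>\<^bsub>M\<^esub> x)"
  shows "module R P" "\<pi> \<in> mod_hom R M P"
proof -
  interpret module R M by fact
  have e: "\<exists>x\<in>carrier M. p = \<pi> x" if "p \<in> carrier P" for p
    using that img by auto
  have i: "\<pi> x \<in> carrier P" if "x \<in> carrier M" for x
    using that img by auto
  have ag: "abelian_group P"
  proof (rule abelian_groupI)
    fix p assume "p \<in> carrier P"
    then obtain x where "x \<in> carrier M" "p = \<pi> x" using e by blast
    then show "\<exists>q\<in>carrier P. q \<oplus>\<^bsub>P\<^esub> p = \<zero>\<^bsub>P\<^esub>"
      by (intro bexI[of _ "\<pi> (\<ominus>\<^bsub>M\<^esub> x)"]) (simp_all add: a M.l_neg z i)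
  qed (auto dest!: e simp: a M.a_ac i simp flip: z)
  show "module R P"
    by (rule moduleI[OF R.is_cring ag])
       (auto dest!: e simp: s i a smult_l_distr smult_r_distr smult_assoc1)
  show "\<pi> \<in> mod_hom R M P"
    by (rule mod_homI) (simp_all add: a s i)
qed

lemma
  assumes "submodule H R M" "module R M"
  shows submodule_subset: "H \<subseteq> carrier M"
    and submodule_zero: "\<zero>\<^bsub>M\<^esub> \<in> H"
    and submodule_neg: "\<And>x. x \<in> H \<Longrightarrow> \<ominus>\<^bsub>M\<^esub> x \<in> H"
    and submodule_smult: "\<And>r x. \<lbrakk>r \<in> carrier R; x \<in> H\<rbrakk> \<Longrightarrow> r \<odot>\<^bsub>M\<^esub> x \<in> H"
    and submodule_add: "\<And>x y. \<lbrakk>x \<in> H; y \<in> H\<rbrakk> \<Longrightarrow> x \<oplus>\<^bsub>M\<^esub> y \<in> H"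
    and submodule_minus: "\<And>x y. \<lbrakk>x \<in> H; y \<in> H\<rbrakk> \<Longrightarrow> x \<ominus>\<^bsub>M\<^esub> y \<in> H"
    and submodule_module: "module R (M\<lparr>carrier := H\<rparr>)"
proof -
  interpret module R M by fact
  note E = submoduleE[OF assms(1)]
  from E(1) E(3) E(4) E(5) 
  show "H \<subseteq> carrier M" "\<And>x. x \<in> H \<Longrightarrow> \<ominus>\<^bsub>M\<^esub> x \<in> H" 
    "\<And>r x. \<lbrakk>r \<in> carrier R; x \<in> H\<rbrakk> \<Longrightarrow> r \<odot>\<^bsub>M\<^esub> x \<in> H"
    "\<And>x y. \<lbrakk>x \<in> H; y \<in> H\<rbrakk> \<Longrightarrow> x \<oplus>\<^bsub>M\<^esub> y \<in> H" by blast+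
  show "\<And>x y. \<lbrakk>x \<in> H; y \<in> H\<rbrakk> \<Longrightarrow> x \<ominus>\<^bsub>M\<^esub> y \<in> H"
    using E by (simp add: a_minus_def)
  from E(2) obtain h where "h \<in> H" by blast
  with E(1) E(3) E(5)[of "\<ominus>\<^bsub>M\<^esub> h" h] show "\<zero>\<^bsub>M\<^esub> \<in> H" by (auto simp: M.l_neg)
  show "module R (M\<lparr>carrier := H\<rparr>)"
    by (rule submodule.submodule_is_module) fact+
qed

text \<open>Closure under negatives is scalar multiplication by -1.\<close>

lemma submoduleI':
  assumes "module R M" "H \<subseteq> carrier M" "\<zero>\<^bsub>M\<^esub> \<in> H"
    and a: "\<And>x y. \<lbrakk>x \<in> H; y \<in> H\<rbrakk> \<Longrightarrow> x \<oplus>\<^bsub>M\<^esub> y \<in> H"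
    and s: "\<And>r x. \<lbrakk>r \<in> carrier R; x \<in> H\<rbrakk> \<Longrightarrow> r \<odot>\<^bsub>M\<^esub> x \<in> H"
  shows "submodule H R M"
proof -
  interpret module R M by fact
  have "\<ominus>\<^bsub>M\<^esub> x \<in> H" if "x \<in> H" for x
    using s[of "\<ominus>\<^bsub>R\<^esub> \<one>\<^bsub>R\<^esub>" x] that assms(2) by (simp add: smult_l_minus subset_iff)
  then show ?thesis
    using assms by (intro submoduleI) auto
qed

lemma submodule_zero_submodule: "module R M \<Longrightarrow> submodule {\<zero>\<^bsub>M\<^esub>} R M"
proof -
  assume m: "module R M"
  then interpret module R M .
  show ?thesis by (rule submoduleI'[OF m]) simp_all
qed

lemma submodule_incl: "H \<subseteq> carrier M \<Longrightarrow> (\<lambda>x. x) \<in> mod_hom R (M\<lparr>carrier := H\<rparr>) M"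
  by (rule mod_homI) auto

lemma mod_hom_ker:
  assumes "f \<in> mod_hom R M N" "module R M" "module R N"
  shows "submodule {x \<in> carrier M. f x = \<zero>\<^bsub>N\<^esub>} R M"
proof -
  interpret M: module R M by fact
  interpret N: module R N by fact
  show ?thesis
    using assms
    by (intro submoduleI'[OF assms(2)]) (auto simp: mod_hom_add mod_hom_smult mod_hom_zero)
qed

lemma mod_hom_preimage:
  assumes "f \<in> mod_hom R M N" "module R M" "module R N" "submodule H R N"
  shows "submodule {x \<in> carrier M. f x \<in> H} R M"
proof -
  interpret M: module R M by fact
  interpret N: module R N by fact
  show ?thesis
    using assms submodule_zero[OF assms(4,3)]
    by (intro submoduleI'[OF assms(2)])
       (auto simp: mod_hom_add mod_hom_smult mod_hom_zero submodule_add submodule_smult)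
qed

lemma mod_hom_image:
  assumes "f \<in> mod_hom R M N" "module R M" "module R N" "submodule H R M"
  shows "submodule (f ` H) R N"
proof (rule submoduleI'[OF assms(3)])
  note sub = submodule_subset[OF assms(4,2)]
  show "f ` H \<subseteq> carrier N" using sub assms(1) by (auto intro: mod_hom_closed)
  show "\<zero>\<^bsub>N\<^esub> \<in> f ` H"
    using submodule_zero[OF assms(4,2)] mod_hom_zero[OF assms(1-3)] by force
  show "x \<oplus>\<^bsub>N\<^esub> y \<in> f ` H" if "x \<in> f ` H" "y \<in> f ` H" for x y
  proof -
    from that obtain u v where "u \<in> H" "v \<in> H" "x = f u" "y = f v" by auto
    then show ?thesis
      using sub assms submodule_add[OF assms(4,2), of u v]
      by (intro image_eqI[of _ _ "u \<oplus>\<^bsub>M\<^esub> v"]) (auto simp: mod_hom_add[OF assms(1)] subset_iff)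
  qed
  show "r \<odot>\<^bsub>N\<^esub> x \<in> f ` H" if "r \<in> carrier R" "x \<in> f ` H" for r x
  proof -
    from that obtain u where "u \<in> H" "x = f u" by auto
    then show ?thesis
      using sub assms that submodule_smult[OF assms(4,2), of r u]
      by (intro image_eqI[of _ _ "r \<odot>\<^bsub>M\<^esub> u"]) (auto simp: mod_hom_smult[OF assms(1)] subset_iff)
  qed
qed

lemma submodule_of_submodule:
  assumes "submodule H R M" "module R M" "submodule K R M" "K \<subseteq> H"
  shows "submodule K R (M\<lparr>carrier := H\<rparr>)"
  using assms by (intro submoduleI'[OF submodule_module])
    (auto simp: submodule_zero submodule_add submodule_smult)

lemma submodule_inter:
  assumes "submodule H R M" "module R M" "submodule K R M"
  shows "submodule (H \<inter> K) R M"
  using assms submodule_subset[OF assms(1,2)]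
  by (intro submoduleI') (auto simp: submodule_zero submodule_add submodule_smult)

definition submodule_sum :: "('a, 'b) module \<Rightarrow> 'b set \<Rightarrow> 'b set \<Rightarrow> 'b set" where
  "submodule_sum M H K = {h \<oplus>\<^bsub>M\<^esub> k | h k. h \<in> H \<and> k \<in> K}"

lemma
  assumes "submodule H R M" "module R M" "submodule K R M"
  shows submodule_sum_submodule: "submodule (submodule_sum M H K) R M"
    and submodule_sum_left: "H \<subseteq> submodule_sum M H K"
    and submodule_sum_right: "K \<subseteq> submodule_sum M H K"
proof -
  interpret module R M by fact
  note H = submodule_subset[OF assms(1,2)] and K = submodule_subset[OF assms(3,2)]
  show l: "H \<subseteq> submodule_sum M H K"
    using submodule_zero[OF assms(3,2)] H unfolding submodule_sum_def
    by (force intro: M.r_zero[symmetric])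
  show "K \<subseteq> submodule_sum M H K"
    using submodule_zero[OF assms(1,2)] K unfolding submodule_sum_def
    by (force intro: M.l_zero[symmetric])
  show "submodule (submodule_sum M H K) R M"
  proof (rule submoduleI'[OF assms(2)])
    show "submodule_sum M H K \<subseteq> carrier M"
      using H K by (auto simp: submodule_sum_def)
    show "\<zero>\<^bsub>M\<^esub> \<in> submodule_sum M H K"
      using l submodule_zero[OF assms(1,2)] by auto
    fix x y assume "x \<in> submodule_sum M H K" "y \<in> submodule_sum M H K"
    then obtain h k h' k' where *: "h \<in> H" "k \<in> K" "h' \<in> H" "k' \<in> K"
      "x = h \<oplus>\<^bsub>M\<^esub> k" "y = h' \<oplus>\<^bsub>M\<^esub> k'" by (auto simp: submodule_sum_def)
    then have "x \<oplus>\<^bsub>M\<^esub> y = (h \<oplus>\<^bsub>M\<^esub> h') \<oplus>\<^bsub>M\<^esub> (k \<oplus>\<^bsub>M\<^esub> k')"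
      using H K by (simp add: subset_iff M.a_ac)
    then show "x \<oplus>\<^bsub>M\<^esub> y \<in> submodule_sum M H K"
      using * submodule_add[OF assms(1,2)] submodule_add[OF assms(3,2)]
      unfolding submodule_sum_def by blast
  next
    fix r x assume "r \<in> carrier R" "x \<in> submodule_sum M H K"
    then show "r \<odot>\<^bsub>M\<^esub> x \<in> submodule_sum M H K"
      using H K submodule_smult[OF assms(1,2)] submodule_smult[OF assms(3,2)]
      unfolding submodule_sum_def by (fastforce simp: smult_r_distr subset_iff)
  qed
qed

lemma
  assumes "module R M" "A \<subseteq> carrier M"
  shows submodule_gen_submodule: "submodule (submodule_gen R M A) R M"
    and submodule_gen_subset: "A \<subseteq> submodule_gen R M A"
proof -
  interpret module R M by fact
  have c: "submodule (carrier M) R M" by (rule carrier_is_submodule)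
  show "A \<subseteq> submodule_gen R M A" by (auto simp: submodule_gen_def)
  show "submodule (submodule_gen R M A) R M"
  proof (rule submoduleI'[OF assms(1)])
    show "submodule_gen R M A \<subseteq> carrier M"
      using c assms(2) by (auto simp: submodule_gen_def)
  qed (auto simp: submodule_gen_def intro: submodule_zero[OF _ assms(1)]
        submodule_add[OF _ assms(1)] submodule_smult[OF _ assms(1)])
qed

lemma submodule_gen_least: "\<lbrakk>submodule H R M; A \<subseteq> H\<rbrakk> \<Longrightarrow> submodule_gen R M A \<subseteq> H"
  by (auto simp: submodule_gen_def)

lemma submodule_gen_mono:
  "\<lbrakk>module R M; A \<subseteq> B; B \<subseteq> carrier M\<rbrakk> \<Longrightarrow> submodule_gen R M A \<subseteq> submodule_gen R M B"
  by (intro submodule_gen_least submodule_gen_submodule) (auto dest: submodule_gen_subset)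

text \<open>The equalizer of two homomorphisms is a submodule.\<close>

lemma mod_hom_eq_on_gen:
  assumes "module R M" "module R N" "A \<subseteq> carrier M"
    and "f \<in> mod_hom R M N" "g \<in> mod_hom R M N"
    and "\<And>x. x \<in> A \<Longrightarrow> f x = g x" "x \<in> submodule_gen R M A"
  shows "f x = g x"
proof -
  interpret M: module R M by fact
  interpret N: module R N by fact
  have "submodule {x \<in> carrier M. f x = g x} R M"
    using assms by (intro submoduleI'[OF assms(1)]) (auto simp: mod_hom_add mod_hom_smult mod_hom_zero)
  from submodule_gen_least[OF this, of A] assms show ?thesis by auto
qed

lemma mod_hom_gen_zero:
  assumes "module R M" "module R N" "A \<subseteq> carrier M" "f \<in> mod_hom R M N"
    and "\<And>x. x \<in> A \<Longrightarrow> f x = \<zero>\<^bsub>N\<^esub>" "x \<in> submodule_gen R M A"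
  shows "f x = \<zero>\<^bsub>N\<^esub>"
  using mod_hom_eq_on_gen[OF assms(1-4) mod_hom_const_zero[OF assms(2)] assms(5,6)] by simp

lemma mod_hom_gen_into:
  assumes "module R M" "module R N" "A \<subseteq> carrier M" "f \<in> mod_hom R M N" "submodule H R N"
    and "\<And>x. x \<in> A \<Longrightarrow> f x \<in> H" "x \<in> submodule_gen R M A"
  shows "f x \<in> H"
  using submodule_gen_least[OF mod_hom_preimage[OF assms(4,1,2,5)], of A] assms by auto

section \<open>Cosets, quotient modules and induced maps\<close>

lemma coset_mem:
  assumes "module R M" "submodule Q R M" "x \<in> carrier M"
  shows "y \<in> Q +>\<^bsub>M\<^esub> x \<longleftrightarrow> y \<in> carrier M \<and> y \<ominus>\<^bsub>M\<^esub> x \<in> Q"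
proof -
  interpret module R M by fact
  note Q = submodule_subset[OF assms(2,1)]
  have "y \<in> Q +>\<^bsub>M\<^esub> x \<longleftrightarrow> (\<exists>q\<in>Q. y = q \<oplus>\<^bsub>M\<^esub> x)" by (auto simp: a_r_coset_def')
  also have "\<dots> \<longleftrightarrow> y \<in> carrier M \<and> y \<ominus>\<^bsub>M\<^esub> x \<in> Q"
  proof
    assume "\<exists>q\<in>Q. y = q \<oplus>\<^bsub>M\<^esub> x"
    then show "y \<in> carrier M \<and> y \<ominus>\<^bsub>M\<^esub> x \<in> Q"
      using assms(3) Q by (auto simp: a_minus_def M.a_assoc M.r_neg)
  next
    assume y: "y \<in> carrier M \<and> y \<ominus>\<^bsub>M\<^esub> x \<in> Q"
    then have "y = (y \<ominus>\<^bsub>M\<^esub> x) \<oplus>\<^bsub>M\<^esub> x" using assms(3) by (simp add: a_minus_def M.a_assoc M.l_neg)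
    with y show "\<exists>q\<in>Q. y = q \<oplus>\<^bsub>M\<^esub> x" by blast
  qed
  finally show ?thesis .
qed

lemma
  assumes "module R M" "submodule Q R M"
  shows coset_self: "x \<in> carrier M \<Longrightarrow> x \<in> Q +>\<^bsub>M\<^esub> x"
    and coset_eq_iff: "\<lbrakk>x \<in> carrier M; y \<in> carrier M\<rbrakk> \<Longrightarrow> Q +>\<^bsub>M\<^esub> x = Q +>\<^bsub>M\<^esub> y \<longleftrightarrow> x \<ominus>\<^bsub>M\<^esub> y \<in> Q"
    and coset_zero: "Q +>\<^bsub>M\<^esub> \<zero>\<^bsub>M\<^esub> = Q"
    and coset_zero_iff: "x \<in> carrier M \<Longrightarrow> Q +>\<^bsub>M\<^esub> x = Q \<longleftrightarrow> x \<in> Q"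
proof -
  interpret module R M by fact
  interpret A: additive_subgroup Q M
    using assms(2) by (simp add: additive_subgroup_def submodule_def)
  interpret Q: abelian_subgroup Q M
    by (rule abelian_subgroupI3) (unfold_locales)
  note mem = coset_mem[OF assms]
  show self: "x \<in> Q +>\<^bsub>M\<^esub> x" if "x \<in> carrier M" for x
    using that A.zero_closed by (simp add: mem M.r_neg a_minus_def)
  show eq: "Q +>\<^bsub>M\<^esub> x = Q +>\<^bsub>M\<^esub> y \<longleftrightarrow> x \<ominus>\<^bsub>M\<^esub> y \<in> Q" if "x \<in> carrier M" "y \<in> carrier M" for x y
  proof
    assume "Q +>\<^bsub>M\<^esub> x = Q +>\<^bsub>M\<^esub> y"
    then show "x \<ominus>\<^bsub>M\<^esub> y \<in> Q" using self[OF that(1)] mem[OF that(2)] by simp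
  next
    assume "x \<ominus>\<^bsub>M\<^esub> y \<in> Q"
    then have "x \<in> Q +>\<^bsub>M\<^esub> y" using mem that by simp
    then show "Q +>\<^bsub>M\<^esub> x = Q +>\<^bsub>M\<^esub> y"
      using M.a_repr_independence[OF _ that(2) A.a_subgroup] by simp
  qed
  show z: "Q +>\<^bsub>M\<^esub> \<zero>\<^bsub>M\<^esub> = Q" using A.a_subset by (rule M.a_coset_add_zero)
  show "Q +>\<^bsub>M\<^esub> x = Q \<longleftrightarrow> x \<in> Q" if "x \<in> carrier M"
    using eq[OF that, of "\<zero>\<^bsub>M\<^esub>"] that z by simp
qed

lemma
  assumes "module R M" "submodule Q R M"
  shows quot_module_carrier: "carrier (quot_module M Q) = (\<lambda>x. Q +>\<^bsub>M\<^esub> x) ` carrier M"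
    and quot_module_zero: "\<zero>\<^bsub>quot_module M Q\<^esub> = Q"
    and quot_module_add: "\<lbrakk>x \<in> carrier M; y \<in> carrier M\<rbrakk> \<Longrightarrow>
      (Q +>\<^bsub>M\<^esub> x) \<oplus>\<^bsub>quot_module M Q\<^esub> (Q +>\<^bsub>M\<^esub> y) = Q +>\<^bsub>M\<^esub> (x \<oplus>\<^bsub>M\<^esub> y)"
    and quot_module_smult: "\<lbrakk>r \<in> carrier R; x \<in> carrier M\<rbrakk> \<Longrightarrow>
      r \<odot>\<^bsub>quot_module M Q\<^esub> (Q +>\<^bsub>M\<^esub> x) = Q +>\<^bsub>M\<^esub> (r \<odot>\<^bsub>M\<^esub> x)"
    and quot_module_module: "module R (quot_module M Q)"
    and quot_module_proj: "(\<lambda>x. Q +>\<^bsub>M\<^esub> x) \<in> mod_hom R M (quot_module M Q)"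
proof -
  interpret module R M by fact
  interpret A: additive_subgroup Q M
    using assms(2) by (simp add: additive_subgroup_def submodule_def)
  interpret Q: abelian_subgroup Q M
    by (rule abelian_subgroupI3) (unfold_locales)
  show c: "carrier (quot_module M Q) = (\<lambda>x. Q +>\<^bsub>M\<^esub> x) ` carrier M"
    by (auto simp: quot_module_def A_RCOSETS_def')
  show z: "\<zero>\<^bsub>quot_module M Q\<^esub> = Q" by (simp add: quot_module_def)
  show a: "(Q +>\<^bsub>M\<^esub> x) \<oplus>\<^bsub>quot_module M Q\<^esub> (Q +>\<^bsub>M\<^esub> y) = Q +>\<^bsub>M\<^esub> (x \<oplus>\<^bsub>M\<^esub> y)"
    if "x \<in> carrier M" "y \<in> carrier M" for x y
    using Q.a_rcos_sum[OF that] by (simp add: quot_module_def)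
  show s: "r \<odot>\<^bsub>quot_module M Q\<^esub> (Q +>\<^bsub>M\<^esub> x) = Q +>\<^bsub>M\<^esub> (r \<odot>\<^bsub>M\<^esub> x)"
    if "r \<in> carrier R" "x \<in> carrier M" for r x
  proof -
    have "Q +>\<^bsub>M\<^esub> (r \<odot>\<^bsub>M\<^esub> y) = Q +>\<^bsub>M\<^esub> (r \<odot>\<^bsub>M\<^esub> x)" if y: "y \<in> Q +>\<^bsub>M\<^esub> x" for y
    proof -
      have y': "y \<in> carrier M" "y \<ominus>\<^bsub>M\<^esub> x \<in> Q" using y coset_mem[OF assms \<open>x \<in> carrier M\<close>] by auto
      then have "r \<odot>\<^bsub>M\<^esub> y \<ominus>\<^bsub>M\<^esub> r \<odot>\<^bsub>M\<^esub> x = r \<odot>\<^bsub>M\<^esub> (y \<ominus>\<^bsub>M\<^esub> x)"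
        using \<open>r \<in> _\<close> \<open>x \<in> _\<close> by (simp add: a_minus_def smult_r_distr smult_r_minus)
      then show ?thesis
        using y' \<open>r \<in> _\<close> \<open>x \<in> _\<close> submodule_smult[OF assms(2,1)] by (simp add: coset_eq_iff[OF assms])
    qed
    then have "(\<Union>y\<in>Q +>\<^bsub>M\<^esub> x. Q +>\<^bsub>M\<^esub> (r \<odot>\<^bsub>M\<^esub> y)) = (\<Union>y\<in>Q +>\<^bsub>M\<^esub> x. Q +>\<^bsub>M\<^esub> (r \<odot>\<^bsub>M\<^esub> x))"
      by (rule SUP_cong[OF refl])
    then show ?thesis using coset_self[OF assms \<open>x \<in> _\<close>] by (auto simp: quot_module_def simp del: UN_simps)
  qed
  show "module R (quot_module M Q)" "(\<lambda>x. Q +>\<^bsub>M\<^esub> x) \<in> mod_hom R M (quot_module M Q)"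
    using module_surj[OF assms(1) c[symmetric]] a s z coset_zero[OF assms] by auto
qed

text \<open>
  On a coset of a submodule that \<open>f\<close> maps into \<open>Q\<close> all cosets in the union agree; the domain and its
  submodule are therefore no arguments.
\<close>

definition quot_map :: "('a, 'c) module \<Rightarrow> 'c set \<Rightarrow> ('b \<Rightarrow> 'c) \<Rightarrow> 'b set \<Rightarrow> 'c set" where
  "quot_map N Q f X = (\<Union>x\<in>X. Q +>\<^bsub>N\<^esub> f x)"

lemma quot_map_coset:
  assumes "module R M" "submodule P R M" "module R N" "submodule Q R N"
    and "f \<in> mod_hom R M N" "f ` P \<subseteq> Q" "x \<in> carrier M"
  shows "quot_map N Q f (P +>\<^bsub>M\<^esub> x) = Q +>\<^bsub>N\<^esub> f x"
proof -
  have "Q +>\<^bsub>N\<^esub> f y = Q +>\<^bsub>N\<^esub> f x" if "y \<in> P +>\<^bsub>M\<^esub> x" for y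
  proof -
    from that have "y \<in> carrier M" "y \<ominus>\<^bsub>M\<^esub> x \<in> P" using coset_mem[OF assms(1,2,7)] by auto
    then show ?thesis
      using assms(6,7) mod_hom_minus[OF assms(5,1,3), of y x] mod_hom_closed[OF assms(5)]
      by (auto simp: coset_eq_iff[OF assms(3,4)])
  qed
  then have "(\<Union>y\<in>P +>\<^bsub>M\<^esub> x. Q +>\<^bsub>N\<^esub> f y) = (\<Union>y\<in>P +>\<^bsub>M\<^esub> x. Q +>\<^bsub>N\<^esub> f x)"
    by (rule SUP_cong[OF refl])
  then show ?thesis
    using coset_self[OF assms(1,2,7)] by (auto simp: quot_map_def simp del: UN_simps)
qed

lemma quot_map_hom:
  assumes "module R M" "submodule P R M" "module R N" "submodule Q R N"
    and "f \<in> mod_hom R M N" "f ` P \<subseteq> Q"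
  shows "quot_map N Q f \<in> mod_hom R (quot_module M P) (quot_module N Q)"
proof -
  interpret M: module R M by fact
  interpret N: module R N by fact
  note c = quot_module_carrier[OF assms(1,2)] quot_module_carrier[OF assms(3,4)]
    quot_map_coset[OF assms] mod_hom_closed[OF assms(5)]
  show ?thesis
  proof (rule mod_homI)
    fix X Y assume "X \<in> carrier (quot_module M P)" "Y \<in> carrier (quot_module M P)"
    then obtain x y where *: "x \<in> carrier M" "y \<in> carrier M" "X = P +>\<^bsub>M\<^esub> x" "Y = P +>\<^bsub>M\<^esub> y"
      by (auto simp: c)
    then show "quot_map N Q f (X \<oplus>\<^bsub>quot_module M P\<^esub> Y) =
        quot_map N Q f X \<oplus>\<^bsub>quot_module N Q\<^esub> quot_map N Q f Y"
      by (simp add: quot_module_add[OF assms(1,2)] c quot_module_add[OF assms(3,4)] mod_hom_add[OF assms(5)])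
  next
    fix r X assume "r \<in> carrier R" "X \<in> carrier (quot_module M P)"
    moreover from this obtain x where *: "x \<in> carrier M" "X = P +>\<^bsub>M\<^esub> x" by (auto simp: c)
    ultimately show "quot_map N Q f (r \<odot>\<^bsub>quot_module M P\<^esub> X) = r \<odot>\<^bsub>quot_module N Q\<^esub> quot_map N Q f X"
      by (simp add: quot_module_smult[OF assms(1,2)] c quot_module_smult[OF assms(3,4)] mod_hom_smult[OF assms(5)])
  qed (auto simp: c)
qed

text \<open>A map that kills \<open>P\<close> is constant on each coset, so its image of a coset is
  a singleton. This is the mechanism behind \<open>tensor_lift\<close>.\<close>

lemma the_elem_coset:
  assumes "module R M" "submodule P R M" "module R N" "f \<in> mod_hom R M N"
    and "\<And>x. x \<in> P \<Longrightarrow> f x = \<zero>\<^bsub>N\<^esub>" "x \<in> carrier M"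
  shows "the_elem (f ` (P +>\<^bsub>M\<^esub> x)) = f x"
proof -
  interpret N: module R N by fact
  have "f y = f x" if "y \<in> P +>\<^bsub>M\<^esub> x" for y
  proof -
    from that coset_mem[OF assms(1,2,6), of y] have y: "y \<in> carrier M" "y \<ominus>\<^bsub>M\<^esub> x \<in> P" by auto
    have "f y \<ominus>\<^bsub>N\<^esub> f x = \<zero>\<^bsub>N\<^esub>"
      using mod_hom_minus[OF assms(4,1,3) y(1) assms(6)] assms(5)[OF y(2)] by simp
    then show "f y = f x"
      using N.minus_eq_zero_iff[OF mod_hom_closed[OF assms(4) y(1)] mod_hom_closed[OF assms(4,6)]] by blast
  qed
  then have "f ` (P +>\<^bsub>M\<^esub> x) = {f x}"
    using coset_self[OF assms(1,2,6)] by (blast intro: sym)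
  then show ?thesis by simp
qed

lemma the_elem_hom:
  assumes "module R M" "submodule P R M" "module R N" "f \<in> mod_hom R M N"
    and "\<And>x. x \<in> P \<Longrightarrow> f x = \<zero>\<^bsub>N\<^esub>"
  shows "(\<lambda>X. the_elem (f ` X)) \<in> mod_hom R (quot_module M P) N"
proof -
  interpret M: module R M by fact
  note c = quot_module_carrier[OF assms(1,2)] the_elem_coset[OF assms] mod_hom_closed[OF assms(4)]
  show ?thesis
  proof (rule mod_homI)
    fix X Y assume "X \<in> carrier (quot_module M P)" "Y \<in> carrier (quot_module M P)"
    then obtain x y where *: "x \<in> carrier M" "y \<in> carrier M" "X = P +>\<^bsub>M\<^esub> x" "Y = P +>\<^bsub>M\<^esub> y"
      by (auto simp: c(1))
    then show "the_elem (f ` (X \<oplus>\<^bsub>quot_module M P\<^esub> Y)) = the_elem (f ` X) \<oplus>\<^bsub>N\<^esub> the_elem (f ` Y)"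
      by (simp add: quot_module_add[OF assms(1,2)] c mod_hom_add[OF assms(4)])
  next
    fix r X assume "r \<in> carrier R" "X \<in> carrier (quot_module M P)"
    moreover from this obtain x where *: "x \<in> carrier M" "X = P +>\<^bsub>M\<^esub> x" by (auto simp: c(1))
    ultimately show "the_elem (f ` (r \<odot>\<^bsub>quot_module M P\<^esub> X)) = r \<odot>\<^bsub>N\<^esub> the_elem (f ` X)"
      by (simp add: quot_module_smult[OF assms(1,2)] c mod_hom_smult[OF assms(4)])
  next
    fix X assume "X \<in> carrier (quot_module M P)"
    then obtain x where *: "x \<in> carrier M" "X = P +>\<^bsub>M\<^esub> x" by (auto simp: c(1))
    then show "the_elem (f ` X) \<in> carrier N" by (simp add: c)
  qed
qed

section \<open>Free modules and presentations\<close>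

lemma free_module_simps:
  "u \<in> carrier (free_module R X) \<longleftrightarrow>
     (\<forall>c. u c \<in> carrier R) \<and> {c. u c \<noteq> \<zero>\<^bsub>R\<^esub>} \<subseteq> X \<and> finite {c. u c \<noteq> \<zero>\<^bsub>R\<^esub>}"
  "\<zero>\<^bsub>free_module R X\<^esub> = (\<lambda>c. \<zero>\<^bsub>R\<^esub>)"
  "u \<oplus>\<^bsub>free_module R X\<^esub> v = (\<lambda>c. u c \<oplus>\<^bsub>R\<^esub> v c)"
  "r \<odot>\<^bsub>free_module R X\<^esub> u = (\<lambda>c. r \<otimes>\<^bsub>R\<^esub> u c)"
  by (simp_all add: free_module_def)

context cring
begin

lemma free_module_module: "module R (free_module R X)"
proof -
  have sub: "finite {c. w c \<noteq> \<zero>} \<and> {c. w c \<noteq> \<zero>} \<subseteq> X"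
    if "{c. w c \<noteq> \<zero>} \<subseteq> {c. u c \<noteq> \<zero>} \<union> {c. v c \<noteq> \<zero>}"
      "u \<in> carrier (free_module R X)" "v \<in> carrier (free_module R X)" for u v w
    using that finite_subset[OF that(1)] by (auto simp: free_module_simps)
  have ag: "abelian_group (free_module R X)"
  proof (rule abelian_groupI)
    fix u v assume *: "u \<in> carrier (free_module R X)" "v \<in> carrier (free_module R X)"
    have "{c. u c \<oplus> v c \<noteq> \<zero>} \<subseteq> {c. u c \<noteq> \<zero>} \<union> {c. v c \<noteq> \<zero>}"
      by auto
    from sub[OF this *] * show "u \<oplus>\<^bsub>free_module R X\<^esub> v \<in> carrier (free_module R X)"
      by (simp add: free_module_simps)
  next
    fix u assume *: "u \<in> carrier (free_module R X)"
    have "{c. \<ominus> u c \<noteq> \<zero>} \<subseteq> {c. u c \<noteq> \<zero>} \<union> {c. u c \<noteq> \<zero>}" by auto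
    from sub[OF this * *] * show "\<exists>v\<in>carrier (free_module R X). v \<oplus>\<^bsub>free_module R X\<^esub> u = \<zero>\<^bsub>free_module R X\<^esub>"
      by (intro bexI[of _ "\<lambda>c. \<ominus> u c"]) (simp_all add: free_module_simps l_neg)
  qed (auto simp: free_module_simps a_ac)
  show ?thesis
  proof (rule moduleI[OF is_cring ag])
    fix r u assume *: "r \<in> carrier R" "u \<in> carrier (free_module R X)"
    have "{c. r \<otimes> u c \<noteq> \<zero>} \<subseteq> {c. u c \<noteq> \<zero>} \<union> {c. u c \<noteq> \<zero>}" using * by auto
    from sub[OF this *(2) *(2)] * show "r \<odot>\<^bsub>free_module R X\<^esub> u \<in> carrier (free_module R X)"
      by (simp add: free_module_simps)
  qed (auto simp: free_module_simps l_distr r_distr m_assoc)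
qed

lemma free_gen_closed: "c \<in> X \<Longrightarrow> free_gen R c \<in> carrier (free_module R X)"
proof -
  assume "c \<in> X"
  have "{c'. free_gen R c c' \<noteq> \<zero>} \<subseteq> {c}" by (auto simp: free_gen_def)
  then have "finite {c'. free_gen R c c' \<noteq> \<zero>}" "{c'. free_gen R c c' \<noteq> \<zero>} \<subseteq> X"
    using \<open>c \<in> X\<close> by (auto intro: finite_subset)
  then show ?thesis by (simp add: free_module_simps) (simp add: free_gen_def)
qed

text \<open>Induction over a finite set containing the support, splitting off one coordinate at a
  time.\<close>

lemma free_module_generated:
  assumes H: "submodule H R (free_module R X)" and "free_gen R ` X \<subseteq> H"
    and "u \<in> carrier (free_module R X)"
  shows "u \<in> H"
proof -
  let ?F = "free_module R X"
  interpret F: module R ?F by (rule free_module_module)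
  have "u \<in> H" if "finite A" "A \<subseteq> X" "u \<in> carrier ?F" "{c. u c \<noteq> \<zero>} \<subseteq> A" for A u
    using that
  proof (induction A arbitrary: u)
    case empty
    then have "u = \<zero>\<^bsub>?F\<^esub>" by (auto simp: free_module_simps)
    then show ?case using submodule_zero[OF H free_module_module] by simp
  next
    case (insert c A)
    let ?v = "u(c := \<zero>)"
    have "{c'. ?v c' \<noteq> \<zero>} \<subseteq> {c. u c \<noteq> \<zero>}" by auto
    then have "finite {c'. ?v c' \<noteq> \<zero>}" "{c'. ?v c' \<noteq> \<zero>} \<subseteq> X"
      using insert.prems by (auto simp: free_module_simps intro: finite_subset)
    then have v: "?v \<in> carrier ?F"
      using insert.prems by (simp add: free_module_simps)
    moreover have "{c'. ?v c' \<noteq> \<zero>} \<subseteq> A" using insert.prems by auto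
    ultimately have "?v \<in> H" using insert.IH insert.prems by simp
    moreover have "u c \<odot>\<^bsub>?F\<^esub> free_gen R c \<in> H"
      using insert.prems assms(2) by (intro submodule_smult[OF H free_module_module]) (auto simp: free_module_simps)
    ultimately have "?v \<oplus>\<^bsub>?F\<^esub> u c \<odot>\<^bsub>?F\<^esub> free_gen R c \<in> H"
      by (rule submodule_add[OF H free_module_module])
    moreover have "?v \<oplus>\<^bsub>?F\<^esub> u c \<odot>\<^bsub>?F\<^esub> free_gen R c = u"
      using insert.prems(2) by (auto simp: free_module_simps free_gen_def fun_eq_iff)
    ultimately show ?case by simp
  qed
  from this[of "{c. u c \<noteq> \<zero>}" u] assms(3) show ?thesis by (auto simp: free_module_simps)
qed

text \<open>\<open>free_lift\<close> sums over the exact support, which changes under addition and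
  scaling; linearity needs a common finite index set.\<close>

lemma free_lift_superset:
  assumes "module R N" "\<phi> \<in> X \<rightarrow> carrier N" "u \<in> carrier (free_module R X)"
    and "finite A" "{c. u c \<noteq> \<zero>} \<subseteq> A" "A \<subseteq> X"
  shows "free_lift R N \<phi> u = (\<Oplus>\<^bsub>N\<^esub>c\<in>A. u c \<odot>\<^bsub>N\<^esub> \<phi> c)"
proof -
  interpret N: module R N by fact
  show ?thesis
    unfolding free_lift_def
    using assms
    by (intro N.add.finprod_mono_neutral_cong_left) (auto simp: free_module_simps Pi_def subset_iff)
qed

lemma free_lift_hom:
  assumes "module R N" "\<phi> \<in> X \<rightarrow> carrier N"
  shows "free_lift R N \<phi> \<in> mod_hom R (free_module R X) N"
proof -
  interpret N: module R N by fact
  interpret F: module R "free_module R X" by (rule free_module_module)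
  note sup = free_lift_superset[OF assms]
  show ?thesis
  proof (rule mod_homI)
    fix u assume "u \<in> carrier (free_module R X)"
    then show "free_lift R N \<phi> u \<in> carrier N"
      using assms(2) unfolding free_lift_def
      by (intro N.finsum_closed) (auto simp: free_module_simps Pi_def subset_iff)
  next
    fix u v assume uv: "u \<in> carrier (free_module R X)" "v \<in> carrier (free_module R X)"
    define A where "A = {c. u c \<noteq> \<zero>} \<union> {c. v c \<noteq> \<zero>}"
    have A: "finite A" "A \<subseteq> X" using uv by (auto simp: A_def free_module_simps)
    have uv': "u c \<in> carrier R" "v c \<in> carrier R" for c using uv by (auto simp: free_module_simps)
    have "free_lift R N \<phi> (u \<oplus>\<^bsub>free_module R X\<^esub> v)
        = (\<Oplus>\<^bsub>N\<^esub>c\<in>A. (u \<oplus>\<^bsub>free_module R X\<^esub> v) c \<odot>\<^bsub>N\<^esub> \<phi> c)"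
      using F.a_closed[OF uv] A by (intro sup) (auto simp: A_def free_module_simps(3) uv')
    also have "\<dots> = (\<Oplus>\<^bsub>N\<^esub>c\<in>A. u c \<odot>\<^bsub>N\<^esub> \<phi> c \<oplus>\<^bsub>N\<^esub> v c \<odot>\<^bsub>N\<^esub> \<phi> c)"
      using A assms(2) uv' by (intro N.finsum_cong') (auto simp: free_module_simps(3) N.smult_l_distr Pi_def subset_iff)
    also have "\<dots> = (\<Oplus>\<^bsub>N\<^esub>c\<in>A. u c \<odot>\<^bsub>N\<^esub> \<phi> c) \<oplus>\<^bsub>N\<^esub> (\<Oplus>\<^bsub>N\<^esub>c\<in>A. v c \<odot>\<^bsub>N\<^esub> \<phi> c)"
      using A assms(2) uv' by (intro N.finsum_addf) (auto simp: Pi_def subset_iff)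
    also have "\<dots> = free_lift R N \<phi> u \<oplus>\<^bsub>N\<^esub> free_lift R N \<phi> v"
      using A uv by (simp add: sup[of _ A] A_def)
    finally show "free_lift R N \<phi> (u \<oplus>\<^bsub>free_module R X\<^esub> v) = \<dots>" .
  next
    fix r u assume r: "r \<in> carrier R" and u: "u \<in> carrier (free_module R X)"
    define A where "A = {c. u c \<noteq> \<zero>}"
    have A: "finite A" "A \<subseteq> X" using u by (auto simp: A_def free_module_simps)
    have u': "u c \<in> carrier R" for c using u by (auto simp: free_module_simps)
    have "free_lift R N \<phi> (r \<odot>\<^bsub>free_module R X\<^esub> u)
        = (\<Oplus>\<^bsub>N\<^esub>c\<in>A. (r \<odot>\<^bsub>free_module R X\<^esub> u) c \<odot>\<^bsub>N\<^esub> \<phi> c)"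
      using F.smult_closed[OF r u] r A by (intro sup) (auto simp: A_def free_module_simps(4) u')
    also have "\<dots> = (\<Oplus>\<^bsub>N\<^esub>c\<in>A. r \<odot>\<^bsub>N\<^esub> (u c \<odot>\<^bsub>N\<^esub> \<phi> c))"
      using A assms(2) u' r by (intro N.finsum_cong') (auto simp: free_module_simps(4) N.smult_assoc1 Pi_def subset_iff)
    also have "\<dots> = r \<odot>\<^bsub>N\<^esub> (\<Oplus>\<^bsub>N\<^esub>c\<in>A. u c \<odot>\<^bsub>N\<^esub> \<phi> c)"
      using A assms(2) u' r by (intro N.finsum_smult_ldistr[symmetric]) (auto simp: Pi_def subset_iff)
    also have "\<dots> = r \<odot>\<^bsub>N\<^esub> free_lift R N \<phi> u"
      using A u by (simp add: sup[of _ A] A_def)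
    finally show "free_lift R N \<phi> (r \<odot>\<^bsub>free_module R X\<^esub> u) = \<dots>" .
  qed
qed

lemma free_lift_gen:
  assumes "module R N" "\<phi> \<in> X \<rightarrow> carrier N" "c \<in> X"
  shows "free_lift R N \<phi> (free_gen R c) = \<phi> c"
proof -
  interpret N: module R N by fact
  have "free_lift R N \<phi> (free_gen R c) = (\<Oplus>\<^bsub>N\<^esub>c'\<in>{c}. free_gen R c c' \<odot>\<^bsub>N\<^esub> \<phi> c')"
    using assms by (intro free_lift_superset free_gen_closed) (auto simp: free_gen_def)
  then show ?thesis using assms by (auto simp: free_gen_def Pi_def)
qed

text \<open>Binary tensor products and tensor products of families are both a free module modulo
  generated relations; the facts common to both are proved here once for an arbitrary set of
  relations.\<close>

lemma
  assumes "rels \<subseteq> carrier (free_module R X)"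
    and "Q = submodule_gen R (free_module R X) rels"
  shows presented_submodule: "submodule Q R (free_module R X)"
    and presented_module: "module R (quot_module (free_module R X) Q)"
    and presented_gen_closed:
      "c \<in> X \<Longrightarrow> Q +>\<^bsub>free_module R X\<^esub> free_gen R c \<in> carrier (quot_module (free_module R X) Q)"
  unfolding assms(2)
  using submodule_gen_submodule[OF free_module_module assms(1)]
  by (auto simp: quot_module_carrier[OF free_module_module] free_gen_closed
      intro: quot_module_module[OF free_module_module])

text \<open>The universal property: a linear extension that kills the relations kills the submodule
  they generate and so factors through the quotient.\<close>

lemma
  assumes "rels \<subseteq> carrier (free_module R X)"
    and "Q = submodule_gen R (free_module R X) rels"
    and "module R N" "\<phi> \<in> X \<rightarrow> carrier N"
    and "\<And>u. u \<in> rels \<Longrightarrow> free_lift R N \<phi> u = \<zero>\<^bsub>N\<^esub>"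
  shows presented_lift_hom: "tensor_lift R N \<phi> \<in> mod_hom R (quot_module (free_module R X) Q) N"
    and presented_lift_gen:
      "c \<in> X \<Longrightarrow> tensor_lift R N \<phi> (Q +>\<^bsub>free_module R X\<^esub> free_gen R c) = \<phi> c"
proof -
  have z: "free_lift R N \<phi> u = \<zero>\<^bsub>N\<^esub>" if "u \<in> Q" for u
    using mod_hom_gen_zero[OF free_module_module assms(3,1) free_lift_hom[OF assms(3,4)] assms(5)] that
    by (simp add: assms(2))
  note * = free_module_module presented_submodule[OF assms(1,2)] assms(3) free_lift_hom[OF assms(3,4)] z
  show "tensor_lift R N \<phi> \<in> mod_hom R (quot_module (free_module R X) Q) N"
    using the_elem_hom[OF *] unfolding tensor_lift_def by simp
  show "tensor_lift R N \<phi> (Q +>\<^bsub>free_module R X\<^esub> free_gen R c) = \<phi> c" if "c \<in> X"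
    using the_elem_coset[OF * free_gen_closed[OF that]] free_lift_gen[OF assms(3,4) that]
    unfolding tensor_lift_def by simp
qed

lemma presented_generated:
  assumes "rels \<subseteq> carrier (free_module R X)"
    and "Q = submodule_gen R (free_module R X) rels"
    and H: "submodule H R (quot_module (free_module R X) Q)"
    and "\<And>c. c \<in> X \<Longrightarrow> Q +>\<^bsub>free_module R X\<^esub> free_gen R c \<in> H"
    and "z \<in> carrier (quot_module (free_module R X) Q)"
  shows "z \<in> H"
proof -
  note Q = presented_submodule[OF assms(1,2)]
  note c = quot_module_carrier[OF free_module_module Q]
  let ?P = "{u \<in> carrier (free_module R X). Q +>\<^bsub>free_module R X\<^esub> u \<in> H}"
  have "submodule ?P R (free_module R X)"
    by (rule mod_hom_preimage[OF quot_module_proj[OF free_module_module Q] free_module_module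
          quot_module_module[OF free_module_module Q] H])
  moreover have "free_gen R ` X \<subseteq> ?P" using assms(4) by (auto intro: free_gen_closed)
  ultimately have "u \<in> ?P" if "u \<in> carrier (free_module R X)" for u
    using free_module_generated that by blast
  with assms(5) show ?thesis by (auto simp: c)
qed

end

section \<open>Tensor products\<close>

definition bilinear ::
  "('a, 'm) ring_scheme \<Rightarrow> ('a, 'b) module \<Rightarrow> ('a, 'c) module \<Rightarrow> ('a, 'd) module \<Rightarrow>
   ('b \<Rightarrow> 'c \<Rightarrow> 'd) \<Rightarrow> bool" where
  "bilinear R M N P b \<longleftrightarrow>
     (\<forall>y\<in>carrier N. (\<lambda>x. b x y) \<in> mod_hom R M P) \<and> (\<forall>x\<in>carrier M. b x \<in> mod_hom R N P)"

lemma tensor_bilinear_rels_closed: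
  assumes "module R M" "module R N"
  shows "bilinear_rels R M N \<subseteq> carrier (free_module R (carrier M \<times> carrier N))"
proof -
  interpret M: module R M by fact
  interpret N: module R N by fact
  interpret F: module R "free_module R (carrier M \<times> carrier N)" by (rule M.free_module_module)
  show ?thesis
    by (auto simp: bilinear_rels_def Let_def intro!: F.minus_closed F.a_closed F.smult_closed M.free_gen_closed)
qed

lemma
  assumes "module R M" "module R N"
  shows tensor_kernel_submodule:
      "submodule (bilinear_kernel R M N) R (free_module R (carrier M \<times> carrier N))"
    and tensor_module: "module R (tensor R M N)"
    and pure_tensor_closed:
      "\<lbrakk>x \<in> carrier M; y \<in> carrier N\<rbrakk> \<Longrightarrow> pure_tensor R M N x y \<in> carrier (tensor R M N)"
  using cring.presented_submodule[OF module_cring tensor_bilinear_rels_closed bilinear_kernel_def, OF assms(1) assms]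
    cring.presented_module[OF module_cring tensor_bilinear_rels_closed bilinear_kernel_def, OF assms(1) assms]
    cring.presented_gen_closed[OF module_cring tensor_bilinear_rels_closed bilinear_kernel_def, OF assms(1) assms]
  by (auto simp: tensor_def pure_tensor_def)

lemma tensor_generated:
  assumes "module R M" "module R N" "submodule H R (tensor R M N)"
    and "\<And>x y. \<lbrakk>x \<in> carrier M; y \<in> carrier N\<rbrakk> \<Longrightarrow> pure_tensor R M N x y \<in> H"
    and "z \<in> carrier (tensor R M N)"
  shows "z \<in> H"
  using cring.presented_generated[OF module_cring tensor_bilinear_rels_closed bilinear_kernel_def,
      OF assms(1) assms(1,2), of H z] assms(3-5)
  by (auto simp: tensor_def pure_tensor_def)

text \<open>The equalizer is a submodule containing all pure tensors. Identities between maps on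
  tensor products, such as functoriality, are checked on pure tensors by this lemma.\<close>

lemma tensor_hom_eq:
  assumes "module R M" "module R N" "module R P"
    and f: "f \<in> mod_hom R (tensor R M N) P" and g: "g \<in> mod_hom R (tensor R M N) P"
    and "\<And>x y. \<lbrakk>x \<in> carrier M; y \<in> carrier N\<rbrakk> \<Longrightarrow> f (pure_tensor R M N x y) = g (pure_tensor R M N x y)"
    and z: "z \<in> carrier (tensor R M N)"
  shows "f z = g z"
proof -
  interpret T: module R "tensor R M N" using assms(1,2) by (rule tensor_module)
  interpret P: module R P by fact
  have "submodule {z \<in> carrier (tensor R M N). f z = g z} R (tensor R M N)"
    by (intro submoduleI'[OF T.module_axioms])
       (auto simp: mod_hom_add[OF f] mod_hom_add[OF g] mod_hom_smult[OF f] mod_hom_smult[OF g]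
         mod_hom_zero[OF f T.module_axioms assms(3)] mod_hom_zero[OF g T.module_axioms assms(3)])
  from tensor_generated[OF assms(1,2) this _ z] show ?thesis
    using assms(6) pure_tensor_closed[OF assms(1,2)] by auto
qed

lemma
  assumes "module R M" "module R N"
  shows pure_tensor_bilinear: "bilinear R M N (tensor R M N) (pure_tensor R M N)"
proof -
  interpret M: module R M by fact
  interpret N: module R N by fact
  let ?F = "free_module R (carrier M \<times> carrier N)" and ?K = "bilinear_kernel R M N"
  interpret F: module R ?F by (rule M.free_module_module)
  note sub = tensor_kernel_submodule[OF assms]
  note p = quot_module_proj[OF F.module_axioms sub]
  note gc = M.free_gen_closed
  have rel: "bilinear_rels R M N \<subseteq> ?K"
    unfolding bilinear_kernel_def
    by (rule submodule_gen_subset[OF F.module_axioms tensor_bilinear_rels_closed[OF assms]])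
  have eq: "?K +>\<^bsub>?F\<^esub> u = ?K +>\<^bsub>?F\<^esub> v"
    if "u \<ominus>\<^bsub>?F\<^esub> v \<in> bilinear_rels R M N" "u \<in> carrier ?F" "v \<in> carrier ?F" for u v
    using that rel coset_eq_iff[OF F.module_axioms sub] by blast
  note defs = pure_tensor_def tensor_def
  show ?thesis
    unfolding bilinear_def
  proof (intro conjI ballI mod_homI)
    fix x y y' assume *: "x \<in> carrier M" "y \<in> carrier N" "y' \<in> carrier N"
    have "?K +>\<^bsub>?F\<^esub> free_gen R (x, y \<oplus>\<^bsub>N\<^esub> y') = ?K +>\<^bsub>?F\<^esub> (free_gen R (x, y) \<oplus>\<^bsub>?F\<^esub> free_gen R (x, y'))"
      by (rule eq) (use * in \<open>auto simp: bilinear_rels_def Let_def intro!: gc F.a_closed F.smult_closed\<close>)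
    then show "pure_tensor R M N x (y \<oplus>\<^bsub>N\<^esub> y') = pure_tensor R M N x y \<oplus>\<^bsub>tensor R M N\<^esub> pure_tensor R M N x y'"
      using * by (simp add: defs mod_hom_add[OF p] gc)
  next
    fix x r y assume *: "x \<in> carrier M" "r \<in> carrier R" "y \<in> carrier N"
    have "?K +>\<^bsub>?F\<^esub> free_gen R (x, r \<odot>\<^bsub>N\<^esub> y) = ?K +>\<^bsub>?F\<^esub> (r \<odot>\<^bsub>?F\<^esub> free_gen R (x, y))"
      by (rule eq) (use * in \<open>auto simp: bilinear_rels_def Let_def intro!: gc F.a_closed F.smult_closed\<close>)
    then show "pure_tensor R M N x (r \<odot>\<^bsub>N\<^esub> y) = r \<odot>\<^bsub>tensor R M N\<^esub> pure_tensor R M N x y"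
      using * by (simp add: defs mod_hom_smult[OF p] gc)
  next
    fix y x x' assume *: "y \<in> carrier N" "x \<in> carrier M" "x' \<in> carrier M"
    have "?K +>\<^bsub>?F\<^esub> free_gen R (x \<oplus>\<^bsub>M\<^esub> x', y) = ?K +>\<^bsub>?F\<^esub> (free_gen R (x, y) \<oplus>\<^bsub>?F\<^esub> free_gen R (x', y))"
      by (rule eq) (use * in \<open>auto simp: bilinear_rels_def Let_def intro!: gc F.a_closed F.smult_closed\<close>)
    then show "pure_tensor R M N (x \<oplus>\<^bsub>M\<^esub> x') y = pure_tensor R M N x y \<oplus>\<^bsub>tensor R M N\<^esub> pure_tensor R M N x' y"
      using * by (simp add: defs mod_hom_add[OF p] gc)
  next
    fix y r x assume *: "y \<in> carrier N" "r \<in> carrier R" "x \<in> carrier M"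
    have "?K +>\<^bsub>?F\<^esub> free_gen R (r \<odot>\<^bsub>M\<^esub> x, y) = ?K +>\<^bsub>?F\<^esub> (r \<odot>\<^bsub>?F\<^esub> free_gen R (x, y))"
      by (rule eq) (use * in \<open>auto simp: bilinear_rels_def Let_def intro!: gc F.a_closed F.smult_closed\<close>)
    then show "pure_tensor R M N (r \<odot>\<^bsub>M\<^esub> x) y = r \<odot>\<^bsub>tensor R M N\<^esub> pure_tensor R M N x y"
      using * by (simp add: defs mod_hom_smult[OF p] gc)
  qed (simp_all add: pure_tensor_closed[OF assms])
qed

lemma
  assumes "module R M" "module R N" "module R P" "bilinear R M N P b"
  shows tensor_lift_hom: "tensor_lift R P (\<lambda>(x, y). b x y) \<in> mod_hom R (tensor R M N) P"
    and tensor_lift_pure: "\<lbrakk>x \<in> carrier M; y \<in> carrier N\<rbrakk> \<Longrightarrow>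
      tensor_lift R P (\<lambda>(x, y). b x y) (pure_tensor R M N x y) = b x y"
proof -
  interpret M: module R M by fact
  interpret N: module R N by fact
  interpret P: module R P by fact
  let ?F = "free_module R (carrier M \<times> carrier N)"
  interpret F: module R ?F by (rule M.free_module_module)
  let ?b = "\<lambda>(x, y). b x y"
  have l: "(\<lambda>x. b x y) \<in> mod_hom R M P" if "y \<in> carrier N" for y
    using assms(4) that by (auto simp: bilinear_def)
  have r: "b x \<in> mod_hom R N P" if "x \<in> carrier M" for x
    using assms(4) that by (auto simp: bilinear_def)
  have \<phi>: "?b \<in> carrier M \<times> carrier N \<rightarrow> carrier P"
    using mod_hom_closed[OF l] by auto
  note h = M.free_lift_hom[OF P.module_axioms \<phi>] and g = M.free_lift_gen[OF P.module_axioms \<phi>]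
  note gc = M.free_gen_closed
  \<comment> \<open>Each relation is a difference of two elements of the free module; it suffices
    that the linear extension takes the same value on both, which is one clause of
    bilinearity.\<close>
  have z: "free_lift R P ?b u = \<zero>\<^bsub>P\<^esub>" if "u \<in> bilinear_rels R M N" for u
  proof -
    have e: "free_lift R P ?b (v \<ominus>\<^bsub>?F\<^esub> w) = \<zero>\<^bsub>P\<^esub>"
      if "free_lift R P ?b v = free_lift R P ?b w" "v \<in> carrier ?F" "w \<in> carrier ?F" for v w
      using that mod_hom_minus[OF h F.module_axioms P.module_axioms, of v w] mod_hom_closed[OF h]
      by (simp add: P.minus_eq_zero_iff)
    show ?thesis
      using that unfolding bilinear_rels_def Let_def
      by (elim UnE CollectE exE conjE; hypsubst)
         (rule e; simp add: gc mod_hom_add[OF h] mod_hom_smult[OF h] g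
            mod_hom_add[OF l] mod_hom_smult[OF l] mod_hom_add[OF r] mod_hom_smult[OF r])+
  qed
  note pl = M.presented_lift_hom[OF tensor_bilinear_rels_closed[OF assms(1,2)] bilinear_kernel_def assms(3) \<phi> z]
    M.presented_lift_gen[OF tensor_bilinear_rels_closed[OF assms(1,2)] bilinear_kernel_def assms(3) \<phi> z]
  show "tensor_lift R P ?b \<in> mod_hom R (tensor R M N) P"
    unfolding tensor_def by (rule pl(1))
  show "tensor_lift R P ?b (pure_tensor R M N x y) = b x y" if "x \<in> carrier M" "y \<in> carrier N"
    using pl(2)[of "(x, y)"] that unfolding pure_tensor_def by simp
qed

lemma
  assumes "module R M" "module R N" "module R M'" "module R N'"
    and f: "f \<in> mod_hom R M M'" and g: "g \<in> mod_hom R N N'"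
  shows tensor_map_hom: "tensor_map R M' N' f g \<in> mod_hom R (tensor R M N) (tensor R M' N')"
    and tensor_map_pure: "\<lbrakk>x \<in> carrier M; y \<in> carrier N\<rbrakk> \<Longrightarrow>
      tensor_map R M' N' f g (pure_tensor R M N x y) = pure_tensor R M' N' (f x) (g y)"
proof -
  have b: "bilinear R M N (tensor R M' N') (\<lambda>x y. pure_tensor R M' N' (f x) (g y))"
    using pure_tensor_bilinear[OF assms(3,4)] mod_hom_closed[OF f] mod_hom_closed[OF g]
    unfolding bilinear_def by (auto intro: mod_hom_comp[OF f] mod_hom_comp[OF g])
  show "tensor_map R M' N' f g \<in> mod_hom R (tensor R M N) (tensor R M' N')"
    unfolding tensor_map_def by (rule tensor_lift_hom[OF assms(1,2) tensor_module[OF assms(3,4)] b])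
  show "\<lbrakk>x \<in> carrier M; y \<in> carrier N\<rbrakk> \<Longrightarrow>
      tensor_map R M' N' f g (pure_tensor R M N x y) = pure_tensor R M' N' (f x) (g y)"
    unfolding tensor_map_def by (rule tensor_lift_pure[OF assms(1,2) tensor_module[OF assms(3,4)] b])
qed

lemma tensor_map_comp:
  assumes "module R M" "module R N" "module R M'" "module R N'" "module R M''" "module R N''"
    and f: "f \<in> mod_hom R M M'" and g: "g \<in> mod_hom R N N'"
    and f': "f' \<in> mod_hom R M' M''" and g': "g' \<in> mod_hom R N' N''"
    and z: "z \<in> carrier (tensor R M N)"
  shows "tensor_map R M'' N'' f' g' (tensor_map R M' N' f g z) =
    tensor_map R M'' N'' (\<lambda>x. f' (f x)) (\<lambda>y. g' (g y)) z"
proof (rule tensor_hom_eq[OF assms(1,2) tensor_module[OF assms(5,6)] _ _ _ z])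
  show "(\<lambda>z. tensor_map R M'' N'' f' g' (tensor_map R M' N' f g z)) \<in>
      mod_hom R (tensor R M N) (tensor R M'' N'')"
    by (rule mod_hom_comp[OF tensor_map_hom[OF assms(1-4) f g] tensor_map_hom[OF assms(3-6) f' g']])
  show "tensor_map R M'' N'' (\<lambda>x. f' (f x)) (\<lambda>y. g' (g y)) \<in> mod_hom R (tensor R M N) (tensor R M'' N'')"
    by (rule tensor_map_hom[OF assms(1,2,5,6) mod_hom_comp[OF f f'] mod_hom_comp[OF g g']])
  fix x y assume "x \<in> carrier M" "y \<in> carrier N"
  then show "tensor_map R M'' N'' f' g' (tensor_map R M' N' f g (pure_tensor R M N x y)) =
      tensor_map R M'' N'' (\<lambda>x. f' (f x)) (\<lambda>y. g' (g y)) (pure_tensor R M N x y)"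
    by (simp add: tensor_map_pure[OF assms(1-4) f g] tensor_map_pure[OF assms(3-6) f' g']
        tensor_map_pure[OF assms(1,2,5,6) mod_hom_comp[OF f f'] mod_hom_comp[OF g g']]
        mod_hom_closed[OF f] mod_hom_closed[OF g])
qed

lemma tensor_map_cong:
  assumes "module R M" "module R N" "module R M'" "module R N'"
    and f: "f \<in> mod_hom R M M'" and g: "g \<in> mod_hom R N N'"
    and "\<And>x. x \<in> carrier M \<Longrightarrow> f x = f' x" "\<And>y. y \<in> carrier N \<Longrightarrow> g y = g' y"
    and z: "z \<in> carrier (tensor R M N)"
  shows "tensor_map R M' N' f g z = tensor_map R M' N' f' g' z"
proof -
  have f': "f' \<in> mod_hom R M M'" by (rule mod_hom_cong[OF f assms(1,7)])
  have g': "g' \<in> mod_hom R N N'" by (rule mod_hom_cong[OF g assms(2,8)])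
  show ?thesis
    by (rule tensor_hom_eq[OF assms(1,2) tensor_module[OF assms(3,4)] tensor_map_hom[OF assms(1-4) f g]
          tensor_map_hom[OF assms(1-4) f' g'] _ z])
       (simp add: tensor_map_pure[OF assms(1-4) f g] tensor_map_pure[OF assms(1-4) f' g'] assms(7,8))
qed

text \<open>The image is a submodule, and a pure tensor is reached by lifting its second entry along
  \<open>g\<close>.\<close>

lemma tensor_map_surj:
  assumes "module R C" "module R M" "module R N"
    and g: "g \<in> mod_hom R M N" "g ` carrier M = carrier N" and z: "z \<in> carrier (tensor R C N)"
  shows "\<exists>w\<in>carrier (tensor R C M). tensor_map R C N (\<lambda>x. x) g w = z"
proof -
  note h = tensor_map_hom[OF assms(1,2,1,3) mod_hom_id g(1)]
  note CM = tensor_module[OF assms(1,2)] and CN = tensor_module[OF assms(1,3)]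
  have c: "submodule (carrier (tensor R C M)) R (tensor R C M)"
    by (rule module.carrier_is_submodule[OF CM])
  have "z \<in> tensor_map R C N (\<lambda>x. x) g ` carrier (tensor R C M)"
  proof (rule tensor_generated[OF assms(1,3) mod_hom_image[OF h CM CN c] _ z])
    fix x y assume x: "x \<in> carrier C" and "y \<in> carrier N"
    then obtain y' where "y' \<in> carrier M" "y = g y'" using g(2) by blast
    with x show "pure_tensor R C N x y \<in> tensor_map R C N (\<lambda>x. x) g ` carrier (tensor R C M)"
      by (intro image_eqI[of _ _ "pure_tensor R C M x y'"])
         (simp_all add: tensor_map_pure[OF assms(1,2,1,3) mod_hom_id g(1)] pure_tensor_closed[OF assms(1,2)])
  qed
  then show ?thesis by auto
qed

section \<open>Tensor products of families and multilinear maps\<close>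

definition multilinear ::
  "('a, 'm) ring_scheme \<Rightarrow> 'k set \<Rightarrow> ('k \<Rightarrow> ('a, 'b) module) \<Rightarrow> ('a, 'd) module \<Rightarrow>
   (('k \<Rightarrow> 'b) \<Rightarrow> 'd) \<Rightarrow> bool" where
  "multilinear R K N P \<phi> \<longleftrightarrow>
     (\<forall>c\<in>\<Pi>\<^sub>E k\<in>K. carrier (N k). \<phi> c \<in> carrier P) \<and>
     (\<forall>c\<in>\<Pi>\<^sub>E k\<in>K. carrier (N k). \<forall>k\<in>K. (\<lambda>x. \<phi> (c(k := x))) \<in> mod_hom R (N k) P)"

lemma PiE_upd: "\<lbrakk>c \<in> (\<Pi>\<^sub>E k\<in>K. A k); k \<in> K; x \<in> A k\<rbrakk> \<Longrightarrow> c(k := x) \<in> (\<Pi>\<^sub>E k\<in>K. A k)"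
  by (auto simp: PiE_def extensional_def Pi_def)

locale module_family = cring R for R :: "('a, 'm) ring_scheme" (structure) +
  fixes K :: "'k set" and N :: "'k \<Rightarrow> ('a, 'b) module"
  assumes fam: "\<And>k. k \<in> K \<Longrightarrow> module R (N k)"
begin

abbreviation "Dom \<equiv> \<Pi>\<^sub>E k\<in>K. carrier (N k)"
abbreviation "FF \<equiv> free_module R Dom"
abbreviation "KK \<equiv> multilinear_kernel R K N"
abbreviation "TT \<equiv> tensor_family R K N"
abbreviation "pure \<equiv> pure_tensor_family R K N"

lemma fam_closed:
  "\<lbrakk>k \<in> K; x \<in> carrier (N k); y \<in> carrier (N k)\<rbrakk> \<Longrightarrow> x \<oplus>\<^bsub>N k\<^esub> y \<in> carrier (N k)"
  "\<lbrakk>k \<in> K; r \<in> carrier R; y \<in> carrier (N k)\<rbrakk> \<Longrightarrow> r \<odot>\<^bsub>N k\<^esub> y \<in> carrier (N k)"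
proof -
  show "x \<oplus>\<^bsub>N k\<^esub> y \<in> carrier (N k)" if "k \<in> K" "x \<in> carrier (N k)" "y \<in> carrier (N k)"
  proof -
    interpret module R "N k" using that(1) by (rule fam)
    show ?thesis using that by simp
  qed
  show "r \<odot>\<^bsub>N k\<^esub> y \<in> carrier (N k)" if "k \<in> K" "r \<in> carrier R" "y \<in> carrier (N k)"
  proof -
    interpret module R "N k" using that(1) by (rule fam)
    show ?thesis using that by simp
  qed
qed

sublocale F: module R FF by (rule free_module_module)

lemma multilinear_rels_closed: "multilinear_rels R K N \<subseteq> carrier FF"
  by (auto simp: multilinear_rels_def Let_def
      intro!: F.minus_closed F.a_closed F.smult_closed free_gen_closed PiE_upd fam_closed)

lemma family_kernel_submodule: "submodule KK R FF"
  and family_module: "module R TT"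
  and pure_family_closed: "c \<in> Dom \<Longrightarrow> pure c \<in> carrier TT"
  using presented_submodule[OF multilinear_rels_closed multilinear_kernel_def]
    presented_module[OF multilinear_rels_closed multilinear_kernel_def]
    presented_gen_closed[OF multilinear_rels_closed multilinear_kernel_def]
  by (auto simp: tensor_family_def pure_tensor_family_def)

lemma family_generated:
  assumes "submodule H R TT" "\<And>c. c \<in> Dom \<Longrightarrow> pure c \<in> H" "z \<in> carrier TT"
  shows "z \<in> H"
  using presented_generated[OF multilinear_rels_closed multilinear_kernel_def, of H z] assms
  by (auto simp: tensor_family_def pure_tensor_family_def)

lemma family_hom_eq:
  assumes "module R P" and f: "f \<in> mod_hom R TT P" and g: "g \<in> mod_hom R TT P"
    and "\<And>c. c \<in> Dom \<Longrightarrow> f (pure c) = g (pure c)" and z: "z \<in> carrier TT"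
  shows "f z = g z"
proof -
  interpret T: module R TT by (rule family_module)
  interpret P: module R P by fact
  have "submodule {z \<in> carrier TT. f z = g z} R TT"
    by (intro submoduleI'[OF T.module_axioms])
       (auto simp: mod_hom_add[OF f] mod_hom_add[OF g] mod_hom_smult[OF f] mod_hom_smult[OF g]
         mod_hom_zero[OF f T.module_axioms assms(1)] mod_hom_zero[OF g T.module_axioms assms(1)])
  from family_generated[OF this _ z] show ?thesis
    using assms(4) pure_family_closed by auto
qed

lemma pure_family_multilinear: "multilinear R K N TT pure"
proof -
  note p = quot_module_proj[OF F.module_axioms family_kernel_submodule]
  note gc = free_gen_closed
  have rel: "multilinear_rels R K N \<subseteq> KK"
    unfolding multilinear_kernel_def
    by (rule submodule_gen_subset[OF F.module_axioms multilinear_rels_closed])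
  have eq: "KK +>\<^bsub>FF\<^esub> u = KK +>\<^bsub>FF\<^esub> v"
    if "u \<ominus>\<^bsub>FF\<^esub> v \<in> multilinear_rels R K N" "u \<in> carrier FF" "v \<in> carrier FF" for u v
    using that rel coset_eq_iff[OF F.module_axioms family_kernel_submodule] by blast
  note defs = pure_tensor_family_def tensor_family_def
  show ?thesis
    unfolding multilinear_def
  proof (intro conjI ballI mod_homI)
    fix c k x y assume *: "c \<in> Dom" "k \<in> K" "x \<in> carrier (N k)" "y \<in> carrier (N k)"
    note u = PiE_upd[OF *(1,2)]
    note u = u[OF *(3)] u[OF *(4)] u[OF fam_closed(1)[OF *(2-4)]]
    have "KK +>\<^bsub>FF\<^esub> free_gen R (c(k := x \<oplus>\<^bsub>N k\<^esub> y)) =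
        KK +>\<^bsub>FF\<^esub> (free_gen R (c(k := x)) \<oplus>\<^bsub>FF\<^esub> free_gen R (c(k := y)))"
    proof (rule eq)
      show "free_gen R (c(k := x \<oplus>\<^bsub>N k\<^esub> y)) \<ominus>\<^bsub>FF\<^esub> (free_gen R (c(k := x)) \<oplus>\<^bsub>FF\<^esub> free_gen R (c(k := y)))
          \<in> multilinear_rels R K N"
        unfolding multilinear_rels_def Let_def using * by (intro UnI1) blast
    qed (auto intro!: gc F.a_closed u)
    then show "pure (c(k := x \<oplus>\<^bsub>N k\<^esub> y)) = pure (c(k := x)) \<oplus>\<^bsub>TT\<^esub> pure (c(k := y))"
      using gc[OF u(1)] gc[OF u(2)] by (simp add: defs mod_hom_add[OF p])
  next
    fix c k r x assume *: "c \<in> Dom" "k \<in> K" "r \<in> carrier R" "x \<in> carrier (N k)"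
    note u = PiE_upd[OF *(1,2)]
    note u = u[OF *(4)] u[OF fam_closed(2)[OF *(2-4)]]
    have "KK +>\<^bsub>FF\<^esub> free_gen R (c(k := r \<odot>\<^bsub>N k\<^esub> x)) =
        KK +>\<^bsub>FF\<^esub> (r \<odot>\<^bsub>FF\<^esub> free_gen R (c(k := x)))"
    proof (rule eq)
      show "free_gen R (c(k := r \<odot>\<^bsub>N k\<^esub> x)) \<ominus>\<^bsub>FF\<^esub> (r \<odot>\<^bsub>FF\<^esub> free_gen R (c(k := x)))
          \<in> multilinear_rels R K N"
        unfolding multilinear_rels_def Let_def using * by (intro UnI2) blast
    qed (auto intro!: gc F.smult_closed u *)
    then show "pure (c(k := r \<odot>\<^bsub>N k\<^esub> x)) = r \<odot>\<^bsub>TT\<^esub> pure (c(k := x))"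
      using gc[OF u(1)] * by (simp add: defs mod_hom_smult[OF p])
  qed (simp_all add: pure_family_closed PiE_upd)
qed

lemma
  assumes "module R P" "multilinear R K N P \<phi>"
  shows family_lift_hom: "tensor_lift R P \<phi> \<in> mod_hom R TT P"
    and family_lift_pure: "c \<in> Dom \<Longrightarrow> tensor_lift R P \<phi> (pure c) = \<phi> c"
proof -
  interpret P: module R P by fact
  have l: "(\<lambda>x. \<phi> (c(k := x))) \<in> mod_hom R (N k) P" if "c \<in> Dom" "k \<in> K" for c k
    using assms(2) that by (auto simp: multilinear_def)
  have \<phi>: "\<phi> \<in> Dom \<rightarrow> carrier P"
    using assms(2) by (auto simp: multilinear_def)
  note h = free_lift_hom[OF P.module_axioms \<phi>] and g = free_lift_gen[OF P.module_axioms \<phi>]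
  note gc = free_gen_closed
  have e: "free_lift R P \<phi> (v \<ominus>\<^bsub>FF\<^esub> w) = \<zero>\<^bsub>P\<^esub>"
    if "free_lift R P \<phi> v = free_lift R P \<phi> w" "v \<in> carrier FF" "w \<in> carrier FF" for v w
    using that mod_hom_minus[OF h F.module_axioms P.module_axioms, of v w] mod_hom_closed[OF h]
    by (simp add: P.minus_eq_zero_iff)
  have z: "free_lift R P \<phi> u = \<zero>\<^bsub>P\<^esub>" if "u \<in> multilinear_rels R K N" for u
    using that unfolding multilinear_rels_def Let_def
  proof (elim UnE CollectE exE conjE; hypsubst)
    fix c k x y assume *: "c \<in> Dom" "k \<in> K" "x \<in> carrier (N k)" "y \<in> carrier (N k)"
    note u = PiE_upd[OF *(1,2)]
    note u = u[OF *(3)] u[OF *(4)] u[OF fam_closed(1)[OF *(2-4)]]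
    show "free_lift R P \<phi> (free_gen R (c(k := x \<oplus>\<^bsub>N k\<^esub> y)) \<ominus>\<^bsub>FF\<^esub>
        (free_gen R (c(k := x)) \<oplus>\<^bsub>FF\<^esub> free_gen R (c(k := y)))) = \<zero>\<^bsub>P\<^esub>"
      using mod_hom_add[OF l[OF *(1,2)] *(3,4)]
      by (intro e) (simp_all add: gc u mod_hom_add[OF h] g)
  next
    fix c k r x assume *: "c \<in> Dom" "k \<in> K" "r \<in> carrier R" "x \<in> carrier (N k)"
    note u = PiE_upd[OF *(1,2)]
    note u = u[OF *(4)] u[OF fam_closed(2)[OF *(2-4)]]
    show "free_lift R P \<phi> (free_gen R (c(k := r \<odot>\<^bsub>N k\<^esub> x)) \<ominus>\<^bsub>FF\<^esub>
        (r \<odot>\<^bsub>FF\<^esub> free_gen R (c(k := x)))) = \<zero>\<^bsub>P\<^esub>"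
      using mod_hom_smult[OF l[OF *(1,2)] *(3,4)] *(3)
      by (intro e) (simp_all add: gc u mod_hom_smult[OF h] g)
  qed
  show "tensor_lift R P \<phi> \<in> mod_hom R TT P"
    unfolding tensor_family_def
    by (rule presented_lift_hom[OF multilinear_rels_closed multilinear_kernel_def assms(1) \<phi> z])
  show "tensor_lift R P \<phi> (pure c) = \<phi> c" if "c \<in> Dom"
    using presented_lift_gen[OF multilinear_rels_closed multilinear_kernel_def assms(1) \<phi> z that]
    unfolding pure_tensor_family_def by simp
qed

end

section \<open>Localization\<close>

definition mult_closed :: "('a, 'm) ring_scheme \<Rightarrow> 'a set \<Rightarrow> bool" where
  "mult_closed R S \<longleftrightarrow> S \<subseteq> carrier R \<and> \<one>\<^bsub>R\<^esub> \<in> S \<and> (\<forall>s\<in>S. \<forall>t\<in>S. s \<otimes>\<^bsub>R\<^esub> t \<in> S)"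

locale module_localization = module R M for R :: "('a, 'm) ring_scheme" (structure)
  and M :: "('a, 'b) module" +
  fixes S assumes S: "mult_closed R S"
begin

lemma S_closed: "s \<in> S \<Longrightarrow> s \<in> carrier R" and S_one: "\<one> \<in> S"
  and S_mult: "\<lbrakk>s \<in> S; t \<in> S\<rbrakk> \<Longrightarrow> s \<otimes> t \<in> S"
  using S by (auto simp: mult_closed_def)

abbreviation "rel \<equiv> frac_rel R S M"
abbreviation "fr x s \<equiv> rel `` {(x, s)}"

text \<open>An equation of two products replaces the vanishing of a difference, so that the later
  calculations with fractions are pure rearrangements of factors.\<close>

lemma rel_iff: "((x, s), (y, t)) \<in> rel \<longleftrightarrow> x \<in> carrier M \<and> s \<in> S \<and> y \<in> carrier M \<and> t \<in> S \<and>
    (\<exists>u\<in>S. (u \<otimes> t) \<odot>\<^bsub>M\<^esub> x = (u \<otimes> s) \<odot>\<^bsub>M\<^esub> y)"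
proof -
  have "u \<odot>\<^bsub>M\<^esub> (t \<odot>\<^bsub>M\<^esub> x \<ominus>\<^bsub>M\<^esub> s \<odot>\<^bsub>M\<^esub> y) = \<zero>\<^bsub>M\<^esub> \<longleftrightarrow> (u \<otimes> t) \<odot>\<^bsub>M\<^esub> x = (u \<otimes> s) \<odot>\<^bsub>M\<^esub> y"
    if "x \<in> carrier M" "s \<in> S" "y \<in> carrier M" "t \<in> S" "u \<in> S" for u
  proof -
    have "u \<odot>\<^bsub>M\<^esub> (t \<odot>\<^bsub>M\<^esub> x \<ominus>\<^bsub>M\<^esub> s \<odot>\<^bsub>M\<^esub> y) = (u \<otimes> t) \<odot>\<^bsub>M\<^esub> x \<ominus>\<^bsub>M\<^esub> (u \<otimes> s) \<odot>\<^bsub>M\<^esub> y"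
      using that by (simp add: a_minus_def smult_r_distr smult_r_minus smult_assoc1 S_closed)
    then show ?thesis using that by (simp add: M.minus_eq_zero_iff S_closed)
  qed
  then show ?thesis by (auto simp: frac_rel_def)
qed

lemma rel_equiv: "equiv (carrier M \<times> S) rel"
proof (rule equivI)
  show "rel \<subseteq> (carrier M \<times> S) \<times> (carrier M \<times> S)" by (auto simp: frac_rel_def)
  show "refl_on (carrier M \<times> S) rel"
    using S_one by (auto simp: refl_on_def rel_iff intro!: bexI[of _ "\<one>"])
  show "sym rel" by (rule symI) (force simp: rel_iff)
  show "trans rel"
  proof (rule transI)
    fix p q w assume "(p, q) \<in> rel" "(q, w) \<in> rel"
    then obtain x s y t z v where e: "p = (x, s)" "q = (y, t)" "w = (z, v)" by (metis surj_pair)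
    with \<open>(p, q) \<in> rel\<close> \<open>(q, w) \<in> rel\<close> obtain a b where
      *: "x \<in> carrier M" "s \<in> S" "y \<in> carrier M" "t \<in> S" "z \<in> carrier M" "v \<in> S" "a \<in> S" "b \<in> S"
      and 1: "(a \<otimes> t) \<odot>\<^bsub>M\<^esub> x = (a \<otimes> s) \<odot>\<^bsub>M\<^esub> y" and 2: "(b \<otimes> v) \<odot>\<^bsub>M\<^esub> y = (b \<otimes> t) \<odot>\<^bsub>M\<^esub> z"
      by (auto simp: rel_iff)
    \<comment> \<open>Multiplying the first relation by \<open>b v\<close> and the second by
      \<open>a s\<close> makes their common middle term cancel out; the extra denominator is
      \<open>a b t\<close>.\<close>
    have "((a \<otimes> b \<otimes> t) \<otimes> v) \<odot>\<^bsub>M\<^esub> x = (b \<otimes> v) \<odot>\<^bsub>M\<^esub> ((a \<otimes> t) \<odot>\<^bsub>M\<^esub> x)"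
      using * by (simp add: S_closed m_ac flip: smult_assoc1)
    also have "\<dots> = (a \<otimes> s) \<odot>\<^bsub>M\<^esub> ((b \<otimes> v) \<odot>\<^bsub>M\<^esub> y)"
      unfolding 1 using * by (simp add: S_closed m_ac flip: smult_assoc1)
    also have "\<dots> = ((a \<otimes> b \<otimes> t) \<otimes> s) \<odot>\<^bsub>M\<^esub> z"
      unfolding 2 using * by (simp add: S_closed m_ac flip: smult_assoc1)
    finally show "(p, w) \<in> rel"
      using * e by (auto simp: rel_iff intro!: bexI[of _ "a \<otimes> b \<otimes> t"] S_mult)
  qed
qed

lemma frac_eq_iff:
  assumes "x \<in> carrier M" "s \<in> S" "y \<in> carrier M" "t \<in> S"
  shows "fr x s = fr y t \<longleftrightarrow> (\<exists>u\<in>S. (u \<otimes> t) \<odot>\<^bsub>M\<^esub> x = (u \<otimes> s) \<odot>\<^bsub>M\<^esub> y)"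
  using eq_equiv_class_iff[OF rel_equiv, of "(x, s)" "(y, t)"] assms by (simp add: rel_iff)

lemma frac_eqI:
  assumes "x \<in> carrier M" "s \<in> S" "y \<in> carrier M" "t \<in> S" "t \<odot>\<^bsub>M\<^esub> x = s \<odot>\<^bsub>M\<^esub> y"
  shows "fr x s = fr y t"
  using assms S_one by (subst frac_eq_iff) (auto intro!: bexI[of _ "\<one>"] simp: S_closed)

abbreviation "Loc \<equiv> localization R S M"

lemma loc_carrier: "carrier Loc = {fr x s | x s. x \<in> carrier M \<and> s \<in> S}"
  by (auto simp: localization_def quotient_def)

lemma frac_closed: "\<lbrakk>x \<in> carrier M; s \<in> S\<rbrakk> \<Longrightarrow> fr x s \<in> carrier Loc"
  by (auto simp: loc_carrier)

lemma frac_memD: "(y, t) \<in> fr x s \<Longrightarrow> y \<in> carrier M \<and> t \<in> S \<and> x \<in> carrier M \<and> s \<in> S \<and> fr y t = fr x s"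
  using equiv_class_eq[OF rel_equiv, of "(x, s)" "(y, t)"] by (auto simp: rel_iff)

lemma frac_self: "\<lbrakk>x \<in> carrier M; s \<in> S\<rbrakk> \<Longrightarrow> (x, s) \<in> fr x s"
  using equiv_class_self[OF rel_equiv] by auto

lemma loc_smult:
  assumes "r \<in> carrier R" "x \<in> carrier M" "s \<in> S"
  shows "r \<odot>\<^bsub>Loc\<^esub> fr x s = fr (r \<odot>\<^bsub>M\<^esub> x) s"
proof -
  have "fr (r \<odot>\<^bsub>M\<^esub> y) t = fr (r \<odot>\<^bsub>M\<^esub> x) s" if yt: "(y, t) \<in> fr x s" for y t
  proof -
    from frac_memD[OF yt] have yt: "y \<in> carrier M" "t \<in> S" and "fr y t = fr x s" by auto
    then obtain u where u: "u \<in> S" "(u \<otimes> s) \<odot>\<^bsub>M\<^esub> y = (u \<otimes> t) \<odot>\<^bsub>M\<^esub> x"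
      using assms by (auto simp: frac_eq_iff)
    have "(u \<otimes> s) \<odot>\<^bsub>M\<^esub> (r \<odot>\<^bsub>M\<^esub> y) = r \<odot>\<^bsub>M\<^esub> ((u \<otimes> s) \<odot>\<^bsub>M\<^esub> y)"
      using u(1) assms yt by (simp add: S_closed m_ac flip: smult_assoc1)
    also have "\<dots> = (u \<otimes> t) \<odot>\<^bsub>M\<^esub> (r \<odot>\<^bsub>M\<^esub> x)"
      unfolding u(2) using u(1) assms yt by (simp add: S_closed m_ac flip: smult_assoc1)
    finally show ?thesis using u(1) assms yt by (subst frac_eq_iff) auto
  qed
  then have "(\<Union>(y, t)\<in>fr x s. fr (r \<odot>\<^bsub>M\<^esub> y) t) = (\<Union>p\<in>fr x s. fr (r \<odot>\<^bsub>M\<^esub> x) s)"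
    by (intro SUP_cong) auto
  then show ?thesis
    using frac_self[OF assms(2,3)] by (auto simp: localization_def)
qed

lemma loc_add:
  assumes "x \<in> carrier M" "s \<in> S" "y \<in> carrier M" "t \<in> S"
  shows "fr x s \<oplus>\<^bsub>Loc\<^esub> fr y t = fr (t \<odot>\<^bsub>M\<^esub> x \<oplus>\<^bsub>M\<^esub> s \<odot>\<^bsub>M\<^esub> y) (s \<otimes> t)"
proof -
  let ?z = "fr (t \<odot>\<^bsub>M\<^esub> x \<oplus>\<^bsub>M\<^esub> s \<odot>\<^bsub>M\<^esub> y) (s \<otimes> t)"
  have *: "fr (t' \<odot>\<^bsub>M\<^esub> x' \<oplus>\<^bsub>M\<^esub> s' \<odot>\<^bsub>M\<^esub> y') (s' \<otimes> t') = ?z"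
    if xs: "(x', s') \<in> fr x s" and yt: "(y', t') \<in> fr y t" for x' s' y' t'
  proof -
    from frac_memD[OF xs] have xs: "x' \<in> carrier M" "s' \<in> S" and "fr x' s' = fr x s" by auto
    then obtain u where u: "u \<in> S" "(u \<otimes> s) \<odot>\<^bsub>M\<^esub> x' = (u \<otimes> s') \<odot>\<^bsub>M\<^esub> x"
      using assms by (auto simp: frac_eq_iff)
    from frac_memD[OF yt] have yt: "y' \<in> carrier M" "t' \<in> S" and "fr y' t' = fr y t" by auto
    then obtain v where v: "v \<in> S" "(v \<otimes> t) \<odot>\<^bsub>M\<^esub> y' = (v \<otimes> t') \<odot>\<^bsub>M\<^esub> y"
      using assms by (auto simp: frac_eq_iff)
    note c = u(1) v(1) assms xs yt
    \<comment> \<open>The product of the witnesses for the two changes of representative is a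
      witness for the sum.\<close>
    have "(u \<otimes> v \<otimes> (s \<otimes> t)) \<odot>\<^bsub>M\<^esub> (t' \<odot>\<^bsub>M\<^esub> x' \<oplus>\<^bsub>M\<^esub> s' \<odot>\<^bsub>M\<^esub> y') =
        (v \<otimes> t \<otimes> t') \<odot>\<^bsub>M\<^esub> ((u \<otimes> s) \<odot>\<^bsub>M\<^esub> x') \<oplus>\<^bsub>M\<^esub> (u \<otimes> s \<otimes> s') \<odot>\<^bsub>M\<^esub> ((v \<otimes> t) \<odot>\<^bsub>M\<^esub> y')"
      using c by (simp add: S_closed m_ac smult_r_distr flip: smult_assoc1)
    also have "\<dots> = (u \<otimes> v \<otimes> (s' \<otimes> t')) \<odot>\<^bsub>M\<^esub> (t \<odot>\<^bsub>M\<^esub> x \<oplus>\<^bsub>M\<^esub> s \<odot>\<^bsub>M\<^esub> y)"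
      unfolding u(2) v(2) using c by (simp add: S_closed m_ac smult_r_distr flip: smult_assoc1)
    finally show ?thesis
      using c by (subst frac_eq_iff) (auto simp: S_closed S_mult)
  qed
  have "(\<Union>(x', s')\<in>fr x s. \<Union>(y', t')\<in>fr y t. fr (t' \<odot>\<^bsub>M\<^esub> x' \<oplus>\<^bsub>M\<^esub> s' \<odot>\<^bsub>M\<^esub> y') (s' \<otimes> t')) = ?z"
    (is "(\<Union>p\<in>_. ?f p) = _")
  proof (rule SUP_eq_const)
    show "fr x s \<noteq> {}" using frac_self[OF assms(1,2)] by blast
    fix p assume "p \<in> fr x s"
    then obtain x' s' where p: "p = (x', s')" "(x', s') \<in> fr x s" by (metis surj_pair)
    have "(\<Union>(y', t')\<in>fr y t. fr (t' \<odot>\<^bsub>M\<^esub> x' \<oplus>\<^bsub>M\<^esub> s' \<odot>\<^bsub>M\<^esub> y') (s' \<otimes> t')) = ?z"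
    proof (rule SUP_eq_const)
      show "fr y t \<noteq> {}" using frac_self[OF assms(3,4)] by blast
      fix q assume "q \<in> fr y t"
      then obtain y' t' where q: "q = (y', t')" "(y', t') \<in> fr y t" by (metis surj_pair)
      show "(case q of (y', t') \<Rightarrow> fr (t' \<odot>\<^bsub>M\<^esub> x' \<oplus>\<^bsub>M\<^esub> s' \<odot>\<^bsub>M\<^esub> y') (s' \<otimes> t')) = ?z"
        unfolding q(1) case_prod_conv by (rule *[OF p(2) q(2)])
    qed
    then show "?f p = ?z" by (simp only: p(1) case_prod_conv)
  qed
  then show ?thesis by (simp add: localization_def)
qed

lemma loc_zero: "\<zero>\<^bsub>Loc\<^esub> = fr \<zero>\<^bsub>M\<^esub> \<one>"
  by (simp add: localization_def)

lemma loc_add_same: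
  assumes "x \<in> carrier M" "s \<in> S" "y \<in> carrier M"
  shows "fr x s \<oplus>\<^bsub>Loc\<^esub> fr y s = fr (x \<oplus>\<^bsub>M\<^esub> y) s"
  using assms unfolding loc_add[OF assms(1,2,3,2)]
  by (intro frac_eqI) (simp_all add: S_closed S_mult smult_r_distr m_ac flip: smult_assoc1)

lemma loc_module: "module R Loc"
proof -
  have ag: "abelian_group Loc"
  proof (rule abelian_groupI)
    fix X Y assume "X \<in> carrier Loc" "Y \<in> carrier Loc"
    then obtain x s y t where *: "X = fr x s" "x \<in> carrier M" "s \<in> S" "Y = fr y t" "y \<in> carrier M" "t \<in> S"
      by (auto simp: loc_carrier)
    then show "X \<oplus>\<^bsub>Loc\<^esub> Y \<in> carrier Loc" by (simp add: loc_add frac_closed S_closed S_mult)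
    from * show "X \<oplus>\<^bsub>Loc\<^esub> Y = Y \<oplus>\<^bsub>Loc\<^esub> X"
      by (simp add: loc_add S_closed m_comm M.a_comm)
    fix Z assume "Z \<in> carrier Loc"
    then obtain z v where **: "Z = fr z v" "z \<in> carrier M" "v \<in> S" by (auto simp: loc_carrier)
    then show "X \<oplus>\<^bsub>Loc\<^esub> Y \<oplus>\<^bsub>Loc\<^esub> Z = X \<oplus>\<^bsub>Loc\<^esub> (Y \<oplus>\<^bsub>Loc\<^esub> Z)"
      using * by (simp add: loc_add S_closed S_mult smult_r_distr m_ac M.a_ac flip: smult_assoc1)
  next
    show "\<zero>\<^bsub>Loc\<^esub> \<in> carrier Loc" by (simp add: loc_zero frac_closed S_one)
  next
    fix X assume "X \<in> carrier Loc"
    then obtain x s where *: "X = fr x s" "x \<in> carrier M" "s \<in> S" by (auto simp: loc_carrier)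
    then show "\<zero>\<^bsub>Loc\<^esub> \<oplus>\<^bsub>Loc\<^esub> X = X"
      by (simp add: loc_zero loc_add S_closed S_one)
    have "fr (\<ominus>\<^bsub>M\<^esub> x) s \<oplus>\<^bsub>Loc\<^esub> X = \<zero>\<^bsub>Loc\<^esub>"
      using * by (simp add: loc_zero loc_add_same M.l_neg) (rule frac_eqI; simp add: S_closed S_one)
    then show "\<exists>Y\<in>carrier Loc. Y \<oplus>\<^bsub>Loc\<^esub> X = \<zero>\<^bsub>Loc\<^esub>"
      using * by (intro bexI[of _ "fr (\<ominus>\<^bsub>M\<^esub> x) s"]) (simp_all add: frac_closed)
  qed
  show ?thesis
  proof (rule moduleI[OF R.is_cring ag])
    fix X a assume "X \<in> carrier Loc" and a: "a \<in> carrier R"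
    then obtain x s where *: "X = fr x s" "x \<in> carrier M" "s \<in> S"
      by (auto simp: loc_carrier)
    then show "a \<odot>\<^bsub>Loc\<^esub> X \<in> carrier Loc" using a by (simp add: loc_smult frac_closed)
    fix b assume b: "b \<in> carrier R"
    from * a b show "(a \<oplus> b) \<odot>\<^bsub>Loc\<^esub> X = a \<odot>\<^bsub>Loc\<^esub> X \<oplus>\<^bsub>Loc\<^esub> b \<odot>\<^bsub>Loc\<^esub> X"
      by (simp add: loc_smult loc_add_same smult_l_distr)
    from * a b show "a \<otimes> b \<odot>\<^bsub>Loc\<^esub> X = a \<odot>\<^bsub>Loc\<^esub> (b \<odot>\<^bsub>Loc\<^esub> X)"
      by (simp add: loc_smult smult_assoc1)
  next
    fix X Y a assume "X \<in> carrier Loc" "Y \<in> carrier Loc" and a: "a \<in> carrier R"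
    then obtain x s y t where *: "X = fr x s" "x \<in> carrier M" "s \<in> S" "Y = fr y t" "y \<in> carrier M" "t \<in> S"
      by (auto simp: loc_carrier)
    then show "a \<odot>\<^bsub>Loc\<^esub> (X \<oplus>\<^bsub>Loc\<^esub> Y) = a \<odot>\<^bsub>Loc\<^esub> X \<oplus>\<^bsub>Loc\<^esub> a \<odot>\<^bsub>Loc\<^esub> Y"
      using a by (simp add: loc_smult loc_add S_closed S_mult smult_r_distr m_ac flip: smult_assoc1)
  qed (auto simp: loc_carrier loc_smult)
qed

lemma frac_hom: "(\<lambda>x. fr x \<one>) \<in> mod_hom R M Loc"
  by (rule mod_homI) (simp_all add: frac_closed S_one loc_add_same loc_smult)

lemma frac_one_zeroD:
  assumes "x \<in> carrier M" "fr x \<one> = \<zero>\<^bsub>Loc\<^esub>"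
  shows "\<exists>s\<in>S. s \<odot>\<^bsub>M\<^esub> x = \<zero>\<^bsub>M\<^esub>"
  using assms S_one by (auto simp: loc_zero frac_eq_iff S_closed)

text \<open>The inverse of multiplication by \<open>s\<close> sends the fraction
  \<open>x / t\<close> to \<open>x / (s t)\<close>.\<close>

lemma loc_bij:
  assumes "s \<in> S"
  shows "bij_betw (\<lambda>z. s \<odot>\<^bsub>Loc\<^esub> z) (carrier Loc) (carrier Loc)"
proof (rule bij_betw_imageI)
  show "inj_on (\<lambda>z. s \<odot>\<^bsub>Loc\<^esub> z) (carrier Loc)"
  proof (rule inj_onI)
    fix X Y assume "X \<in> carrier Loc" "Y \<in> carrier Loc" and e: "s \<odot>\<^bsub>Loc\<^esub> X = s \<odot>\<^bsub>Loc\<^esub> Y"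
    then obtain x p y q where *: "X = fr x p" "x \<in> carrier M" "p \<in> S" "Y = fr y q" "y \<in> carrier M" "q \<in> S"
      by (auto simp: loc_carrier)
    with e assms obtain u where u: "u \<in> S" "(u \<otimes> q) \<odot>\<^bsub>M\<^esub> (s \<odot>\<^bsub>M\<^esub> x) = (u \<otimes> p) \<odot>\<^bsub>M\<^esub> (s \<odot>\<^bsub>M\<^esub> y)"
      by (auto simp: loc_smult frac_eq_iff S_closed)
    then have "((u \<otimes> s) \<otimes> q) \<odot>\<^bsub>M\<^esub> x = ((u \<otimes> s) \<otimes> p) \<odot>\<^bsub>M\<^esub> y"
      using * assms by (simp add: S_closed m_ac flip: smult_assoc1)
    then show "X = Y" using * u(1) assms
      by (simp add: frac_eq_iff) (blast intro: S_mult)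
  qed
  have "fr x t = s \<odot>\<^bsub>Loc\<^esub> fr x (s \<otimes> t)" if "x \<in> carrier M" "t \<in> S" for x t
    using that assms
    by (simp add: loc_smult S_closed S_mult) (intro frac_eqI, simp_all add: S_closed S_mult m_ac flip: smult_assoc1)
  then show "(\<lambda>z. s \<odot>\<^bsub>Loc\<^esub> z) ` carrier Loc = carrier Loc"
    using assms module.smult_closed[OF loc_module] frac_closed
    by (fastforce simp: loc_carrier S_closed S_mult)
qed

end

text \<open>For multiplicative \<open>S\<close> these are the modules over the localization
  \<open>S^-1 R\<close>; in this form no second ring has to be introduced.\<close>

definition smult_bij :: "('a, 'm) ring_scheme \<Rightarrow> 'a set \<Rightarrow> ('a, 'b) module \<Rightarrow> bool" where
  "smult_bij R S L \<longleftrightarrow> (\<forall>s\<in>S. bij_betw (\<lambda>x. s \<odot>\<^bsub>L\<^esub> x) (carrier L) (carrier L))"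

lemma
  assumes "smult_bij R S L" "s \<in> S"
  shows smult_bij_inj: "\<lbrakk>x \<in> carrier L; y \<in> carrier L; s \<odot>\<^bsub>L\<^esub> x = s \<odot>\<^bsub>L\<^esub> y\<rbrakk> \<Longrightarrow> x = y"
    and smult_bij_surj: "y \<in> carrier L \<Longrightarrow> \<exists>x\<in>carrier L. s \<odot>\<^bsub>L\<^esub> x = y"
proof -
  from assms have b: "bij_betw (\<lambda>x. s \<odot>\<^bsub>L\<^esub> x) (carrier L) (carrier L)" by (auto simp: smult_bij_def)
  then show "\<lbrakk>x \<in> carrier L; y \<in> carrier L; s \<odot>\<^bsub>L\<^esub> x = s \<odot>\<^bsub>L\<^esub> y\<rbrakk> \<Longrightarrow> x = y"
    by (auto simp: bij_betw_def dest: inj_onD)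
  show "\<exists>x\<in>carrier L. s \<odot>\<^bsub>L\<^esub> x = y" if "y \<in> carrier L"
  proof -
    have "y \<in> (\<lambda>x. s \<odot>\<^bsub>L\<^esub> x) ` carrier L" using that bij_betw_imp_surj_on[OF b] by simp
    then show ?thesis by blast
  qed
qed

text \<open>A linear map commutes with multiplication by \<open>s\<close>, so a right inverse that
  is linear is a left inverse too.\<close>

lemma smult_bijI:
  assumes "module R X" "s \<in> carrier R" and \<sigma>: "\<sigma> \<in> mod_hom R X X"
    and inv: "\<And>x. x \<in> carrier X \<Longrightarrow> s \<odot>\<^bsub>X\<^esub> \<sigma> x = x"
  shows "bij_betw (\<lambda>x. s \<odot>\<^bsub>X\<^esub> x) (carrier X) (carrier X)"
proof (rule bij_betw_imageI)
  interpret module R X by fact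
  show "inj_on (\<lambda>x. s \<odot>\<^bsub>X\<^esub> x) (carrier X)"
  proof (rule inj_onI)
    fix x y assume *: "x \<in> carrier X" "y \<in> carrier X" "s \<odot>\<^bsub>X\<^esub> x = s \<odot>\<^bsub>X\<^esub> y"
    then have "s \<odot>\<^bsub>X\<^esub> \<sigma> x = s \<odot>\<^bsub>X\<^esub> \<sigma> y"
      using mod_hom_smult[OF \<sigma> assms(2), of x] mod_hom_smult[OF \<sigma> assms(2), of y] by simp
    then show "x = y" using * inv by simp
  qed
  show "(\<lambda>x. s \<odot>\<^bsub>X\<^esub> x) ` carrier X = carrier X"
  proof (intro equalityI subsetI)
    fix x assume "x \<in> carrier X"
    then show "x \<in> (\<lambda>x. s \<odot>\<^bsub>X\<^esub> x) ` carrier X"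
      using mod_hom_closed[OF \<sigma>] by (intro image_eqI[of _ _ "\<sigma> x"]) (simp_all add: inv)
  qed (use assms(2) in auto)
qed

lemma smult_bij_inverse:
  assumes "module R X" "smult_bij R S X" "s \<in> S" "s \<in> carrier R"
  obtains \<sigma> where "\<sigma> \<in> mod_hom R X X" "\<And>x. x \<in> carrier X \<Longrightarrow> s \<odot>\<^bsub>X\<^esub> \<sigma> x = x"
proof -
  interpret module R X by fact
  have "\<exists>\<sigma>. \<forall>x\<in>carrier X. \<sigma> x \<in> carrier X \<and> s \<odot>\<^bsub>X\<^esub> \<sigma> x = x"
    using smult_bij_surj[OF assms(2,3)] by (intro bchoice) blast
  then obtain \<sigma> where c: "\<And>x. x \<in> carrier X \<Longrightarrow> \<sigma> x \<in> carrier X"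
    and i: "\<And>x. x \<in> carrier X \<Longrightarrow> s \<odot>\<^bsub>X\<^esub> \<sigma> x = x" by blast
  note inj = smult_bij_inj[OF assms(2,3)]
  have "\<sigma> \<in> mod_hom R X X"
  proof (rule mod_homI)
    fix x y assume "x \<in> carrier X" "y \<in> carrier X"
    then show "\<sigma> (x \<oplus>\<^bsub>X\<^esub> y) = \<sigma> x \<oplus>\<^bsub>X\<^esub> \<sigma> y"
      using assms(4) by - (rule inj; simp_all add: c i smult_r_distr)
  next
    fix r x assume *: "r \<in> carrier R" "x \<in> carrier X"
    then have "s \<odot>\<^bsub>X\<^esub> (r \<odot>\<^bsub>X\<^esub> \<sigma> x) = r \<odot>\<^bsub>X\<^esub> (s \<odot>\<^bsub>X\<^esub> \<sigma> x)"
      using assms(4) by (simp add: c R.m_comm flip: smult_assoc1)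
    then show "\<sigma> (r \<odot>\<^bsub>X\<^esub> x) = r \<odot>\<^bsub>X\<^esub> \<sigma> x"
      using * by - (rule inj; simp_all add: c i)
  qed (fact c)
  then show thesis using i that by blast
qed

text \<open>\<open>T\<close> with \<open>e\<close> in the role of \<open>1\<close> is a localization of \<open>R\<close> at \<open>S\<close>.\<close>

definition is_loc :: "('a, 'm) ring_scheme \<Rightarrow> 'a set \<Rightarrow> ('a, 'b) module \<Rightarrow> 'b \<Rightarrow> bool" where
  "is_loc R S T e \<longleftrightarrow> mult_closed R S \<and> module R T \<and> e \<in> carrier T \<and> smult_bij R S T \<and>
     (\<forall>t\<in>carrier T. \<exists>s\<in>S. \<exists>r\<in>carrier R. s \<odot>\<^bsub>T\<^esub> t = r \<odot>\<^bsub>T\<^esub> e) \<and>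
     (\<forall>r\<in>carrier R. r \<odot>\<^bsub>T\<^esub> e = \<zero>\<^bsub>T\<^esub> \<longrightarrow> (\<exists>s\<in>S. s \<otimes>\<^bsub>R\<^esub> r = \<zero>\<^bsub>R\<^esub>))"

text \<open>The multiplication of \<open>T = S\<^sup>-\<^sup>1R\<close> on a module \<open>L\<close> on which \<open>S\<close> acts bijectively.\<close>

definition loc_act ::
  "('a, 'm) ring_scheme \<Rightarrow> 'a set \<Rightarrow> ('a, 'b) module \<Rightarrow> 'b \<Rightarrow> ('a, 'c) module \<Rightarrow> 'b \<Rightarrow> 'c \<Rightarrow> 'c" where
  "loc_act R S T e L t l = (THE l'. l' \<in> carrier L \<and>
     (\<exists>s\<in>S. \<exists>r\<in>carrier R. s \<odot>\<^bsub>T\<^esub> t = r \<odot>\<^bsub>T\<^esub> e \<and> s \<odot>\<^bsub>L\<^esub> l' = r \<odot>\<^bsub>L\<^esub> l))"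

locale localized = T: module R T for R :: "('a, 'm) ring_scheme" (structure)
  and T :: "('a, 'b) module" +
  fixes S :: "'a set" and e :: 'b
  assumes loc: "is_loc R S T e"
begin

lemma S: "mult_closed R S" and e_closed: "e \<in> carrier T" and bij: "smult_bij R S T"
  and denom: "t \<in> carrier T \<Longrightarrow> \<exists>s\<in>S. \<exists>r\<in>carrier R. s \<odot>\<^bsub>T\<^esub> t = r \<odot>\<^bsub>T\<^esub> e"
  and kernel: "\<lbrakk>r \<in> carrier R; r \<odot>\<^bsub>T\<^esub> e = \<zero>\<^bsub>T\<^esub>\<rbrakk> \<Longrightarrow> \<exists>s\<in>S. s \<otimes> r = \<zero>"
  using loc by (auto simp: is_loc_def)

lemma S_closed: "s \<in> S \<Longrightarrow> s \<in> carrier R" and S_one: "\<one> \<in> S"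
  and S_mult: "\<lbrakk>s \<in> S; t \<in> S\<rbrakk> \<Longrightarrow> s \<otimes> t \<in> S"
  using S by (auto simp: mult_closed_def)

abbreviation "act \<equiv> loc_act R S T e"

text \<open>Two expressions of \<open>t\<close> as a fraction give \<open>s2 r1 - s1 r2\<close>
  annihilating \<open>e\<close>. The kernel clause of \<open>is_loc\<close> then provides
  \<open>u\<close> in \<open>S\<close> killing this difference in \<open>R\<close>, and
  \<open>u s1 s2\<close> can be cancelled on \<open>L\<close>. Without that clause the action of
  \<open>T\<close> on \<open>L\<close> would depend on the fraction chosen.\<close>

lemma act_unique:
  assumes L: "module R L" "smult_bij R S L" and t: "t \<in> carrier T" and l: "l \<in> carrier L"
    and 1: "s1 \<in> S" "r1 \<in> carrier R" "s1 \<odot>\<^bsub>T\<^esub> t = r1 \<odot>\<^bsub>T\<^esub> e" "l1 \<in> carrier L" "s1 \<odot>\<^bsub>L\<^esub> l1 = r1 \<odot>\<^bsub>L\<^esub> l"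
    and 2: "s2 \<in> S" "r2 \<in> carrier R" "s2 \<odot>\<^bsub>T\<^esub> t = r2 \<odot>\<^bsub>T\<^esub> e" "l2 \<in> carrier L" "s2 \<odot>\<^bsub>L\<^esub> l2 = r2 \<odot>\<^bsub>L\<^esub> l"
  shows "l1 = l2"
proof -
  interpret L: module R L by fact
  have "(s2 \<otimes> r1) \<odot>\<^bsub>T\<^esub> e = s2 \<odot>\<^bsub>T\<^esub> (s1 \<odot>\<^bsub>T\<^esub> t)" using 1 2 e_closed t by (simp add: S_closed T.smult_assoc1)
  also have "\<dots> = s1 \<odot>\<^bsub>T\<^esub> (s2 \<odot>\<^bsub>T\<^esub> t)" using 1(1,2) 2(1,2) e_closed t by (simp add: S_closed T.R.m_comm flip: T.smult_assoc1)
  also have "\<dots> = (s1 \<otimes> r2) \<odot>\<^bsub>T\<^esub> e" using 1 2 e_closed t by (simp add: S_closed T.smult_assoc1)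
  finally have "(s2 \<otimes> r1 \<ominus> s1 \<otimes> r2) \<odot>\<^bsub>T\<^esub> e = \<zero>\<^bsub>T\<^esub>"
    using 1 2 e_closed by (simp add: a_minus_def T.smult_l_distr T.smult_l_minus S_closed T.M.r_neg)
  then obtain u where u: "u \<in> S" "u \<otimes> (s2 \<otimes> r1 \<ominus> s1 \<otimes> r2) = \<zero>"
    using kernel[of "s2 \<otimes> r1 \<ominus> s1 \<otimes> r2"] 1(1,2) 2(1,2) S_closed by auto
  have "u \<otimes> (s2 \<otimes> r1) \<ominus> u \<otimes> (s1 \<otimes> r2) = u \<otimes> (s2 \<otimes> r1 \<ominus> s1 \<otimes> r2)"
    using u(1) 1(1,2) 2(1,2) by (simp add: a_minus_def T.R.r_distr T.R.r_minus S_closed)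
  then have ueq: "u \<otimes> (s2 \<otimes> r1) = u \<otimes> (s1 \<otimes> r2)"
    using u 1(1,2) 2(1,2) by (simp add: T.R.minus_eq_zero_iff S_closed)
  have "(u \<otimes> s1 \<otimes> s2) \<odot>\<^bsub>L\<^esub> l1 = (u \<otimes> s2) \<odot>\<^bsub>L\<^esub> (s1 \<odot>\<^bsub>L\<^esub> l1)"
    using u(1) 1(1,2,4) 2(1,2,4) by (simp add: S_closed T.R.m_ac flip: L.smult_assoc1)
  also have "\<dots> = (u \<otimes> (s2 \<otimes> r1)) \<odot>\<^bsub>L\<^esub> l"
    unfolding 1(5) using u(1) 1(1,2,4) 2(1,2,4) l by (simp add: S_closed T.R.m_ac flip: L.smult_assoc1)
  also have "\<dots> = (u \<otimes> s1) \<odot>\<^bsub>L\<^esub> (s2 \<odot>\<^bsub>L\<^esub> l2)"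
    unfolding ueq 2(5) using u(1) 1(1,2,4) 2(1,2,4) l by (simp add: S_closed T.R.m_ac flip: L.smult_assoc1)
  also have "\<dots> = (u \<otimes> s1 \<otimes> s2) \<odot>\<^bsub>L\<^esub> l2"
    using u(1) 1(1,2,4) 2(1,2,4) by (simp add: S_closed T.R.m_ac flip: L.smult_assoc1)
  finally show ?thesis
    using 1 2 u(1) by - (rule smult_bij_inj[OF L(2), of "u \<otimes> s1 \<otimes> s2"]; simp_all add: S_mult)
qed

lemma act_eqI:
  assumes "module R L" "smult_bij R S L" "t \<in> carrier T" "l \<in> carrier L"
    and "s \<in> S" "r \<in> carrier R" "s \<odot>\<^bsub>T\<^esub> t = r \<odot>\<^bsub>T\<^esub> e" "l' \<in> carrier L" "s \<odot>\<^bsub>L\<^esub> l' = r \<odot>\<^bsub>L\<^esub> l"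
  shows "act L t l = l'"
  unfolding loc_act_def
proof (rule the_equality)
  show "l' \<in> carrier L \<and> (\<exists>s\<in>S. \<exists>r\<in>carrier R. s \<odot>\<^bsub>T\<^esub> t = r \<odot>\<^bsub>T\<^esub> e \<and> s \<odot>\<^bsub>L\<^esub> l' = r \<odot>\<^bsub>L\<^esub> l)"
    using assms(5-9) by blast
  fix l'' assume "l'' \<in> carrier L \<and> (\<exists>s\<in>S. \<exists>r\<in>carrier R. s \<odot>\<^bsub>T\<^esub> t = r \<odot>\<^bsub>T\<^esub> e \<and> s \<odot>\<^bsub>L\<^esub> l'' = r \<odot>\<^bsub>L\<^esub> l)"
  then show "l'' = l'" using act_unique[OF assms(1-4) _ _ _ _ _ assms(5-9)] by blast
qed

lemma act_witness:
  assumes "module R L" "smult_bij R S L" "t \<in> carrier T" "l \<in> carrier L"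
  obtains s r where "s \<in> S" "r \<in> carrier R" "s \<odot>\<^bsub>T\<^esub> t = r \<odot>\<^bsub>T\<^esub> e"
    "act L t l \<in> carrier L" "s \<odot>\<^bsub>L\<^esub> act L t l = r \<odot>\<^bsub>L\<^esub> l"
proof -
  interpret L: module R L by fact
  obtain s r where sr: "s \<in> S" "r \<in> carrier R" "s \<odot>\<^bsub>T\<^esub> t = r \<odot>\<^bsub>T\<^esub> e"
    using denom[OF assms(3)] by blast
  moreover from sr obtain l' where "l' \<in> carrier L" "s \<odot>\<^bsub>L\<^esub> l' = r \<odot>\<^bsub>L\<^esub> l"
    using smult_bij_surj[OF assms(2), of s "r \<odot>\<^bsub>L\<^esub> l"] assms(4) by auto
  ultimately show thesis using act_eqI[OF assms, of s r l'] that[of s r] by blast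
qed

text \<open>Both sides are compared after multiplication by a common denominator;
  \<open>act_eqI\<close> turns such a comparison into the value of the action.\<close>

lemma act_bilinear:
  assumes L: "module R L" "smult_bij R S L"
  shows "bilinear R T L L (act L)"
proof -
  interpret L: module R L by fact
  show ?thesis
    unfolding bilinear_def
  proof (intro conjI ballI mod_homI)
    fix l t t' assume l: "l \<in> carrier L" and t: "t \<in> carrier T" "t' \<in> carrier T"
    obtain s r where sr: "s \<in> S" "r \<in> carrier R" "s \<odot>\<^bsub>T\<^esub> t = r \<odot>\<^bsub>T\<^esub> e"
      "act L t l \<in> carrier L" "s \<odot>\<^bsub>L\<^esub> act L t l = r \<odot>\<^bsub>L\<^esub> l" using act_witness[OF L t(1) l] .
    obtain s' r' where sr': "s' \<in> S" "r' \<in> carrier R" "s' \<odot>\<^bsub>T\<^esub> t' = r' \<odot>\<^bsub>T\<^esub> e"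
      "act L t' l \<in> carrier L" "s' \<odot>\<^bsub>L\<^esub> act L t' l = r' \<odot>\<^bsub>L\<^esub> l" using act_witness[OF L t(2) l] .
    note c = sr(1,2,4) sr'(1,2,4) l t e_closed S_closed[OF sr(1)] S_closed[OF sr'(1)] S_mult[OF sr(1) sr'(1)]
    have "(s \<otimes> s') \<odot>\<^bsub>T\<^esub> (t \<oplus>\<^bsub>T\<^esub> t') = s' \<odot>\<^bsub>T\<^esub> (s \<odot>\<^bsub>T\<^esub> t) \<oplus>\<^bsub>T\<^esub> s \<odot>\<^bsub>T\<^esub> (s' \<odot>\<^bsub>T\<^esub> t')"
      using c by (simp add: T.smult_r_distr T.R.m_ac flip: T.smult_assoc1)
    also have "\<dots> = (s' \<otimes> r \<oplus> s \<otimes> r') \<odot>\<^bsub>T\<^esub> e"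
      unfolding sr(3) sr'(3) using c by (simp add: T.smult_l_distr flip: T.smult_assoc1)
    finally have 1: "(s \<otimes> s') \<odot>\<^bsub>T\<^esub> (t \<oplus>\<^bsub>T\<^esub> t') = (s' \<otimes> r \<oplus> s \<otimes> r') \<odot>\<^bsub>T\<^esub> e" .
    have "(s \<otimes> s') \<odot>\<^bsub>L\<^esub> (act L t l \<oplus>\<^bsub>L\<^esub> act L t' l) = s' \<odot>\<^bsub>L\<^esub> (s \<odot>\<^bsub>L\<^esub> act L t l) \<oplus>\<^bsub>L\<^esub> s \<odot>\<^bsub>L\<^esub> (s' \<odot>\<^bsub>L\<^esub> act L t' l)"
      using c by (simp add: L.smult_r_distr T.R.m_ac flip: L.smult_assoc1)
    also have "\<dots> = (s' \<otimes> r \<oplus> s \<otimes> r') \<odot>\<^bsub>L\<^esub> l"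
      unfolding sr(5) sr'(5) using c by (simp add: L.smult_l_distr flip: L.smult_assoc1)
    finally have 2: "(s \<otimes> s') \<odot>\<^bsub>L\<^esub> (act L t l \<oplus>\<^bsub>L\<^esub> act L t' l) = (s' \<otimes> r \<oplus> s \<otimes> r') \<odot>\<^bsub>L\<^esub> l" .
    show "act L (t \<oplus>\<^bsub>T\<^esub> t') l = act L t l \<oplus>\<^bsub>L\<^esub> act L t' l"
      by (rule act_eqI[OF L _ l _ _ 1 _ 2]) (use c in \<open>simp_all\<close>)
  next
    fix l a t assume l: "l \<in> carrier L" and t: "t \<in> carrier T" and a: "a \<in> carrier R"
    obtain s r where sr: "s \<in> S" "r \<in> carrier R" "s \<odot>\<^bsub>T\<^esub> t = r \<odot>\<^bsub>T\<^esub> e"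
      "act L t l \<in> carrier L" "s \<odot>\<^bsub>L\<^esub> act L t l = r \<odot>\<^bsub>L\<^esub> l" using act_witness[OF L t l] .
    note c = sr(1,2,4) a l t e_closed S_closed[OF sr(1)]
    have "s \<odot>\<^bsub>T\<^esub> (a \<odot>\<^bsub>T\<^esub> t) = a \<odot>\<^bsub>T\<^esub> (s \<odot>\<^bsub>T\<^esub> t)"
      using c by (simp add: T.R.m_comm flip: T.smult_assoc1)
    then have 1: "s \<odot>\<^bsub>T\<^esub> (a \<odot>\<^bsub>T\<^esub> t) = (a \<otimes> r) \<odot>\<^bsub>T\<^esub> e"
      unfolding sr(3) using c by (simp add: T.smult_assoc1)
    have "s \<odot>\<^bsub>L\<^esub> (a \<odot>\<^bsub>L\<^esub> act L t l) = a \<odot>\<^bsub>L\<^esub> (s \<odot>\<^bsub>L\<^esub> act L t l)"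
      using c by (simp add: T.R.m_comm flip: L.smult_assoc1)
    then have 2: "s \<odot>\<^bsub>L\<^esub> (a \<odot>\<^bsub>L\<^esub> act L t l) = (a \<otimes> r) \<odot>\<^bsub>L\<^esub> l"
      unfolding sr(5) using c by (simp add: L.smult_assoc1)
    show "act L (a \<odot>\<^bsub>T\<^esub> t) l = a \<odot>\<^bsub>L\<^esub> act L t l"
      by (rule act_eqI[OF L _ l _ _ 1 _ 2]) (use c in \<open>simp_all\<close>)
  next
    fix t l l' assume l: "l \<in> carrier L" "l' \<in> carrier L" and t: "t \<in> carrier T"
    obtain s r where sr: "s \<in> S" "r \<in> carrier R" "s \<odot>\<^bsub>T\<^esub> t = r \<odot>\<^bsub>T\<^esub> e"
      "act L t l \<in> carrier L" "s \<odot>\<^bsub>L\<^esub> act L t l = r \<odot>\<^bsub>L\<^esub> l" using act_witness[OF L t l(1)] .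
    have *: "act L t l' \<in> carrier L" using act_witness[OF L t l(2)] by metis
    obtain l2 where l2: "l2 \<in> carrier L" "s \<odot>\<^bsub>L\<^esub> l2 = r \<odot>\<^bsub>L\<^esub> l'"
      using smult_bij_surj[OF L(2) sr(1), of "r \<odot>\<^bsub>L\<^esub> l'"] sr l by auto
    have "act L t l' = l2" by (rule act_eqI[OF L t l(2) sr(1-3) l2])
    moreover have "act L t (l \<oplus>\<^bsub>L\<^esub> l') = act L t l \<oplus>\<^bsub>L\<^esub> l2"
      using sr l l2 by (intro act_eqI[OF L t _ sr(1-3)]) (simp_all add: S_closed L.smult_r_distr)
    ultimately show "act L t (l \<oplus>\<^bsub>L\<^esub> l') = act L t l \<oplus>\<^bsub>L\<^esub> act L t l'" by simp
  next
    fix t a l assume l: "l \<in> carrier L" and t: "t \<in> carrier T" and a: "a \<in> carrier R"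
    obtain s r where sr: "s \<in> S" "r \<in> carrier R" "s \<odot>\<^bsub>T\<^esub> t = r \<odot>\<^bsub>T\<^esub> e"
      "act L t l \<in> carrier L" "s \<odot>\<^bsub>L\<^esub> act L t l = r \<odot>\<^bsub>L\<^esub> l" using act_witness[OF L t l] .
    have "s \<odot>\<^bsub>L\<^esub> (a \<odot>\<^bsub>L\<^esub> act L t l) = a \<odot>\<^bsub>L\<^esub> (s \<odot>\<^bsub>L\<^esub> act L t l)"
      using sr(1,2,4) a by (simp add: S_closed T.R.m_comm flip: L.smult_assoc1)
    also have "\<dots> = r \<odot>\<^bsub>L\<^esub> (a \<odot>\<^bsub>L\<^esub> l)"
      unfolding sr(5) using sr(1,2,4) a l by (simp add: S_closed T.R.m_comm flip: L.smult_assoc1)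
    finally show "act L t (a \<odot>\<^bsub>L\<^esub> l) = a \<odot>\<^bsub>L\<^esub> act L t l"
      using sr(4) a l by (intro act_eqI[OF L t _ sr(1-3)]) simp_all
  qed (metis act_witness[OF L])+
qed

lemma act_e: "\<lbrakk>module R L; smult_bij R S L; l \<in> carrier L\<rbrakk> \<Longrightarrow> act L e l = l"
  by (rule act_eqI[where s = \<one> and r = \<one>]) (auto simp: e_closed S_one)

text \<open>The inverse of \<open>s\<close> on \<open>T\<close>, tensored with the identity of
  \<open>M\<close>, is an inverse on the tensor product.\<close>

lemma tensor_smult_bij:
  assumes M: "module R M"
  shows "smult_bij R S (tensor R T M)"
  unfolding smult_bij_def
proof
  interpret M: module R M by fact
  fix s assume s: "s \<in> S"
  obtain \<sigma> where \<sigma>: "\<sigma> \<in> mod_hom R T T" "\<And>x. x \<in> carrier T \<Longrightarrow> s \<odot>\<^bsub>T\<^esub> \<sigma> x = x"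
    using smult_bij_inverse[OF T.module_axioms bij s S_closed[OF s]] by blast
  note TM = tensor_module[OF T.module_axioms M]
  note h = tensor_map_hom[OF T.module_axioms M T.module_axioms M \<sigma>(1) mod_hom_id]
  show "bij_betw (\<lambda>x. s \<odot>\<^bsub>tensor R T M\<^esub> x) (carrier (tensor R T M)) (carrier (tensor R T M))"
  proof (rule smult_bijI[OF TM S_closed[OF s] h])
    fix z assume z: "z \<in> carrier (tensor R T M)"
    show "s \<odot>\<^bsub>tensor R T M\<^esub> tensor_map R T M \<sigma> (\<lambda>y. y) z = z"
    proof (rule tensor_hom_eq[OF T.module_axioms M TM mod_hom_scale[OF h TM S_closed[OF s]] mod_hom_id _ z])
      fix x y assume *: "x \<in> carrier T" "y \<in> carrier M"
      have "s \<odot>\<^bsub>tensor R T M\<^esub> pure_tensor R T M (\<sigma> x) y = pure_tensor R T M (s \<odot>\<^bsub>T\<^esub> \<sigma> x) y"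
      proof -
        have "(\<lambda>t. pure_tensor R T M t y) \<in> mod_hom R T (tensor R T M)"
          using pure_tensor_bilinear[OF T.module_axioms M] * by (auto simp: bilinear_def)
        from mod_hom_smult[OF this S_closed[OF s] mod_hom_closed[OF \<sigma>(1) *(1)]] show ?thesis by simp
      qed
      then show "s \<odot>\<^bsub>tensor R T M\<^esub> tensor_map R T M \<sigma> (\<lambda>y. y) (pure_tensor R T M x y) = pure_tensor R T M x y"
        using * by (simp add: tensor_map_pure[OF T.module_axioms M T.module_axioms M \<sigma>(1) mod_hom_id] \<sigma>(2))
    qed
  qed
qed

lemma pure_tensor_e_hom: "module R M \<Longrightarrow> pure_tensor R T M e \<in> mod_hom R M (tensor R T M)"
  using pure_tensor_bilinear[OF T.module_axioms] e_closed by (auto simp: bilinear_def)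

text \<open>The elements with this property form a submodule, by common denominators, and it
  contains the pure tensors because \<open>t\<close> itself is a fraction with numerator a multiple
  of \<open>e\<close>.\<close>

lemma tensor_denom:
  assumes M: "module R M" and z: "z \<in> carrier (tensor R T M)"
  shows "\<exists>s\<in>S. \<exists>m\<in>carrier M. s \<odot>\<^bsub>tensor R T M\<^esub> z = pure_tensor R T M e m"
proof -
  interpret M: module R M by fact
  interpret X: module R "tensor R T M" by (rule tensor_module[OF T.module_axioms M])
  note ph = pure_tensor_e_hom[OF M]
  let ?H = "{z \<in> carrier (tensor R T M). \<exists>s\<in>S. \<exists>m\<in>carrier M. s \<odot>\<^bsub>tensor R T M\<^esub> z = pure_tensor R T M e m}"
  have "submodule ?H R (tensor R T M)"
  proof (rule submoduleI'[OF X.module_axioms])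
    show "\<zero>\<^bsub>tensor R T M\<^esub> \<in> ?H"
    proof -
      have "\<one> \<odot>\<^bsub>tensor R T M\<^esub> \<zero>\<^bsub>tensor R T M\<^esub> = pure_tensor R T M e \<zero>\<^bsub>M\<^esub>"
        using mod_hom_zero[OF ph M X.module_axioms] by simp
      then show ?thesis using S_one M.zero_closed X.zero_closed by blast
    qed
    fix x y assume "x \<in> ?H" "y \<in> ?H"
    then obtain s m s' m' where *: "x \<in> carrier (tensor R T M)" "y \<in> carrier (tensor R T M)" "s \<in> S" "s' \<in> S"
      "m \<in> carrier M" "m' \<in> carrier M" and e: "s \<odot>\<^bsub>tensor R T M\<^esub> x = pure_tensor R T M e m"
      "s' \<odot>\<^bsub>tensor R T M\<^esub> y = pure_tensor R T M e m'" by auto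
    have "(s \<otimes> s') \<odot>\<^bsub>tensor R T M\<^esub> (x \<oplus>\<^bsub>tensor R T M\<^esub> y) =
        s' \<odot>\<^bsub>tensor R T M\<^esub> (s \<odot>\<^bsub>tensor R T M\<^esub> x) \<oplus>\<^bsub>tensor R T M\<^esub> s \<odot>\<^bsub>tensor R T M\<^esub> (s' \<odot>\<^bsub>tensor R T M\<^esub> y)"
      using * by (simp add: X.smult_r_distr S_closed T.R.m_comm flip: X.smult_assoc1)
    also have "\<dots> = pure_tensor R T M e (s' \<odot>\<^bsub>M\<^esub> m \<oplus>\<^bsub>M\<^esub> s \<odot>\<^bsub>M\<^esub> m')"
      unfolding e using * by (simp add: mod_hom_add[OF ph] mod_hom_smult[OF ph] S_closed)
    finally show "x \<oplus>\<^bsub>tensor R T M\<^esub> y \<in> ?H"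
      using * S_mult[OF *(3,4)] S_closed[OF *(3)] S_closed[OF *(4)]
      by (auto intro!: bexI[of _ "s \<otimes> s'"] bexI[of _ "s' \<odot>\<^bsub>M\<^esub> m \<oplus>\<^bsub>M\<^esub> s \<odot>\<^bsub>M\<^esub> m'"])
  next
    fix r x assume r: "r \<in> carrier R" and "x \<in> ?H"
    then obtain s m where *: "x \<in> carrier (tensor R T M)" "s \<in> S"
      "m \<in> carrier M" and e: "s \<odot>\<^bsub>tensor R T M\<^esub> x = pure_tensor R T M e m" by auto
    have "s \<odot>\<^bsub>tensor R T M\<^esub> (r \<odot>\<^bsub>tensor R T M\<^esub> x) = r \<odot>\<^bsub>tensor R T M\<^esub> (s \<odot>\<^bsub>tensor R T M\<^esub> x)"
      using * r by (simp add: S_closed T.R.m_comm flip: X.smult_assoc1)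
    also have "\<dots> = pure_tensor R T M e (r \<odot>\<^bsub>M\<^esub> m)"
      unfolding e using * r by (simp add: mod_hom_smult[OF ph])
    finally show "r \<odot>\<^bsub>tensor R T M\<^esub> x \<in> ?H" using * r by auto
  qed auto
  moreover have "pure_tensor R T M t m \<in> ?H" if tm: "t \<in> carrier T" "m \<in> carrier M" for t m
  proof -
    obtain s r where sr: "s \<in> S" "r \<in> carrier R" "s \<odot>\<^bsub>T\<^esub> t = r \<odot>\<^bsub>T\<^esub> e"
      using denom[OF tm(1)] by blast
    have l: "(\<lambda>t. pure_tensor R T M t m) \<in> mod_hom R T (tensor R T M)"
      using pure_tensor_bilinear[OF T.module_axioms M] tm by (auto simp: bilinear_def)
    have "s \<odot>\<^bsub>tensor R T M\<^esub> pure_tensor R T M t m = pure_tensor R T M e (r \<odot>\<^bsub>M\<^esub> m)"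
      using sr tm mod_hom_smult[OF l S_closed[OF sr(1)] tm(1)] mod_hom_smult[OF l sr(2) e_closed]
        mod_hom_smult[OF ph sr(2) tm(2)] by simp
    then show ?thesis using sr tm pure_tensor_closed[OF T.module_axioms M] by auto
  qed
  ultimately show ?thesis using tensor_generated[OF T.module_axioms M _ _ z] by blast
qed

text \<open>To detect which \<open>e \<otimes> m\<close> vanish, the tensor product is mapped to the
  concrete localization of \<open>M\<close> by letting \<open>t\<close> act on \<open>m / 1\<close>.
  There \<open>e \<otimes> m\<close> becomes \<open>m / 1\<close>, whose vanishing is
  understood.\<close>

lemma pure_tensor_e_zeroD:
  assumes M: "module R M" and m: "m \<in> carrier M" "pure_tensor R T M e m = \<zero>\<^bsub>tensor R T M\<^esub>"
  shows "\<exists>s\<in>S. s \<odot>\<^bsub>M\<^esub> m = \<zero>\<^bsub>M\<^esub>"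
proof -
  interpret L: module_localization R M S
    using M S by (simp add: module_localization_def module_localization_axioms_def)
  interpret X: module R "tensor R T M" by (rule tensor_module[OF T.module_axioms M])
  have bijL: "smult_bij R S L.Loc" using L.loc_bij by (simp add: smult_bij_def)
  note act = act_bilinear[OF L.loc_module bijL]
  have b: "bilinear R T M L.Loc (\<lambda>t m. act L.Loc t (L.fr m \<one>))"
    unfolding bilinear_def
  proof (intro conjI ballI)
    fix m assume "m \<in> carrier M"
    then show "(\<lambda>t. act L.Loc t (L.fr m \<one>)) \<in> mod_hom R T L.Loc"
      using act mod_hom_closed[OF L.frac_hom] by (auto simp: bilinear_def)
  next
    fix t assume "t \<in> carrier T"
    then have "act L.Loc t \<in> mod_hom R L.Loc L.Loc" using act by (auto simp: bilinear_def)
    from mod_hom_comp[OF L.frac_hom this] show "(\<lambda>m. act L.Loc t (L.fr m \<one>)) \<in> mod_hom R M L.Loc" .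
  qed
  let ?g = "tensor_lift R L.Loc (\<lambda>(t, m). act L.Loc t (L.fr m \<one>))"
  note g = tensor_lift_hom[OF T.module_axioms M L.loc_module b]
  have "?g (pure_tensor R T M e m) = L.fr m \<one>"
    using tensor_lift_pure[OF T.module_axioms M L.loc_module b e_closed m(1)]
      act_e[OF L.loc_module bijL mod_hom_closed[OF L.frac_hom m(1)]] by simp
  then have "L.fr m \<one> = \<zero>\<^bsub>L.Loc\<^esub>"
    unfolding m(2) using mod_hom_zero[OF g X.module_axioms L.loc_module] by simp
  from L.frac_one_zeroD[OF m(1) this] show ?thesis .
qed

text \<open>Flatness of a localization by clearing denominators: a multiple of \<open>z\<close> is
  \<open>e \<otimes> m\<close>, a further element \<open>s'\<close> of \<open>S\<close> kills
  \<open>g m\<close>, so \<open>s' m = f l\<close>. Dividing \<open>e \<otimes> l\<close> by the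
  accumulated denominator gives the preimage.\<close>

theorem tensor_exact:
  assumes L: "module R L" and M: "module R M" and N: "module R N"
    and f: "f \<in> mod_hom R L M" and g: "g \<in> mod_hom R M N"
    and ex: "\<And>x. \<lbrakk>x \<in> carrier M; g x = \<zero>\<^bsub>N\<^esub>\<rbrakk> \<Longrightarrow> x \<in> f ` carrier L"
    and z: "z \<in> carrier (tensor R T M)" "tensor_map R T N (\<lambda>t. t) g z = \<zero>\<^bsub>tensor R T N\<^esub>"
  shows "\<exists>y\<in>carrier (tensor R T L). tensor_map R T M (\<lambda>t. t) f y = z"
proof -
  interpret L: module R L by fact
  interpret M: module R M by fact
  interpret N: module R N by fact
  note TL = tensor_module[OF T.module_axioms L] and TM = tensor_module[OF T.module_axioms M]
    and TN = tensor_module[OF T.module_axioms N]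
  interpret TL: module R "tensor R T L" by (rule TL)
  interpret TM: module R "tensor R T M" by (rule TM)
  interpret TN: module R "tensor R T N" by (rule TN)
  note hg = tensor_map_hom[OF T.module_axioms M T.module_axioms N mod_hom_id g]
    and hf = tensor_map_hom[OF T.module_axioms L T.module_axioms M mod_hom_id f]
  obtain s m where s: "s \<in> S" and m: "m \<in> carrier M" "s \<odot>\<^bsub>tensor R T M\<^esub> z = pure_tensor R T M e m"
    using tensor_denom[OF M z(1)] by blast
  have "pure_tensor R T N e (g m) = tensor_map R T N (\<lambda>t. t) g (s \<odot>\<^bsub>tensor R T M\<^esub> z)"
    using m by (simp add: tensor_map_pure[OF T.module_axioms M T.module_axioms N mod_hom_id g] e_closed)
  also have "\<dots> = \<zero>\<^bsub>tensor R T N\<^esub>"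
    using z s by (simp add: mod_hom_smult[OF hg] S_closed)
  finally obtain s' where s': "s' \<in> S" "s' \<odot>\<^bsub>N\<^esub> g m = \<zero>\<^bsub>N\<^esub>"
    using pure_tensor_e_zeroD[OF N mod_hom_closed[OF g m(1)]] by blast
  then have "g (s' \<odot>\<^bsub>M\<^esub> m) = \<zero>\<^bsub>N\<^esub>" using m by (simp add: mod_hom_smult[OF g] S_closed)
  then obtain l where l: "l \<in> carrier L" "s' \<odot>\<^bsub>M\<^esub> m = f l" using ex[of "s' \<odot>\<^bsub>M\<^esub> m"] m s' S_closed by auto
  note ss = S_mult[OF s'(1) s]
  obtain y where y: "y \<in> carrier (tensor R T L)" "(s' \<otimes> s) \<odot>\<^bsub>tensor R T L\<^esub> y = pure_tensor R T L e l"
    using smult_bij_surj[OF tensor_smult_bij[OF L] ss] pure_tensor_closed[OF T.module_axioms L e_closed l(1)] by blast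
  have "(s' \<otimes> s) \<odot>\<^bsub>tensor R T M\<^esub> tensor_map R T M (\<lambda>t. t) f y = pure_tensor R T M e (f l)"
    using y l ss mod_hom_smult[OF hf S_closed[OF ss] y(1)]
    by (simp add: tensor_map_pure[OF T.module_axioms L T.module_axioms M mod_hom_id f] e_closed)
  also have "\<dots> = (s' \<otimes> s) \<odot>\<^bsub>tensor R T M\<^esub> z"
    using m s s' z l by (simp add: TM.smult_assoc1 S_closed mod_hom_smult[OF pure_tensor_e_hom[OF M]] flip: l(2))
  finally have "tensor_map R T M (\<lambda>t. t) f y = z"
    using mod_hom_closed[OF hf y(1)] z by - (rule smult_bij_inj[OF tensor_smult_bij[OF M] ss]; simp)
  then show ?thesis using y(1) by blast
qed

end

section \<open>Tensor products of finitely many localizations\<close>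

lemma module_familyI: "\<lbrakk>cring R; \<And>k. k \<in> K \<Longrightarrow> module R (N k)\<rbrakk> \<Longrightarrow> module_family R K N"
  by (simp add: module_family_def module_family_axioms_def)

context module_family
begin

lemma slot_hom: "\<lbrakk>c \<in> Dom; k \<in> K\<rbrakk> \<Longrightarrow> (\<lambda>x. pure (c(k := x))) \<in> mod_hom R (N k) TT"
  using pure_family_multilinear by (auto simp: multilinear_def)

lemma pure_slot_smult:
  assumes "c \<in> Dom" "k \<in> K" "r \<in> carrier R" "x \<in> carrier (N k)"
  shows "pure (c(k := r \<odot>\<^bsub>N k\<^esub> x)) = r \<odot>\<^bsub>TT\<^esub> pure (c(k := x))"
  using mod_hom_smult[OF slot_hom[OF assms(1,2)] assms(3,4)] .

lemma pure_slot_zero: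
  assumes "c \<in> Dom" "k \<in> K"
  shows "pure (c(k := \<zero>\<^bsub>N k\<^esub>)) = \<zero>\<^bsub>TT\<^esub>"
  using mod_hom_zero[OF slot_hom[OF assms] fam[OF assms(2)] family_module] .

lemma slot_map_multilinear:
  assumes "k \<in> K" and h: "h \<in> mod_hom R (N k) (N k)"
  shows "multilinear R K N TT (\<lambda>c. pure (c(k := h (c k))))"
proof -
  have hc: "c(k := h (c k)) \<in> Dom" if "c \<in> Dom" for c
    using that assms(1) mod_hom_closed[OF h] by (intro PiE_upd) auto
  show ?thesis
    unfolding multilinear_def
  proof (intro conjI ballI)
    fix c j assume c: "c \<in> Dom" and j: "j \<in> K"
    show "(\<lambda>x. pure ((c(j := x))(k := h ((c(j := x)) k)))) \<in> mod_hom R (N j) TT"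
    proof (cases "j = k")
      case True
      then show ?thesis using mod_hom_comp[OF h slot_hom[OF c assms(1)]] by simp
    next
      case False
      then have "(\<lambda>x. pure ((c(j := x))(k := h ((c(j := x)) k)))) = (\<lambda>x. pure ((c(k := h (c k)))(j := x)))"
        by (simp add: fun_upd_twist)
      then show ?thesis using slot_hom[OF hc[OF c] j] by simp
    qed
  qed (simp add: pure_family_closed hc)
qed

text \<open>Invertibility of \<open>s\<close> on a single factor is enough: its inverse there,
  applied to that slot only, is multilinear and inverts \<open>s\<close> on the whole tensor
  product.\<close>

lemma family_smult_bij:
  assumes k: "k \<in> K" and "smult_bij R S (N k)" "S \<subseteq> carrier R"
  shows "smult_bij R S TT"
  unfolding smult_bij_def
proof
  fix s assume s: "s \<in> S"
  then have sR: "s \<in> carrier R" using assms by auto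
  obtain \<sigma> where \<sigma>: "\<sigma> \<in> mod_hom R (N k) (N k)" "\<And>x. x \<in> carrier (N k) \<Longrightarrow> s \<odot>\<^bsub>N k\<^esub> \<sigma> x = x"
    using smult_bij_inverse[OF fam[OF k] assms(2) s sR] by blast
  note h = family_lift_hom[OF family_module slot_map_multilinear[OF k \<sigma>(1)]]
  show "bij_betw (\<lambda>x. s \<odot>\<^bsub>TT\<^esub> x) (carrier TT) (carrier TT)"
  proof (rule smult_bijI[OF family_module sR h])
    fix z assume z: "z \<in> carrier TT"
    show "s \<odot>\<^bsub>TT\<^esub> tensor_lift R TT (\<lambda>c. pure (c(k := \<sigma> (c k)))) z = z"
    proof (rule family_hom_eq[OF family_module mod_hom_scale[OF h family_module sR] mod_hom_id _ z])
      fix c assume c: "c \<in> Dom"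
      then have ck: "c k \<in> carrier (N k)" using k by auto
      have "s \<odot>\<^bsub>TT\<^esub> pure (c(k := \<sigma> (c k))) = pure (c(k := s \<odot>\<^bsub>N k\<^esub> \<sigma> (c k)))"
        using pure_slot_smult[OF c k sR mod_hom_closed[OF \<sigma>(1) ck]] by simp
      then show "s \<odot>\<^bsub>TT\<^esub> tensor_lift R TT (\<lambda>c. pure (c(k := \<sigma> (c k)))) (pure c) = pure c"
        by (simp add: family_lift_pure[OF family_module slot_map_multilinear[OF k \<sigma>(1)] c] \<sigma>(2)[OF ck])
    qed
  qed
qed

end

lemma smult_bij_mult:
  assumes "module R X" "smult_bij R S X" "smult_bij R S' X" "S \<subseteq> carrier R" "S' \<subseteq> carrier R"
  shows "smult_bij R {s \<otimes>\<^bsub>R\<^esub> t | s t. s \<in> S \<and> t \<in> S'} X"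
  unfolding smult_bij_def
proof
  interpret module R X by fact
  fix u assume "u \<in> {s \<otimes>\<^bsub>R\<^esub> t | s t. s \<in> S \<and> t \<in> S'}"
  then obtain s t where u: "u = s \<otimes>\<^bsub>R\<^esub> t" "s \<in> S" "t \<in> S'" by auto
  then have "bij_betw ((\<lambda>x. s \<odot>\<^bsub>X\<^esub> x) \<circ> (\<lambda>x. t \<odot>\<^bsub>X\<^esub> x)) (carrier X) (carrier X)"
    using assms by (intro bij_betw_trans) (auto simp: smult_bij_def)
  then show "bij_betw (\<lambda>x. u \<odot>\<^bsub>X\<^esub> x) (carrier X) (carrier X)"
    using u assms(4,5) by (subst bij_betw_cong[where g = "(\<lambda>x. s \<odot>\<^bsub>X\<^esub> x) \<circ> (\<lambda>x. t \<odot>\<^bsub>X\<^esub> x)"])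
      (auto simp: subset_iff smult_assoc1)
qed

lemma regular_module_simps:
  "carrier (regular_module R) = carrier R" "\<zero>\<^bsub>regular_module R\<^esub> = \<zero>\<^bsub>R\<^esub>"
  "x \<oplus>\<^bsub>regular_module R\<^esub> y = x \<oplus>\<^bsub>R\<^esub> y" "x \<odot>\<^bsub>regular_module R\<^esub> y = x \<otimes>\<^bsub>R\<^esub> y"
  by (simp_all add: regular_module_def)

lemma regular_module_module: assumes "cring R" shows "module R (regular_module R)"
proof -
  interpret cring R by fact
  show ?thesis
  proof (rule moduleI[OF is_cring])
    show "abelian_group (regular_module R)"
    proof (rule abelian_groupI)
      show "\<exists>y\<in>carrier (regular_module R). y \<oplus>\<^bsub>regular_module R\<^esub> x = \<zero>\<^bsub>regular_module R\<^esub>"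
        if "x \<in> carrier (regular_module R)" for x
        using that by (intro bexI[of _ "\<ominus>\<^bsub>R\<^esub> x"]) (auto simp: regular_module_simps l_neg)
    qed (auto simp: regular_module_simps a_ac)
  qed (auto simp: regular_module_simps l_distr r_distr m_assoc)
qed

text \<open>The multiplicative set at which the tensor product of localizations at
  \<open>S 0\<close>, \<open>S 1\<close>, ... is again a localization: the products of one factor
  from each set.\<close>

primrec prod_sets :: "('a, 'm) ring_scheme \<Rightarrow> (nat \<Rightarrow> 'a set) \<Rightarrow> nat \<Rightarrow> 'a set" where
  "prod_sets R S 0 = {\<one>\<^bsub>R\<^esub>}"
| "prod_sets R S (Suc n) = {s \<otimes>\<^bsub>R\<^esub> t | s t. s \<in> prod_sets R S n \<and> t \<in> S n}"

lemma prod_sets_closed: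
  assumes "cring R" "\<And>k. k < n \<Longrightarrow> mult_closed R (S k)"
  shows "mult_closed R (prod_sets R S n)"
  using assms(2)
proof (induction n)
  case 0
  interpret cring R by fact
  show ?case by (simp add: mult_closed_def)
next
  case (Suc n)
  interpret cring R by fact
  have 1: "mult_closed R (prod_sets R S n)" and 2: "mult_closed R (S n)" using Suc by auto
  show ?case
    unfolding mult_closed_def
  proof (intro conjI ballI)
    show "prod_sets R S (Suc n) \<subseteq> carrier R" using 1 2 by (auto simp: mult_closed_def)
    show "\<one>\<^bsub>R\<^esub> \<in> prod_sets R S (Suc n)" using 1 2 by (force simp: mult_closed_def)
    fix u v assume "u \<in> prod_sets R S (Suc n)" "v \<in> prod_sets R S (Suc n)"
    then obtain s t s' t' where *: "u = s \<otimes>\<^bsub>R\<^esub> t" "v = s' \<otimes>\<^bsub>R\<^esub> t'" "s \<in> prod_sets R S n" "t \<in> S n"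
      "s' \<in> prod_sets R S n" "t' \<in> S n" by auto
    then have eq: "u \<otimes>\<^bsub>R\<^esub> v = (s \<otimes>\<^bsub>R\<^esub> s') \<otimes>\<^bsub>R\<^esub> (t \<otimes>\<^bsub>R\<^esub> t')"
      using 1 2 by (auto simp: mult_closed_def subset_iff m_ac)
    have "s \<otimes>\<^bsub>R\<^esub> s' \<in> prod_sets R S n" "t \<otimes>\<^bsub>R\<^esub> t' \<in> S n"
      using * 1 2 by (auto simp: mult_closed_def)
    then show "u \<otimes>\<^bsub>R\<^esub> v \<in> prod_sets R S (Suc n)"
      unfolding eq prod_sets.simps by blast
  qed
qed

lemma prod_sets_member:
  assumes "cring R" "\<And>k. k < n \<Longrightarrow> mult_closed R (S k)" "k < n"
  shows "S k \<subseteq> prod_sets R S n"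
  using assms(2,3)
proof (induction n)
  case (Suc n)
  interpret cring R by fact
  show ?case
  proof
    fix s assume s: "s \<in> S k"
    then have sR: "s \<in> carrier R" using Suc.prems by (auto simp: mult_closed_def)
    show "s \<in> prod_sets R S (Suc n)"
    proof (cases "k = n")
      case True
      have "\<one>\<^bsub>R\<^esub> \<in> prod_sets R S n"
        using prod_sets_closed[OF assms(1), of n S] Suc.prems by (auto simp: mult_closed_def)
      moreover have "s = \<one>\<^bsub>R\<^esub> \<otimes>\<^bsub>R\<^esub> s" using sR by simp
      ultimately show ?thesis using s True unfolding prod_sets.simps by blast
    next
      case False
      then have "s \<in> prod_sets R S n" using Suc s by auto
      moreover have "\<one>\<^bsub>R\<^esub> \<in> S n" using Suc.prems by (auto simp: mult_closed_def)
      moreover have "s = s \<otimes>\<^bsub>R\<^esub> \<one>\<^bsub>R\<^esub>" using sR by simp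
      ultimately show ?thesis unfolding prod_sets.simps by blast
    qed
  qed
qed simp

text \<open>The entries of \<open>c\<close> act on \<open>l\<close> one after the other. With
  \<open>l = 1\<close> in a localization of \<open>R\<close> this is the product of the fractions in
  \<open>c\<close>, the map that multiplies a pure tensor out.\<close>

primrec fold_act :: "('a, 'm) ring_scheme \<Rightarrow> (nat \<Rightarrow> 'a set) \<Rightarrow> (nat \<Rightarrow> ('a, 'b) module) \<Rightarrow>
    (nat \<Rightarrow> 'b) \<Rightarrow> ('a, 'c) module \<Rightarrow> 'c \<Rightarrow> nat \<Rightarrow> (nat \<Rightarrow> 'b) \<Rightarrow> 'c" where
  "fold_act R S N e L l 0 c = l"
| "fold_act R S N e L l (Suc n) c = loc_act R (S n) (N n) (e n) L (c n) (fold_act R S N e L l n c)"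

locale localized_family = cring R for R :: "('a, 'm) ring_scheme" (structure) +
  fixes r :: nat and N :: "nat \<Rightarrow> ('a, 'b) module" and S :: "nat \<Rightarrow> 'a set" and e :: "nat \<Rightarrow> 'b"
  assumes locs: "\<And>k. k < r \<Longrightarrow> is_loc R (S k) (N k) (e k)"
begin

lemma localized: "k < r \<Longrightarrow> localized R (N k) (S k) (e k)"
  using locs by (auto simp: localized_def localized_axioms_def is_loc_def)

sublocale module_family R "{..<r}" N
  by (rule module_familyI) (use locs is_cring in \<open>auto simp: is_loc_def\<close>)

lemma Sk: "k < r \<Longrightarrow> mult_closed R (S k)"
  using locs by (auto simp: is_loc_def)

abbreviation "PS \<equiv> prod_sets R S r"
abbreviation "e0 \<equiv> \<lambda>k\<in>{..<r}. e k"

lemma e0: "e0 \<in> Dom"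
  using locs by (auto simp: is_loc_def)

lemma PS: "mult_closed R PS"
  by (rule prod_sets_closed[OF is_cring Sk])

lemma family_PS_bij: "n \<le> r \<Longrightarrow> smult_bij R (prod_sets R S n) TT"
proof (induction n)
  case 0
  interpret T: module R TT by (rule family_module)
  have "bij_betw (\<lambda>x. \<one> \<odot>\<^bsub>TT\<^esub> x) (carrier TT) (carrier TT)"
    by (rule smult_bijI[OF family_module one_closed mod_hom_id]) simp
  then show ?case by (simp add: smult_bij_def)
next
  case (Suc n)
  then have n: "n < r" by simp
  have "smult_bij R (S n) TT"
    using locs[OF n] n by (intro family_smult_bij[of n]) (auto simp: is_loc_def mult_closed_def)
  moreover have "mult_closed R (prod_sets R S n)"
    using Sk n by (intro prod_sets_closed[OF is_cring]) auto
  ultimately show ?case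
    using Suc Sk[OF n] smult_bij_mult[OF family_module, of "prod_sets R S n" "S n"]
    by (simp add: mult_closed_def)
qed

text \<open>The slots are normalized one at a time: a multiple of the entry in slot \<open>n\<close>
  is a multiple of the unit there, and both scalars move out of the tensor.\<close>

lemma pure_denom:
  assumes c: "c \<in> Dom" and "n \<le> r"
  shows "\<exists>s\<in>prod_sets R S n. \<exists>a\<in>carrier R. s \<odot>\<^bsub>TT\<^esub> pure c = a \<odot>\<^bsub>TT\<^esub> pure (\<lambda>k. if k < n then e k else c k)"
  using assms(2)
proof (induction n)
  case 0
  then show ?case by auto
next
  case (Suc n)
  interpret T: module R TT by (rule family_module)
  define c' where "c' = (\<lambda>k. if k < n then e k else c k)"
  have n: "n < r" using Suc by simp
  interpret Nn: localized R "N n" "S n" "e n" by (rule localized[OF n])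
  have c': "c' \<in> Dom"
    using c locs n by (auto simp: c'_def PiE_def extensional_def Pi_def is_loc_def)
  obtain s a where sa: "s \<in> prod_sets R S n" "a \<in> carrier R" "s \<odot>\<^bsub>TT\<^esub> pure c = a \<odot>\<^bsub>TT\<^esub> pure c'"
    using Suc unfolding c'_def by auto
  have c'n: "c' n \<in> carrier (N n)" using c' n by auto
  then obtain t b where tb: "t \<in> S n" "b \<in> carrier R" "t \<odot>\<^bsub>N n\<^esub> c' n = b \<odot>\<^bsub>N n\<^esub> e n"
    using Nn.denom by blast
  have sR: "s \<in> carrier R"
    using sa(1) prod_sets_closed[OF is_cring, of n S] Sk n by (auto simp: mult_closed_def)
  have tR: "t \<in> carrier R" using tb(1) Nn.S_closed by simp
  have "(s \<otimes> t) \<odot>\<^bsub>TT\<^esub> pure c = t \<odot>\<^bsub>TT\<^esub> (s \<odot>\<^bsub>TT\<^esub> pure c)"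
    using sR tR pure_family_closed[OF c] by (simp add: m_comm flip: T.smult_assoc1)
  also have "\<dots> = a \<odot>\<^bsub>TT\<^esub> (t \<odot>\<^bsub>TT\<^esub> pure c')"
    unfolding sa(3) using sa(2) tR pure_family_closed[OF c'] by (simp add: m_comm flip: T.smult_assoc1)
  also have "t \<odot>\<^bsub>TT\<^esub> pure c' = pure (c'(n := t \<odot>\<^bsub>N n\<^esub> c' n))"
    using pure_slot_smult[OF c' _ tR c'n] n by simp
  also have "\<dots> = b \<odot>\<^bsub>TT\<^esub> pure (c'(n := e n))"
    unfolding tb(3) using pure_slot_smult[OF c' _ tb(2) Nn.e_closed] n by simp
  also have "c'(n := e n) = (\<lambda>k. if k < Suc n then e k else c k)"
    by (auto simp: c'_def fun_eq_iff)
  finally have "(s \<otimes> t) \<odot>\<^bsub>TT\<^esub> pure c = (a \<otimes> b) \<odot>\<^bsub>TT\<^esub> pure (\<lambda>k. if k < Suc n then e k else c k)"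
    using sa(2) tb(2) PiE_upd[OF c', of n "e n"] n Nn.e_closed
    by (simp add: T.smult_assoc1 pure_family_closed \<open>c'(n := e n) = _\<close>)
  then show ?case using sa(1,2) tb(1,2) by (simp, blast intro: m_closed)
qed

lemma PS_closed: "s \<in> PS \<Longrightarrow> s \<in> carrier R" and PS_one: "\<one> \<in> PS"
  and PS_mult: "\<lbrakk>s \<in> PS; t \<in> PS\<rbrakk> \<Longrightarrow> s \<otimes> t \<in> PS"
  using PS by (auto simp: mult_closed_def)

lemma family_denom:
  assumes z: "z \<in> carrier TT"
  shows "\<exists>s\<in>PS. \<exists>a\<in>carrier R. s \<odot>\<^bsub>TT\<^esub> z = a \<odot>\<^bsub>TT\<^esub> pure e0"
proof -
  interpret T: module R TT by (rule family_module)
  note e0c = pure_family_closed[OF e0]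
  let ?H = "{z \<in> carrier TT. \<exists>s\<in>PS. \<exists>a\<in>carrier R. s \<odot>\<^bsub>TT\<^esub> z = a \<odot>\<^bsub>TT\<^esub> pure e0}"
  have "submodule ?H R TT"
  proof (rule submoduleI'[OF family_module])
    have "\<one> \<odot>\<^bsub>TT\<^esub> \<zero>\<^bsub>TT\<^esub> = \<zero> \<odot>\<^bsub>TT\<^esub> pure e0" using e0c by simp
    then show "\<zero>\<^bsub>TT\<^esub> \<in> ?H" using PS_one by blast
    fix x y assume "x \<in> ?H" "y \<in> ?H"
    then obtain s a s' a' where *: "x \<in> carrier TT" "y \<in> carrier TT" "s \<in> PS" "s' \<in> PS"
      "a \<in> carrier R" "a' \<in> carrier R" and eq: "s \<odot>\<^bsub>TT\<^esub> x = a \<odot>\<^bsub>TT\<^esub> pure e0"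
      "s' \<odot>\<^bsub>TT\<^esub> y = a' \<odot>\<^bsub>TT\<^esub> pure e0" by auto
    have "(s \<otimes> s') \<odot>\<^bsub>TT\<^esub> (x \<oplus>\<^bsub>TT\<^esub> y) =
        s' \<odot>\<^bsub>TT\<^esub> (s \<odot>\<^bsub>TT\<^esub> x) \<oplus>\<^bsub>TT\<^esub> s \<odot>\<^bsub>TT\<^esub> (s' \<odot>\<^bsub>TT\<^esub> y)"
      using * by (simp add: T.smult_r_distr PS_closed m_comm flip: T.smult_assoc1)
    also have "\<dots> = (s' \<otimes> a \<oplus> s \<otimes> a') \<odot>\<^bsub>TT\<^esub> pure e0"
      unfolding eq using * e0c by (simp add: T.smult_l_distr T.smult_assoc1 PS_closed)
    finally have "(s \<otimes> s') \<odot>\<^bsub>TT\<^esub> (x \<oplus>\<^bsub>TT\<^esub> y) = (s' \<otimes> a \<oplus> s \<otimes> a') \<odot>\<^bsub>TT\<^esub> pure e0" .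
    moreover have "x \<oplus>\<^bsub>TT\<^esub> y \<in> carrier TT" "s \<otimes> s' \<in> PS" "s' \<otimes> a \<oplus> s \<otimes> a' \<in> carrier R"
      using * PS_mult[OF *(3,4)] PS_closed[OF *(3)] PS_closed[OF *(4)] by simp_all
    ultimately show "x \<oplus>\<^bsub>TT\<^esub> y \<in> ?H" by blast
  next
    fix b x assume b: "b \<in> carrier R" and "x \<in> ?H"
    then obtain s a where *: "x \<in> carrier TT" "s \<in> PS" "a \<in> carrier R"
      and eq: "s \<odot>\<^bsub>TT\<^esub> x = a \<odot>\<^bsub>TT\<^esub> pure e0" by auto
    have "s \<odot>\<^bsub>TT\<^esub> (b \<odot>\<^bsub>TT\<^esub> x) = b \<odot>\<^bsub>TT\<^esub> (s \<odot>\<^bsub>TT\<^esub> x)"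
      using * b by (simp add: PS_closed m_comm flip: T.smult_assoc1)
    also have "\<dots> = (b \<otimes> a) \<odot>\<^bsub>TT\<^esub> pure e0"
      unfolding eq using * b e0c by (simp add: T.smult_assoc1)
    finally show "b \<odot>\<^bsub>TT\<^esub> x \<in> ?H" using * b by auto
  qed auto
  moreover have "pure c \<in> ?H" if c: "c \<in> Dom" for c
  proof -
    have "(\<lambda>k. if k < r then e k else c k) = e0" using c by (auto simp: PiE_def extensional_def)
    then show ?thesis using pure_denom[OF c order_refl] pure_family_closed[OF c] by simp
  qed
  ultimately show ?thesis using family_generated[OF _ _ z] by blast
qed

text \<open>The induction needs both cases. Linearity in slot \<open>n\<close> at stage
  \<open>n + 1\<close> holds because the value accumulated so far does not change with that slot;
  linearity in the earlier slots survives since acting by a fixed entry is linear.\<close>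

lemma fold_act_multilinear:
  assumes L: "module R L" "\<And>k. k < r \<Longrightarrow> smult_bij R (S k) L" and l: "l \<in> carrier L" and "n \<le> r"
  shows "(\<forall>c\<in>Dom. fold_act R S N e L l n c \<in> carrier L) \<and>
    (\<forall>c\<in>Dom. \<forall>k<r. if k < n then (\<lambda>x. fold_act R S N e L l n (c(k := x))) \<in> mod_hom R (N k) L
       else \<forall>x. fold_act R S N e L l n (c(k := x)) = fold_act R S N e L l n c)"
  using assms(4)
proof (induction n)
  case 0
  then show ?case using l by simp
next
  case (Suc n)
  then have n: "n < r" by simp
  interpret Nn: localized R "N n" "S n" "e n" by (rule localized[OF n])
  note b = Nn.act_bilinear[OF L(1) L(2)[OF n]]
  have bl: "(\<lambda>t. Nn.act L t y) \<in> mod_hom R (N n) L" if "y \<in> carrier L" for y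
    using b that by (auto simp: bilinear_def)
  have br: "Nn.act L t \<in> mod_hom R L L" if "t \<in> carrier (N n)" for t
    using b that by (auto simp: bilinear_def)
  have IHc: "fold_act R S N e L l n c \<in> carrier L" if "c \<in> Dom" for c
    using Suc that by simp
  have IHh: "(\<lambda>x. fold_act R S N e L l n (c(k := x))) \<in> mod_hom R (N k) L" if "c \<in> Dom" "k < n" for c k
    using Suc that n by (auto split: if_splits)
  have IHe: "fold_act R S N e L l n (c(k := x)) = fold_act R S N e L l n c" if "c \<in> Dom" "\<not> k < n" "k < r" for c k x
    using Suc that n by (auto split: if_splits)
  have cn: "c n \<in> carrier (N n)" if "c \<in> Dom" for c
    using that n by auto
  show ?case
  proof (intro conjI ballI allI impI)
    fix c assume c: "c \<in> Dom"
    show "fold_act R S N e L l (Suc n) c \<in> carrier L"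
      using mod_hom_closed[OF bl[OF IHc[OF c]] cn[OF c]] by simp
    fix k assume k: "k < r"
    show "if k < Suc n then (\<lambda>x. fold_act R S N e L l (Suc n) (c(k := x))) \<in> mod_hom R (N k) L
       else \<forall>x. fold_act R S N e L l (Suc n) (c(k := x)) = fold_act R S N e L l (Suc n) c"
    proof (cases "k = n")
      case True
      then show ?thesis using bl[OF IHc[OF c]] IHe[OF c _ n] by simp
    next
      case False
      then show ?thesis
        using mod_hom_comp[OF IHh[OF c, of k] br[OF cn[OF c]]] IHe[OF c _ k] by auto
    qed
  qed
qed

lemma fold_act_e0:
  assumes L: "module R L" "\<And>k. k < r \<Longrightarrow> smult_bij R (S k) L" and l: "l \<in> carrier L" and "n \<le> r"
  shows "fold_act R S N e L l n e0 = l"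
  using assms(4)
proof (induction n)
  case (Suc n)
  then have n: "n < r" by simp
  interpret Nn: localized R "N n" "S n" "e n" by (rule localized[OF n])
  show ?case using Suc n Nn.act_e[OF L(1) L(2)[OF n] l] by simp
qed simp

text \<open>The delicate clause is the kernel of the unit. Multiplying fractions out maps the tensor
  product to the concrete localization at \<open>PS\<close> and sends the unit to
  \<open>1 / 1\<close>; an \<open>a\<close> that kills the unit thus has \<open>a / 1 = 0\<close>
  there.\<close>

theorem family_is_loc: "is_loc R PS TT (pure e0)"
proof -
  interpret T: module R TT by (rule family_module)
  have "\<exists>s\<in>PS. s \<otimes> a = \<zero>" if a: "a \<in> carrier R" "a \<odot>\<^bsub>TT\<^esub> pure e0 = \<zero>\<^bsub>TT\<^esub>" for a
  proof -
    interpret L: module_localization R "regular_module R" PS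
      using regular_module_module[OF is_cring] PS
      by (simp add: module_localization_def module_localization_axioms_def)
    have bijL: "smult_bij R (S k) L.Loc" if "k < r" for k
      using L.loc_bij prod_sets_member[of R r S, OF is_cring Sk that] by (auto simp: smult_bij_def)
    have one: "\<one> \<in> carrier (regular_module R)" by (simp add: regular_module_def)
    note l = mod_hom_closed[OF L.frac_hom one]
    let ?\<phi> = "fold_act R S N e L.Loc (L.fr \<one> \<one>) r"
    have ml: "multilinear R {..<r} N L.Loc ?\<phi>"
      using fold_act_multilinear[OF L.loc_module bijL l order_refl] by (auto simp: multilinear_def)
    note h = family_lift_hom[OF L.loc_module ml]
    have "tensor_lift R L.Loc ?\<phi> (a \<odot>\<^bsub>TT\<^esub> pure e0) = a \<odot>\<^bsub>L.Loc\<^esub> L.fr \<one> \<one>"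
      using a(1) by (simp add: mod_hom_smult[OF h] pure_family_closed[OF e0] family_lift_pure[OF L.loc_module ml e0]
          fold_act_e0[OF L.loc_module bijL l])
    also have "\<dots> = L.fr a \<one>"
      using a(1) mod_hom_smult[OF L.frac_hom a(1) one] by (simp add: regular_module_def)
    finally have "L.fr a \<one> = \<zero>\<^bsub>L.Loc\<^esub>"
      unfolding a(2) using mod_hom_zero[OF h family_module L.loc_module] by simp
    from L.frac_one_zeroD[OF _ this] a show ?thesis by (simp add: regular_module_def)
  qed
  then show ?thesis
    using family_PS_bij[OF order_refl] family_denom PS family_module pure_family_closed[OF e0]
    by (auto simp: is_loc_def)
qed

end

section \<open>The terms of a Cech factor as localizations\<close>

lemma regular_is_loc: assumes "cring R" shows "is_loc R {\<one>\<^bsub>R\<^esub>} (regular_module R) \<one>\<^bsub>R\<^esub>"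
proof -
  interpret cring R by fact
  show ?thesis
    using regular_module_module[OF assms] smult_bijI[OF regular_module_module[OF assms] one_closed mod_hom_id]
    by (auto simp: is_loc_def mult_closed_def smult_bij_def regular_module_simps)
qed

lemma localization_is_loc:
  assumes "cring R" "mult_closed R S"
  shows "is_loc R S (localization R S (regular_module R))
    (frac_rel R S (regular_module R) `` {(\<one>\<^bsub>R\<^esub>, \<one>\<^bsub>R\<^esub>)})"
proof -
  interpret cring R by fact
  interpret L: module_localization R "regular_module R" S
    using regular_module_module assms by (simp add: module_localization_def module_localization_axioms_def)
  have one: "\<one>\<^bsub>R\<^esub> \<in> carrier (regular_module R)" by (simp add: regular_module_simps)
  have sm: "r \<odot>\<^bsub>L.Loc\<^esub> L.fr \<one>\<^bsub>R\<^esub> \<one>\<^bsub>R\<^esub> = L.fr r \<one>\<^bsub>R\<^esub>" if "r \<in> carrier R" for r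
    using mod_hom_smult[OF L.frac_hom that one] that by (simp add: regular_module_simps)
  have "\<exists>s\<in>S. \<exists>r\<in>carrier R. s \<odot>\<^bsub>L.Loc\<^esub> t = r \<odot>\<^bsub>L.Loc\<^esub> L.fr \<one>\<^bsub>R\<^esub> \<one>\<^bsub>R\<^esub>" if "t \<in> carrier L.Loc" for t
  proof -
    from that obtain x s where xs: "t = L.fr x s" "x \<in> carrier R" "s \<in> S"
      by (auto simp: L.loc_carrier regular_module_simps)
    have "s \<odot>\<^bsub>L.Loc\<^esub> t = L.fr x \<one>\<^bsub>R\<^esub>"
      unfolding xs(1) using xs L.S_closed[OF xs(3)] L.S_one
      by (subst L.loc_smult) (simp_all add: regular_module_simps, rule L.frac_eqI, simp_all add: regular_module_simps)
    then show ?thesis using xs sm by auto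
  qed
  moreover have "\<exists>s\<in>S. s \<otimes>\<^bsub>R\<^esub> r = \<zero>\<^bsub>R\<^esub>" if "r \<in> carrier R" "r \<odot>\<^bsub>L.Loc\<^esub> L.fr \<one>\<^bsub>R\<^esub> \<one>\<^bsub>R\<^esub> = \<zero>\<^bsub>L.Loc\<^esub>" for r
    using L.frac_one_zeroD[of r] that sm by (simp add: regular_module_simps)
  ultimately show ?thesis
    using assms(2) L.loc_module mod_hom_closed[OF L.frac_hom one] L.loc_bij
    by (auto simp: is_loc_def smult_bij_def)
qed

lemma
  assumes M: "module R M" and inj: "inj_on h (carrier M)"
  shows image_module_module: "module R (image_module h M)"
    and image_module_hom: "h \<in> mod_hom R M (image_module h M)"
    and image_module_inv_hom: "inv_into (carrier M) h \<in> mod_hom R (image_module h M) M"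
proof -
  interpret module R M by fact
  have a: "h x \<oplus>\<^bsub>image_module h M\<^esub> h y = h (x \<oplus>\<^bsub>M\<^esub> y)" if "x \<in> carrier M" "y \<in> carrier M" for x y
    using that inj by (simp add: image_module_def inv_into_f_f)
  have s: "r \<odot>\<^bsub>image_module h M\<^esub> h x = h (r \<odot>\<^bsub>M\<^esub> x)" if "r \<in> carrier R" "x \<in> carrier M" for x r
    using that inj by (simp add: image_module_def inv_into_f_f)
  show "module R (image_module h M)"
    by (rule module_surj(1)[OF M _ _ a s]) (simp_all add: image_module_def)
  show "h \<in> mod_hom R M (image_module h M)"
    by (rule module_surj(2)[OF M _ _ a s]) (simp_all add: image_module_def)
  have c: "carrier (image_module h M) = h ` carrier M" by (simp add: image_module_def)
  show "inv_into (carrier M) h \<in> mod_hom R (image_module h M) M"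
    using inj by (intro mod_homI) (auto simp: c inv_into_f_f a s)
qed

lemma is_loc_image:
  assumes loc: "is_loc R S T e" and inj: "inj_on h (carrier T)"
  shows "is_loc R S (image_module h T) (h e)"
proof -
  have T: "module R T" using loc by (simp add: is_loc_def)
  interpret T: localized R T S e using loc T by (simp add: localized_def localized_axioms_def)
  note m = image_module_module[OF T inj] and h = image_module_hom[OF T inj] and i = image_module_inv_hom[OF T inj]
  have c: "carrier (image_module h T) = h ` carrier T" by (simp add: image_module_def)
  have hz: "h \<zero>\<^bsub>T\<^esub> = \<zero>\<^bsub>image_module h T\<^esub>" by (simp add: image_module_def)
  have "smult_bij R S (image_module h T)"
    unfolding smult_bij_def
  proof
    fix s assume s: "s \<in> S"
    then have sR: "s \<in> carrier R" by (rule T.S_closed)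
    obtain \<sigma> where \<sigma>: "\<sigma> \<in> mod_hom R T T" "\<And>x. x \<in> carrier T \<Longrightarrow> s \<odot>\<^bsub>T\<^esub> \<sigma> x = x"
      using smult_bij_inverse[OF T T.bij s sR] by blast
    show "bij_betw (\<lambda>x. s \<odot>\<^bsub>image_module h T\<^esub> x) (carrier (image_module h T)) (carrier (image_module h T))"
      using inj sR
      by (intro smult_bijI[OF m sR mod_hom_comp[OF mod_hom_comp[OF i \<sigma>(1)] h]])
         (auto simp: c inv_into_f_f \<sigma>(2) mod_hom_closed[OF \<sigma>(1)] simp flip: mod_hom_smult[OF h])
  qed
  moreover have "\<exists>s\<in>S. \<exists>r\<in>carrier R. s \<odot>\<^bsub>image_module h T\<^esub> t = r \<odot>\<^bsub>image_module h T\<^esub> h e"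
    if "t \<in> carrier (image_module h T)" for t
  proof -
    from that obtain x where x: "x \<in> carrier T" "t = h x" by (auto simp: c)
    from T.denom[OF x(1)] obtain s r where sr: "s \<in> S" "r \<in> carrier R" "s \<odot>\<^bsub>T\<^esub> x = r \<odot>\<^bsub>T\<^esub> e" by blast
    then show ?thesis
      using x mod_hom_smult[OF h T.S_closed[OF sr(1)] x(1)] mod_hom_smult[OF h sr(2) T.e_closed]
      by (intro bexI[OF _ sr(1)] bexI[OF _ sr(2)]) simp
  qed
  moreover have "\<exists>s\<in>S. s \<otimes>\<^bsub>R\<^esub> r = \<zero>\<^bsub>R\<^esub>"
    if "r \<in> carrier R" "r \<odot>\<^bsub>image_module h T\<^esub> h e = \<zero>\<^bsub>image_module h T\<^esub>" for r
  proof -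
    have "h (r \<odot>\<^bsub>T\<^esub> e) = h \<zero>\<^bsub>T\<^esub>" using that mod_hom_smult[OF h that(1) T.e_closed] hz by simp
    then have "r \<odot>\<^bsub>T\<^esub> e = \<zero>\<^bsub>T\<^esub>" using inj that(1) T.e_closed by (auto dest: inj_onD)
    then show ?thesis using T.kernel that(1) by blast
  qed
  ultimately show ?thesis
    using T.S m mod_hom_closed[OF h T.e_closed] by (auto simp: is_loc_def)
qed

lemma zero_module_module: assumes "cring R" shows "module R (zero_module z)"
proof -
  interpret cring R by fact
  show ?thesis
  proof (rule moduleI[OF is_cring])
    show "abelian_group (zero_module z)"
      by (rule abelian_groupI) (auto simp: zero_module_def)
  qed (auto simp: zero_module_def)
qed

text \<open>Inverting 0 gives the zero module. This makes the vanishing degrees of a Cech factor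
  localizations as well, so that all multidegrees are handled alike.\<close>

lemma zero_module_is_loc: assumes "cring R" shows "is_loc R {\<zero>\<^bsub>R\<^esub>, \<one>\<^bsub>R\<^esub>} (zero_module z) z"
proof -
  interpret cring R by fact
  show ?thesis
    using zero_module_module[OF assms, of z]
    by (auto simp: is_loc_def mult_closed_def smult_bij_def zero_module_def bij_betw_def)
qed

section \<open>Direct sums\<close>

lemma direct_sum_simps:
  "\<zero>\<^bsub>direct_sum E N\<^esub> = (\<lambda>e\<in>E. \<zero>\<^bsub>N e\<^esub>)"
  "f \<oplus>\<^bsub>direct_sum E N\<^esub> g = (\<lambda>e\<in>E. f e \<oplus>\<^bsub>N e\<^esub> g e)"
  "r \<odot>\<^bsub>direct_sum E N\<^esub> f = (\<lambda>e\<in>E. r \<odot>\<^bsub>N e\<^esub> f e)"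
  by (simp_all add: direct_sum_def)

lemma direct_sum_carrier: "finite E \<Longrightarrow> carrier (direct_sum E N) = (\<Pi>\<^sub>E e\<in>E. carrier (N e))"
  by (auto simp: direct_sum_def)

locale finite_direct_sum = cring R for R :: "('a, 'm) ring_scheme" (structure) +
  fixes E :: "'e set" and N :: "'e \<Rightarrow> ('a, 'b) module"
  assumes fin: "finite E" and mods: "\<And>e. e \<in> E \<Longrightarrow> module R (N e)"
begin

abbreviation "DS \<equiv> direct_sum E N"
abbreviation "incl \<equiv> direct_sum_inj E N"

lemma am: "e \<in> E \<Longrightarrow> abelian_monoid (N e)"
  using mods by (auto simp: module_def abelian_group_def)

lemma mod_neg:
  assumes "e \<in> E" "x \<in> carrier (N e)"
  shows "\<ominus>\<^bsub>N e\<^esub> x \<in> carrier (N e)" "\<ominus>\<^bsub>N e\<^esub> x \<oplus>\<^bsub>N e\<^esub> x = \<zero>\<^bsub>N e\<^esub>"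
proof -
  interpret module R "N e" using assms(1) by (rule mods)
  show "\<ominus>\<^bsub>N e\<^esub> x \<in> carrier (N e)" "\<ominus>\<^bsub>N e\<^esub> x \<oplus>\<^bsub>N e\<^esub> x = \<zero>\<^bsub>N e\<^esub>"
    using assms(2) by (simp_all add: M.l_neg)
qed

lemmas mod_facts =
  abelian_monoid.zero_closed[OF am] abelian_monoid.a_closed[OF am] module.smult_closed[OF mods]
  abelian_monoid.l_zero[OF am] abelian_monoid.r_zero[OF am]
  abelian_monoid.a_comm[OF am] abelian_monoid.a_assoc[OF am] abelian_monoid.a_lcomm[OF am]
  module.smult_l_distr[OF mods] module.smult_r_distr[OF mods] module.smult_assoc1[OF mods]
  module.smult_one[OF mods] module.smult_r_null[OF mods]

lemma DS_closed: "\<lbrakk>f \<in> carrier DS; e \<in> E\<rbrakk> \<Longrightarrow> f e \<in> carrier (N e)"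
  by (auto simp: direct_sum_carrier[OF fin])

lemma DS_memI: "(\<And>e. e \<in> E \<Longrightarrow> f e \<in> carrier (N e)) \<Longrightarrow> (\<lambda>e\<in>E. f e) \<in> carrier DS"
  by (auto simp: direct_sum_carrier[OF fin])

lemma DS_restrict: "f \<in> carrier DS \<Longrightarrow> (\<lambda>e\<in>E. f e) = f"
  by (simp add: direct_sum_carrier[OF fin] PiE_def extensional_restrict)

lemma direct_sum_module: "module R DS"
proof (rule moduleI[OF is_cring])
  have eq: "(\<lambda>e\<in>E. g e) = f" if "f \<in> carrier DS" "\<And>e. e \<in> E \<Longrightarrow> g e = f e" for f g
    using DS_restrict[OF that(1)] restrict_ext[of E g f] that(2) by simp
  show "abelian_group DS"
  proof (rule abelian_groupI)
    fix f assume f: "f \<in> carrier DS"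
    show "\<exists>g\<in>carrier DS. g \<oplus>\<^bsub>DS\<^esub> f = \<zero>\<^bsub>DS\<^esub>"
      by (rule bexI[of _ "\<lambda>e\<in>E. \<ominus>\<^bsub>N e\<^esub> f e"])
         (auto simp: direct_sum_simps mod_neg DS_closed[OF f] intro!: DS_memI restrict_ext)
    show "\<zero>\<^bsub>DS\<^esub> \<oplus>\<^bsub>DS\<^esub> f = f"
      by (auto simp: direct_sum_simps mod_facts DS_closed[OF f] intro!: eq[OF f])
  qed (auto simp: direct_sum_simps mod_facts DS_closed intro!: DS_memI restrict_ext)
  show "\<one> \<odot>\<^bsub>DS\<^esub> f = f" if "f \<in> carrier DS" for f
    by (auto simp: direct_sum_simps mod_facts DS_closed[OF that] intro!: eq[OF that])
qed (auto simp: direct_sum_simps mod_facts DS_closed intro!: DS_memI restrict_ext)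

lemma proj_hom: "e \<in> E \<Longrightarrow> (\<lambda>f. f e) \<in> mod_hom R DS (N e)"
  by (rule mod_homI) (auto simp: direct_sum_carrier[OF fin] direct_sum_simps)

lemma inj_hom: "e \<in> E \<Longrightarrow> incl e \<in> mod_hom R (N e) DS"
  by (rule mod_homI)
     (auto simp: direct_sum_carrier[OF fin] direct_sum_simps direct_sum_inj_def mod_facts fun_eq_iff)

lemma sum_inj_proj:
  assumes f: "f \<in> carrier DS"
  shows "(\<Oplus>\<^bsub>DS\<^esub>e\<in>E. incl e (f e)) = f"
proof -
  interpret D: module R DS by (rule direct_sum_module)
  have fc: "f e \<in> carrier (N e)" if "e \<in> E" for e
    using f that by (auto simp: direct_sum_carrier[OF fin])
  have ic: "(\<lambda>e. incl e (f e)) \<in> E \<rightarrow> carrier DS"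
    using fc mod_hom_closed[OF inj_hom] by auto
  have "(\<Oplus>\<^bsub>DS\<^esub>e\<in>E. incl e (f e)) e' = f e'" for e'
  proof (cases "e' \<in> E")
    case True
    interpret M: module R "N e'" using True by (rule mods)
    have "(\<Oplus>\<^bsub>DS\<^esub>e\<in>E. incl e (f e)) e' = (\<Oplus>\<^bsub>N e'\<^esub>e\<in>E. incl e (f e) e')"
      by (rule mod_hom_finsum[OF proj_hom[OF True] direct_sum_module M.module_axioms fin ic])
    also have "\<dots> = (\<Oplus>\<^bsub>N e'\<^esub>e\<in>E. if e' = e then f e' else \<zero>\<^bsub>N e'\<^esub>)"
      using True fc by (intro M.M.finsum_cong') (auto simp: direct_sum_inj_def)
    also have "\<dots> = f e'"
      using M.M.finsum_singleton[OF True fin, of "\<lambda>_. f e'"] fc[OF True] by auto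
    finally show ?thesis .
  next
    case False
    have "(\<Oplus>\<^bsub>DS\<^esub>e\<in>E. incl e (f e)) \<in> carrier DS" using ic by (rule D.M.finsum_closed)
    then show ?thesis using f False by (auto simp: direct_sum_carrier[OF fin] PiE_def extensional_def)
  qed
  then show ?thesis by (rule ext)
qed

end

section \<open>The tensor product of cochain complexes\<close>

definition is_cochain :: "('a, 'm) ring_scheme \<Rightarrow> ('a, 'b) cochain \<Rightarrow> bool" where
  "is_cochain R C \<longleftrightarrow> (\<forall>i. module R (obj C i)) \<and>
     (\<forall>i. diff C i \<in> mod_hom R (obj C i) (obj C (Suc i))) \<and>
     (\<forall>i. \<forall>x\<in>carrier (obj C i). diff C (Suc i) (diff C i x) = \<zero>\<^bsub>obj C (Suc (Suc i))\<^esub>)"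

text \<open>The cancellation behind \<open>d d = 0\<close>. The condition on the diagonal is
  separate because antisymmetry alone gives only \<open>2 a = 0\<close> there. Removing the last row
  together with the last column keeps the shape for induction.\<close>

lemma (in abelian_group) finsum_antisymmetric:
  fixes a :: "nat \<Rightarrow> nat \<Rightarrow> 'a"
  assumes "\<And>k l. \<lbrakk>k < n; l < n\<rbrakk> \<Longrightarrow> a k l \<in> carrier G"
    and "\<And>k. k < n \<Longrightarrow> a k k = \<zero>"
    and "\<And>k l. \<lbrakk>k < l; l < n\<rbrakk> \<Longrightarrow> a l k = \<ominus> a k l"
  shows "(\<Oplus>k\<in>{..<n}. \<Oplus>l\<in>{..<n}. a k l) = \<zero>"
  using assms
proof (induction n)
  case (Suc n)
  have IH: "(\<Oplus>k\<in>{..<n}. \<Oplus>l\<in>{..<n}. a k l) = \<zero>"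
    by (rule Suc.IH; rule Suc.prems; simp)
  have neg: "a n k \<oplus> a k n = \<zero>" if "k < n" for k
    unfolding Suc.prems(3)[OF that lessI] using Suc.prems(1)[of k n] that by (simp add: l_neg)
  have c: "(\<lambda>k. a k n) \<in> {..<n} \<rightarrow> carrier G" "(\<lambda>k. a n k) \<in> {..<n} \<rightarrow> carrier G"
    "(\<lambda>k. \<Oplus>l\<in>{..<n}. a k l) \<in> {..<n} \<rightarrow> carrier G" "a n n \<in> carrier G"
    using Suc.prems(1) by (auto intro!: finsum_closed)
  have row: "(\<Oplus>l\<in>{..<Suc n}. a k l) = a k n \<oplus> (\<Oplus>l\<in>{..<n}. a k l)" if "k < Suc n" for k
    using that Suc.prems(1) by (simp add: lessThan_Suc Pi_def)
  have "(\<Oplus>k\<in>{..<Suc n}. \<Oplus>l\<in>{..<Suc n}. a k l) =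
      (\<Oplus>k\<in>{..<Suc n}. a k n \<oplus> (\<Oplus>l\<in>{..<n}. a k l))"
    using Suc.prems(1) by (intro finsum_cong') (auto simp: row intro!: a_closed finsum_closed)
  also have "\<dots> = (a n n \<oplus> (\<Oplus>l\<in>{..<n}. a n l)) \<oplus> (\<Oplus>k\<in>{..<n}. a k n \<oplus> (\<Oplus>l\<in>{..<n}. a k l))"
    using c Suc.prems(1) by (subst lessThan_Suc, subst finsum_insert) (auto intro!: a_closed finsum_closed)
  also have "(\<Oplus>k\<in>{..<n}. a k n \<oplus> (\<Oplus>l\<in>{..<n}. a k l)) = (\<Oplus>k\<in>{..<n}. a k n) \<oplus> \<zero>"
    using c by (simp add: finsum_addf IH)
  also have "(a n n \<oplus> (\<Oplus>l\<in>{..<n}. a n l)) \<oplus> ((\<Oplus>k\<in>{..<n}. a k n) \<oplus> \<zero>) =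
      (\<Oplus>l\<in>{..<n}. a n l) \<oplus> (\<Oplus>k\<in>{..<n}. a k n)"
    using c Suc.prems(2)[of n] by (simp add: finsum_closed)
  also have "\<dots> = (\<Oplus>k\<in>{..<n}. a n k \<oplus> a k n)"
    using c by (simp add: finsum_addf)
  also have "\<dots> = (\<Oplus>k\<in>{..<n}. \<zero>)"
    by (intro finsum_cong') (auto simp: neg)
  finally show ?case by simp
next
  case 0
  show ?case by simp
qed

locale cochain_family = cring R for R :: "('a, 'm) ring_scheme" (structure) +
  fixes r :: nat and C :: "nat \<Rightarrow> ('a, 'b) cochain"
  assumes cochains: "\<And>k. k < r \<Longrightarrow> is_cochain R (C k)"
begin

abbreviation "comps e \<equiv> \<lambda>k. obj (C k) (e k)"
abbreviation "bump e k \<equiv> e(k := Suc (e k))"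
abbreviation "ddom e \<equiv> (\<Pi>\<^sub>E k\<in>{..<r}. carrier (comps e k))"
abbreviation "tp e \<equiv> tensor_part R r C e"
abbreviation "ptens e \<equiv> pure_tensor_family R {..<r} (comps e)"
abbreviation "E i \<equiv> multidegrees r i"
abbreviation "D i \<equiv> tensor_cochain_obj R r C i"
abbreviation "\<iota> i \<equiv> direct_sum_inj (E i) (tensor_part R r C)"
abbreviation "sg e (k::nat) \<equiv> (\<ominus> \<one>) [^] (\<Sum>l<k. e l :: nat)"

lemma fam: "module_family R {..<r} (comps e)"
  by (rule module_familyI) (use cochains is_cring in \<open>auto simp: is_cochain_def\<close>)

lemma diff_hom: "k < r \<Longrightarrow> diff (C k) j \<in> mod_hom R (obj (C k) j) (obj (C k) (Suc j))"
  and diff_diff: "\<lbrakk>k < r; x \<in> carrier (obj (C k) j)\<rbrakk> \<Longrightarrow>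
    diff (C k) (Suc j) (diff (C k) j x) = \<zero>\<^bsub>obj (C k) (Suc (Suc j))\<^esub>"
  using cochains by (auto simp: is_cochain_def)

lemma tp_module: "module R (tp e)"
  unfolding tensor_part_def by (rule module_family.family_module[OF fam])

lemma E_finite: "finite (E i)"
proof (rule finite_subset)
  show "E i \<subseteq> (\<Pi>\<^sub>E k\<in>{..<r}. {..i})"
  proof
    fix e assume "e \<in> E i"
    then have e: "e \<in> (\<Pi>\<^sub>E k\<in>{..<r}. UNIV)" "(\<Sum>k<r. e k) = i" by (auto simp: multidegrees_def)
    have "e k \<le> i" if "k < r" for k
      using member_le_sum[of k "{..<r}" e] that e(2) by simp
    with e(1) show "e \<in> (\<Pi>\<^sub>E k\<in>{..<r}. {..i})" by (auto simp: PiE_def)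
  qed
qed (auto intro: finite_PiE)

lemma up_mem: "\<lbrakk>e \<in> E i; k < r\<rbrakk> \<Longrightarrow> bump e k \<in> E (Suc i)"
proof -
  assume e: "e \<in> E i" and k: "k < r"
  then have "bump e k \<in> (\<Pi>\<^sub>E k\<in>{..<r}. UNIV)" by (intro PiE_upd) (auto simp: multidegrees_def)
  moreover have "(\<Sum>l<r. bump e k l) = Suc i"
  proof -
    have "(\<Sum>l<r. bump e k l) = Suc (e k) + (\<Sum>l\<in>{..<r}-{k}. bump e k l)"
      using k by (subst sum.remove[of _ k]) auto
    also have "(\<Sum>l\<in>{..<r}-{k}. bump e k l) = (\<Sum>l\<in>{..<r}-{k}. e l)" by (rule sum.cong) auto
    also have "Suc (e k) + \<dots> = Suc (\<Sum>l<r. e l)" using k by (subst sum.remove[of _ k]) auto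
    finally show ?thesis using e by (simp add: multidegrees_def)
  qed
  ultimately show ?thesis by (simp add: multidegrees_def)
qed

lemma sums: "finite_direct_sum R (E i) (tensor_part R r C)"
  by (simp add: finite_direct_sum_def finite_direct_sum_axioms_def is_cring E_finite tp_module)

lemma D_module: "module R (D i)"
  unfolding tensor_cochain_obj_def by (rule finite_direct_sum.direct_sum_module[OF sums])

lemma \<iota>_hom: "e \<in> E i \<Longrightarrow> \<iota> i e \<in> mod_hom R (tp e) (D i)"
  unfolding tensor_cochain_obj_def by (rule finite_direct_sum.inj_hom[OF sums])

lemma ptens_closed: "c \<in> ddom e \<Longrightarrow> ptens e c \<in> carrier (tp e)"
  unfolding tensor_part_def by (rule module_family.pure_family_closed[OF fam])

lemma dd_upd:
  assumes "c \<in> ddom e" "k < r"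
  shows "c(k := diff (C k) (e k) (c k)) \<in> ddom (bump e k)"
proof -
  have ck: "c k \<in> carrier (comps e k)" using assms by auto
  show ?thesis
    using assms mod_hom_closed[OF diff_hom[OF assms(2)] ck]
    by (auto simp: PiE_def extensional_def Pi_def)
qed

text \<open>In the slot that is differentiated, linearity is that of the differential composed with
  the slot; any other slot is untouched and the two updates commute.\<close>

lemma slot_diff_hom:
  assumes c: "c \<in> ddom e" and k: "k < r" and j: "j < r"
  shows "(\<lambda>x. ptens (bump e k) ((c(j := x))(k := diff (C k) (e k) ((c(j := x)) k)))) \<in>
    mod_hom R (comps e j) (tp (bump e k))"
proof (cases "j = k")
  case True
  have "(\<lambda>y. ptens (bump e k) ((c(k := diff (C k) (e k) (c k)))(k := y))) \<in>
      mod_hom R (comps (bump e k) k) (tp (bump e k))"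
    unfolding tensor_part_def using module_family.slot_hom[OF fam dd_upd[OF c k]] k by blast
  from mod_hom_comp[OF _ this, of "diff (C k) (e k)" "comps e k"] diff_hom[OF k] True
  show ?thesis by simp
next
  case False
  have "(\<lambda>y. ptens (bump e k) ((c(k := diff (C k) (e k) (c k)))(j := y))) \<in>
      mod_hom R (comps (bump e k) j) (tp (bump e k))"
    unfolding tensor_part_def using module_family.slot_hom[OF fam dd_upd[OF c k]] j by blast
  with False show ?thesis by (simp add: fun_upd_twist)
qed

text \<open>The value of the total differential on the pure tensor of \<open>c\<close> in
  multidegree \<open>e\<close>, that is, the Koszul sum inside \<open>tensor_cochain_diff\<close>,
  isolated so that its multilinearity can be stated.\<close>

definition \<psi> where
  "\<psi> i e c = (\<Oplus>\<^bsub>D (Suc i)\<^esub>k\<in>{..<r}. sg e k \<odot>\<^bsub>D (Suc i)\<^esub>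
     \<iota> (Suc i) (bump e k) (ptens (bump e k) (c(k := diff (C k) (e k) (c k)))))"

lemma sg_closed: "sg e k \<in> carrier R"
  by (rule nat_pow_closed) simp

lemma \<psi>_term_closed:
  assumes "e \<in> E i" "c \<in> ddom e" "k < r"
  shows "\<iota> (Suc i) (bump e k) (ptens (bump e k) (c(k := diff (C k) (e k) (c k)))) \<in> carrier (D (Suc i))"
  by (rule mod_hom_closed[OF \<iota>_hom[OF up_mem[OF assms(1,3)]] ptens_closed[OF dd_upd[OF assms(2,3)]]])

lemma \<psi>_multilinear:
  assumes e: "e \<in> E i"
  shows "multilinear R {..<r} (comps e) (D (Suc i)) (\<psi> i e)"
  unfolding multilinear_def
proof (intro conjI ballI)
  interpret Dm: module R "D (Suc i)" by (rule D_module)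
  show "\<psi> i e c \<in> carrier (D (Suc i))" if "c \<in> ddom e" for c
    unfolding \<psi>_def using \<psi>_term_closed[OF e that]
    by (intro Dm.M.finsum_closed) (auto intro!: Dm.smult_closed sg_closed)
  fix c j assume c: "c \<in> ddom e" and j: "j \<in> {..<r}"
  show "(\<lambda>x. \<psi> i e (c(j := x))) \<in> mod_hom R (comps e j) (D (Suc i))"
    unfolding \<psi>_def
  proof (rule mod_hom_sum[OF _ _ D_module])
    fix k assume "k \<in> {..<r}"
    then show "(\<lambda>x. sg e k \<odot>\<^bsub>D (Suc i)\<^esub> \<iota> (Suc i) (bump e k)
        (ptens (bump e k) ((c(j := x))(k := diff (C k) (e k) ((c(j := x)) k))))) \<in>
        mod_hom R (comps e j) (D (Suc i))"
      using j by (intro mod_hom_scale[OF mod_hom_comp[OF slot_diff_hom[OF c] \<iota>_hom[OF up_mem[OF e]]] D_module sg_closed]) auto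
  qed simp
qed

abbreviation "lift i e \<equiv> tensor_lift R (D (Suc i)) (\<psi> i e)"

lemma
  assumes "e \<in> E i"
  shows lift_hom: "lift i e \<in> mod_hom R (tp e) (D (Suc i))"
    and lift_pure: "c \<in> ddom e \<Longrightarrow> lift i e (ptens e c) = \<psi> i e c"
  unfolding tensor_part_def
  by (rule module_family.family_lift_hom[OF fam D_module \<psi>_multilinear[OF assms]],
      rule module_family.family_lift_pure[OF fam D_module \<psi>_multilinear[OF assms]])

abbreviation "d i \<equiv> tensor_cochain_diff R r C i"

lemma d_eq: "d i f = (\<Oplus>\<^bsub>D (Suc i)\<^esub>e\<in>E i. lift i e (f e))"
  by (simp add: tensor_cochain_diff_def Let_def \<psi>_def[abs_def])

lemma d_hom: "d i \<in> mod_hom R (D i) (D (Suc i))"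
proof -
  have p: "(\<lambda>f. f e) \<in> mod_hom R (D i) (tp e)" if "e \<in> E i" for e
    unfolding tensor_cochain_obj_def by (rule finite_direct_sum.proj_hom[OF sums that])
  have "(\<lambda>f. \<Oplus>\<^bsub>D (Suc i)\<^esub>e\<in>E i. lift i e (f e)) \<in> mod_hom R (D i) (D (Suc i))"
    by (rule mod_hom_sum[OF E_finite mod_hom_comp[OF p lift_hom] D_module])
  then show ?thesis unfolding d_eq[abs_def] .
qed

lemma d_\<iota>: assumes e: "e \<in> E i" and t: "t \<in> carrier (tp e)" shows "d i (\<iota> i e t) = lift i e t"
proof -
  interpret Dm: module R "D (Suc i)" by (rule D_module)
  have "d i (\<iota> i e t) = (\<Oplus>\<^bsub>D (Suc i)\<^esub>e'\<in>E i. if e = e' then lift i e t else \<zero>\<^bsub>D (Suc i)\<^esub>)"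
    unfolding d_eq
    using mod_hom_closed[OF lift_hom[OF e] t] mod_hom_zero[OF lift_hom tp_module D_module] e
    by (intro Dm.M.finsum_cong') (auto simp: direct_sum_inj_def)
  also have "\<dots> = lift i e t"
    using mod_hom_closed[OF lift_hom[OF e] t] Dm.M.finsum_singleton[OF e E_finite, of "\<lambda>_. lift i e t"]
    by auto
  finally show ?thesis .
qed

text \<open>The double sum over differentiated slots is antisymmetric. On the diagonal two
  successive differentials of one factor put zero into a slot; off the diagonal both orders give the
  same tensor with opposite Koszul signs.\<close>

lemma d_\<psi>_zero:
  assumes e: "e \<in> E i" and c: "c \<in> ddom e"
  shows "d (Suc i) (\<psi> i e c) = \<zero>\<^bsub>D (Suc (Suc i))\<^esub>"
proof -
  let ?D = "D (Suc (Suc i))" and ?D1 = "D (Suc i)"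
  interpret Dm: module R ?D by (rule D_module)
  interpret D1: module R ?D1 by (rule D_module)
  define ck where "ck k = c(k := diff (C k) (e k) (c k))" for k
  define ckl where "ckl k l = (ck k)(l := diff (C l) (bump e k l) (ck k l))" for k l
  define x where "x k l = \<iota> (Suc (Suc i)) (bump (bump e k) l) (ptens (bump (bump e k) l) (ckl k l))" for k l
  define a where "a k l = (sg e k \<otimes> sg (bump e k) l) \<odot>\<^bsub>?D\<^esub> x k l" for k l
  have ck: "ck k \<in> ddom (bump e k)" if "k < r" for k
    unfolding ck_def by (rule dd_upd[OF c that])
  have ckl: "ckl k l \<in> ddom (bump (bump e k) l)" if "k < r" "l < r" for k l
    unfolding ckl_def by (rule dd_upd[OF ck[OF that(1)] that(2)])
  have upE: "bump e k \<in> E (Suc i)" if "k < r" for k by (rule up_mem[OF e that])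
  have xc: "x k l \<in> carrier ?D" if "k < r" "l < r" for k l
    unfolding x_def by (rule mod_hom_closed[OF \<iota>_hom[OF up_mem[OF upE[OF that(1)] that(2)]] ptens_closed[OF ckl[OF that]]])
  have ac: "a k l \<in> carrier ?D" if "k < r" "l < r" for k l
    using xc[OF that] by (simp add: a_def)
  have tc: "\<iota> (Suc i) (bump e k) (ptens (bump e k) (ck k)) \<in> carrier ?D1" if "k < r" for k
    unfolding ck_def by (rule \<psi>_term_closed[OF e c that])
  have "d (Suc i) (\<psi> i e c) =
      (\<Oplus>\<^bsub>?D\<^esub>k\<in>{..<r}. d (Suc i) (sg e k \<odot>\<^bsub>?D1\<^esub> \<iota> (Suc i) (bump e k) (ptens (bump e k) (ck k))))"
    unfolding \<psi>_def ck_def[symmetric]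
    using tc by (intro mod_hom_finsum[OF d_hom D_module D_module]) (auto intro!: D1.smult_closed sg_closed)
  also have "\<dots> = (\<Oplus>\<^bsub>?D\<^esub>k\<in>{..<r}. \<Oplus>\<^bsub>?D\<^esub>l\<in>{..<r}. a k l)"
  proof (rule Dm.M.finsum_cong'[OF refl])
    show "(\<lambda>k. \<Oplus>\<^bsub>?D\<^esub>l\<in>{..<r}. a k l) \<in> {..<r} \<rightarrow> carrier ?D"
      using ac by (auto intro!: Dm.M.finsum_closed)
    fix k assume "k \<in> {..<r}"
    then have k: "k < r" by simp
    have "d (Suc i) (sg e k \<odot>\<^bsub>?D1\<^esub> \<iota> (Suc i) (bump e k) (ptens (bump e k) (ck k))) =
        sg e k \<odot>\<^bsub>?D\<^esub> \<psi> (Suc i) (bump e k) (ck k)"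
      by (simp only: mod_hom_smult[OF d_hom sg_closed tc[OF k]] d_\<iota>[OF upE[OF k] ptens_closed[OF ck[OF k]]]
        lift_pure[OF upE[OF k] ck[OF k]])
    also have "\<psi> (Suc i) (bump e k) (ck k) = (\<Oplus>\<^bsub>?D\<^esub>l\<in>{..<r}. sg (bump e k) l \<odot>\<^bsub>?D\<^esub> x k l)"
      by (simp add: \<psi>_def x_def ckl_def)
    also have "sg e k \<odot>\<^bsub>?D\<^esub> \<dots> = (\<Oplus>\<^bsub>?D\<^esub>l\<in>{..<r}. sg e k \<odot>\<^bsub>?D\<^esub> (sg (bump e k) l \<odot>\<^bsub>?D\<^esub> x k l))"
      using xc k by (intro Dm.finsum_smult_ldistr) auto
    also have "\<dots> = (\<Oplus>\<^bsub>?D\<^esub>l\<in>{..<r}. a k l)"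
      using xc k ac by (intro Dm.M.finsum_cong') (auto simp: a_def Dm.smult_assoc1)
    finally show "d (Suc i) (sg e k \<odot>\<^bsub>?D1\<^esub> \<iota> (Suc i) (bump e k) (ptens (bump e k) (ck k))) = \<dots>" .
  qed
  also have "\<dots> = \<zero>\<^bsub>?D\<^esub>"
  proof (rule Dm.M.finsum_antisymmetric[OF ac])
    fix k assume k: "k < r"
    have cc: "c k \<in> carrier (comps e k)" using c k by auto
    have up: "bump (bump e k) k \<in> E (Suc (Suc i))" by (rule up_mem[OF upE[OF k] k])
    have "ckl k k = (ckl k k)(k := \<zero>\<^bsub>comps (bump (bump e k) k) k\<^esub>)"
      using diff_diff[OF k cc] by (simp add: ckl_def ck_def)
    then have "ptens (bump (bump e k) k) (ckl k k) = \<zero>\<^bsub>tp (bump (bump e k) k)\<^esub>"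
      using module_family.pure_slot_zero[OF fam ckl[OF k k], of k] k by (simp add: tensor_part_def)
    then have "x k k = \<zero>\<^bsub>?D\<^esub>"
      unfolding x_def using mod_hom_zero[OF \<iota>_hom[OF up] tp_module D_module] by simp
    then show "a k k = \<zero>\<^bsub>?D\<^esub>" by (simp add: a_def)
  next
    fix k l assume kl: "k < l" "l < r"
    have "x l k = x k l"
      using kl by (simp add: x_def ckl_def ck_def fun_upd_twist)
    \<comment> \<open>Raising slot \<open>k\<close> shifts the exponent of the sign at the later
      slot \<open>l\<close> by one, while raising \<open>l\<close> does not affect the sign at
      \<open>k\<close>. This asymmetry is the only source of the minus sign.\<close>
    moreover have "(\<Sum>j<l. bump e k j) = Suc (\<Sum>j<l. e j)"
    proof -
      have "(\<Sum>j<l. bump e k j) = Suc (e k) + (\<Sum>j\<in>{..<l}-{k}. bump e k j)"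
        using kl by (subst sum.remove[of _ k]) auto
      also have "(\<Sum>j\<in>{..<l}-{k}. bump e k j) = (\<Sum>j\<in>{..<l}-{k}. e j)" by (rule sum.cong) auto
      also have "Suc (e k) + \<dots> = Suc (\<Sum>j<l. e j)" using kl by (subst sum.remove[of _ k]) auto
      finally show ?thesis .
    qed
    moreover have "(\<Sum>j<k. bump e l j) = (\<Sum>j<k. e j)" using kl by (intro sum.cong) auto
    ultimately show "a l k = \<ominus>\<^bsub>?D\<^esub> a k l"
      using kl xc[of k l] sg_closed[of e k] sg_closed[of e l]
      by (simp add: a_def l_minus r_minus m_comm Dm.smult_l_minus)
  qed
  finally show ?thesis .
qed

text \<open>A cochain is the sum of its components, and on each summand a linear map is determined
  by pure tensors, where \<open>d_\<psi>_zero\<close> applies.\<close>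

theorem tensor_cochain_is_cochain: "is_cochain R (tensor_cochain R r C)"
  unfolding is_cochain_def
proof (intro conjI allI ballI)
  fix i
  show "module R (obj (tensor_cochain R r C) i)" by (simp add: tensor_cochain_def D_module)
  show "diff (tensor_cochain R r C) i \<in>
      mod_hom R (obj (tensor_cochain R r C) i) (obj (tensor_cochain R r C) (Suc i))"
    by (simp add: tensor_cochain_def d_hom)
  fix f assume "f \<in> carrier (obj (tensor_cochain R r C) i)"
  then have f: "f \<in> carrier (D i)" by (simp add: tensor_cochain_def)
  note dd = mod_hom_comp[OF d_hom d_hom, of i]
  interpret D: module R "D i" by (rule D_module)
  interpret D2: module R "D (Suc (Suc i))" by (rule D_module)
  have z: "d (Suc i) (d i (\<iota> i e t)) = \<zero>\<^bsub>D (Suc (Suc i))\<^esub>" if e: "e \<in> E i" and t: "t \<in> carrier (tp e)" for e t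
  proof -
    have "(\<lambda>t. d (Suc i) (d i (\<iota> i e t))) t = (\<lambda>t. \<zero>\<^bsub>D (Suc (Suc i))\<^esub>) t"
    proof (rule module_family.family_hom_eq[OF fam D_module, of _ e])
      show "(\<lambda>t. d (Suc i) (d i (\<iota> i e t))) \<in> mod_hom R (tensor_family R {..<r} (comps e)) (D (Suc (Suc i)))"
        using mod_hom_comp[OF \<iota>_hom[OF e] dd] by (simp add: tensor_part_def)
      show "(\<lambda>t. \<zero>\<^bsub>D (Suc (Suc i))\<^esub>) \<in> mod_hom R (tensor_family R {..<r} (comps e)) (D (Suc (Suc i)))"
        by (rule mod_hom_const_zero[OF D_module])
      show "t \<in> carrier (tensor_family R {..<r} (comps e))" using t by (simp add: tensor_part_def)
      fix c assume c: "c \<in> ddom e"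
      then show "d (Suc i) (d i (\<iota> i e (ptens e c))) = \<zero>\<^bsub>D (Suc (Suc i))\<^esub>"
        by (simp add: d_\<iota>[OF e ptens_closed[OF c]] lift_pure[OF e c] d_\<psi>_zero[OF e c])
    qed
    then show ?thesis by simp
  qed
  have fe: "f e \<in> carrier (tp e)" if "e \<in> E i" for e
    using f finite_direct_sum.DS_closed[OF sums] that by (simp add: tensor_cochain_obj_def)
  have "f = (\<Oplus>\<^bsub>D i\<^esub>e\<in>E i. \<iota> i e (f e))"
    using finite_direct_sum.sum_inj_proj[OF sums, of f i] f by (simp add: tensor_cochain_obj_def)
  then have "d (Suc i) (d i f) = d (Suc i) (d i (\<Oplus>\<^bsub>D i\<^esub>e\<in>E i. \<iota> i e (f e)))" by simp
  also have "\<dots> = (\<Oplus>\<^bsub>D (Suc (Suc i))\<^esub>e\<in>E i. d (Suc i) (d i (\<iota> i e (f e))))"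
    using fe mod_hom_closed[OF \<iota>_hom] by (intro mod_hom_finsum[OF dd D_module D_module E_finite]) auto
  also have "\<dots> = (\<Oplus>\<^bsub>D (Suc (Suc i))\<^esub>e\<in>E i. \<zero>\<^bsub>D (Suc (Suc i))\<^esub>)"
    using z fe by (intro D2.M.finsum_cong') auto
  also have "\<dots> = \<zero>\<^bsub>D (Suc (Suc i))\<^esub>" by simp
  finally show "diff (tensor_cochain R r C) (Suc i) (diff (tensor_cochain R r C) i f) =
      \<zero>\<^bsub>obj (tensor_cochain R r C) (Suc (Suc i))\<^esub>"
    by (simp add: tensor_cochain_def)
qed

end

section \<open>The Cech complex\<close>

lemma mult_set_mult_closed:
  assumes "cring R" "ideal J R" "x \<in> carrier R"
  shows "mult_closed R (mult_set R x J)"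
proof -
  interpret cring R by fact
  interpret J: ideal J R by fact
  have Jc: "j \<in> carrier R" if "j \<in> J" for j using that by (rule J.Icarr)
  show ?thesis
    unfolding mult_closed_def
  proof (intro conjI ballI)
    show "mult_set R x J \<subseteq> carrier R" using assms(3) Jc by (auto simp: mult_set_def)
    show "\<one>\<^bsub>R\<^esub> \<in> mult_set R x J"
    proof -
      have "\<one>\<^bsub>R\<^esub> = x [^]\<^bsub>R\<^esub> (0::nat) \<oplus>\<^bsub>R\<^esub> \<zero>\<^bsub>R\<^esub>" by simp
      then show ?thesis unfolding mult_set_def using J.zero_closed by blast
    qed
    fix u v assume "u \<in> mult_set R x J" "v \<in> mult_set R x J"
    then obtain n j n' j' where *: "u = x [^]\<^bsub>R\<^esub> (n::nat) \<oplus>\<^bsub>R\<^esub> j" "j \<in> J" "v = x [^]\<^bsub>R\<^esub> (n'::nat) \<oplus>\<^bsub>R\<^esub> j'" "j' \<in> J"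
      by (auto simp: mult_set_def)
    let ?p = "x [^]\<^bsub>R\<^esub> n" and ?q = "x [^]\<^bsub>R\<^esub> n'"
    let ?j = "(?p \<otimes>\<^bsub>R\<^esub> j' \<oplus>\<^bsub>R\<^esub> j \<otimes>\<^bsub>R\<^esub> ?q) \<oplus>\<^bsub>R\<^esub> j \<otimes>\<^bsub>R\<^esub> j'"
    have "u \<otimes>\<^bsub>R\<^esub> v = x [^]\<^bsub>R\<^esub> (n + n') \<oplus>\<^bsub>R\<^esub> ?j"
      using * assms(3) by (simp add: Jc l_distr r_distr a_ac nat_pow_mult)
    moreover have "?j \<in> J"
      using * assms(3) by (intro J.a_closed) (auto intro: J.I_l_closed J.I_r_closed simp: Jc)
    ultimately show "u \<otimes>\<^bsub>R\<^esub> v \<in> mult_set R x J" by (auto simp: mult_set_def)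
  qed
qed

text \<open>The multiplicative set of the degree \<open>i\<close> term of a Cech factor: the trivial
  one where the term is \<open>R\<close>, and one containing 0 where the term is zero. That 0 is
  what later kills everything above the length of the sequence.\<close>

definition cech_set :: "('a, 'm) ring_scheme \<Rightarrow> 'a \<Rightarrow> 'a set \<Rightarrow> nat \<Rightarrow> 'a set" where
  "cech_set R x J i = (if i = 0 then {\<one>\<^bsub>R\<^esub>} else if i = 1 then mult_set R x J else {\<zero>\<^bsub>R\<^esub>, \<one>\<^bsub>R\<^esub>})"

definition cech_unit :: "('a, 'm) ring_scheme \<Rightarrow> 'a \<Rightarrow> 'a set \<Rightarrow> nat \<Rightarrow> 'a + ('a \<times> 'a) set" where
  "cech_unit R x J i = (if i = 0 then Inl \<one>\<^bsub>R\<^esub>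
     else if i = 1 then Inr (frac_rel R (mult_set R x J) (regular_module R) `` {(\<one>\<^bsub>R\<^esub>, \<one>\<^bsub>R\<^esub>)})
     else Inl \<zero>\<^bsub>R\<^esub>)"

lemma cech_factor_is_loc:
  assumes "cring R" "ideal J R" "x \<in> carrier R"
  shows "is_loc R (cech_set R x J i) (obj (cech_factor R x J) i) (cech_unit R x J i)"
  using is_loc_image[OF regular_is_loc[OF assms(1)], of Inl]
    is_loc_image[OF localization_is_loc[OF assms(1) mult_set_mult_closed[OF assms]], of Inr]
    zero_module_is_loc[OF assms(1)]
  by (auto simp: cech_factor_def cech_set_def cech_unit_def)

lemma cech_factor_is_cochain:
  assumes "cring R" "ideal J R" "x \<in> carrier R"
  shows "is_cochain R (cech_factor R x J)"
proof -
  interpret cring R by fact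
  let ?C = "cech_factor R x J"
  interpret L: module_localization R "regular_module R" "mult_set R x J"
    using regular_module_module[OF assms(1)] mult_set_mult_closed[OF assms]
    by (simp add: module_localization_def module_localization_axioms_def)
  have m: "module R (obj ?C i)" for i
    using cech_factor_is_loc[OF assms, of i] by (simp add: is_loc_def)
  have z: "Inl \<zero>\<^bsub>R\<^esub> = \<zero>\<^bsub>obj ?C (Suc (Suc i))\<^esub>" for i
    by (simp add: cech_factor_def zero_module_def)
  have pz: "(\<lambda>y. Inl \<zero>\<^bsub>R\<^esub>) \<in> mod_hom R (obj ?C (Suc i)) (obj ?C (Suc (Suc i)))" for i
    unfolding z[of i] by (rule mod_hom_const_zero[OF m])
  have 0: "diff ?C 0 \<in> mod_hom R (obj ?C 0) (obj ?C (Suc 0))"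
  proof -
    have i: "inj_on Inl (carrier (regular_module R))" "inj_on Inr (carrier L.Loc)" by simp_all
    note a = image_module_inv_hom[OF regular_module_module[OF assms(1)] i(1)]
      and b = image_module_hom[OF L.loc_module i(2)]
    have "(\<lambda>y. Inr (L.fr (inv_into (carrier (regular_module R)) Inl y) \<one>\<^bsub>R\<^esub>)) \<in>
        mod_hom R (image_module Inl (regular_module R)) (image_module Inr L.Loc)"
      using mod_hom_comp[OF mod_hom_comp[OF a L.frac_hom] b] .
    then have "(\<lambda>y. Inr (L.fr (projl y) \<one>\<^bsub>R\<^esub>)) \<in>
        mod_hom R (image_module Inl (regular_module R)) (image_module Inr L.Loc)"
      by (rule mod_hom_cong[OF _ image_module_module[OF regular_module_module[OF assms(1)] i(1)]])
         (auto simp: image_module_def inv_into_f_f)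
    then show ?thesis by (simp add: cech_factor_def)
  qed
  show ?thesis
    unfolding is_cochain_def
  proof (intro conjI allI ballI)
    fix i
    show "diff ?C i \<in> mod_hom R (obj ?C i) (obj ?C (Suc i))"
    proof (cases i)
      case (Suc j)
      have "diff ?C (Suc j) = (\<lambda>y. Inl \<zero>\<^bsub>R\<^esub>)" by (simp add: cech_factor_def)
      then show ?thesis using pz[of j] Suc by simp
    qed (use 0 in simp)
    show "diff ?C (Suc i) (diff ?C i y) = \<zero>\<^bsub>obj ?C (Suc (Suc i))\<^esub>" for y
      by (simp add: cech_factor_def zero_module_def)
  qed (rule m)
qed

section \<open>Powers of an ideal acting on a module\<close>

context
  fixes R :: "('a, 'm) ring_scheme" and \<aa> :: "'a set"
  assumes R: "cring R" and \<aa>: "ideal \<aa> R"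
begin

lemma ideal_pow_0: "\<aa> [^]\<^bsub>ideals_set R\<^esub> (0::nat) = carrier R"
  and ideal_pow_Suc: "\<aa> [^]\<^bsub>ideals_set R\<^esub> (Suc n) = ideal_prod R (\<aa> [^]\<^bsub>ideals_set R\<^esub> n) \<aa>"
  and ideal_pow_ideal: "ideal (\<aa> [^]\<^bsub>ideals_set R\<^esub> (n::nat)) R"
proof -
  interpret cring R by (fact R)
  interpret I: comm_monoid "ideals_set R" by (rule ideals_set_is_comm_monoid)
  have c: "\<aa> \<in> carrier (ideals_set R)" using \<aa> by (simp add: ideals_set_def)
  show "\<aa> [^]\<^bsub>ideals_set R\<^esub> (0::nat) = carrier R" by (simp add: ideals_set_def nat_pow_def)
  show "\<aa> [^]\<^bsub>ideals_set R\<^esub> (Suc n) = ideal_prod R (\<aa> [^]\<^bsub>ideals_set R\<^esub> n) \<aa>"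
    using I.nat_pow_Suc[of \<aa> n] by (simp add: ideals_set_def)
  show "ideal (\<aa> [^]\<^bsub>ideals_set R\<^esub> (n::nat)) R"
    using I.nat_pow_closed[OF c, of n] by (simp add: ideals_set_def)
qed

lemma ideal_pow_closed: "r \<in> \<aa> [^]\<^bsub>ideals_set R\<^esub> (n::nat) \<Longrightarrow> r \<in> carrier R"
  using ideal.Icarr[OF ideal_pow_ideal] .

lemma ideal_pow_decreasing: "\<aa> [^]\<^bsub>ideals_set R\<^esub> (Suc n) \<subseteq> \<aa> [^]\<^bsub>ideals_set R\<^esub> n"
  unfolding ideal_pow_Suc
  using ring.ideal_prod_inter[OF cring.axioms(1)[OF R] ideal_pow_ideal \<aa>] by blast

abbreviation AM :: "('a, 'b) module \<Rightarrow> nat \<Rightarrow> 'b set" where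
  "AM M n \<equiv> ideal_pow_smult R \<aa> n M"

lemma AM_gens_closed:
  "module R M \<Longrightarrow> {r \<odot>\<^bsub>M\<^esub> x | r x. r \<in> \<aa> [^]\<^bsub>ideals_set R\<^esub> (n::nat) \<and> x \<in> carrier M} \<subseteq> carrier M"
proof -
  assume "module R M"
  then interpret module R M .
  show ?thesis using ideal_pow_closed[of _ n] by auto
qed

lemma AM_submodule: "module R M \<Longrightarrow> submodule (AM M n) R M"
  unfolding ideal_pow_smult_def by (intro submodule_gen_submodule AM_gens_closed)

lemma AM_decreasing: assumes "module R M" shows "AM M (Suc n) \<subseteq> AM M n"
  unfolding ideal_pow_smult_def
  using ideal_pow_decreasing[of n] by (intro submodule_gen_mono[OF assms _ AM_gens_closed[OF assms]]) blast

lemma AM_antimono: assumes "module R M" "n \<le> m" shows "AM M m \<subseteq> AM M n"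
  using assms(2)
proof (induction m rule: dec_induct)
  case (step m)
  then show ?case using AM_decreasing[OF assms(1), of m] by blast
qed simp

lemma AM_hom:
  assumes M: "module R M" and N: "module R N" and f: "f \<in> mod_hom R M N"
  shows "f ` AM M n \<subseteq> AM N n"
proof
  fix y assume "y \<in> f ` AM M n"
  then obtain x where x: "x \<in> AM M n" "y = f x" by auto
  note g = submodule_gen_subset[OF N AM_gens_closed[OF N, of n], folded ideal_pow_smult_def]
  have "f x \<in> AM N n"
  proof (rule mod_hom_gen_into[OF M N AM_gens_closed[OF M] f AM_submodule[OF N]])
    show "x \<in> submodule_gen R M {r \<odot>\<^bsub>M\<^esub> x | r x. r \<in> \<aa> [^]\<^bsub>ideals_set R\<^esub> n \<and> x \<in> carrier M}"
      using x by (simp add: ideal_pow_smult_def)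
    fix z assume "z \<in> {r \<odot>\<^bsub>M\<^esub> x | r x. r \<in> \<aa> [^]\<^bsub>ideals_set R\<^esub> n \<and> x \<in> carrier M}"
    then obtain r x where "z = r \<odot>\<^bsub>M\<^esub> x" "r \<in> \<aa> [^]\<^bsub>ideals_set R\<^esub> n" "x \<in> carrier M" by auto
    then have "f z \<in> {r \<odot>\<^bsub>N\<^esub> x | r x. r \<in> \<aa> [^]\<^bsub>ideals_set R\<^esub> n \<and> x \<in> carrier N}"
      using mod_hom_smult[OF f ideal_pow_closed] mod_hom_closed[OF f] by blast
    then show "f z \<in> AM N n" using g by blast
  qed
  then show "y \<in> AM N n" using x by simp
qed

text \<open>A generator \<open>r x\<close> with \<open>r\<close> in the power of the ideal is the
  image of \<open>r x'\<close> for any preimage \<open>x'\<close> of \<open>x\<close>.\<close>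

lemma AM_surj:
  assumes M: "module R M" and N: "module R N" and f: "f \<in> mod_hom R M N" and s: "f ` carrier M = carrier N"
  shows "AM N n \<subseteq> f ` AM M n"
  unfolding ideal_pow_smult_def[of R \<aa> n N]
proof (rule submodule_gen_least[OF mod_hom_image[OF f M N AM_submodule[OF M]]])
  note g = submodule_gen_subset[OF M AM_gens_closed[OF M, of n], folded ideal_pow_smult_def]
  show "{r \<odot>\<^bsub>N\<^esub> x | r x. r \<in> \<aa> [^]\<^bsub>ideals_set R\<^esub> n \<and> x \<in> carrier N} \<subseteq> f ` AM M n"
  proof
    fix z assume "z \<in> {r \<odot>\<^bsub>N\<^esub> x | r x. r \<in> \<aa> [^]\<^bsub>ideals_set R\<^esub> n \<and> x \<in> carrier N}"
    then obtain r x where *: "z = r \<odot>\<^bsub>N\<^esub> x" "r \<in> \<aa> [^]\<^bsub>ideals_set R\<^esub> n" "x \<in> carrier N" by auto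
    then obtain x' where x': "x' \<in> carrier M" "x = f x'" using s by blast
    have "z = f (r \<odot>\<^bsub>M\<^esub> x')" using * x' mod_hom_smult[OF f ideal_pow_closed] by simp
    moreover have "r \<odot>\<^bsub>M\<^esub> x' \<in> AM M n" using g * x' by blast
    ultimately show "z \<in> f ` AM M n" by blast
  qed
qed

end

section \<open>Inverse limits\<close>

lemma inverse_limit_simps:
  "carrier (inverse_limit N \<phi>) = {f. \<forall>n. f n \<in> carrier (N n) \<and> \<phi> n (f (Suc n)) = f n}"
  "\<zero>\<^bsub>inverse_limit N \<phi>\<^esub> = (\<lambda>n. \<zero>\<^bsub>N n\<^esub>)"
  "f \<oplus>\<^bsub>inverse_limit N \<phi>\<^esub> g = (\<lambda>n. f n \<oplus>\<^bsub>N n\<^esub> g n)"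
  "r \<odot>\<^bsub>inverse_limit N \<phi>\<^esub> f = (\<lambda>n. r \<odot>\<^bsub>N n\<^esub> f n)"
  by (simp_all add: inverse_limit_def)

lemma inverse_limit_module:
  assumes N: "\<And>n. module R (N n)" and \<phi>: "\<And>n. \<phi> n \<in> mod_hom R (N (Suc n)) (N n)"
  shows "module R (inverse_limit N \<phi>)"
proof -
  interpret N: module R "N n" for n by (rule N)
  let ?L = "inverse_limit N \<phi>"
  note \<phi>s = mod_hom_add[OF \<phi>] mod_hom_smult[OF \<phi>] mod_hom_zero[OF \<phi> N N] mod_hom_neg[OF \<phi> N N]
  show "module R ?L"
  proof (rule moduleI[OF N.R.is_cring])
    show "abelian_group ?L"
    proof (rule abelian_groupI)
      fix f assume f: "f \<in> carrier ?L"
      then show "\<exists>g\<in>carrier ?L. g \<oplus>\<^bsub>?L\<^esub> f = \<zero>\<^bsub>?L\<^esub>"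
        by (intro bexI[of _ "\<lambda>n. \<ominus>\<^bsub>N n\<^esub> f n"]) (auto simp: inverse_limit_simps \<phi>s N.M.l_neg)
    qed (auto simp: inverse_limit_simps \<phi>s N.M.a_ac)
  qed (auto simp: inverse_limit_simps \<phi>s N.smult_l_distr N.smult_r_distr N.smult_assoc1)
qed

section \<open>Complexes of direct sums of localizations\<close>

text \<open>What the homological argument uses of the Cech complex: finite sums of localizations,
  with no formula for the differential. An index \<open>e\<close> stands for a multidegree, which
  already fixes the module; hence \<open>T\<close>, \<open>S\<close> and \<open>u\<close> have no
  degree argument.\<close>

locale loc_cochain = cring R for R :: "('a, 'm) ring_scheme" (structure) +
  fixes C :: "('a, 'e \<Rightarrow> 'c) cochain" and E :: "nat \<Rightarrow> 'e set" and T :: "'e \<Rightarrow> ('a, 'c) module"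
    and S :: "'e \<Rightarrow> 'a set" and u :: "'e \<Rightarrow> 'c"
  assumes cochain: "is_cochain R C" and obj_eq: "\<And>i. obj C i = direct_sum (E i) T"
    and E_fin: "\<And>i. finite (E i)" and locs: "\<And>i e. e \<in> E i \<Longrightarrow> is_loc R (S e) (T e) (u e)"
begin

lemma C_module: "module R (obj C i)" and C_diff: "diff C i \<in> mod_hom R (obj C i) (obj C (Suc i))"
  and C_dd: "x \<in> carrier (obj C i) \<Longrightarrow> diff C (Suc i) (diff C i x) = \<zero>\<^bsub>obj C (Suc (Suc i))\<^esub>"
  using cochain by (auto simp: is_cochain_def)

lemma T_module: "e \<in> E i \<Longrightarrow> module R (T e)"
  using locs by (auto simp: is_loc_def)

lemma localized: "e \<in> E i \<Longrightarrow> localized R (T e) (S e) (u e)"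
  using locs T_module by (auto simp: localized_def localized_axioms_def)

lemma sums: "finite_direct_sum R (E i) T"
  using T_module by (simp add: finite_direct_sum_def finite_direct_sum_axioms_def is_cring E_fin)

abbreviation "G i M \<equiv> tensor R (obj C i) M"
abbreviation "Gm i N f \<equiv> tensor_map R (obj C i) N (\<lambda>z. z) f"
abbreviation "Gd i N \<equiv> tensor_map R (obj C (Suc i)) N (diff C i) (\<lambda>y. y)"

lemma G_module: "module R M \<Longrightarrow> module R (G i M)"
  by (rule tensor_module[OF C_module])

lemma Gm_hom: "\<lbrakk>module R M; module R N; f \<in> mod_hom R M N\<rbrakk> \<Longrightarrow> Gm i N f \<in> mod_hom R (G i M) (G i N)"
  by (rule tensor_map_hom[OF C_module _ C_module _ mod_hom_id])

lemma Gm_comp: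
  "\<lbrakk>module R M; module R N; module R P; f \<in> mod_hom R M N; g \<in> mod_hom R N P; z \<in> carrier (G i M)\<rbrakk> \<Longrightarrow>
    Gm i P g (Gm i N f z) = Gm i P (\<lambda>x. g (f x)) z"
  by (rule tensor_map_comp[OF C_module _ C_module _ C_module _ mod_hom_id _ mod_hom_id])

lemma Gm_cong:
  "\<lbrakk>module R M; module R N; f \<in> mod_hom R M N; z \<in> carrier (G i M); \<And>x. x \<in> carrier M \<Longrightarrow> f x = g x\<rbrakk> \<Longrightarrow>
    Gm i N f z = Gm i N g z"
  by (rule tensor_map_cong[OF C_module _ C_module _ mod_hom_id]) auto

lemma Gm_comp_eq:
  assumes "module R M" "module R N" "module R P" "f \<in> mod_hom R M N" "g \<in> mod_hom R N P"
    and "z \<in> carrier (G i M)" "\<And>x. x \<in> carrier M \<Longrightarrow> g (f x) = h x"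
  shows "Gm i P g (Gm i N f z) = Gm i P h z"
  using Gm_comp[OF assms(1-6)] Gm_cong[OF assms(1,3) mod_hom_comp[OF assms(4,5)] assms(6,7)] by simp

lemma Gm_square:
  assumes "module R M" "module R N" "module R P" "f \<in> mod_hom R M N" "g \<in> mod_hom R N P"
    and "module R N'" "f' \<in> mod_hom R M N'" "g' \<in> mod_hom R N' P"
    and "z \<in> carrier (G i M)" "\<And>x. x \<in> carrier M \<Longrightarrow> g (f x) = g' (f' x)"
  shows "Gm i P g (Gm i N f z) = Gm i P g' (Gm i N' f' z)"
  using Gm_comp_eq[OF assms(1-5,9,10)] Gm_comp[OF assms(1,6,3,7,8,9)] by simp

lemma Gm_zero:
  assumes M: "module R M" and N: "module R N" and z: "z \<in> carrier (G i M)"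
    and f: "f \<in> mod_hom R M N" "\<And>x. x \<in> carrier M \<Longrightarrow> f x = \<zero>\<^bsub>N\<^esub>"
  shows "Gm i N f z = \<zero>\<^bsub>G i N\<^esub>"
proof (rule tensor_hom_eq[OF C_module M G_module[OF N] Gm_hom[OF M N f(1)] mod_hom_const_zero[OF G_module[OF N]] _ z])
  fix x y assume xy: "x \<in> carrier (obj C i)" "y \<in> carrier M"
  have r: "pure_tensor R (obj C i) N x \<in> mod_hom R N (G i N)"
    using pure_tensor_bilinear[OF C_module N] xy by (auto simp: bilinear_def)
  show "Gm i N f (pure_tensor R (obj C i) M x y) = \<zero>\<^bsub>G i N\<^esub>"
    using mod_hom_zero[OF r N G_module[OF N]]
    by (simp add: tensor_map_pure[OF C_module M C_module N mod_hom_id f(1) xy] f(2)[OF xy(2)])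
qed

lemma Gm_smult:
  assumes M: "module R M" and y: "y \<in> carrier R" and z: "z \<in> carrier (G i M)"
  shows "Gm i M (\<lambda>x. y \<odot>\<^bsub>M\<^esub> x) z = y \<odot>\<^bsub>G i M\<^esub> z"
proof -
  note h = mod_hom_scale[OF mod_hom_id M y]
  show ?thesis
  proof (rule tensor_hom_eq[OF C_module M G_module[OF M] Gm_hom[OF M M h]
        mod_hom_scale[OF mod_hom_id G_module[OF M] y] _ z])
    fix c m assume cm: "c \<in> carrier (obj C i)" "m \<in> carrier M"
    have r: "pure_tensor R (obj C i) M c \<in> mod_hom R M (G i M)"
      using pure_tensor_bilinear[OF C_module M] cm by (auto simp: bilinear_def)
    show "Gm i M (\<lambda>x. y \<odot>\<^bsub>M\<^esub> x) (pure_tensor R (obj C i) M c m) = y \<odot>\<^bsub>G i M\<^esub> pure_tensor R (obj C i) M c m"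
      using mod_hom_smult[OF r y cm(2)] by (simp add: tensor_map_pure[OF C_module M C_module M mod_hom_id h cm])
  qed
qed

lemma Gm_surj:
  "\<lbrakk>module R M; module R N; f \<in> mod_hom R M N; f ` carrier M = carrier N; z \<in> carrier (G i N)\<rbrakk> \<Longrightarrow>
    \<exists>w\<in>carrier (G i M). Gm i N f w = z"
  by (rule tensor_map_surj[OF C_module])

lemma Gd_hom: "module R M \<Longrightarrow> Gd i M \<in> mod_hom R (G i M) (G (Suc i) M)"
  by (rule tensor_map_hom[OF C_module _ C_module _ C_diff mod_hom_id])

lemma Gd_natural:
  assumes "module R M" "module R N" "f \<in> mod_hom R M N" "z \<in> carrier (G i M)"
  shows "Gd i N (Gm i N f z) = Gm (Suc i) N f (Gd i M z)"
  by (simp add: tensor_map_comp[OF C_module assms(1) C_module assms(2) C_module assms(2) mod_hom_id assms(3) C_diff mod_hom_id assms(4)]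
      tensor_map_comp[OF C_module assms(1) C_module assms(1) C_module assms(2) C_diff mod_hom_id mod_hom_id assms(3,4)])

lemma Gd_Gd:
  assumes M: "module R M" and z: "z \<in> carrier (G i M)"
  shows "Gd (Suc i) M (Gd i M z) = \<zero>\<^bsub>G (Suc (Suc i)) M\<^esub>"
proof (rule tensor_hom_eq[OF C_module M G_module[OF M] mod_hom_comp[OF Gd_hom[OF M] Gd_hom[OF M]]
        mod_hom_const_zero[OF G_module[OF M]] _ z])
  fix x y assume xy: "x \<in> carrier (obj C i)" "y \<in> carrier M"
  have l: "(\<lambda>x. pure_tensor R (obj C (Suc (Suc i))) M x y) \<in> mod_hom R (obj C (Suc (Suc i))) (G (Suc (Suc i)) M)"
    using pure_tensor_bilinear[OF C_module M] xy by (auto simp: bilinear_def)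
  show "Gd (Suc i) M (Gd i M (pure_tensor R (obj C i) M x y)) = \<zero>\<^bsub>G (Suc (Suc i)) M\<^esub>"
    using mod_hom_zero[OF l C_module G_module[OF M]] xy mod_hom_closed[OF C_diff xy(1)]
    by (simp add: tensor_map_pure[OF C_module M C_module M C_diff mod_hom_id] C_dd)
qed

text \<open>The identity of a finite direct sum is the sum of inclusions after projections.
  Tensoring this equation replaces an isomorphism between the tensor product of a sum and the sum of
  the tensor products.\<close>

lemma G_decompose:
  assumes M: "module R M" and z: "z \<in> carrier (G i M)"
  shows "z = (\<Oplus>\<^bsub>G i M\<^esub>e\<in>E i. tensor_map R (obj C i) M (direct_sum_inj (E i) T e) (\<lambda>y. y)
      (tensor_map R (T e) M (\<lambda>f. f e) (\<lambda>y. y) z))"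
proof -
  interpret M: module R M by fact
  interpret G: module R "G i M" by (rule G_module[OF M])
  have p: "(\<lambda>f. f e) \<in> mod_hom R (obj C i) (T e)" if "e \<in> E i" for e
    unfolding obj_eq by (rule finite_direct_sum.proj_hom[OF sums that])
  have j: "direct_sum_inj (E i) T e \<in> mod_hom R (T e) (obj C i)" if "e \<in> E i" for e
    unfolding obj_eq by (rule finite_direct_sum.inj_hom[OF sums that])
  note P = tensor_map_hom[OF C_module M T_module M p mod_hom_id]
    and J = tensor_map_hom[OF T_module M C_module M j mod_hom_id]
  show ?thesis
  proof (rule tensor_hom_eq[OF C_module M G.module_axioms mod_hom_id
        mod_hom_sum[OF E_fin mod_hom_comp[OF P J] G.module_axioms] _ z])
    fix x y assume xy: "x \<in> carrier (obj C i)" "y \<in> carrier M"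
    have xe: "x e \<in> carrier (T e)" if "e \<in> E i" for e
      using mod_hom_closed[OF p[OF that] xy(1)] .
    have l: "(\<lambda>x. pure_tensor R (obj C i) M x y) \<in> mod_hom R (obj C i) (G i M)"
      using pure_tensor_bilinear[OF C_module M] xy by (auto simp: bilinear_def)
    have jx: "(\<lambda>e. direct_sum_inj (E i) T e (x e)) \<in> E i \<rightarrow> carrier (obj C i)"
      using mod_hom_closed[OF j xe] by auto
    have "(\<Oplus>\<^bsub>G i M\<^esub>e\<in>E i. tensor_map R (obj C i) M (direct_sum_inj (E i) T e) (\<lambda>y. y)
        (tensor_map R (T e) M (\<lambda>f. f e) (\<lambda>y. y) (pure_tensor R (obj C i) M x y))) =
      (\<Oplus>\<^bsub>G i M\<^esub>e\<in>E i. pure_tensor R (obj C i) M (direct_sum_inj (E i) T e (x e)) y)"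
      using xy xe jx pure_tensor_closed[OF C_module M _ xy(2)]
      by (intro G.M.finsum_cong')
         (auto simp: tensor_map_pure[OF C_module M T_module M p mod_hom_id]
            tensor_map_pure[OF T_module M C_module M j mod_hom_id])
    also have "\<dots> = pure_tensor R (obj C i) M (\<Oplus>\<^bsub>obj C i\<^esub>e\<in>E i. direct_sum_inj (E i) T e (x e)) y"
      using mod_hom_finsum[OF l C_module G.module_axioms E_fin jx] by simp
    also have "(\<Oplus>\<^bsub>obj C i\<^esub>e\<in>E i. direct_sum_inj (E i) T e (x e)) = x"
      using finite_direct_sum.sum_inj_proj[OF sums, of x i] xy(1) by (simp add: obj_eq)
    finally show "pure_tensor R (obj C i) M x y = (\<Oplus>\<^bsub>G i M\<^esub>e\<in>E i.
        tensor_map R (obj C i) M (direct_sum_inj (E i) T e) (\<lambda>y. y)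
        (tensor_map R (T e) M (\<lambda>f. f e) (\<lambda>y. y) (pure_tensor R (obj C i) M x y)))" by simp
  qed
qed

text \<open>Each component of \<open>z\<close> lies in the kernel at its own localization and is
  lifted there; reassembling the lifts along the inclusions gives a preimage of
  \<open>z\<close>.\<close>

theorem Gm_exact:
  assumes L: "module R L" and M: "module R M" and N: "module R N"
    and f: "f \<in> mod_hom R L M" and g: "g \<in> mod_hom R M N"
    and ex: "\<And>x. \<lbrakk>x \<in> carrier M; g x = \<zero>\<^bsub>N\<^esub>\<rbrakk> \<Longrightarrow> x \<in> f ` carrier L"
    and z: "z \<in> carrier (G i M)" "Gm i N g z = \<zero>\<^bsub>G i N\<^esub>"
  shows "\<exists>y\<in>carrier (G i L). Gm i M f y = z"
proof -
  interpret GL: module R "G i L" by (rule G_module[OF L])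
  interpret GM: module R "G i M" by (rule G_module[OF M])
  have p: "(\<lambda>f. f e) \<in> mod_hom R (obj C i) (T e)" if "e \<in> E i" for e
    unfolding obj_eq by (rule finite_direct_sum.proj_hom[OF sums that])
  have j: "direct_sum_inj (E i) T e \<in> mod_hom R (T e) (obj C i)" if "e \<in> E i" for e
    unfolding obj_eq by (rule finite_direct_sum.inj_hom[OF sums that])
  let ?P = "\<lambda>M e. tensor_map R (T e) M (\<lambda>f. f e) (\<lambda>y. y)"
  let ?J = "\<lambda>M e. tensor_map R (obj C i) M (direct_sum_inj (E i) T e) (\<lambda>y. y)"
  have "\<exists>y\<in>carrier (tensor R (T e) L). tensor_map R (T e) M (\<lambda>t. t) f y = ?P M e z" if e: "e \<in> E i" for e
  proof (rule localized.tensor_exact[OF localized[OF e] L M N f g ex])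
    note P = tensor_map_hom[OF C_module M T_module[OF e] M p[OF e] mod_hom_id]
      and PN = tensor_map_hom[OF C_module N T_module[OF e] N p[OF e] mod_hom_id]
    show "?P M e z \<in> carrier (tensor R (T e) M)" by (rule mod_hom_closed[OF P z(1)])
    have "tensor_map R (T e) N (\<lambda>t. t) g (?P M e z) = tensor_map R (T e) N (\<lambda>f. f e) g z"
      by (rule tensor_map_comp[OF C_module M T_module[OF e] M T_module[OF e] N p[OF e] mod_hom_id mod_hom_id g z(1)])
    also have "\<dots> = ?P N e (Gm i N g z)"
      by (rule tensor_map_comp[OF C_module M C_module N T_module[OF e] N mod_hom_id g p[OF e] mod_hom_id z(1), symmetric])
    also have "\<dots> = \<zero>\<^bsub>tensor R (T e) N\<^esub>"
      unfolding z(2) by (rule mod_hom_zero[OF PN G_module[OF N] tensor_module[OF T_module[OF e] N]])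
    finally show "tensor_map R (T e) N (\<lambda>t. t) g (?P M e z) = \<zero>\<^bsub>tensor R (T e) N\<^esub>" .
  qed
  then obtain y where y: "\<And>e. e \<in> E i \<Longrightarrow> y e \<in> carrier (tensor R (T e) L)"
    "\<And>e. e \<in> E i \<Longrightarrow> tensor_map R (T e) M (\<lambda>t. t) f (y e) = ?P M e z" by metis
  note J = tensor_map_hom[OF T_module L C_module L j mod_hom_id]
  have yc: "(\<lambda>e. ?J L e (y e)) \<in> E i \<rightarrow> carrier (G i L)"
    using mod_hom_closed[OF J y(1)] by auto
  have "Gm i M f (\<Oplus>\<^bsub>G i L\<^esub>e\<in>E i. ?J L e (y e)) = (\<Oplus>\<^bsub>G i M\<^esub>e\<in>E i. Gm i M f (?J L e (y e)))"
    by (rule mod_hom_finsum[OF Gm_hom[OF L M f] GL.module_axioms GM.module_axioms E_fin yc])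
  also have "\<dots> = (\<Oplus>\<^bsub>G i M\<^esub>e\<in>E i. ?J M e (?P M e z))"
  proof (rule GM.M.finsum_cong'[OF refl])
    show "(\<lambda>e. ?J M e (?P M e z)) \<in> E i \<rightarrow> carrier (G i M)"
      using mod_hom_closed[OF tensor_map_hom[OF T_module M C_module M j mod_hom_id]
          mod_hom_closed[OF tensor_map_hom[OF C_module M T_module M p mod_hom_id] z(1)]] by auto
    fix e assume e: "e \<in> E i"
    have "Gm i M f (?J L e (y e)) = tensor_map R (obj C i) M (direct_sum_inj (E i) T e) f (y e)"
      by (rule tensor_map_comp[OF T_module[OF e] L C_module L C_module M j[OF e] mod_hom_id mod_hom_id f y(1)[OF e]])
    also have "\<dots> = ?J M e (tensor_map R (T e) M (\<lambda>t. t) f (y e))"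
      by (rule tensor_map_comp[OF T_module[OF e] L T_module[OF e] M C_module M mod_hom_id f j[OF e] mod_hom_id y(1)[OF e], symmetric])
    finally show "Gm i M f (?J L e (y e)) = ?J M e (?P M e z)" using y(2)[OF e] by simp
  qed
  also have "\<dots> = z" using G_decompose[OF M z(1)] by simp
  finally show ?thesis using yc by (intro bexI[of _ "\<Oplus>\<^bsub>G i L\<^esub>e\<in>E i. ?J L e (y e)"]) (auto intro: GL.M.finsum_closed)
qed

text \<open>On each summand tensored with \<open>M\<close>, some \<open>s\<close> acts bijectively
  through the localization and as zero through \<open>M\<close>.\<close>

lemma G_trivial:
  assumes M: "module R M" and k: "\<And>e. e \<in> E i \<Longrightarrow> \<exists>s\<in>S e. \<forall>x\<in>carrier M. s \<odot>\<^bsub>M\<^esub> x = \<zero>\<^bsub>M\<^esub>"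
    and z: "z \<in> carrier (G i M)"
  shows "z = \<zero>\<^bsub>G i M\<^esub>"
proof -
  interpret M: module R M by fact
  interpret G: module R "G i M" by (rule G_module[OF M])
  have p: "(\<lambda>f. f e) \<in> mod_hom R (obj C i) (T e)" if "e \<in> E i" for e
    unfolding obj_eq by (rule finite_direct_sum.proj_hom[OF sums that])
  have j: "direct_sum_inj (E i) T e \<in> mod_hom R (T e) (obj C i)" if "e \<in> E i" for e
    unfolding obj_eq by (rule finite_direct_sum.inj_hom[OF sums that])
  have 0: "t = \<zero>\<^bsub>tensor R (T e) M\<^esub>" if e: "e \<in> E i" and t: "t \<in> carrier (tensor R (T e) M)" for e t
  proof -
    interpret l: localized R "T e" "S e" "u e" by (rule localized[OF e])
    interpret X: module R "tensor R (T e) M" by (rule tensor_module[OF T_module[OF e] M])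
    obtain s where s: "s \<in> S e" "\<And>x. x \<in> carrier M \<Longrightarrow> s \<odot>\<^bsub>M\<^esub> x = \<zero>\<^bsub>M\<^esub>" using k[OF e] by blast
    have sR: "s \<in> carrier R" using l.S_closed[OF s(1)] .
    have "s \<odot>\<^bsub>tensor R (T e) M\<^esub> t = \<zero>\<^bsub>tensor R (T e) M\<^esub>"
    proof (rule tensor_hom_eq[OF T_module[OF e] M X.module_axioms mod_hom_scale[OF mod_hom_id X.module_axioms sR]
          mod_hom_const_zero[OF X.module_axioms] _ t])
      fix x y assume xy: "x \<in> carrier (T e)" "y \<in> carrier M"
      have r: "pure_tensor R (T e) M x \<in> mod_hom R M (tensor R (T e) M)"
        using pure_tensor_bilinear[OF T_module[OF e] M] xy by (auto simp: bilinear_def)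
      show "s \<odot>\<^bsub>tensor R (T e) M\<^esub> pure_tensor R (T e) M x y = \<zero>\<^bsub>tensor R (T e) M\<^esub>"
        using mod_hom_smult[OF r sR xy(2)] s(2)[OF xy(2)] mod_hom_zero[OF r M X.module_axioms] by simp
    qed
    then have "s \<odot>\<^bsub>tensor R (T e) M\<^esub> t = s \<odot>\<^bsub>tensor R (T e) M\<^esub> \<zero>\<^bsub>tensor R (T e) M\<^esub>" using sR by simp
    then show ?thesis
      using smult_bij_inj[OF l.tensor_smult_bij[OF M] s(1) t X.M.zero_closed] by simp
  qed
  have "z = (\<Oplus>\<^bsub>G i M\<^esub>e\<in>E i. tensor_map R (obj C i) M (direct_sum_inj (E i) T e) (\<lambda>y. y)
      (tensor_map R (T e) M (\<lambda>f. f e) (\<lambda>y. y) z))" by (rule G_decompose[OF M z])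
  also have "\<dots> = (\<Oplus>\<^bsub>G i M\<^esub>e\<in>E i. \<zero>\<^bsub>G i M\<^esub>)"
  proof (rule G.M.finsum_cong'[OF refl])
    fix e assume e: "e \<in> E i"
    have "tensor_map R (T e) M (\<lambda>f. f e) (\<lambda>y. y) z = \<zero>\<^bsub>tensor R (T e) M\<^esub>"
      by (rule 0[OF e mod_hom_closed[OF tensor_map_hom[OF C_module M T_module[OF e] M p[OF e] mod_hom_id] z]])
    then show "tensor_map R (obj C i) M (direct_sum_inj (E i) T e) (\<lambda>y. y)
      (tensor_map R (T e) M (\<lambda>f. f e) (\<lambda>y. y) z) = \<zero>\<^bsub>G i M\<^esub>"
      using mod_hom_zero[OF tensor_map_hom[OF T_module[OF e] M C_module M j[OF e] mod_hom_id]
          tensor_module[OF T_module[OF e] M] G.module_axioms] by simp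
  qed simp
  also have "\<dots> = \<zero>\<^bsub>G i M\<^esub>" by simp
  finally show ?thesis .
qed

end

section \<open>The formal complex\<close>

locale formal_cochain = loc_cochain R C E T S u
  for R :: "('a, 'm) ring_scheme" (structure) and C :: "('a, 'e \<Rightarrow> 'c) cochain"
    and E :: "nat \<Rightarrow> 'e set" and T :: "'e \<Rightarrow> ('a, 'c) module" and S :: "'e \<Rightarrow> 'a set" and u :: "'e \<Rightarrow> 'c" +
  fixes \<aa> :: "'a set"
  assumes \<aa>: "ideal \<aa> R"
begin

abbreviation "A M n \<equiv> ideal_pow_smult R \<aa> n M"
abbreviation "Q M n \<equiv> quot_pow R \<aa> M n"
abbreviation "pr M n x \<equiv> A M n +>\<^bsub>M\<^esub> x"
abbreviation "tr M n \<equiv> quot_pow_proj R \<aa> M n"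
abbreviation "qm N n f \<equiv> quot_map N (A N n) f"

text \<open>For \<open>C\<close> the Cech complex this is \<open>cech_formal_complex\<close> after
  unfolding; here \<open>C\<close> stays abstract.\<close>

definition FC :: "('a, 'b) module \<Rightarrow> ('a, nat \<Rightarrow> (('e \<Rightarrow> 'c) \<times> 'b set \<Rightarrow> 'a) set) cochain" where
  "FC M = inverse_limit_cochain (\<lambda>n. tensor_cochain_module R C (Q M n)) (\<lambda>n i. Gm i (Q M n) (tr M n))"

lemmas A_sub = AM_submodule[OF is_cring \<aa>]

lemma Q_module: "module R M \<Longrightarrow> module R (Q M n)"
  by (rule quot_module_module[OF _ A_sub])

lemma pr_hom: "module R M \<Longrightarrow> (\<lambda>x. pr M n x) \<in> mod_hom R M (Q M n)"
  by (rule quot_module_proj[OF _ A_sub])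

lemma Q_carrier: "module R M \<Longrightarrow> carrier (Q M n) = (\<lambda>x. pr M n x) ` carrier M"
  by (rule quot_module_carrier[OF _ A_sub])

lemma pr_zero_iff: "\<lbrakk>module R M; x \<in> carrier M\<rbrakk> \<Longrightarrow> pr M n x = \<zero>\<^bsub>Q M n\<^esub> \<longleftrightarrow> x \<in> A M n"
  using coset_zero_iff[OF _ A_sub, of M x n] quot_module_zero[OF _ A_sub, of M n] by simp

lemma tr_eq: "tr M n = quot_map M (A M n) (\<lambda>x. x)"
  by (auto simp: quot_pow_proj_def quot_map_def fun_eq_iff)

lemma tr_hom: assumes "module R M" shows "tr M n \<in> mod_hom R (Q M (Suc n)) (Q M n)"
  unfolding tr_eq
  using AM_decreasing[OF is_cring \<aa> assms, of n]
  by (intro quot_map_hom[OF assms A_sub[OF assms] assms A_sub[OF assms] mod_hom_id]) simp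

lemma tr_pr: assumes "module R M" "x \<in> carrier M" shows "tr M n (pr M (Suc n) x) = pr M n x"
  unfolding tr_eq
  using AM_decreasing[OF is_cring \<aa> assms(1), of n]
  by (intro quot_map_coset[OF assms(1) A_sub[OF assms(1)] assms(1) A_sub[OF assms(1)] mod_hom_id _ assms(2)]) simp

lemma qm_hom:
  assumes "module R M" "module R N" "f \<in> mod_hom R M N"
  shows "qm N n f \<in> mod_hom R (Q M n) (Q N n)"
  by (rule quot_map_hom[OF assms(1) A_sub[OF assms(1)] assms(2) A_sub[OF assms(2)] assms(3)
        AM_hom[OF is_cring \<aa> assms]])

lemma qm_pr:
  assumes "module R M" "module R N" "f \<in> mod_hom R M N" "x \<in> carrier M"
  shows "qm N n f (pr M n x) = pr N n (f x)"
  by (rule quot_map_coset[OF assms(1) A_sub[OF assms(1)] assms(2) A_sub[OF assms(2)] assms(3)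
        AM_hom[OF is_cring \<aa> assms(1-3)] assms(4)])

lemma Q_mem: "\<lbrakk>module R M; X \<in> carrier (Q M n); \<And>x. x \<in> carrier M \<Longrightarrow> X = pr M n x \<Longrightarrow> thesis\<rbrakk> \<Longrightarrow> thesis"
  by (auto simp: Q_carrier)

lemma tr_qm:
  assumes "module R M" "module R N" "f \<in> mod_hom R M N" "X \<in> carrier (Q M (Suc n))"
  shows "tr N n (qm N (Suc n) f X) = qm N n f (tr M n X)"
  using assms(1,4)
  by (rule Q_mem) (simp add: qm_pr[OF assms(1-3)] tr_pr[OF assms(1)] tr_pr[OF assms(2) mod_hom_closed[OF assms(3)]])

lemma FC_obj: "obj (FC M) i = inverse_limit (\<lambda>n. G i (Q M n)) (\<lambda>n. Gm i (Q M n) (tr M n))"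
  by (simp add: FC_def inverse_limit_cochain_def tensor_cochain_module_def)

lemma FC_diff: "diff (FC M) i w = (\<lambda>n. Gd i (Q M n) (w n))"
  by (simp add: FC_def inverse_limit_cochain_def tensor_cochain_module_def)

lemma FC_mem: "w \<in> carrier (obj (FC M) i) \<longleftrightarrow>
    (\<forall>n. w n \<in> carrier (G i (Q M n)) \<and> Gm i (Q M n) (tr M n) (w (Suc n)) = w n)"
  by (simp add: FC_obj inverse_limit_simps)

lemma FC_zero: "\<zero>\<^bsub>obj (FC M) i\<^esub> = (\<lambda>n. \<zero>\<^bsub>G i (Q M n)\<^esub>)"
  and FC_add: "v \<oplus>\<^bsub>obj (FC M) i\<^esub> w = (\<lambda>n. v n \<oplus>\<^bsub>G i (Q M n)\<^esub> w n)"
  and FC_smult: "r \<odot>\<^bsub>obj (FC M) i\<^esub> w = (\<lambda>n. r \<odot>\<^bsub>G i (Q M n)\<^esub> w n)"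
  by (simp_all add: FC_obj inverse_limit_simps)

lemma GQ_module: "module R M \<Longrightarrow> module R (G i (Q M n))"
  by (intro G_module Q_module)

lemma Gtr_hom: "module R M \<Longrightarrow> Gm i (Q M n) (tr M n) \<in> mod_hom R (G i (Q M (Suc n))) (G i (Q M n))"
  by (intro Gm_hom Q_module tr_hom)

lemma FC_module: "module R M \<Longrightarrow> module R (obj (FC M) i)"
  unfolding FC_obj by (rule inverse_limit_module) (simp_all add: GQ_module Gtr_hom)

lemma FC_is_cochain:
  assumes M: "module R M"
  shows "is_cochain R (FC M)"
  unfolding is_cochain_def
proof (intro conjI allI ballI)
  note QM = Q_module[OF M] and d = Gd_hom[OF Q_module[OF M]]
  fix i
  show "module R (obj (FC M) i)" by (rule FC_module[OF M])
  show "diff (FC M) i \<in> mod_hom R (obj (FC M) i) (obj (FC M) (Suc i))"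
  proof (rule mod_homI)
    fix w assume "w \<in> carrier (obj (FC M) i)"
    then have w: "w n \<in> carrier (G i (Q M n))" "Gm i (Q M n) (tr M n) (w (Suc n)) = w n" for n
      by (auto simp: FC_mem)
    show "diff (FC M) i w \<in> carrier (obj (FC M) (Suc i))"
      using mod_hom_closed[OF d w(1)] Gd_natural[OF QM QM tr_hom[OF M] w(1), symmetric] w(2)
      by (simp add: FC_mem FC_diff)
  qed (auto simp: FC_diff FC_add FC_smult FC_mem mod_hom_add[OF d] mod_hom_smult[OF d])
  fix w assume "w \<in> carrier (obj (FC M) i)"
  then show "diff (FC M) (Suc i) (diff (FC M) i w) = \<zero>\<^bsub>obj (FC M) (Suc (Suc i))\<^esub>"
    using Gd_Gd[OF QM] by (simp add: FC_diff FC_zero FC_mem)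
qed

definition Fm :: "nat \<Rightarrow> ('a, 'f) module \<Rightarrow> ('b \<Rightarrow> 'f) \<Rightarrow>
    (nat \<Rightarrow> (('e \<Rightarrow> 'c) \<times> 'b set \<Rightarrow> 'a) set) \<Rightarrow> (nat \<Rightarrow> (('e \<Rightarrow> 'c) \<times> 'f set \<Rightarrow> 'a) set)" where
  "Fm i N f w = (\<lambda>n. Gm i (Q N n) (qm N n f) (w n))"

lemma Fm_hom:
  assumes M: "module R M" and N: "module R N" and f: "f \<in> mod_hom R M N"
  shows "Fm i N f \<in> mod_hom R (obj (FC M) i) (obj (FC N) i)"
proof (rule mod_homI)
  note h = Gm_hom[OF Q_module[OF M] Q_module[OF N] qm_hom[OF M N f]]
  fix w assume "w \<in> carrier (obj (FC M) i)"
  then have w: "w n \<in> carrier (G i (Q M n))" "Gm i (Q M n) (tr M n) (w (Suc n)) = w n" for n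
    by (auto simp: FC_mem)
  show "Fm i N f w \<in> carrier (obj (FC N) i)"
    unfolding FC_mem Fm_def
  proof (intro allI conjI)
    fix n
    show "Gm i (Q N n) (qm N n f) (w n) \<in> carrier (G i (Q N n))" by (rule mod_hom_closed[OF h w(1)])
    have "Gm i (Q N n) (tr N n) (Gm i (Q N (Suc n)) (qm N (Suc n) f) (w (Suc n))) =
        Gm i (Q N n) (qm N n f) (Gm i (Q M n) (tr M n) (w (Suc n)))"
      by (rule Gm_square[OF Q_module[OF M] Q_module[OF N] Q_module[OF N] qm_hom[OF M N f] tr_hom[OF N]
            Q_module[OF M] tr_hom[OF M] qm_hom[OF M N f] w(1) tr_qm[OF M N f]])
    then show "Gm i (Q N n) (tr N n) (Gm i (Q N (Suc n)) (qm N (Suc n) f) (w (Suc n))) =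
        Gm i (Q N n) (qm N n f) (w n)" by (simp add: w(2))
  qed
qed (auto simp: Fm_def FC_add FC_smult FC_mem mod_hom_add[OF Gm_hom[OF Q_module[OF M] Q_module[OF N] qm_hom[OF M N f]]]
      mod_hom_smult[OF Gm_hom[OF Q_module[OF M] Q_module[OF N] qm_hom[OF M N f]]])

lemma Fm_natural:
  assumes M: "module R M" and N: "module R N" and f: "f \<in> mod_hom R M N" and w: "w \<in> carrier (obj (FC M) i)"
  shows "diff (FC N) i (Fm i N f w) = Fm (Suc i) N f (diff (FC M) i w)"
  using w Gd_natural[OF Q_module[OF M] Q_module[OF N] qm_hom[OF M N f]]
  by (simp add: FC_diff Fm_def FC_mem)

lemma Fm_comp:
  assumes M: "module R M" and N: "module R N" and P: "module R P" and f: "f \<in> mod_hom R M N"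
    and g: "g \<in> mod_hom R N P" and w: "w \<in> carrier (obj (FC M) i)"
    and h: "h \<in> mod_hom R M P" "\<And>x. x \<in> carrier M \<Longrightarrow> g (f x) = h x"
  shows "Fm i P g (Fm i N f w) = Fm i P h w"
proof -
  have "Gm i (Q P n) (qm P n g) (Gm i (Q N n) (qm N n f) (w n)) = Gm i (Q P n) (qm P n h) (w n)" for n
  proof (rule Gm_comp_eq[OF Q_module[OF M] Q_module[OF N] Q_module[OF P] qm_hom[OF M N f] qm_hom[OF N P g]])
    show "w n \<in> carrier (G i (Q M n))" using w by (simp add: FC_mem)
    fix X assume "X \<in> carrier (Q M n)"
    with M show "qm P n g (qm N n f X) = qm P n h X"
      by (rule Q_mem) (simp add: qm_pr[OF M N f] qm_pr[OF N P g mod_hom_closed[OF f]] qm_pr[OF M P h(1)] h(2))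
  qed
  then show ?thesis by (simp add: Fm_def)
qed

text \<open>Expresses a scalar on the complex as the map induced by an endomorphism of the module,
  so that it can be factored through the submodule \<open>y M\<close>.\<close>

lemma Fm_smult:
  assumes M: "module R M" and y: "y \<in> carrier R" and w: "w \<in> carrier (obj (FC M) i)"
  shows "Fm i M (\<lambda>x. y \<odot>\<^bsub>M\<^esub> x) w = y \<odot>\<^bsub>obj (FC M) i\<^esub> w"
proof -
  note h = mod_hom_scale[OF mod_hom_id M y]
  have "Gm i (Q M n) (qm M n (\<lambda>x. y \<odot>\<^bsub>M\<^esub> x)) (w n) = y \<odot>\<^bsub>G i (Q M n)\<^esub> w n" for n
  proof -
    have wn: "w n \<in> carrier (G i (Q M n))" using w by (simp add: FC_mem)
    have "Gm i (Q M n) (qm M n (\<lambda>x. y \<odot>\<^bsub>M\<^esub> x)) (w n) = Gm i (Q M n) (\<lambda>X. y \<odot>\<^bsub>Q M n\<^esub> X) (w n)"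
    proof (rule Gm_cong[OF Q_module[OF M] Q_module[OF M] qm_hom[OF M M h] wn])
      fix X assume "X \<in> carrier (Q M n)"
      with M show "qm M n (\<lambda>x. y \<odot>\<^bsub>M\<^esub> x) X = y \<odot>\<^bsub>Q M n\<^esub> X"
        by (rule Q_mem) (simp add: qm_pr[OF M M h] mod_hom_smult[OF pr_hom[OF M] y])
    qed
    also have "\<dots> = y \<odot>\<^bsub>G i (Q M n)\<^esub> w n" by (rule Gm_smult[OF Q_module[OF M] y wn])
    finally show ?thesis .
  qed
  then show ?thesis by (simp add: Fm_def FC_smult)
qed

text \<open>An element of the limit need not come from \<open>C \<otimes> M\<close>, but each single
  level does; a preimage of level \<open>m\<close> also represents all lower levels.\<close>

lemma FC_transition:
  assumes M: "module R M" and w: "w \<in> carrier (obj (FC M) i)" and "n \<le> m"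
    and v: "v \<in> carrier (G i M)" "Gm i (Q M m) (\<lambda>x. pr M m x) v = w m"
  shows "Gm i (Q M n) (\<lambda>x. pr M n x) v = w n"
  using assms(3)
proof (induction n rule: inc_induct)
  case (step n)
  have "Gm i (Q M n) (\<lambda>x. pr M n x) v = Gm i (Q M n) (tr M n) (Gm i (Q M (Suc n)) (\<lambda>x. pr M (Suc n) x) v)"
    by (rule Gm_comp_eq[OF M Q_module[OF M] Q_module[OF M] pr_hom[OF M] tr_hom[OF M] v(1) tr_pr[OF M], symmetric])
  also have "\<dots> = w n" using step w by (simp add: FC_mem)
  finally show ?case .
qed (rule v(2))

end

text \<open>
  A short exact sequence \<open>0 \<rightarrow> L \<rightarrow> M \<rightarrow> N \<rightarrow> 0\<close>, together with the weak form of the Artin--Rees lemma that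
  makes the two natural filtrations of \<open>L\<close> cofinal.
\<close>

locale formal_ses = formal_cochain R C E T S u \<aa>
  for R :: "('a, 'm) ring_scheme" (structure) and C :: "('a, 'e \<Rightarrow> 'c) cochain"
    and E :: "nat \<Rightarrow> 'e set" and T :: "'e \<Rightarrow> ('a, 'c) module" and S :: "'e \<Rightarrow> 'a set" and u :: "'e \<Rightarrow> 'c"
    and \<aa> :: "'a set" +
  fixes M :: "('a, 'b) module" and N :: "('a, 'd) module" and f :: "'b \<Rightarrow> 'd" and K :: "'b set"
  assumes M: "module R M" and N: "module R N" and f: "f \<in> mod_hom R M N"
    and surj: "f ` carrier M = carrier N"
    and K: "K = {x \<in> carrier M. f x = \<zero>\<^bsub>N\<^esub>}"
    and artin_rees: "\<And>n. \<exists>m\<ge>n. K \<inter> A M m \<subseteq> A (M\<lparr>carrier := K\<rparr>) n"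
begin

abbreviation "L \<equiv> M\<lparr>carrier := K\<rparr>"

lemma K_sub: "submodule K R M"
  unfolding K by (rule mod_hom_ker[OF f M N])

lemma L: "module R L"
  by (rule submodule_module[OF K_sub M])

lemma incl: "(\<lambda>x. x) \<in> mod_hom R L M"
  by (rule submodule_incl[OF submodule_subset[OF K_sub M]])

lemma pr_incl: "(\<lambda>x. pr M n x) \<in> mod_hom R L (Q M n)"
  by (rule mod_hom_comp[OF incl pr_hom[OF M]])

text \<open>By exactness, an element that dies in level \<open>m\<close> of \<open>M\<close> comes
  from the submodule \<open>K \<inter> \<aa>^m M\<close>. Artin--Rees puts this submodule into
  \<open>\<aa>^n K\<close>, so the element dies in level \<open>n\<close> of
  \<open>L\<close>.\<close>

lemma L_zero_lift:
  assumes v: "v \<in> carrier (G i L)" and z: "Gm i (Q M m) (\<lambda>x. pr M m x) v = \<zero>\<^bsub>G i (Q M m)\<^esub>"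
    and m: "K \<inter> A M m \<subseteq> A L n"
  shows "Gm i (Q L n) (\<lambda>x. pr L n x) v = \<zero>\<^bsub>G i (Q L n)\<^esub>"
proof -
  let ?H = "L\<lparr>carrier := K \<inter> A M m\<rparr>"
  have s: "submodule (K \<inter> A M m) R L"
    by (rule submodule_of_submodule[OF K_sub M submodule_inter[OF K_sub M A_sub[OF M]]]) simp
  have H: "module R ?H" by (rule submodule_module[OF s L])
  have hi: "(\<lambda>x. x) \<in> mod_hom R ?H L" by (rule submodule_incl) simp
  have "\<exists>h\<in>carrier (G i ?H). Gm i L (\<lambda>x. x) h = v"
  proof (rule Gm_exact[OF H L Q_module[OF M] hi pr_incl _ v z])
    fix x assume "x \<in> carrier L" "pr M m x = \<zero>\<^bsub>Q M m\<^esub>"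
    then show "x \<in> (\<lambda>x. x) ` carrier ?H"
      using pr_zero_iff[OF M, of x m] submodule_subset[OF K_sub M] by auto
  qed
  then obtain h where h: "h \<in> carrier (G i ?H)" "Gm i L (\<lambda>x. x) h = v" by blast
  have z: "(\<lambda>x. pr L n x) \<in> mod_hom R ?H (Q L n)" by (rule mod_hom_comp[OF hi pr_hom[OF L]])
  have "Gm i (Q L n) (\<lambda>x. pr L n x) v = Gm i (Q L n) (\<lambda>x. pr L n x) h"
    unfolding h(2)[symmetric] by (rule Gm_comp[OF H L Q_module[OF L] hi pr_hom[OF L] h(1)])
  also have "\<dots> = \<zero>\<^bsub>G i (Q L n)\<^esub>"
  proof (rule Gm_zero[OF H Q_module[OF L] h(1) z])
    fix x assume "x \<in> carrier ?H"
    then show "pr L n x = \<zero>\<^bsub>Q L n\<^esub>" using m by (subst pr_zero_iff[OF L]) auto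
  qed
  finally show ?thesis .
qed

text \<open>The map may fail to be injective at a fixed level. Level \<open>n\<close> of
  \<open>v\<close> is computed from a lift of a deeper level \<open>m\<close>, chosen so that
  vanishing in \<open>M\<close> at level \<open>m\<close> forces vanishing in \<open>L\<close> at
  level \<open>n\<close>.\<close>

lemma Fm_incl_inj:
  assumes v: "v \<in> carrier (obj (FC L) i)" and z: "Fm i M (\<lambda>x. x) v = \<zero>\<^bsub>obj (FC M) i\<^esub>"
  shows "v = \<zero>\<^bsub>obj (FC L) i\<^esub>"
proof -
  have "v n = \<zero>\<^bsub>G i (Q L n)\<^esub>" for n
  proof -
    obtain m where m: "m \<ge> n" "K \<inter> A M m \<subseteq> A L n" using artin_rees by blast
    have "v m \<in> carrier (G i (Q L m))" using v by (simp add: FC_mem)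
    then obtain x where x: "x \<in> carrier (G i L)" "Gm i (Q L m) (\<lambda>x. pr L m x) x = v m"
      using Gm_surj[OF L Q_module[OF L] pr_hom[OF L] Q_carrier[OF L, symmetric]] by blast
    have "Gm i (Q M m) (\<lambda>x. pr M m x) x = Gm i (Q M m) (qm M m (\<lambda>x. x)) (v m)"
      unfolding x(2)[symmetric]
      by (rule Gm_comp_eq[OF L Q_module[OF L] Q_module[OF M] pr_hom[OF L] qm_hom[OF L M incl] x(1)
            qm_pr[OF L M incl], symmetric])
    also have "\<dots> = \<zero>\<^bsub>G i (Q M m)\<^esub>" using fun_cong[OF z, of m] by (simp add: Fm_def FC_zero)
    finally have "Gm i (Q L n) (\<lambda>x. pr L n x) x = \<zero>\<^bsub>G i (Q L n)\<^esub>" by (rule L_zero_lift[OF x(1) _ m(2)])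
    with FC_transition[OF L v m(1) x] show ?thesis by simp
  qed
  then show ?thesis by (auto simp: FC_zero)
qed

text \<open>An \<open>x\<close> with \<open>f x\<close> in \<open>\<aa>^n N\<close> differs from an
  element of \<open>K\<close> by some \<open>y\<close> in \<open>\<aa>^n M\<close>, because
  \<open>\<aa>^n N\<close> is the image of \<open>\<aa>^n M\<close>.\<close>

lemma quot_exact:
  assumes "X \<in> carrier (Q M n)" "qm N n f X = \<zero>\<^bsub>Q N n\<^esub>"
  shows "X \<in> (\<lambda>x. pr M n x) ` carrier L"
proof -
  interpret M: module R M by (rule M)
  interpret N: module R N by (rule N)
  obtain x where x: "x \<in> carrier M" "X = pr M n x" using assms(1) by (auto simp: Q_carrier[OF M])
  then have "pr N n (f x) = \<zero>\<^bsub>Q N n\<^esub>" using assms(2) by (simp add: qm_pr[OF M N f])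
  then have "f x \<in> A N n" using pr_zero_iff[OF N mod_hom_closed[OF f x(1)]] by simp
  then obtain y where y: "y \<in> A M n" "f x = f y" using AM_surj[OF is_cring \<aa> M N f surj] by blast
  have yc: "y \<in> carrier M" using y submodule_subset[OF A_sub[OF M] M] by auto
  have "f (x \<ominus>\<^bsub>M\<^esub> y) = \<zero>\<^bsub>N\<^esub>"
    using x yc y mod_hom_closed[OF f] by (simp add: mod_hom_minus[OF f M N] N.minus_eq_zero_iff)
  then have "x \<ominus>\<^bsub>M\<^esub> y \<in> K" using x yc by (simp add: K)
  moreover have "pr M n (x \<ominus>\<^bsub>M\<^esub> y) = X"
  proof -
    have "x \<ominus>\<^bsub>M\<^esub> y \<ominus>\<^bsub>M\<^esub> x = \<ominus>\<^bsub>M\<^esub> y"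
      using x yc by (simp add: a_minus_def M.M.a_ac M.M.r_neg2 M.M.r_neg1)
    then show ?thesis
      using x yc y submodule_neg[OF A_sub[OF M] M] by (simp add: coset_eq_iff[OF M A_sub[OF M]])
  qed
  ultimately show ?thesis by auto
qed

lemma G_quot_exact:
  assumes "z \<in> carrier (G i (Q M n))" "Gm i (Q N n) (qm N n f) z = \<zero>\<^bsub>G i (Q N n)\<^esub>"
  shows "\<exists>y\<in>carrier (G i L). Gm i (Q M n) (\<lambda>x. pr M n x) y = z"
  by (rule Gm_exact[OF L Q_module[OF M] Q_module[OF N] pr_incl qm_hom[OF M N f] quot_exact assms])

text \<open>The Mittag-Leffler argument: at every level the kernel is an image of the one module
  \<open>C \<otimes> L\<close>, so the kernels form a system with surjective transition maps and
  lifts can be corrected one level at a time.\<close>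

lemma Fm_surj:
  assumes z: "z \<in> carrier (obj (FC N) i)"
  shows "\<exists>w\<in>carrier (obj (FC M) i). Fm i N f w = z"
proof -
  note QM = Q_module[OF M] and QN = Q_module[OF N] and qh = qm_hom[OF M N f]
  have qs: "qm N n f ` carrier (Q M n) = carrier (Q N n)" for n
    using surj by (auto simp: Q_carrier[OF M] Q_carrier[OF N] qm_pr[OF M N f] mod_hom_closed[OF f] image_iff)
      (metis imageE qm_pr[OF M N f])
  have zn: "z n \<in> carrier (G i (Q N n))" "Gm i (Q N n) (tr N n) (z (Suc n)) = z n" for n
    using z by (auto simp: FC_mem)
  have "\<exists>w. \<forall>n. (w n \<in> carrier (G i (Q M n)) \<and> Gm i (Q N n) (qm N n f) (w n) = z n) \<and>
      Gm i (Q M n) (tr M n) (w (Suc n)) = w n"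
  proof (rule dependent_nat_choice)
    show "\<exists>x. x \<in> carrier (G i (Q M 0)) \<and> Gm i (Q N 0) (qm N 0 f) x = z 0"
      using Gm_surj[OF QM QN qh qs zn(1)] by blast
    fix x n assume x: "x \<in> carrier (G i (Q M n)) \<and> Gm i (Q N n) (qm N n f) x = z n"
    interpret GM: module R "G i (Q M n)" by (rule GQ_module[OF M])
    interpret GM1: module R "G i (Q M (Suc n))" by (rule GQ_module[OF M])
    interpret GN: module R "G i (Q N n)" by (rule GQ_module[OF N])
    interpret GN1: module R "G i (Q N (Suc n))" by (rule GQ_module[OF N])
    obtain y where y: "y \<in> carrier (G i (Q M (Suc n)))" "Gm i (Q N (Suc n)) (qm N (Suc n) f) y = z (Suc n)"
      using Gm_surj[OF QM QN qh qs zn(1)] by blast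
    let ?t = "Gm i (Q M n) (tr M n)"
    note th = Gm_hom[OF QM QM tr_hom[OF M], where i = i] and hh = Gm_hom[OF QM QN qh, where i = i]
    have ty: "?t y \<in> carrier (G i (Q M n))" by (rule mod_hom_closed[OF th y(1)])
    have "Gm i (Q N n) (qm N n f) (?t y) = Gm i (Q N n) (tr N n) (Gm i (Q N (Suc n)) (qm N (Suc n) f) y)"
      by (rule Gm_square[OF QM QM QN tr_hom[OF M] qh QN qh tr_hom[OF N] y(1) tr_qm[OF M N f, symmetric]])
    then have fz: "Gm i (Q N n) (qm N n f) (?t y \<ominus>\<^bsub>G i (Q M n)\<^esub> x) = \<zero>\<^bsub>G i (Q N n)\<^esub>"
      using x ty y(2) zn by (simp add: mod_hom_minus[OF hh GM.module_axioms GN.module_axioms] GN.minus_eq_zero_iff)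
    have "?t y \<ominus>\<^bsub>G i (Q M n)\<^esub> x \<in> carrier (G i (Q M n))" using x ty by simp
    then obtain k where k: "k \<in> carrier (G i L)" "Gm i (Q M n) (\<lambda>x. pr M n x) k = ?t y \<ominus>\<^bsub>G i (Q M n)\<^esub> x"
      using G_quot_exact[OF _ fz] by blast
    let ?k = "Gm i (Q M (Suc n)) (\<lambda>x. pr M (Suc n) x) k"
    have kc: "?k \<in> carrier (G i (Q M (Suc n)))" by (rule mod_hom_closed[OF Gm_hom[OF L QM pr_incl] k(1)])
    have tk: "?t ?k = ?t y \<ominus>\<^bsub>G i (Q M n)\<^esub> x"
      unfolding k(2)[symmetric]
      by (rule Gm_comp_eq[OF L QM QM pr_incl tr_hom[OF M] k(1) tr_pr[OF M]])
         (use submodule_subset[OF K_sub M] in auto)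
    have fk: "Gm i (Q N (Suc n)) (qm N (Suc n) f) ?k = \<zero>\<^bsub>G i (Q N (Suc n))\<^esub>"
    proof -
      have z0: "qm N (Suc n) f (pr M (Suc n) x) = \<zero>\<^bsub>Q N (Suc n)\<^esub>" if "x \<in> carrier L" for x
      proof -
        interpret N: module R N by (rule N)
        have "x \<in> carrier M" "f x = \<zero>\<^bsub>N\<^esub>" using that by (auto simp: K)
        then show ?thesis
          using submodule_zero[OF A_sub[OF N] N] by (simp add: qm_pr[OF M N f] pr_zero_iff[OF N])
      qed
      have "Gm i (Q N (Suc n)) (qm N (Suc n) f) ?k = Gm i (Q N (Suc n)) (\<lambda>x. qm N (Suc n) f (pr M (Suc n) x)) k"
        by (rule Gm_comp[OF L QM QN pr_incl qh k(1)])
      also have "\<dots> = \<zero>\<^bsub>G i (Q N (Suc n))\<^esub>"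
        by (rule Gm_zero[OF L QN k(1) mod_hom_comp[OF pr_incl qh] z0])
      finally show ?thesis .
    qed
    \<comment> \<open>Subtracting the class of \<open>k\<close> repairs the transition to level
      \<open>n\<close> and leaves the image in \<open>N\<close> alone.\<close>
    let ?w = "y \<ominus>\<^bsub>G i (Q M (Suc n))\<^esub> ?k"
    have "?t ?w = x"
    proof -
      have "?t ?w = ?t y \<ominus>\<^bsub>G i (Q M n)\<^esub> (?t y \<ominus>\<^bsub>G i (Q M n)\<^esub> x)"
        using y kc by (simp add: mod_hom_minus[OF th GM1.module_axioms GM.module_axioms] tk)
      also have "\<dots> = x" using x ty by (simp add: a_minus_def GM.M.minus_add GM.M.r_neg2)
      finally show ?thesis .
    qed
    moreover have "Gm i (Q N (Suc n)) (qm N (Suc n) f) ?w = z (Suc n)"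
      using y kc zn fk by (simp add: mod_hom_minus[OF hh GM1.module_axioms GN1.module_axioms])
    moreover have "?w \<in> carrier (G i (Q M (Suc n)))" using y kc by simp
    ultimately show "\<exists>y. (y \<in> carrier (G i (Q M (Suc n))) \<and> Gm i (Q N (Suc n)) (qm N (Suc n) f) y = z (Suc n)) \<and>
        ?t y = x" by blast
  qed
  then obtain w where w: "\<And>n. w n \<in> carrier (G i (Q M n))" "\<And>n. Gm i (Q N n) (qm N n f) (w n) = z n"
      "\<And>n. Gm i (Q M n) (tr M n) (w (Suc n)) = w n" by metis
  then show ?thesis
    by (intro bexI[of _ w]) (auto simp: Fm_def FC_mem)
qed

text \<open>Exactness at each level yields lifts \<open>x n\<close> over \<open>L\<close> that need
  not be compatible with each other. Their classes modulo a fixed \<open>\<aa>^n L\<close> become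
  constant for large index, and the stable classes form the required element of the limit.\<close>

lemma Fm_exact:
  assumes w: "w \<in> carrier (obj (FC M) i)" and z: "Fm i N f w = \<zero>\<^bsub>obj (FC N) i\<^esub>"
  shows "\<exists>v\<in>carrier (obj (FC L) i). Fm i M (\<lambda>x. x) v = w"
proof -
  note QM = Q_module[OF M] and QN = Q_module[OF N] and QL = Q_module[OF L]
  interpret GL: module R "G i L" by (rule G_module[OF L])
  interpret GQL: module R "G i (Q L n)" for n by (rule GQ_module[OF L])
  interpret GQM: module R "G i (Q M n)" for n by (rule GQ_module[OF M])
  have wn: "w n \<in> carrier (G i (Q M n))" for n using w by (simp add: FC_mem)
  have "\<exists>x\<in>carrier (G i L). Gm i (Q M n) (\<lambda>x. pr M n x) x = w n" for n
    using G_quot_exact[OF wn] fun_cong[OF z, of n] by (simp add: Fm_def FC_zero)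
  then obtain x where x: "\<And>n. x n \<in> carrier (G i L)" "\<And>n. Gm i (Q M n) (\<lambda>x. pr M n x) (x n) = w n" by metis
  obtain m where m: "\<And>n. m n \<ge> n" "\<And>n. K \<inter> A M (m n) \<subseteq> A L n" using artin_rees by metis
  have xw: "Gm i (Q M j) (\<lambda>x. pr M j x) (x k) = w j" if "j \<le> k" for j k
  proof -
    have c: "Gm i M (\<lambda>x. x) (x k) \<in> carrier (G i M)" by (rule mod_hom_closed[OF Gm_hom[OF L M incl] x(1)])
    have e: "Gm i (Q M n) (\<lambda>x. pr M n x) (Gm i M (\<lambda>x. x) (x k)) = Gm i (Q M n) (\<lambda>x. pr M n x) (x k)" for n
      by (rule Gm_comp[OF L M QM incl pr_hom[OF M] x(1)])
    show ?thesis using FC_transition[OF M w that c] e x(2) by simp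
  qed
  let ?p = "\<lambda>n. Gm i (Q L n) (\<lambda>x. pr L n x)"
  note ph = Gm_hom[OF L QL pr_hom[OF L], where i = i] and pMh = Gm_hom[OF L QM pr_incl, where i = i]
  \<comment> \<open>From index \<open>m n\<close> on, all the lifts have the same class in level
    \<open>m n\<close> of \<open>M\<close>, so any two of them differ by an element that
    \<open>L_zero_lift\<close> kills in level \<open>n\<close> of \<open>L\<close>.\<close>
  have stable: "?p n (x k) = ?p n (x (m n))" if "m n \<le> k" for n k
  proof -
    have "Gm i (Q M (m n)) (\<lambda>x. pr M (m n) x) (x k \<ominus>\<^bsub>G i L\<^esub> x (m n)) = \<zero>\<^bsub>G i (Q M (m n))\<^esub>"
      using x(1) wn by (simp add: mod_hom_minus[OF pMh GL.module_axioms GQM.module_axioms] xw[OF that] xw GQM.minus_eq_zero_iff)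
    then have "?p n (x k \<ominus>\<^bsub>G i L\<^esub> x (m n)) = \<zero>\<^bsub>G i (Q L n)\<^esub>"
      using x(1) by (intro L_zero_lift[OF _ _ m(2)]) auto
    then show ?thesis
      using x(1) mod_hom_closed[OF ph x(1)]
      by (simp add: mod_hom_minus[OF ph GL.module_axioms GQL.module_axioms] GQL.minus_eq_zero_iff)
  qed
  define v where "v n = ?p n (x (m n))" for n
  have "Gm i (Q L n) (tr L n) (v (Suc n)) = v n" for n
  proof -
    define k where "k = max (m n) (m (Suc n))"
    have "Gm i (Q L n) (tr L n) (v (Suc n)) = Gm i (Q L n) (tr L n) (?p (Suc n) (x k))"
      unfolding v_def using stable[of "Suc n" k] by (simp add: k_def)
    also have "\<dots> = ?p n (x k)"
      by (rule Gm_comp_eq[OF L QL QL pr_hom[OF L] tr_hom[OF L] x(1) tr_pr[OF L]])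
    also have "\<dots> = v n" unfolding v_def using stable[of n k] by (simp add: k_def)
    finally show ?thesis .
  qed
  then have vc: "v \<in> carrier (obj (FC L) i)"
    using mod_hom_closed[OF ph x(1)] by (simp add: FC_mem v_def)
  have "Gm i (Q M n) (qm M n (\<lambda>x. x)) (v n) = w n" for n
  proof -
    have "Gm i (Q M n) (qm M n (\<lambda>x. x)) (v n) = Gm i (Q M n) (\<lambda>x. pr M n x) (x (m n))"
      unfolding v_def
      by (rule Gm_comp_eq[OF L QL QM pr_hom[OF L] qm_hom[OF L M incl] x(1) qm_pr[OF L M incl]])
    then show ?thesis using xw[OF m(1)] by simp
  qed
  then have "Fm i M (\<lambda>x. x) v = w" by (auto simp: Fm_def)
  with vc show ?thesis by blast
qed

end

section \<open>Cohomology\<close>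

text \<open>The reverse inclusion holds in every cochain complex. Vanishing stated in this way lets
  the diagram chases work with cocycles instead of classes in quotient modules.\<close>

definition acyclic_at :: "('a, 'b) cochain \<Rightarrow> nat \<Rightarrow> bool" where
  "acyclic_at X i \<longleftrightarrow> cocycles X i \<subseteq> coboundaries X i"

lemma is_cochainD:
  assumes "is_cochain R X"
  shows "module R (obj X i)" "diff X i \<in> mod_hom R (obj X i) (obj X (Suc i))"
    "x \<in> carrier (obj X i) \<Longrightarrow> diff X (Suc i) (diff X i x) = \<zero>\<^bsub>obj X (Suc (Suc i))\<^esub>"
  using assms by (auto simp: is_cochain_def)

lemma coboundaries_Suc: "coboundaries X (Suc j) = diff X j ` carrier (obj X j)"
  by (simp add: coboundaries_def)

context
  fixes R :: "('a, 'm) ring_scheme" and X :: "('a, 'b) cochain"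
  assumes X: "is_cochain R X"
begin

lemma cocycles_submodule: "submodule (cocycles X i) R (obj X i)"
  unfolding cocycles_def using is_cochainD[OF X] by (intro mod_hom_ker)

lemma coboundaries_submodule: "submodule (coboundaries X i) R (obj X i)"
proof (cases i)
  case 0
  then show ?thesis by (simp add: coboundaries_def submodule_zero_submodule is_cochainD(1)[OF X])
next
  case (Suc j)
  then show ?thesis
    unfolding Suc coboundaries_Suc
    by (intro mod_hom_image[OF is_cochainD(2)[OF X] is_cochainD(1)[OF X] is_cochainD(1)[OF X]] module.carrier_is_submodule[OF is_cochainD(1)[OF X]])
qed

lemma coboundaries_subset_cocycles: "coboundaries X i \<subseteq> cocycles X i"
proof (cases i)
  case 0
  then show ?thesis
    using submodule_zero[OF cocycles_submodule is_cochainD(1)[OF X]] by (simp add: coboundaries_def)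
next
  case (Suc j)
  then show ?thesis
    unfolding Suc coboundaries_Suc using is_cochainD(3)[OF X] mod_hom_closed[OF is_cochainD(2)[OF X]]
    by (auto simp: cocycles_def)
qed

lemma cocycles_module: "module R ((obj X i)\<lparr>carrier := cocycles X i\<rparr>)"
  by (rule submodule_module[OF cocycles_submodule is_cochainD(1)[OF X]])

lemma coboundaries_sub: "submodule (coboundaries X i) R ((obj X i)\<lparr>carrier := cocycles X i\<rparr>)"
  by (rule submodule_of_submodule[OF cocycles_submodule is_cochainD(1)[OF X] coboundaries_submodule
        coboundaries_subset_cocycles])

lemma cohomology_module: "module R (cohomology X i)"
  unfolding cohomology_def by (rule quot_module_module[OF cocycles_module coboundaries_sub])

lemma trivial_cohomology_iff: "trivial_module (cohomology X i) \<longleftrightarrow> acyclic_at X i"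
proof -
  let ?Z = "(obj X i)\<lparr>carrier := cocycles X i\<rparr>" and ?B = "coboundaries X i"
  have "trivial_module (cohomology X i) \<longleftrightarrow> (\<lambda>x. ?B +>\<^bsub>?Z\<^esub> x) ` carrier ?Z = {?B}"
    by (simp add: trivial_module_def cohomology_def quot_module_zero[OF cocycles_module coboundaries_sub]
        quot_module_carrier[OF cocycles_module coboundaries_sub])
  also have "\<dots> \<longleftrightarrow> (\<forall>x\<in>carrier ?Z. ?B +>\<^bsub>?Z\<^esub> x = ?B)"
    using submodule_zero[OF cocycles_submodule is_cochainD(1)[OF X]] by auto
  also have "\<dots> \<longleftrightarrow> acyclic_at X i"
    using coset_zero_iff[OF cocycles_module[of i] coboundaries_sub[of i]] by (auto simp: acyclic_at_def)
  finally show ?thesis .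
qed

end

lemma fin_gen_surj:
  assumes M: "module R M" and N: "module R N" and f: "f \<in> mod_hom R M N" "f ` carrier M = carrier N"
    and "fin_gen_module R M"
  shows "fin_gen_module R N"
proof -
  obtain A where A: "finite A" "A \<subseteq> carrier M" "submodule_gen R M A = carrier M"
    using assms(5) by (auto simp: fin_gen_module_def)
  have fA: "f ` A \<subseteq> carrier N" using A mod_hom_closed[OF f(1)] by auto
  note s = submodule_gen_submodule[OF N fA] and g = submodule_gen_subset[OF N fA]
  have "carrier N \<subseteq> submodule_gen R N (f ` A)"
  proof
    fix y assume "y \<in> carrier N"
    then obtain x where x: "x \<in> submodule_gen R M A" "y = f x" using f(2) A(3) by blast
    show "y \<in> submodule_gen R N (f ` A)"
      unfolding x(2) using g by (intro mod_hom_gen_into[OF M N A(2) f(1) s _ x(1)]) auto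
  qed
  then show ?thesis
    using A(1) fA submodule_subset[OF s N] by (auto simp: fin_gen_module_def intro!: exI[of _ "f ` A"])
qed

section \<open>Pieces of the long exact cohomology sequence\<close>

locale cochain_ses =
  fixes R :: "('a, 'm) ring_scheme" and X :: "('a, 'b) cochain" and Y :: "('a, 'c) cochain"
    and Z :: "('a, 'd) cochain" and f :: "nat \<Rightarrow> 'b \<Rightarrow> 'c" and g :: "nat \<Rightarrow> 'c \<Rightarrow> 'd"
  assumes X: "is_cochain R X" and Y: "is_cochain R Y" and Z: "is_cochain R Z"
    and f: "f i \<in> mod_hom R (obj X i) (obj Y i)" and g: "g i \<in> mod_hom R (obj Y i) (obj Z i)"
    and fd: "x \<in> carrier (obj X i) \<Longrightarrow> diff Y i (f i x) = f (Suc i) (diff X i x)"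
    and gd: "y \<in> carrier (obj Y i) \<Longrightarrow> diff Z i (g i y) = g (Suc i) (diff Y i y)"
    and f_inj: "\<lbrakk>x \<in> carrier (obj X i); f i x = \<zero>\<^bsub>obj Y i\<^esub>\<rbrakk> \<Longrightarrow> x = \<zero>\<^bsub>obj X i\<^esub>"
    and gf: "x \<in> carrier (obj X i) \<Longrightarrow> g i (f i x) = \<zero>\<^bsub>obj Z i\<^esub>"
    and ex: "\<lbrakk>y \<in> carrier (obj Y i); g i y = \<zero>\<^bsub>obj Z i\<^esub>\<rbrakk> \<Longrightarrow> \<exists>x\<in>carrier (obj X i). f i x = y"
    and g_surj: "z \<in> carrier (obj Z i) \<Longrightarrow> \<exists>y\<in>carrier (obj Y i). g i y = z"
begin

sublocale Xm: module R "obj X i" for i by (rule is_cochainD(1)[OF X])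
sublocale Ym: module R "obj Y i" for i by (rule is_cochainD(1)[OF Y])
sublocale Zm: module R "obj Z i" for i by (rule is_cochainD(1)[OF Z])

lemmas dX = is_cochainD(2)[OF X] and dY = is_cochainD(2)[OF Y] and dZ = is_cochainD(2)[OF Z]
lemmas ddY = is_cochainD(3)[OF Y]
lemmas gm = mod_hom_minus[OF g Ym.module_axioms Zm.module_axioms]
  and dXm = mod_hom_minus[OF dX Xm.module_axioms Xm.module_axioms]
  and dYm = mod_hom_minus[OF dY Ym.module_axioms Ym.module_axioms]
  and dZm = mod_hom_minus[OF dZ Zm.module_axioms Zm.module_axioms]

text \<open>The obstruction to lifting a cocycle of \<open>Z\<close> is its image under the
  connecting map, a class of \<open>X\<close> one degree higher.\<close>

lemma lift_cocycle:
  assumes a: "acyclic_at X (Suc i)" and z: "z \<in> cocycles Z i"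
  shows "\<exists>y\<in>cocycles Y i. g i y = z"
proof -
  have z: "z \<in> carrier (obj Z i)" "diff Z i z = \<zero>\<^bsub>obj Z (Suc i)\<^esub>" using z by (auto simp: cocycles_def)
  obtain y where y: "y \<in> carrier (obj Y i)" "g i y = z" using g_surj[OF z(1)] by blast
  have dy: "diff Y i y \<in> carrier (obj Y (Suc i))" by (rule mod_hom_closed[OF dY y(1)])
  have "g (Suc i) (diff Y i y) = \<zero>\<^bsub>obj Z (Suc i)\<^esub>" using gd[OF y(1)] y z by simp
  then obtain x where x: "x \<in> carrier (obj X (Suc i))" "f (Suc i) x = diff Y i y" using ex[OF dy] by blast
  have "f (Suc (Suc i)) (diff X (Suc i) x) = \<zero>\<^bsub>obj Y (Suc (Suc i))\<^esub>"
    using fd[OF x(1)] x(2) ddY[OF y(1)] by simp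
  then have "diff X (Suc i) x = \<zero>\<^bsub>obj X (Suc (Suc i))\<^esub>"
    by (rule f_inj[OF mod_hom_closed[OF dX x(1)]])
  \<comment> \<open>The connecting class is a coboundary; a cochain bounding it is the correction
    that makes \<open>y\<close> a cocycle.\<close>
  then obtain x' where x': "x' \<in> carrier (obj X i)" "x = diff X i x'"
    using a x(1) by (auto simp: acyclic_at_def cocycles_def coboundaries_Suc)
  have fx: "f i x' \<in> carrier (obj Y i)" by (rule mod_hom_closed[OF f x'(1)])
  have "diff Y i (y \<ominus>\<^bsub>obj Y i\<^esub> f i x') = \<zero>\<^bsub>obj Y (Suc i)\<^esub>"
    using y(1) fx dy x x' by (simp add: dYm fd Ym.minus_eq_zero_iff)
  moreover have "g i (y \<ominus>\<^bsub>obj Y i\<^esub> f i x') = z"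
    using y fx z(1) by (simp add: gm gf[OF x'(1)])
  ultimately show ?thesis
    using y(1) fx by (intro bexI[of _ "y \<ominus>\<^bsub>obj Y i\<^esub> f i x'"]) (auto simp: cocycles_def)
qed

text \<open>Vanishing for \<open>Z\<close> means that every class of \<open>Y\<close> comes from
  \<open>X\<close>; the coboundary is kept explicit because the divisibility argument needs an
  equation between cocycles.\<close>

lemma cocycle_decompose:
  assumes a: "acyclic_at Z (Suc j)" and y: "y \<in> cocycles Y (Suc j)"
  shows "\<exists>x\<in>cocycles X (Suc j). \<exists>b\<in>carrier (obj Y j). y = f (Suc j) x \<oplus>\<^bsub>obj Y (Suc j)\<^esub> diff Y j b"
proof -
  have y: "y \<in> carrier (obj Y (Suc j))" "diff Y (Suc j) y = \<zero>\<^bsub>obj Y (Suc (Suc j))\<^esub>"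
    using y by (auto simp: cocycles_def)
  have "g (Suc j) y \<in> cocycles Z (Suc j)"
    using y gd[OF y(1)] mod_hom_closed[OF g y(1)] mod_hom_zero[OF g Ym.module_axioms Zm.module_axioms]
    by (simp add: cocycles_def)
  then obtain z where z: "z \<in> carrier (obj Z j)" "g (Suc j) y = diff Z j z"
    using a by (auto simp: acyclic_at_def coboundaries_Suc)
  obtain b where b: "b \<in> carrier (obj Y j)" "g j b = z" using g_surj[OF z(1)] by blast
  have db: "diff Y j b \<in> carrier (obj Y (Suc j))" by (rule mod_hom_closed[OF dY b(1)])
  have "g (Suc j) (y \<ominus>\<^bsub>obj Y (Suc j)\<^esub> diff Y j b) = \<zero>\<^bsub>obj Z (Suc j)\<^esub>"
    using y b db z mod_hom_closed[OF g db] by (simp add: gm flip: gd) (simp add: gd Zm.minus_eq_zero_iff)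
  then obtain x where x: "x \<in> carrier (obj X (Suc j))" "f (Suc j) x = y \<ominus>\<^bsub>obj Y (Suc j)\<^esub> diff Y j b"
    using ex[of "y \<ominus>\<^bsub>obj Y (Suc j)\<^esub> diff Y j b"] y(1) db by auto
  have "f (Suc (Suc j)) (diff X (Suc j) x) = \<zero>\<^bsub>obj Y (Suc (Suc j))\<^esub>"
    using fd[OF x(1)] y db by (simp add: x(2) dYm ddY[OF b(1)])
  then have "diff X (Suc j) x = \<zero>\<^bsub>obj X (Suc (Suc j))\<^esub>"
    by (rule f_inj[OF mod_hom_closed[OF dX x(1)]])
  then have "x \<in> cocycles X (Suc j)" using x by (simp add: cocycles_def)
  moreover have "y = f (Suc j) x \<oplus>\<^bsub>obj Y (Suc j)\<^esub> diff Y j b"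
    using y db by (simp add: x(2) a_minus_def Ym.M.a_assoc Ym.M.l_neg)
  ultimately show ?thesis using b(1) by blast
qed

lemma acyclic_middle:
  assumes "acyclic_at X (Suc j)" "acyclic_at Z (Suc j)"
  shows "acyclic_at Y (Suc j)"
  unfolding acyclic_at_def
proof
  fix y assume "y \<in> cocycles Y (Suc j)"
  then obtain x b where x: "x \<in> cocycles X (Suc j)" and b: "b \<in> carrier (obj Y j)"
    and y: "y = f (Suc j) x \<oplus>\<^bsub>obj Y (Suc j)\<^esub> diff Y j b"
    using cocycle_decompose[OF assms(2)] by blast
  obtain x' where x': "x' \<in> carrier (obj X j)" "x = diff X j x'"
    using assms(1) x by (auto simp: acyclic_at_def coboundaries_Suc)
  have "y = diff Y j (f j x' \<oplus>\<^bsub>obj Y j\<^esub> b)"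
    using x' b y by (simp add: mod_hom_add[OF dY] mod_hom_closed[OF f] fd)
  then show "y \<in> coboundaries Y (Suc j)"
    using x' b mod_hom_closed[OF f x'(1)] by (auto simp: coboundaries_Suc)
qed

lemma acyclic_right:
  assumes "acyclic_at Y (Suc j)" "acyclic_at X (Suc (Suc j))"
  shows "acyclic_at Z (Suc j)"
  unfolding acyclic_at_def
proof
  fix z assume "z \<in> cocycles Z (Suc j)"
  then obtain y where y: "y \<in> cocycles Y (Suc j)" "g (Suc j) y = z"
    using lift_cocycle[OF assms(2)] by blast
  then obtain b where b: "b \<in> carrier (obj Y j)" "y = diff Y j b"
    using assms(1) by (auto simp: acyclic_at_def coboundaries_Suc)
  then show "z \<in> coboundaries Z (Suc j)"
    using y gd[OF b(1)] mod_hom_closed[OF g b(1)] by (auto simp: coboundaries_Suc intro!: image_eqI[of _ _ "g j b"])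
qed

text \<open>With the connecting map zero, the cohomology of \<open>Z\<close> is a homomorphic image
  of that of \<open>Y\<close>.\<close>

lemma fin_gen_right:
  assumes a: "acyclic_at X (Suc (Suc j))" and fg: "fin_gen_module R (cohomology Y (Suc j))"
  shows "fin_gen_module R (cohomology Z (Suc j))"
proof -
  let ?i = "Suc j"
  let ?Y = "(obj Y ?i)\<lparr>carrier := cocycles Y ?i\<rparr>" and ?Z = "(obj Z ?i)\<lparr>carrier := cocycles Z ?i\<rparr>"
  have gh: "g ?i \<in> mod_hom R ?Y ?Z"
  proof (rule mod_homI)
    fix y assume "y \<in> carrier ?Y"
    then show "g ?i y \<in> carrier ?Z"
      using gd[of y ?i] mod_hom_closed[OF g, of y ?i] mod_hom_zero[OF g Ym.module_axioms Zm.module_axioms]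
      by (auto simp: cocycles_def)
  qed (auto simp: cocycles_def mod_hom_add[OF g] mod_hom_smult[OF g])
  have gB: "g ?i ` coboundaries Y ?i \<subseteq> coboundaries Z ?i"
    using gd mod_hom_closed[OF g] by (auto simp: coboundaries_Suc simp flip: gd)
  note h = quot_map_hom[OF cocycles_module[OF Y] coboundaries_sub[OF Y] cocycles_module[OF Z] coboundaries_sub[OF Z] gh gB]
    and hc = quot_map_coset[OF cocycles_module[OF Y] coboundaries_sub[OF Y] cocycles_module[OF Z] coboundaries_sub[OF Z] gh gB]
  note cY = quot_module_carrier[OF cocycles_module[OF Y, of ?i] coboundaries_sub[OF Y, of ?i]]
    and cZ = quot_module_carrier[OF cocycles_module[OF Z, of ?i] coboundaries_sub[OF Z, of ?i]]
  show ?thesis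
  proof (rule fin_gen_surj[OF cohomology_module[OF Y] cohomology_module[OF Z] _ _ fg])
    show hh: "quot_map ?Z (coboundaries Z ?i) (g ?i) \<in> mod_hom R (cohomology Y ?i) (cohomology Z ?i)"
      unfolding cohomology_def by (rule h)
    show "quot_map ?Z (coboundaries Z ?i) (g ?i) ` carrier (cohomology Y ?i) = carrier (cohomology Z ?i)"
    proof
      show "quot_map ?Z (coboundaries Z ?i) (g ?i) ` carrier (cohomology Y ?i) \<subseteq> carrier (cohomology Z ?i)"
        using mod_hom_closed[OF hh] by blast
      show "carrier (cohomology Z ?i) \<subseteq> quot_map ?Z (coboundaries Z ?i) (g ?i) ` carrier (cohomology Y ?i)"
      proof
        fix w assume "w \<in> carrier (cohomology Z ?i)"
        then obtain z where z: "z \<in> cocycles Z ?i" "w = coboundaries Z ?i +>\<^bsub>?Z\<^esub> z"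
          unfolding cohomology_def cZ by auto
        obtain y where y: "y \<in> cocycles Y ?i" "g ?i y = z" using lift_cocycle[OF a z(1)] by blast
        have "w = quot_map ?Z (coboundaries Z ?i) (g ?i) (coboundaries Y ?i +>\<^bsub>?Y\<^esub> y)"
          using hc[of y] y z by simp
        moreover have "coboundaries Y ?i +>\<^bsub>?Y\<^esub> y \<in> carrier (cohomology Y ?i)"
          unfolding cohomology_def cY using y by auto
        ultimately show "w \<in> quot_map ?Z (coboundaries Z ?i) (g ?i) ` carrier (cohomology Y ?i)" by blast
      qed
    qed
  qed
qed

end

text \<open>Artin--Rees enters through injectivity on the left and exactness in the middle;
  surjectivity on the right comes from lifting level by level.\<close>

sublocale formal_ses \<subseteq> ses: cochain_ses R "FC L" "FC M" "FC N" "\<lambda>i. Fm i M (\<lambda>x. x)" "\<lambda>i. Fm i N f"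
proof
  show "is_cochain R (FC L)" "is_cochain R (FC M)" "is_cochain R (FC N)"
    using FC_is_cochain L M N by blast+
  fix i
  show "Fm i M (\<lambda>x. x) \<in> mod_hom R (obj (FC L) i) (obj (FC M) i)" by (rule Fm_hom[OF L M incl])
  show "Fm i N f \<in> mod_hom R (obj (FC M) i) (obj (FC N) i)" by (rule Fm_hom[OF M N f])
  fix x assume x: "x \<in> carrier (obj (FC L) i)"
  show "diff (FC M) i (Fm i M (\<lambda>x. x) x) = Fm (Suc i) M (\<lambda>x. x) (diff (FC L) i x)"
    by (rule Fm_natural[OF L M incl x])
  have z: "(\<lambda>x. \<zero>\<^bsub>N\<^esub>) \<in> mod_hom R L N" by (rule mod_hom_const_zero[OF N])
  have "Fm i N f (Fm i M (\<lambda>x. x) x) = Fm i N (\<lambda>x. \<zero>\<^bsub>N\<^esub>) x"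
    by (rule Fm_comp[OF L M N incl f x z]) (simp add: K)
  also have "\<dots> = \<zero>\<^bsub>obj (FC N) i\<^esub>"
  proof -
    interpret N: module R N by (rule N)
    have "Gm i (Q N n) (qm N n (\<lambda>x. \<zero>\<^bsub>N\<^esub>)) (x n) = \<zero>\<^bsub>G i (Q N n)\<^esub>" for n
    proof (rule Gm_zero[OF Q_module[OF L] Q_module[OF N] _ qm_hom[OF L N z]])
      show "x n \<in> carrier (G i (Q L n))" using x by (simp add: FC_mem)
      fix X assume "X \<in> carrier (Q L n)"
      with L show "qm N n (\<lambda>x. \<zero>\<^bsub>N\<^esub>) X = \<zero>\<^bsub>Q N n\<^esub>"
        by (rule Q_mem) (simp add: qm_pr[OF L N z] pr_zero_iff[OF N] submodule_zero[OF A_sub[OF N] N])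
    qed
    then show ?thesis by (simp add: Fm_def FC_zero)
  qed
  finally show "Fm i N f (Fm i M (\<lambda>x. x) x) = \<zero>\<^bsub>obj (FC N) i\<^esub>" .
next
  fix i y assume y: "y \<in> carrier (obj (FC M) i)"
  show "diff (FC N) i (Fm i N f y) = Fm (Suc i) N f (diff (FC M) i y)"
    by (rule Fm_natural[OF M N f y])
next
  fix i x assume "x \<in> carrier (obj (FC L) i)" "Fm i M (\<lambda>x. x) x = \<zero>\<^bsub>obj (FC M) i\<^esub>"
  then show "x = \<zero>\<^bsub>obj (FC L) i\<^esub>" by (rule Fm_incl_inj)
next
  fix i y assume "y \<in> carrier (obj (FC M) i)" "Fm i N f y = \<zero>\<^bsub>obj (FC N) i\<^esub>"
  then show "\<exists>x\<in>carrier (obj (FC L) i). Fm i M (\<lambda>x. x) x = y" by (rule Fm_exact)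
next
  fix i z assume "z \<in> carrier (obj (FC N) i)"
  then show "\<exists>y\<in>carrier (obj (FC M) i). Fm i N f y = z" by (rule Fm_surj)
qed

text \<open>Already the term of degree \<open>i\<close> vanishes at every level, since an element
  killing \<open>M\<close> kills each quotient \<open>M / \<aa>^n M\<close>.\<close>

lemma (in formal_cochain) acyclic_trivial:
  assumes M: "module R M"
    and k: "\<And>e. e \<in> E i \<Longrightarrow> \<exists>s\<in>S e. \<forall>x\<in>carrier M. s \<odot>\<^bsub>M\<^esub> x = \<zero>\<^bsub>M\<^esub>"
  shows "acyclic_at (FC M) i"
proof -
  have "w = \<zero>\<^bsub>obj (FC M) i\<^esub>" if w: "w \<in> carrier (obj (FC M) i)" for w
  proof -
    have "w n = \<zero>\<^bsub>G i (Q M n)\<^esub>" for n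
    proof (rule G_trivial[OF Q_module[OF M]])
      show "w n \<in> carrier (G i (Q M n))" using w by (simp add: FC_mem)
      fix e assume e: "e \<in> E i"
      then obtain s where s: "s \<in> S e" "\<And>x. x \<in> carrier M \<Longrightarrow> s \<odot>\<^bsub>M\<^esub> x = \<zero>\<^bsub>M\<^esub>" using k by blast
      have sR: "s \<in> carrier R"
        using locs[OF e] s(1) by (auto simp: is_loc_def mult_closed_def)
      have "s \<odot>\<^bsub>Q M n\<^esub> X = \<zero>\<^bsub>Q M n\<^esub>" if "X \<in> carrier (Q M n)" for X
        using M that
      proof (rule Q_mem)
        fix x assume x: "x \<in> carrier M" "X = pr M n x"
        then show ?thesis
          using mod_hom_smult[OF pr_hom[OF M] sR x(1), of n] s(2)[OF x(1)]
            mod_hom_zero[OF pr_hom[OF M] M Q_module[OF M], of n] by simp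
      qed
      then show "\<exists>s\<in>S e. \<forall>x\<in>carrier (Q M n). s \<odot>\<^bsub>Q M n\<^esub> x = \<zero>\<^bsub>Q M n\<^esub>" using s(1) by blast
    qed
    then show ?thesis by (auto simp: FC_zero)
  qed
  then show ?thesis
    using submodule_zero[OF coboundaries_submodule[OF FC_is_cochain[OF M]] FC_module[OF M]]
    by (auto simp: acyclic_at_def cocycles_def)
qed

section \<open>Noetherian modules\<close>

lemma (in abelian_group) add_minus_cancel: "\<lbrakk>x \<in> carrier G; y \<in> carrier G\<rbrakk> \<Longrightarrow> (x \<oplus> y) \<ominus> x = y"
  by (simp add: a_minus_def a_comm[of x y] a_assoc r_neg)

definition noetherian_module :: "('a, 'm) ring_scheme \<Rightarrow> ('a, 'b) module \<Rightarrow> bool" where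
  "noetherian_module R M \<longleftrightarrow> module R M \<and>
     (\<forall>H. submodule H R M \<longrightarrow> (\<exists>A. finite A \<and> A \<subseteq> H \<and> submodule_gen R M A = H))"

lemma noetherian_moduleD: "noetherian_module R M \<Longrightarrow> module R M"
  by (simp add: noetherian_module_def)

lemma noetherian_module_gen:
  assumes "noetherian_module R M" "submodule H R M"
  obtains A where "finite A" "A \<subseteq> H" "submodule_gen R M A = H"
  using assms unfolding noetherian_module_def by metis

text \<open>Without a maximal element, dependent choice gives a strictly ascending chain; its union
  is finitely generated, hence reached at a finite stage. Noetherian induction is used throughout in
  this form, with \<open>P\<close> often describing members of an ascending chain.\<close>

lemma noetherian_module_maximal:
  fixes M :: "('a, 'b) module"
  assumes M: "noetherian_module R M" and "submodule H0 R M" "P H0"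
  obtains H where "submodule H R M" "P H" "\<forall>H'. submodule H' R M \<longrightarrow> P H' \<longrightarrow> H \<subseteq> H' \<longrightarrow> H' = H"
proof (rule ccontr)
  assume contr: "\<not> thesis"
  note mM = noetherian_moduleD[OF M]
  have "\<exists>f. \<forall>n::nat. (submodule (f n) R M \<and> P (f n)) \<and> f n \<subset> f (Suc n)"
  proof (rule dependent_nat_choice)
    fix H :: "'b set" and n :: nat assume H: "submodule H R M \<and> P H"
    show "\<exists>H'. (submodule H' R M \<and> P H') \<and> H \<subset> H'"
    proof (rule ccontr)
      assume no: "\<not> (\<exists>H'. (submodule H' R M \<and> P H') \<and> H \<subset> H')"
      have mx: "\<forall>H'. submodule H' R M \<longrightarrow> P H' \<longrightarrow> H \<subseteq> H' \<longrightarrow> H' = H"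
        using no by (simp add: psubset_eq) metis
      have thesis by (rule that[OF conjunct1[OF H] conjunct2[OF H] mx])
      with contr show False by contradiction
    qed
  qed (use assms(2,3) in blast)
  then obtain f :: "nat \<Rightarrow> 'b set" where
    "\<forall>n. (submodule (f n) R M \<and> P (f n)) \<and> f n \<subset> f (Suc n)" ..
  then have f: "\<And>n. submodule (f n) R M" "\<And>n. f n \<subset> f (Suc n)" by auto
  have mono: "f m \<subseteq> f n" if "m \<le> n" for m n
    by (rule lift_Suc_mono_le[of f, OF psubset_imp_subset[OF f(2)] that])
  have "submodule (\<Union>n. f n) R M"
  proof (rule submoduleI'[OF mM])
    fix x y assume "x \<in> (\<Union>n. f n)" "y \<in> (\<Union>n. f n)"
    then obtain m n where "x \<in> f m" "y \<in> f n" by auto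
    then have "x \<in> f (max m n)" "y \<in> f (max m n)" using mono[of m "max m n"] mono[of n "max m n"] by auto
    then have "x \<oplus>\<^bsub>M\<^esub> y \<in> f (max m n)" by (rule submodule_add[OF f(1) mM])
    then show "x \<oplus>\<^bsub>M\<^esub> y \<in> (\<Union>n. f n)" by (rule UN_I[OF UNIV_I])
  next
    fix r x assume r: "r \<in> carrier R" and "x \<in> (\<Union>n. f n)"
    then obtain m where "x \<in> f m" by auto
    then have "r \<odot>\<^bsub>M\<^esub> x \<in> f m" by (rule submodule_smult[OF f(1) mM r])
    then show "r \<odot>\<^bsub>M\<^esub> x \<in> (\<Union>n. f n)" by (rule UN_I[OF UNIV_I])
  next
    show "(\<Union>n. f n) \<subseteq> carrier M" by (rule UN_least, rule submodule_subset[OF f(1) mM])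
    show "\<zero>\<^bsub>M\<^esub> \<in> (\<Union>n. f n)" by (rule UN_I[OF UNIV_I], rule submodule_zero[OF f(1) mM])
  qed
  then obtain A where A: "finite A" "A \<subseteq> (\<Union>n. f n)" "submodule_gen R M A = (\<Union>n. f n)"
    by (rule noetherian_module_gen[OF M])
  have "\<exists>n. A \<subseteq> f n"
    using A(1,2)
  proof (induction A)
    case (insert a A)
    then obtain m n where "a \<in> f m" "A \<subseteq> f n" by auto
    then have "insert a A \<subseteq> f (max m n)" using mono[of m "max m n"] mono[of n "max m n"] by auto
    then show ?case ..
  qed simp
  then obtain n where "A \<subseteq> f n" ..
  then have "(\<Union>n. f n) \<subseteq> f n" using submodule_gen_least[OF f(1)] A(3) by blast
  then show False using f(2)[of n] by blast
qed

lemma submodule_trans: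
  fixes M :: "('a, 'b) module"
  assumes "submodule K R M" "module R M" "submodule H R (M\<lparr>carrier := K\<rparr>)"
  shows "submodule H R M" "H \<subseteq> K"
proof -
  note mK = submodule_module[OF assms(1,2)]
  show "H \<subseteq> K" using submodule_subset[OF assms(3) mK] by simp
  then show "submodule H R M"
    using submodule_subset[OF assms(1,2)] submodule_zero[OF assms(3) mK] submodule_add[OF assms(3) mK]
      submodule_smult[OF assms(3) mK]
    by (intro submoduleI'[OF assms(2)]) auto
qed

lemma submodule_gen_restrict:
  fixes M :: "('a, 'b) module"
  assumes K: "submodule K R M" and M: "module R M" and A: "A \<subseteq> K"
  shows "submodule_gen R (M\<lparr>carrier := K\<rparr>) A = submodule_gen R M A"
proof
  note mK = submodule_module[OF K M]
  have AM: "A \<subseteq> carrier M" and AK: "A \<subseteq> carrier (M\<lparr>carrier := K\<rparr>)"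
    using A submodule_subset[OF K M] by auto
  show "submodule_gen R (M\<lparr>carrier := K\<rparr>) A \<subseteq> submodule_gen R M A"
    by (intro submodule_gen_least submodule_of_submodule[OF K M] submodule_gen_submodule[OF M AM]
        submodule_gen_subset[OF M AM] K A)
  show "submodule_gen R M A \<subseteq> submodule_gen R (M\<lparr>carrier := K\<rparr>) A"
    by (intro submodule_gen_least submodule_trans(1)[OF K M] submodule_gen_submodule[OF mK AK]
        submodule_gen_subset[OF mK AK])
qed

lemma noetherian_submodule:
  assumes M: "noetherian_module R M" and K: "submodule K R M"
  shows "noetherian_module R (M\<lparr>carrier := K\<rparr>)"
  unfolding noetherian_module_def
proof (intro conjI allI impI)
  note mM = noetherian_moduleD[OF M]
  show "module R (M\<lparr>carrier := K\<rparr>)" by (rule submodule_module[OF K mM])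
  fix H assume H: "submodule H R (M\<lparr>carrier := K\<rparr>)"
  note H' = submodule_trans[OF K mM H]
  obtain A where "finite A" "A \<subseteq> H" "submodule_gen R M A = H"
    by (rule noetherian_module_gen[OF M H'(1)])
  then show "\<exists>A. finite A \<and> A \<subseteq> H \<and> submodule_gen R (M\<lparr>carrier := K\<rparr>) A = H"
    using submodule_gen_restrict[OF K mM, of A] H'(2) by auto
qed

lemma submodule_gen_image:
  assumes M: "module R M" and N: "module R N" and f: "f \<in> mod_hom R M N" and A: "A \<subseteq> carrier M"
  shows "submodule_gen R N (f ` A) = f ` submodule_gen R M A"
proof
  have fA: "f ` A \<subseteq> carrier N" using A mod_hom_closed[OF f] by auto
  show "submodule_gen R N (f ` A) \<subseteq> f ` submodule_gen R M A"
    using submodule_gen_subset[OF M A]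
    by (intro submodule_gen_least mod_hom_image[OF f M N] submodule_gen_submodule[OF M A]) auto
  show "f ` submodule_gen R M A \<subseteq> submodule_gen R N (f ` A)"
    using mod_hom_gen_into[OF M N A f submodule_gen_submodule[OF N fA]] submodule_gen_subset[OF N fA] by blast
qed

lemma noetherian_image:
  assumes M: "noetherian_module R M" and N: "module R N" and f: "f \<in> mod_hom R M N" "f ` carrier M = carrier N"
  shows "noetherian_module R N"
  unfolding noetherian_module_def
proof (intro conjI allI impI N)
  note mM = noetherian_moduleD[OF M]
  fix H assume H: "submodule H R N"
  obtain A where A: "finite A" "A \<subseteq> {x \<in> carrier M. f x \<in> H}" "submodule_gen R M A = {x \<in> carrier M. f x \<in> H}"
    by (rule noetherian_module_gen[OF M mod_hom_preimage[OF f(1) mM N H]])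
  have "f ` {x \<in> carrier M. f x \<in> H} = H"
  proof
    show "H \<subseteq> f ` {x \<in> carrier M. f x \<in> H}"
      using submodule_subset[OF H N] unfolding f(2)[symmetric] by blast
  qed blast
  moreover have "A \<subseteq> carrier M" using A(2) by blast
  ultimately have "submodule_gen R N (f ` A) = H"
    using submodule_gen_image[OF mM N f(1), of A] A(3) by simp
  then show "\<exists>A. finite A \<and> A \<subseteq> H \<and> submodule_gen R N A = H"
    using A by (intro exI[of _ "f ` A"]) auto
qed

lemma noetherian_extension:
  assumes M: "module R M" and N: "noetherian_module R N" and g: "g \<in> mod_hom R M N"
    and K: "K = {x \<in> carrier M. g x = \<zero>\<^bsub>N\<^esub>}" and nK: "noetherian_module R (M\<lparr>carrier := K\<rparr>)"
  shows "noetherian_module R M"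
  unfolding noetherian_module_def
proof (intro conjI allI impI M)
  note mN = noetherian_moduleD[OF N]
  interpret M: module R M by (rule M)
  interpret N: module R N by (rule mN)
  have sK: "submodule K R M" unfolding K by (rule mod_hom_ker[OF g M mN])
  fix H assume H: "submodule H R M"
  have "submodule (H \<inter> K) R (M\<lparr>carrier := K\<rparr>)"
    by (rule submodule_of_submodule[OF sK M submodule_inter[OF H M sK]]) simp
  then obtain A where A: "finite A" "A \<subseteq> H \<inter> K" and A': "submodule_gen R (M\<lparr>carrier := K\<rparr>) A = H \<inter> K"
    by (rule noetherian_module_gen[OF nK])
  have A3: "submodule_gen R M A = H \<inter> K"
    using submodule_gen_restrict[OF sK M, of A] A(2) A' by simp
  obtain B where B: "finite B" "B \<subseteq> g ` H" "submodule_gen R N B = g ` H"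
    by (rule noetherian_module_gen[OF N mod_hom_image[OF g M mN H]])
  obtain B' where B': "B' \<subseteq> H" "finite B'" "B = g ` B'" using finite_subset_image[OF B(1,2)] by blast
  have cH: "H \<subseteq> carrier M" by (rule submodule_subset[OF H M])
  have AB: "A \<union> B' \<subseteq> carrier M" using A B' cH by auto
  note s = submodule_gen_submodule[OF M AB]
  have "H \<subseteq> submodule_gen R M (A \<union> B')"
  proof
    fix h assume h: "h \<in> H"
    then have "g h \<in> g ` submodule_gen R M B'"
      using B(3) submodule_gen_image[OF M mN g, of B'] B' cH by auto
    then obtain b where b: "b \<in> submodule_gen R M B'" "g h = g b" by auto
    have bH: "b \<in> H" using b submodule_gen_least[OF H B'(1)] by auto
    have "h \<ominus>\<^bsub>M\<^esub> b \<in> H \<inter> K"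
      using h bH b cH submodule_minus[OF H M h bH] mod_hom_closed[OF g]
      by (auto simp: K mod_hom_minus[OF g M mN] N.minus_eq_zero_iff subset_iff)
    then have 1: "h \<ominus>\<^bsub>M\<^esub> b \<in> submodule_gen R M (A \<union> B')"
      using A3 submodule_gen_mono[OF M _ AB, of A] by auto
    have 2: "b \<in> submodule_gen R M (A \<union> B')"
      using b submodule_gen_mono[OF M _ AB, of B'] by auto
    have "h = (h \<ominus>\<^bsub>M\<^esub> b) \<oplus>\<^bsub>M\<^esub> b"
      using h bH cH by (auto simp: a_minus_def M.M.a_assoc M.M.l_neg subset_iff)
    then show "h \<in> submodule_gen R M (A \<union> B')" using submodule_add[OF s M 1 2] by simp
  qed
  moreover have "submodule_gen R M (A \<union> B') \<subseteq> H" using A B' by (intro submodule_gen_least[OF H]) auto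
  ultimately show "\<exists>A. finite A \<and> A \<subseteq> H \<and> submodule_gen R M A = H"
    using A B' by (intro exI[of _ "A \<union> B'"]) auto
qed

lemma regular_a_inv: "\<ominus>\<^bsub>regular_module R\<^esub> x = \<ominus>\<^bsub>R\<^esub> x"
  by (simp add: a_inv_def m_inv_def regular_module_def)

lemma regular_minus: "x \<ominus>\<^bsub>regular_module R\<^esub> y = x \<ominus>\<^bsub>R\<^esub> y"
  by (simp add: a_minus_def regular_a_inv regular_module_simps)

lemma regular_submodule_iff:
  assumes "cring R" shows "submodule H R (regular_module R) \<longleftrightarrow> ideal H R"
proof
  interpret cring R by fact
  assume H: "submodule H R (regular_module R)"
  note m = regular_module_module[OF assms]
  have HR: "H \<subseteq> carrier R" using submodule_subset[OF H m] by (simp add: regular_module_simps)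
  show "ideal H R"
  proof (rule idealI[OF ring_axioms])
    show "subgroup H (add_monoid R)"
      using submodule_zero[OF H m] submodule_add[OF H m] submodule_neg[OF H m] HR
      by (intro add.subgroupI) (auto simp: regular_module_simps regular_a_inv)
    fix a x assume "a \<in> H" "x \<in> carrier R"
    then show "x \<otimes>\<^bsub>R\<^esub> a \<in> H" "a \<otimes>\<^bsub>R\<^esub> x \<in> H"
      using submodule_smult[OF H m, of x a] HR m_comm[of a x] by (auto simp: regular_module_simps)
  qed
next
  interpret cring R by fact
  assume "ideal H R"
  then interpret ideal H R .
  show "submodule H R (regular_module R)"
    using a_subset I_l_closed
    by (intro submoduleI'[OF regular_module_module[OF assms]]) (auto simp: regular_module_simps)
qed

lemma regular_noetherian:
  assumes "noetherian_ring R" "cring R"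
  shows "noetherian_module R (regular_module R)"
  unfolding noetherian_module_def
proof (intro conjI allI impI regular_module_module assms(2))
  interpret cring R by fact
  fix H assume "submodule H R (regular_module R)"
  then have "ideal H R" by (simp add: regular_submodule_iff[OF assms(2)])
  then obtain A where A: "A \<subseteq> carrier R" "finite A" "H = Idl\<^bsub>R\<^esub> A"
    using noetherian_ring.finetely_gen[OF assms(1)] by blast
  have "submodule_gen R (regular_module R) A = Idl\<^bsub>R\<^esub> A"
    by (simp add: submodule_gen_def genideal_def regular_submodule_iff[OF assms(2)])
  then show "\<exists>A. finite A \<and> A \<subseteq> H \<and> submodule_gen R (regular_module R) A = H"
    using A genideal_self[OF A(1)] by auto
qed

definition cyclic :: "('a, 'm) ring_scheme \<Rightarrow> ('a, 'b) module \<Rightarrow> 'b \<Rightarrow> 'b set" where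
  "cyclic R M x = (\<lambda>r. r \<odot>\<^bsub>M\<^esub> x) ` carrier R"

lemma smult_hom:
  assumes "module R M" "x \<in> carrier M"
  shows "(\<lambda>r. r \<odot>\<^bsub>M\<^esub> x) \<in> mod_hom R (regular_module R) M"
proof -
  interpret module R M by fact
  show ?thesis
    using assms(2) by (intro mod_homI) (auto simp: regular_module_simps smult_l_distr smult_assoc1)
qed

lemma cyclic_submodule:
  assumes "module R M" "x \<in> carrier M"
  shows "submodule (cyclic R M x) R M" "x \<in> cyclic R M x"
proof -
  interpret module R M by fact
  show "submodule (cyclic R M x) R M"
    using mod_hom_image[OF smult_hom[OF assms] regular_module_module[OF R.is_cring] assms(1)
        module.carrier_is_submodule[OF regular_module_module[OF R.is_cring]]]
    by (simp add: cyclic_def regular_module_simps)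
  have "x = \<one>\<^bsub>R\<^esub> \<odot>\<^bsub>M\<^esub> x" using assms(2) by simp
  then show "x \<in> cyclic R M x" unfolding cyclic_def by blast
qed

lemma quot_module_noetherian:
  assumes "noetherian_module R M" "submodule K R M"
  shows "noetherian_module R (quot_module M K)"
  using assms noetherian_moduleD[OF assms(1)]
  by (intro noetherian_image[OF assms(1) _ quot_module_proj]) (auto simp: quot_module_module quot_module_carrier)

lemma submodule_gen_insert:
  assumes "module R M" "a \<in> carrier M" "A \<subseteq> carrier M"
  shows "submodule_gen R M (insert a A) = submodule_sum M (submodule_gen R M A) (cyclic R M a)"
proof
  note g = submodule_gen_submodule[OF assms(1,3)] and c = cyclic_submodule[OF assms(1,2)]
  have ic: "insert a A \<subseteq> carrier M" using assms by simp
  note gi = submodule_gen_submodule[OF assms(1) ic]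
  show "submodule_gen R M (insert a A) \<subseteq> submodule_sum M (submodule_gen R M A) (cyclic R M a)"
    using submodule_sum_left[OF g assms(1) c(1)] submodule_sum_right[OF g assms(1) c(1)] c(2)
      submodule_gen_subset[OF assms(1,3)]
    by (intro submodule_gen_least submodule_sum_submodule[OF g assms(1) c(1)]) auto
  have "submodule_gen R M A \<subseteq> submodule_gen R M (insert a A)"
    by (rule submodule_gen_mono[OF assms(1) _ ic]) auto
  moreover have "cyclic R M a \<subseteq> submodule_gen R M (insert a A)"
    using submodule_smult[OF gi assms(1)] submodule_gen_subset[OF assms(1) ic] by (auto simp: cyclic_def)
  ultimately show "submodule_sum M (submodule_gen R M A) (cyclic R M a) \<subseteq> submodule_gen R M (insert a A)"
    using submodule_add[OF gi assms(1)] unfolding submodule_sum_def by blast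
qed

text \<open>Induction on the generators: adjoining one of them extends by a quotient that is an
  image of \<open>R\<close>.\<close>

lemma fin_gen_noetherian:
  assumes R: "noetherian_ring R" and M: "module R M" and fg: "fin_gen_module R M"
  shows "noetherian_module R M"
proof -
  interpret module R M by fact
  note reg = regular_noetherian[OF R R.is_cring]
  have "noetherian_module R (M\<lparr>carrier := submodule_gen R M A\<rparr>)" if "finite A" "A \<subseteq> carrier M" for A
    using that
  proof (induction A)
    case empty
    have "submodule_gen R M {} = {\<zero>\<^bsub>M\<^esub>}"
      using submodule_gen_least[OF submodule_zero_submodule[OF M], of "{}"]
        submodule_zero[OF submodule_gen_submodule[OF M, of "{}"] M] by auto
    moreover have "noetherian_module R (M\<lparr>carrier := {\<zero>\<^bsub>M\<^esub>}\<rparr>)"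
      by (rule noetherian_image[OF reg submodule_module[OF submodule_zero_submodule[OF M] M],
            of "\<lambda>_. \<zero>\<^bsub>M\<^esub>"])
         (auto simp: mod_hom_def regular_module_simps)
    ultimately show ?case by simp
  next
    case (insert a A)
    let ?K = "submodule_gen R M A" and ?N = "submodule_gen R M (insert a A)"
    have A: "A \<subseteq> carrier M" and a: "a \<in> carrier M" and aA: "insert a A \<subseteq> carrier M" using insert by auto
    note K = submodule_gen_submodule[OF M A] and N = submodule_gen_submodule[OF M aA]
    let ?MN = "M\<lparr>carrier := ?N\<rparr>"
    note MN = submodule_module[OF N M]
    have KN: "?K \<subseteq> ?N" by (rule submodule_gen_mono[OF M _ aA]) auto
    note K' = submodule_of_submodule[OF N M K KN]
    let ?X = "quot_module ?MN ?K"
    note X = quot_module_module[OF MN K'] and p = quot_module_proj[OF MN K']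
    have aN: "a \<in> carrier ?MN" using submodule_gen_subset[OF M aA] by simp
    note h = mod_hom_comp[OF smult_hom[OF MN aN] p]
    have "noetherian_module R ?X"
    proof (rule noetherian_image[OF reg X h])
      show "(\<lambda>r. ?K +>\<^bsub>?MN\<^esub> r \<odot>\<^bsub>?MN\<^esub> a) ` carrier (regular_module R) = carrier ?X"
      proof
        show "carrier ?X \<subseteq> (\<lambda>r. ?K +>\<^bsub>?MN\<^esub> r \<odot>\<^bsub>?MN\<^esub> a) ` carrier (regular_module R)"
        proof
          fix Y assume "Y \<in> carrier ?X"
          then obtain y where y: "y \<in> ?N" "Y = ?K +>\<^bsub>?MN\<^esub> y" by (auto simp: quot_module_carrier[OF MN K'])
          then obtain k r where kr: "k \<in> ?K" "r \<in> carrier R" "y = k \<oplus>\<^bsub>M\<^esub> r \<odot>\<^bsub>M\<^esub> a"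
            unfolding submodule_gen_insert[OF M a A] submodule_sum_def cyclic_def by blast
          have ra: "r \<odot>\<^bsub>M\<^esub> a \<in> ?N" using module.smult_closed[OF MN kr(2) aN] by simp
          have kN: "k \<in> ?N" using kr KN by auto
          have "Y = (?K +>\<^bsub>?MN\<^esub> k) \<oplus>\<^bsub>?X\<^esub> (?K +>\<^bsub>?MN\<^esub> (r \<odot>\<^bsub>M\<^esub> a))"
            using kr(3) y(2) mod_hom_add[OF p, of k "r \<odot>\<^bsub>M\<^esub> a"] kN ra by simp
          also have "?K +>\<^bsub>?MN\<^esub> k = \<zero>\<^bsub>?X\<^esub>"
            using coset_zero_iff[OF MN K', of k] kN kr(1) quot_module_zero[OF MN K'] by simp
          also have "\<zero>\<^bsub>?X\<^esub> \<oplus>\<^bsub>?X\<^esub> (?K +>\<^bsub>?MN\<^esub> (r \<odot>\<^bsub>M\<^esub> a)) = ?K +>\<^bsub>?MN\<^esub> (r \<odot>\<^bsub>M\<^esub> a)"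
          proof -
            interpret X: module R ?X by (rule X)
            show ?thesis using mod_hom_closed[OF p, of "r \<odot>\<^bsub>M\<^esub> a"] ra by simp
          qed
          finally show "Y \<in> (\<lambda>r. ?K +>\<^bsub>?MN\<^esub> r \<odot>\<^bsub>?MN\<^esub> a) ` carrier (regular_module R)"
            using kr(2) by (auto simp: regular_module_simps)
        qed
      qed (use mod_hom_closed[OF h] in blast)
    qed
    moreover have "noetherian_module R (?MN\<lparr>carrier := ?K\<rparr>)" using insert by simp
    moreover have "?K = {x \<in> carrier ?MN. ?K +>\<^bsub>?MN\<^esub> x = \<zero>\<^bsub>?X\<^esub>}"
      using coset_zero_iff[OF MN K'] quot_module_zero[OF MN K'] KN by auto
    ultimately show ?case using noetherian_extension[OF MN _ p] by blast
  qed
  moreover obtain A where A: "finite A" "A \<subseteq> carrier M" "submodule_gen R M A = carrier M"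
    using fg unfolding fin_gen_module_def by blast
  moreover have "M\<lparr>carrier := carrier M\<rparr> = M" by (cases M) simp
  ultimately show ?thesis by metis
qed

section \<open>Associated primes and the Artin--Rees lemma\<close>

definition colon :: "('a, 'm) ring_scheme \<Rightarrow> ('a, 'b) module \<Rightarrow> 'b set \<Rightarrow> 'b \<Rightarrow> 'a set" where
  "colon R M N x = {r \<in> carrier R. r \<odot>\<^bsub>M\<^esub> x \<in> N}"

lemma colon_ideal:
  assumes "module R M" "submodule N R M" "x \<in> carrier M"
  shows "ideal (colon R M N x) R"
proof -
  interpret module R M by fact
  note m = regular_module_module[OF R.is_cring]
  show ?thesis
    using mod_hom_preimage[OF smult_hom[OF assms(1,3)] m assms(1,2)]
    by (simp add: colon_def regular_submodule_iff[OF R.is_cring] regular_module_simps)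
qed

text \<open>A maximal one among the annihilators of nonzero elements of \<open>M / N\<close> is
  prime: if \<open>a b\<close> kills the class of \<open>x\<close> and \<open>b\<close> does not,
  then the annihilator of \<open>b x\<close> contains that of \<open>x\<close>, hence equals it, and
  it contains \<open>a\<close>.\<close>

lemma exists_associated_prime:
  assumes R: "noetherian_ring R" and M: "module R M" and N: "submodule N R M" "N \<noteq> carrier M"
  obtains x where "x \<in> carrier M" "x \<notin> N" "primeideal (colon R M N x) R"
proof -
  interpret module R M by fact
  note c = R.is_cring
  obtain x0 where x0: "x0 \<in> carrier M" "x0 \<notin> N" using N submodule_subset[OF N(1) M] by auto
  let ?P = "\<lambda>H. \<exists>x. x \<in> carrier M \<and> x \<notin> N \<and> H = colon R M N x"
  have "submodule (colon R M N x0) R (regular_module R)"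
    by (simp add: regular_submodule_iff[OF c] colon_ideal[OF M N(1) x0(1)])
  moreover have "?P (colon R M N x0)" using x0 by blast
  ultimately obtain H where "submodule H R (regular_module R)" and H: "?P H"
    and max: "\<forall>H'. submodule H' R (regular_module R) \<longrightarrow> ?P H' \<longrightarrow> H \<subseteq> H' \<longrightarrow> H' = H"
    by (rule noetherian_module_maximal[OF regular_noetherian[OF R c], where P = ?P])
  then obtain x where x: "x \<in> carrier M" "x \<notin> N" "H = colon R M N x" by blast
  have "primeideal H R"
  proof (rule primeidealI)
    show "ideal H R" unfolding x(3) by (rule colon_ideal[OF M N(1) x(1)])
    have "\<one>\<^bsub>R\<^esub> \<notin> H" using x by (simp add: colon_def)
    then show "carrier R \<noteq> H" by auto
    fix a b assume ab: "a \<in> carrier R" "b \<in> carrier R" "a \<otimes>\<^bsub>R\<^esub> b \<in> H"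
    show "a \<in> H \<or> b \<in> H"
    proof (rule disjCI)
      assume "b \<notin> H"
      then have b: "b \<odot>\<^bsub>M\<^esub> x \<notin> N" using ab by (simp add: x(3) colon_def)
      have bx: "b \<odot>\<^bsub>M\<^esub> x \<in> carrier M" using ab x by simp
      have "H \<subseteq> colon R M N (b \<odot>\<^bsub>M\<^esub> x)"
      proof
        fix r assume "r \<in> H"
        then have r: "r \<in> carrier R" "r \<odot>\<^bsub>M\<^esub> x \<in> N" by (auto simp: x(3) colon_def)
        have "r \<odot>\<^bsub>M\<^esub> (b \<odot>\<^bsub>M\<^esub> x) = b \<odot>\<^bsub>M\<^esub> (r \<odot>\<^bsub>M\<^esub> x)"
          using r ab x by (simp add: R.m_comm flip: smult_assoc1)
        then show "r \<in> colon R M N (b \<odot>\<^bsub>M\<^esub> x)" using r submodule_smult[OF N(1) M ab(2) r(2)] by (simp add: colon_def)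
      qed
      then have "colon R M N (b \<odot>\<^bsub>M\<^esub> x) = H"
        using b bx colon_ideal[OF M N(1) bx] by (intro max[rule_format]) (auto simp: regular_submodule_iff[OF c])
      moreover have "a \<in> colon R M N (b \<odot>\<^bsub>M\<^esub> x)"
        using ab x by (auto simp: colon_def smult_assoc1)
      ultimately show "a \<in> H" by simp
    qed
  qed (rule c)
  then show thesis using that x by blast
qed

text \<open>Turns exponents that depend on \<open>y\<close> and \<open>x\<close> into one power of
  the ideal. An associated prime replaces a count of monomials in generators of
  \<open>\<aa>\<close>.\<close>

lemma ideal_pow_smult_subset:
  assumes R: "noetherian_ring R" and \<aa>: "ideal \<aa> R" and nM: "noetherian_module R M"
    and Q: "submodule Q R M"
    and nil: "\<And>y x. \<lbrakk>y \<in> \<aa>; x \<in> carrier M\<rbrakk> \<Longrightarrow> \<exists>k::nat. (y [^]\<^bsub>R\<^esub> k) \<odot>\<^bsub>M\<^esub> x \<in> Q"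
  shows "\<exists>p. ideal_pow_smult R \<aa> p M \<subseteq> Q"
proof -
  note M = noetherian_moduleD[OF nM]
  interpret module R M by (rule M)
  note c = R.is_cring
  interpret a: ideal \<aa> R by fact
  \<comment> \<open>\<open>F p\<close> is the submodule of elements multiplied into \<open>Q\<close>
    by \<open>\<aa>^p\<close>. The chain ascends; once it is stationary, no element outside it can
    be moved into it by all of \<open>\<aa>\<close>.\<close>
  define F where "F p = {x \<in> carrier M. \<forall>r\<in>\<aa> [^]\<^bsub>ideals_set R\<^esub> (p::nat). r \<odot>\<^bsub>M\<^esub> x \<in> Q}" for p
  note pc = ideal_pow_closed[OF c \<aa>]
  have F: "submodule (F p) R M" for p
  proof (rule submoduleI'[OF M])
    fix s x assume s: "s \<in> carrier R" and x: "x \<in> F p"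
    have "r \<odot>\<^bsub>M\<^esub> (s \<odot>\<^bsub>M\<^esub> x) \<in> Q" if r: "r \<in> \<aa> [^]\<^bsub>ideals_set R\<^esub> p" for r
    proof -
      have "r \<odot>\<^bsub>M\<^esub> (s \<odot>\<^bsub>M\<^esub> x) = s \<odot>\<^bsub>M\<^esub> (r \<odot>\<^bsub>M\<^esub> x)"
        using s x pc[OF r] by (simp add: F_def R.m_comm flip: smult_assoc1)
      then show ?thesis using x r submodule_smult[OF Q M s] by (simp add: F_def)
    qed
    then show "s \<odot>\<^bsub>M\<^esub> x \<in> F p" using s x by (simp add: F_def)
  qed (auto simp: F_def smult_r_distr pc submodule_zero[OF Q M] submodule_add[OF Q M])
  have FS: "F p \<subseteq> F (Suc p)" for p
    using ideal_pow_decreasing[OF c \<aa>, of p] by (auto simp: F_def)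
  have QF: "Q \<subseteq> F p" for p
    using submodule_subset[OF Q M] submodule_smult[OF Q M] pc by (auto simp: F_def)
  have step: "x \<in> F (Suc p)" if x: "x \<in> carrier M" and ax: "\<And>y. y \<in> \<aa> \<Longrightarrow> y \<odot>\<^bsub>M\<^esub> x \<in> F p" for x p
  proof -
    have "r \<odot>\<^bsub>M\<^esub> x \<in> Q" if "r \<in> ideal_prod R (\<aa> [^]\<^bsub>ideals_set R\<^esub> p) \<aa>" for r
      using that
    proof (induction r rule: ideal_prod.induct)
      case (prod i j)
      then have "i \<odot>\<^bsub>M\<^esub> (j \<odot>\<^bsub>M\<^esub> x) \<in> Q" using ax by (simp add: F_def)
      then show ?case using prod x pc by (simp add: smult_assoc1)
    next
      case (sum r s)
      have "r \<in> carrier R" "s \<in> carrier R"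
        using sum.hyps R.ideal_prod_in_carrier[OF ideal_pow_ideal[OF c \<aa>] \<aa>] by blast+
      then show ?case using sum.IH x by (simp add: smult_l_distr submodule_add[OF Q M])
    qed
    then show ?thesis using x unfolding F_def ideal_pow_Suc[OF c \<aa>] by blast
  qed
  have "\<exists>p. F 0 = F p" by blast
  with F[of 0] obtain H where "submodule H R M" "\<exists>p. H = F p"
    and "\<forall>H'. submodule H' R M \<longrightarrow> (\<exists>p. H' = F p) \<longrightarrow> H \<subseteq> H' \<longrightarrow> H' = H"
    by (rule noetherian_module_maximal[OF nM, where P = "\<lambda>H. \<exists>p. H = F p"])
  then obtain p where max: "\<And>H'. \<lbrakk>submodule H' R M; \<exists>p. H' = F p; F p \<subseteq> H'\<rbrakk> \<Longrightarrow> H' = F p" by metis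
  have stable: "F (Suc p) = F p" by (rule max) (use F FS in auto)
  have "F p = carrier M"
  proof (rule ccontr)
    assume "F p \<noteq> carrier M"
    then obtain x where x: "x \<in> carrier M" "x \<notin> F p" and pr: "primeideal (colon R M (F p) x) R"
      using exists_associated_prime[OF R M F] by blast
    interpret P: primeideal "colon R M (F p) x" R by (rule pr)
    \<comment> \<open>A power of each \<open>y\<close> in \<open>\<aa>\<close> lies in the prime
      ideal, so all of \<open>\<aa>\<close> does, and \<open>x\<close> would belong to the next
      member of the chain.\<close>
    have "y \<odot>\<^bsub>M\<^esub> x \<in> F p" if y: "y \<in> \<aa>" for y
    proof -
      have yR: "y \<in> carrier R" using y by (rule a.Icarr)
      obtain k :: nat where "(y [^]\<^bsub>R\<^esub> k) \<odot>\<^bsub>M\<^esub> x \<in> Q" using nil[OF y x(1)] by blast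
      moreover have "y [^]\<^bsub>R\<^esub> k \<in> carrier R" using yR by simp
      ultimately have "y [^]\<^bsub>R\<^esub> k \<in> colon R M (F p) x" using QF[of p] unfolding colon_def by blast
      then have "y \<in> colon R M (F p) x"
      proof (induction k)
        case 0
        then show ?case using P.one_imp_carrier P.I_notcarr by simp
      next
        case (Suc k)
        then show ?case using P.I_prime[of "y [^]\<^bsub>R\<^esub> k" y] yR by auto
      qed
      then show ?thesis unfolding colon_def by blast
    qed
    then have "x \<in> F (Suc p)" by (rule step[OF x(1)])
    then show False using x(2) stable by simp
  qed
  then have "ideal_pow_smult R \<aa> p M \<subseteq> Q"
    unfolding ideal_pow_smult_def by (intro submodule_gen_least[OF Q]) (auto simp: F_def)
  then show ?thesis ..
qed

text \<open>Instead of a Rees algebra, a submodule \<open>Q\<close> maximal with trace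
  \<open>\<aa>^n K\<close> on \<open>K\<close> is used. Maximality forces every element of
  \<open>\<aa>\<close> to act nilpotently on \<open>M / Q\<close>, so \<open>Q\<close> contains some
  \<open>\<aa>^p M\<close>, whose trace on \<open>K\<close> then lies in
  \<open>\<aa>^n K\<close>.\<close>

theorem artin_rees:
  assumes R: "noetherian_ring R" and \<aa>: "ideal \<aa> R" and nM: "noetherian_module R M"
    and K: "submodule K R M"
  shows "\<exists>m\<ge>n. K \<inter> ideal_pow_smult R \<aa> m M \<subseteq> ideal_pow_smult R \<aa> n (M\<lparr>carrier := K\<rparr>)"
proof -
  note M = noetherian_moduleD[OF nM]
  interpret module R M by (rule M)
  note c = R.is_cring
  interpret a: ideal \<aa> R by fact
  let ?L = "M\<lparr>carrier := K\<rparr>"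
  note L = submodule_module[OF K M]
  let ?A = "ideal_pow_smult R \<aa> n ?L"
  note A = submodule_trans[OF K M AM_submodule[OF c \<aa> L, of n]]
  have "?A \<inter> K = ?A" using A(2) by blast
  with A(1) obtain Q where Q: "submodule Q R M" "Q \<inter> K = ?A"
    and max: "\<forall>H'. submodule H' R M \<longrightarrow> H' \<inter> K = ?A \<longrightarrow> Q \<subseteq> H' \<longrightarrow> H' = Q"
    by (rule noetherian_module_maximal[OF nM, where P = "\<lambda>Q. Q \<inter> K = ?A"])
  have QM: "Q \<subseteq> carrier M" by (rule submodule_subset[OF Q(1) M])
  have "\<exists>k::nat. (y [^]\<^bsub>R\<^esub> k) \<odot>\<^bsub>M\<^esub> x \<in> Q" if y: "y \<in> \<aa>" and x: "x \<in> carrier M" for y x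
  proof -
    have yR: "y \<in> carrier R" using y by (rule a.Icarr)
    \<comment> \<open>The chain of submodules that powers of \<open>y\<close> multiply into
      \<open>Q\<close>. It is stationary from \<open>k\<close> on, and this \<open>k\<close> is the
      exponent claimed.\<close>
    define V where "V k = {x \<in> carrier M. (y [^]\<^bsub>R\<^esub> (k::nat)) \<odot>\<^bsub>M\<^esub> x \<in> Q}" for k
    have V: "submodule (V k) R M" for k
      unfolding V_def using yR by (intro mod_hom_preimage[OF mod_hom_scale[OF mod_hom_id M] M M Q(1)]) simp
    have "\<exists>k. V 0 = V k" by blast
    with V[of 0] obtain H where "submodule H R M" "\<exists>k. H = V k"
      and "\<forall>H'. submodule H' R M \<longrightarrow> (\<exists>k. H' = V k) \<longrightarrow> H \<subseteq> H' \<longrightarrow> H' = H"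
      by (rule noetherian_module_maximal[OF nM, where P = "\<lambda>H. \<exists>k. H = V k"])
    then obtain k where k: "\<And>H'. \<lbrakk>submodule H' R M; \<exists>k. H' = V k; V k \<subseteq> H'\<rbrakk> \<Longrightarrow> H' = V k" by metis
    have "V k \<subseteq> V (n + k)"
    proof
      fix x assume x: "x \<in> V k"
      then have "y [^]\<^bsub>R\<^esub> n \<odot>\<^bsub>M\<^esub> ((y [^]\<^bsub>R\<^esub> k) \<odot>\<^bsub>M\<^esub> x) \<in> Q"
        using yR by - (rule submodule_smult[OF Q(1) M], auto simp: V_def)
      then show "x \<in> V (n + k)" using x yR by (simp add: V_def R.nat_pow_mult flip: smult_assoc1)
    qed
    then have stable: "V (n + k) = V k" using V by (intro k) auto
    let ?Y = "(\<lambda>x. (y [^]\<^bsub>R\<^esub> k) \<odot>\<^bsub>M\<^esub> x) ` carrier M"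
    have Y: "submodule ?Y R M"
      using yR carrier_is_submodule by (intro mod_hom_image[OF mod_hom_scale[OF mod_hom_id M] M M]) auto
    note sl = submodule_sum_left[OF Q(1) M Y] and sr = submodule_sum_right[OF Q(1) M Y]
    \<comment> \<open>Enlarging \<open>Q\<close> by \<open>y^k M\<close> does not enlarge its trace
      on \<open>K\<close>: for \<open>z = q + y^k x\<close> in \<open>K\<close>, the element
      \<open>y^n z\<close> lies in \<open>\<aa>^n K\<close>, hence in \<open>Q\<close>. So
      \<open>y^(n+k) x\<close> is in \<open>Q\<close>, and by stability \<open>y^k x\<close> is as
      well.\<close>
    have "submodule_sum M Q ?Y \<inter> K \<subseteq> Q"
    proof
      fix z assume "z \<in> submodule_sum M Q ?Y \<inter> K"
      then obtain q x where z: "z \<in> K" "q \<in> Q" "x \<in> carrier M" "z = q \<oplus>\<^bsub>M\<^esub> (y [^]\<^bsub>R\<^esub> k) \<odot>\<^bsub>M\<^esub> x"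
        by (auto simp: submodule_sum_def)
      have "y [^]\<^bsub>R\<^esub> n \<in> \<aa> [^]\<^bsub>ideals_set R\<^esub> n"
      proof (induction n)
        case (Suc n)
        then show ?case using y unfolding ideal_pow_Suc[OF c \<aa>] R.nat_pow_Suc by (rule ideal_prod.prod)
      next
        case 0
        show ?case unfolding ideal_pow_0[OF c \<aa>] R.nat_pow_0 by (rule R.one_closed)
      qed
      then have "(y [^]\<^bsub>R\<^esub> n) \<odot>\<^bsub>M\<^esub> z \<in> ?A"
        using submodule_gen_subset[OF L AM_gens_closed[OF c \<aa> L, of n]] z(1)
        unfolding ideal_pow_smult_def by auto
      then have 1: "(y [^]\<^bsub>R\<^esub> n) \<odot>\<^bsub>M\<^esub> z \<in> Q" using Q(2) by auto
      have 2: "(y [^]\<^bsub>R\<^esub> n) \<odot>\<^bsub>M\<^esub> q \<in> Q" using yR z by (intro submodule_smult[OF Q(1) M]) auto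
      have qc: "q \<in> carrier M" using z QM by auto
      have "(y [^]\<^bsub>R\<^esub> (n + k)) \<odot>\<^bsub>M\<^esub> x = (y [^]\<^bsub>R\<^esub> n) \<odot>\<^bsub>M\<^esub> z \<ominus>\<^bsub>M\<^esub> (y [^]\<^bsub>R\<^esub> n) \<odot>\<^bsub>M\<^esub> q"
        using yR z(3) qc
        by (simp add: z(4) smult_r_distr M.add_minus_cancel R.nat_pow_mult flip: smult_assoc1)
      then have "x \<in> V (n + k)" using z(3) submodule_minus[OF Q(1) M 1 2] by (simp add: V_def)
      then have "(y [^]\<^bsub>R\<^esub> k) \<odot>\<^bsub>M\<^esub> x \<in> Q" unfolding stable by (simp add: V_def)
      then show "z \<in> Q" using z submodule_add[OF Q(1) M] by simp
    qed
    then have "submodule_sum M Q ?Y \<inter> K = ?A" using Q(2) sl by blast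
    then have "submodule_sum M Q ?Y = Q" using max[rule_format, OF submodule_sum_submodule[OF Q(1) M Y] _ sl] by blast
    then show ?thesis using sr x by blast
  qed
  then obtain p where p: "ideal_pow_smult R \<aa> p M \<subseteq> Q"
    using ideal_pow_smult_subset[OF R \<aa> nM Q(1)] by blast
  \<comment> \<open>The maximum only serves to obtain an exponent that is at least
    \<open>n\<close>.\<close>
  have "ideal_pow_smult R \<aa> (max n p) M \<subseteq> Q"
    using AM_antimono[OF c \<aa> M, of p "max n p"] p by auto
  then show ?thesis using Q(2) by (intro exI[of _ "max n p"]) auto
qed

text \<open>A prime filtration in the form of an induction principle: a maximal submodule with
  \<open>P\<close> would otherwise be enlarged by a cyclic step whose factor is \<open>R\<close>
  modulo a prime.\<close>

lemma prime_filtration: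
  assumes R: "noetherian_ring R" and nM: "noetherian_module R M"
    and base: "P {\<zero>\<^bsub>M\<^esub>}"
    and step: "\<And>N x. \<lbrakk>submodule N R M; x \<in> carrier M; x \<notin> N; primeideal (colon R M N x) R; P N\<rbrakk> \<Longrightarrow>
      P (submodule_sum M N (cyclic R M x))"
  shows "P (carrier M)"
proof -
  note M = noetherian_moduleD[OF nM]
  obtain N where N: "submodule N R M" "P N" and max: "\<forall>H'. submodule H' R M \<longrightarrow> P H' \<longrightarrow> N \<subseteq> H' \<longrightarrow> H' = N"
    using submodule_zero_submodule[OF M] base by (rule noetherian_module_maximal[OF nM])
  have "N = carrier M"
  proof (rule ccontr)
    assume "N \<noteq> carrier M"
    then obtain x where x: "x \<in> carrier M" "x \<notin> N" "primeideal (colon R M N x) R"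
      using exists_associated_prime[OF R M N(1)] by blast
    note cx = cyclic_submodule[OF M x(1)]
    have "submodule_sum M N (cyclic R M x) = N"
      by (rule max[rule_format, OF submodule_sum_submodule[OF N(1) M cx(1)] step[OF N(1) x N(2)] submodule_sum_left[OF N(1) M cx(1)]])
    then show False using submodule_sum_right[OF N(1) M cx(1)] cx(2) x(2) by blast
  qed
  then show ?thesis using N(2) by simp
qed

section \<open>Support\<close>

lemma prime_complement_mult_closed:
  assumes "primeideal \<pp> R"
  shows "mult_closed R (carrier R - \<pp>)"
proof -
  interpret primeideal \<pp> R by fact
  show ?thesis
    unfolding mult_closed_def using one_imp_carrier I_notcarr I_prime by auto
qed

text \<open>Whether \<open>x / s\<close> vanishes does not depend on \<open>s\<close>. The witness
  \<open>x\<close> is an element whose annihilator is contained in \<open>\<pp>\<close>.\<close>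

lemma supp_iff:
  assumes "module R M"
  shows "\<pp> \<in> supp R M \<longleftrightarrow> primeideal \<pp> R \<and>
    (\<exists>x\<in>carrier M. \<forall>s\<in>carrier R - \<pp>. s \<odot>\<^bsub>M\<^esub> x \<noteq> \<zero>\<^bsub>M\<^esub>)"
proof (cases "primeideal \<pp> R")
  case True
  interpret L: module_localization R M "carrier R - \<pp>"
    using assms prime_complement_mult_closed[OF True]
    by (simp add: module_localization_def module_localization_axioms_def)
  have zero_iff: "L.fr x s = \<zero>\<^bsub>L.Loc\<^esub> \<longleftrightarrow> (\<exists>t\<in>carrier R - \<pp>. t \<odot>\<^bsub>M\<^esub> x = \<zero>\<^bsub>M\<^esub>)"
    if "x \<in> carrier M" "s \<in> carrier R - \<pp>" for x s
    unfolding L.loc_zero using that L.S_one by (subst L.frac_eq_iff) auto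
  have "trivial_module L.Loc \<longleftrightarrow> (\<forall>X\<in>carrier L.Loc. X = \<zero>\<^bsub>L.Loc\<^esub>)"
    using L.frac_closed[OF L.M.zero_closed L.S_one] unfolding trivial_module_def L.loc_zero by auto
  also have "\<dots> \<longleftrightarrow> (\<forall>x\<in>carrier M. \<forall>s\<in>carrier R - \<pp>. L.fr x s = \<zero>\<^bsub>L.Loc\<^esub>)"
    by (auto simp: L.loc_carrier)
  also have "\<dots> \<longleftrightarrow> (\<forall>x\<in>carrier M. \<exists>t\<in>carrier R - \<pp>. t \<odot>\<^bsub>M\<^esub> x = \<zero>\<^bsub>M\<^esub>)"
    using zero_iff L.S_one by blast
  finally show ?thesis using True by (auto simp: supp_def)
qed (simp add: supp_def)

lemma suppD: "\<pp> \<in> supp R M \<Longrightarrow> primeideal \<pp> R"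
  by (simp add: supp_def)

lemma supp_submodule:
  assumes "module R M" "submodule K R M"
  shows "supp R (M\<lparr>carrier := K\<rparr>) \<subseteq> supp R M"
proof
  fix \<pp> assume "\<pp> \<in> supp R (M\<lparr>carrier := K\<rparr>)"
  then have "primeideal \<pp> R" "\<exists>x\<in>K. \<forall>s\<in>carrier R - \<pp>. s \<odot>\<^bsub>M\<^esub> x \<noteq> \<zero>\<^bsub>M\<^esub>"
    by (simp_all add: supp_iff[OF submodule_module[OF assms(2,1)]])
  then show "\<pp> \<in> supp R M"
    using submodule_subset[OF assms(2,1)] unfolding supp_iff[OF assms(1)] by blast
qed

lemma supp_image:
  assumes M: "module R M" and N: "module R N" and f: "f \<in> mod_hom R M N" "f ` carrier M = carrier N"
  shows "supp R N \<subseteq> supp R M"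
proof
  fix \<pp> assume "\<pp> \<in> supp R N"
  then obtain y where y: "primeideal \<pp> R" "y \<in> carrier N" "\<And>s. s \<in> carrier R - \<pp> \<Longrightarrow> s \<odot>\<^bsub>N\<^esub> y \<noteq> \<zero>\<^bsub>N\<^esub>"
    by (auto simp: supp_iff[OF N])
  then obtain x where x: "x \<in> carrier M" "y = f x" using f(2) by blast
  have "s \<odot>\<^bsub>M\<^esub> x \<noteq> \<zero>\<^bsub>M\<^esub>" if "s \<in> carrier R - \<pp>" for s
    using y(3)[OF that] mod_hom_smult[OF f(1), of s x] mod_hom_zero[OF f(1) M N] that x by auto
  then show "\<pp> \<in> supp R M" using x y(1) by (auto simp: supp_iff[OF M])
qed

lemma supp_upward:
  assumes "module R M" "\<pp> \<in> supp R M" "primeideal \<qq> R" "\<pp> \<subseteq> \<qq>"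
  shows "\<qq> \<in> supp R M"
proof -
  obtain x where "x \<in> carrier M" "\<And>s. s \<in> carrier R - \<pp> \<Longrightarrow> s \<odot>\<^bsub>M\<^esub> x \<noteq> \<zero>\<^bsub>M\<^esub>"
    using assms(2) by (auto simp: supp_iff[OF assms(1)])
  then show ?thesis using assms(3,4) by (subst supp_iff[OF assms(1)]) blast
qed

lemma supp_annihilator:
  assumes "module R M" "\<pp> \<in> supp R M" "r \<in> carrier R" "\<And>x. x \<in> carrier M \<Longrightarrow> r \<odot>\<^bsub>M\<^esub> x = \<zero>\<^bsub>M\<^esub>"
  shows "r \<in> \<pp>"
  using assms by (auto simp: supp_iff[OF assms(1)])

lemma (in abelian_group)
  assumes "x \<in> carrier G" "y \<in> carrier G" "z \<in> carrier G"
  shows minus_minus_left: "(x \<ominus> y) \<ominus> (x \<ominus> z) = z \<ominus> y"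
    and minus_minus_right: "(x \<ominus> y) \<ominus> (z \<ominus> y) = x \<ominus> z"
proof -
  have "(x \<ominus> y) \<ominus> (x \<ominus> z) = (x \<oplus> \<ominus> x) \<oplus> (z \<oplus> \<ominus> y)"
    using assms by (simp add: a_minus_def minus_add a_ac)
  then show "(x \<ominus> y) \<ominus> (x \<ominus> z) = z \<ominus> y" using assms by (simp add: r_neg a_minus_def)
  have "(x \<ominus> y) \<ominus> (z \<ominus> y) = (y \<oplus> \<ominus> y) \<oplus> (x \<oplus> \<ominus> z)"
    using assms by (simp add: a_minus_def minus_add a_ac)
  then show "(x \<ominus> y) \<ominus> (z \<ominus> y) = x \<ominus> z" using assms by (simp add: r_neg a_minus_def)
qed

section \<open>Maps to \<open>R / \<pp>\<close>\<close>

lemma regular_quot: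
  assumes "cring R" "ideal \<pp> R"
  shows "module R (quot_module (regular_module R) \<pp>)"
    and "(\<lambda>r. \<pp> +>\<^bsub>regular_module R\<^esub> r) \<in> mod_hom R (regular_module R) (quot_module (regular_module R) \<pp>)"
    and "carrier (quot_module (regular_module R) \<pp>) = (\<lambda>r. \<pp> +>\<^bsub>regular_module R\<^esub> r) ` carrier R"
    and "\<zero>\<^bsub>quot_module (regular_module R) \<pp>\<^esub> = \<pp>"
    and "r \<in> carrier R \<Longrightarrow> \<pp> +>\<^bsub>regular_module R\<^esub> r = \<pp> \<longleftrightarrow> r \<in> \<pp>"
proof -
  note m = regular_module_module[OF assms(1)]
  have s: "submodule \<pp> R (regular_module R)" using assms by (simp add: regular_submodule_iff)
  show "module R (quot_module (regular_module R) \<pp>)"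
    "(\<lambda>r. \<pp> +>\<^bsub>regular_module R\<^esub> r) \<in> mod_hom R (regular_module R) (quot_module (regular_module R) \<pp>)"
    "carrier (quot_module (regular_module R) \<pp>) = (\<lambda>r. \<pp> +>\<^bsub>regular_module R\<^esub> r) ` carrier R"
    "\<zero>\<^bsub>quot_module (regular_module R) \<pp>\<^esub> = \<pp>"
    "r \<in> carrier R \<Longrightarrow> \<pp> +>\<^bsub>regular_module R\<^esub> r = \<pp> \<longleftrightarrow> r \<in> \<pp>"
    using quot_module_module[OF m s] quot_module_proj[OF m s] quot_module_carrier[OF m s]
      quot_module_zero[OF m s] coset_zero_iff[OF m s, of r] by (simp_all add: regular_module_simps)
qed

text \<open>
  \<open>quotient_map R M N s x y\<close> is the class of the fraction \<open>s y / x\<close> modulo \<open>N\<close>, that is, of those \<open>r\<close>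
  with \<open>s y \<equiv> r x\<close> modulo \<open>N\<close>; they form a coset of \<open>colon R M N x\<close>.
\<close>

definition quotient_map ::
  "('a, 'm) ring_scheme \<Rightarrow> ('a, 'b) module \<Rightarrow> 'b set \<Rightarrow> 'a \<Rightarrow> 'b \<Rightarrow> 'b \<Rightarrow> 'a set" where
  "quotient_map R M N s x y = {r \<in> carrier R. s \<odot>\<^bsub>M\<^esub> y \<ominus>\<^bsub>M\<^esub> r \<odot>\<^bsub>M\<^esub> x \<in> N}"

text \<open>Two admissible \<open>r\<close> differ by an element of the colon ideal. Given that
  every \<open>y\<close> in \<open>D\<close> has an admissible \<open>r\<close>, linearity follows
  because these add and scale along with \<open>y\<close>.\<close>

lemma
  assumes M: "module R M" and N: "submodule N R M" and x: "x \<in> carrier M" and s: "s \<in> carrier R"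
  shows quotient_map_eq: "\<lbrakk>y \<in> carrier M; r \<in> carrier R; s \<odot>\<^bsub>M\<^esub> y \<ominus>\<^bsub>M\<^esub> r \<odot>\<^bsub>M\<^esub> x \<in> N\<rbrakk> \<Longrightarrow>
      quotient_map R M N s x y = colon R M N x +>\<^bsub>regular_module R\<^esub> r"
    and quotient_map_hom: "\<lbrakk>submodule D R M; \<And>y. y \<in> D \<Longrightarrow> \<exists>r\<in>carrier R. s \<odot>\<^bsub>M\<^esub> y \<ominus>\<^bsub>M\<^esub> r \<odot>\<^bsub>M\<^esub> x \<in> N\<rbrakk> \<Longrightarrow>
      quotient_map R M N s x \<in> mod_hom R (M\<lparr>carrier := D\<rparr>) (quot_module (regular_module R) (colon R M N x))"
proof -
  interpret module R M by fact
  let ?p = "colon R M N x"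
  note p = colon_ideal[OF M N x]
  note q = regular_quot[OF R.is_cring p]
  have sp: "submodule ?p R (regular_module R)" by (simp add: regular_submodule_iff[OF R.is_cring] p)
  show eq: "quotient_map R M N s x y = ?p +>\<^bsub>regular_module R\<^esub> r"
    if y: "y \<in> carrier M" and r: "r \<in> carrier R" "s \<odot>\<^bsub>M\<^esub> y \<ominus>\<^bsub>M\<^esub> r \<odot>\<^bsub>M\<^esub> x \<in> N" for y r
  proof (rule Set.set_eqI)
    fix r'
    have "r' \<in> quotient_map R M N s x y \<longleftrightarrow> r' \<ominus>\<^bsub>R\<^esub> r \<in> ?p" if r': "r' \<in> carrier R"
    proof -
      have sm: "(r' \<ominus>\<^bsub>R\<^esub> r) \<odot>\<^bsub>M\<^esub> x = r' \<odot>\<^bsub>M\<^esub> x \<ominus>\<^bsub>M\<^esub> r \<odot>\<^bsub>M\<^esub> x"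
        using x r(1) r' by (simp add: a_minus_def smult_l_distr smult_l_minus)
      have d: "(s \<odot>\<^bsub>M\<^esub> y \<ominus>\<^bsub>M\<^esub> r \<odot>\<^bsub>M\<^esub> x) \<ominus>\<^bsub>M\<^esub> (s \<odot>\<^bsub>M\<^esub> y \<ominus>\<^bsub>M\<^esub> r' \<odot>\<^bsub>M\<^esub> x) = (r' \<ominus>\<^bsub>R\<^esub> r) \<odot>\<^bsub>M\<^esub> x"
        using s x y r(1) r' sm by (simp add: M.minus_minus_left)
      have d': "s \<odot>\<^bsub>M\<^esub> y \<ominus>\<^bsub>M\<^esub> r' \<odot>\<^bsub>M\<^esub> x = (s \<odot>\<^bsub>M\<^esub> y \<ominus>\<^bsub>M\<^esub> r \<odot>\<^bsub>M\<^esub> x) \<ominus>\<^bsub>M\<^esub> (r' \<ominus>\<^bsub>R\<^esub> r) \<odot>\<^bsub>M\<^esub> x"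
        using s x y r(1) r' sm by (simp add: M.minus_minus_right)
      show ?thesis
        using r' r d d' submodule_minus[OF N M, of "s \<odot>\<^bsub>M\<^esub> y \<ominus>\<^bsub>M\<^esub> r \<odot>\<^bsub>M\<^esub> x" "s \<odot>\<^bsub>M\<^esub> y \<ominus>\<^bsub>M\<^esub> r' \<odot>\<^bsub>M\<^esub> x"]
          submodule_minus[OF N M, of "s \<odot>\<^bsub>M\<^esub> y \<ominus>\<^bsub>M\<^esub> r \<odot>\<^bsub>M\<^esub> x" "(r' \<ominus>\<^bsub>R\<^esub> r) \<odot>\<^bsub>M\<^esub> x"]
        by (auto simp: quotient_map_def colon_def)
    qed
    then show "r' \<in> quotient_map R M N s x y \<longleftrightarrow> r' \<in> ?p +>\<^bsub>regular_module R\<^esub> r"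
      using coset_mem[OF regular_module_module[OF R.is_cring] sp, of r r'] r(1)
      by (auto simp: regular_module_simps regular_minus quotient_map_def)
  qed
  show "quotient_map R M N s x \<in> mod_hom R (M\<lparr>carrier := D\<rparr>) (quot_module (regular_module R) ?p)"
    if D: "submodule D R M" and w: "\<And>y. y \<in> D \<Longrightarrow> \<exists>r\<in>carrier R. s \<odot>\<^bsub>M\<^esub> y \<ominus>\<^bsub>M\<^esub> r \<odot>\<^bsub>M\<^esub> x \<in> N"
  proof (rule mod_homI)
    note DM = submodule_subset[OF D M]
    fix y assume "y \<in> carrier (M\<lparr>carrier := D\<rparr>)"
    then have y: "y \<in> D" "y \<in> carrier M" using DM by auto
    obtain r where r: "r \<in> carrier R" "s \<odot>\<^bsub>M\<^esub> y \<ominus>\<^bsub>M\<^esub> r \<odot>\<^bsub>M\<^esub> x \<in> N" using w[OF y(1)] by blast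
    show "quotient_map R M N s x y \<in> carrier (quot_module (regular_module R) ?p)"
      using eq[OF y(2) r] r(1) by (simp add: q(3))
    fix y' assume "y' \<in> carrier (M\<lparr>carrier := D\<rparr>)"
    then have y': "y' \<in> D" "y' \<in> carrier M" using DM by auto
    obtain r' where r': "r' \<in> carrier R" "s \<odot>\<^bsub>M\<^esub> y' \<ominus>\<^bsub>M\<^esub> r' \<odot>\<^bsub>M\<^esub> x \<in> N" using w[OF y'(1)] by blast
    have "s \<odot>\<^bsub>M\<^esub> (y \<oplus>\<^bsub>M\<^esub> y') \<ominus>\<^bsub>M\<^esub> (r \<oplus>\<^bsub>R\<^esub> r') \<odot>\<^bsub>M\<^esub> x =
        (s \<odot>\<^bsub>M\<^esub> y \<ominus>\<^bsub>M\<^esub> r \<odot>\<^bsub>M\<^esub> x) \<oplus>\<^bsub>M\<^esub> (s \<odot>\<^bsub>M\<^esub> y' \<ominus>\<^bsub>M\<^esub> r' \<odot>\<^bsub>M\<^esub> x)"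
      using s x y y' r(1) r'(1) by (simp add: a_minus_def smult_l_distr smult_r_distr M.minus_add M.a_ac)
    then have "s \<odot>\<^bsub>M\<^esub> (y \<oplus>\<^bsub>M\<^esub> y') \<ominus>\<^bsub>M\<^esub> (r \<oplus>\<^bsub>R\<^esub> r') \<odot>\<^bsub>M\<^esub> x \<in> N" using submodule_add[OF N M r(2) r'(2)] by simp
    then show "quotient_map R M N s x (y \<oplus>\<^bsub>M\<lparr>carrier := D\<rparr>\<^esub> y') =
        quotient_map R M N s x y \<oplus>\<^bsub>quot_module (regular_module R) ?p\<^esub> quotient_map R M N s x y'"
      using y y' r r' eq[OF y(2) r] eq[OF y'(2) r'] eq[of "y \<oplus>\<^bsub>M\<^esub> y'" "r \<oplus>\<^bsub>R\<^esub> r'"]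
        mod_hom_add[OF q(2), of r r'] by (simp add: regular_module_simps)
  next
    note DM = submodule_subset[OF D M]
    fix a y assume a: "a \<in> carrier R" and "y \<in> carrier (M\<lparr>carrier := D\<rparr>)"
    then have y: "y \<in> D" "y \<in> carrier M" using DM by auto
    obtain r where r: "r \<in> carrier R" "s \<odot>\<^bsub>M\<^esub> y \<ominus>\<^bsub>M\<^esub> r \<odot>\<^bsub>M\<^esub> x \<in> N" using w[OF y(1)] by blast
    have "s \<odot>\<^bsub>M\<^esub> (a \<odot>\<^bsub>M\<^esub> y) \<ominus>\<^bsub>M\<^esub> (a \<otimes>\<^bsub>R\<^esub> r) \<odot>\<^bsub>M\<^esub> x = a \<odot>\<^bsub>M\<^esub> (s \<odot>\<^bsub>M\<^esub> y \<ominus>\<^bsub>M\<^esub> r \<odot>\<^bsub>M\<^esub> x)"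
      using s x y r(1) a by (simp add: a_minus_def smult_r_distr smult_r_minus R.m_comm flip: smult_assoc1)
    then have "s \<odot>\<^bsub>M\<^esub> (a \<odot>\<^bsub>M\<^esub> y) \<ominus>\<^bsub>M\<^esub> (a \<otimes>\<^bsub>R\<^esub> r) \<odot>\<^bsub>M\<^esub> x \<in> N" using submodule_smult[OF N M a r(2)] by simp
    then show "quotient_map R M N s x (a \<odot>\<^bsub>M\<lparr>carrier := D\<rparr>\<^esub> y) =
        a \<odot>\<^bsub>quot_module (regular_module R) ?p\<^esub> quotient_map R M N s x y"
      using y r a eq[OF y(2) r] eq[of "a \<odot>\<^bsub>M\<^esub> y" "a \<otimes>\<^bsub>R\<^esub> r"] mod_hom_smult[OF q(2) a, of r] by (simp add: regular_module_simps)
  qed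
qed

text \<open>The isomorphism of \<open>(N + R x) / N\<close> with \<open>R / (N : x)\<close>, stated
  as a surjection with kernel \<open>N\<close>, which is the shape that the short exact sequences
  require.\<close>

lemma cyclic_extension:
  assumes M: "module R M" and N: "submodule N R M" and x: "x \<in> carrier M"
  defines "N' \<equiv> submodule_sum M N (cyclic R M x)" and "\<pp> \<equiv> colon R M N x"
  obtains g where "g \<in> mod_hom R (M\<lparr>carrier := N'\<rparr>) (quot_module (regular_module R) \<pp>)"
    "g ` N' = carrier (quot_module (regular_module R) \<pp>)"
    "N = {y \<in> N'. g y = \<zero>\<^bsub>quot_module (regular_module R) \<pp>\<^esub>}"
proof
  interpret module R M by fact
  note cx = cyclic_submodule[OF M x]
  have N': "submodule N' R M" unfolding N'_def by (rule submodule_sum_submodule[OF N M cx(1)])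
  note NM = submodule_subset[OF N M] and N'M = submodule_subset[OF N' M]
  note q = regular_quot[OF R.is_cring colon_ideal[OF M N x], folded \<pp>_def]
  let ?g = "quotient_map R M N \<one>\<^bsub>R\<^esub> x"
  note eq = quotient_map_eq[OF M N x R.one_closed, folded \<pp>_def]
  have w: "\<exists>r\<in>carrier R. \<one>\<^bsub>R\<^esub> \<odot>\<^bsub>M\<^esub> y \<ominus>\<^bsub>M\<^esub> r \<odot>\<^bsub>M\<^esub> x \<in> N" if y: "y \<in> N'" for y
  proof -
    obtain n r where *: "n \<in> N" "r \<in> carrier R" "y = n \<oplus>\<^bsub>M\<^esub> r \<odot>\<^bsub>M\<^esub> x"
      using y by (auto simp: N'_def submodule_sum_def cyclic_def)
    then have "\<one>\<^bsub>R\<^esub> \<odot>\<^bsub>M\<^esub> y \<ominus>\<^bsub>M\<^esub> r \<odot>\<^bsub>M\<^esub> x = n"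
      using NM x M.add_minus_cancel[of "r \<odot>\<^bsub>M\<^esub> x" n] by (auto simp: M.a_comm subset_iff)
    with *(1,2) show ?thesis by (intro bexI[of _ r]) simp_all
  qed
  show h: "?g \<in> mod_hom R (M\<lparr>carrier := N'\<rparr>) (quot_module (regular_module R) \<pp>)"
    unfolding \<pp>_def by (rule quotient_map_hom[OF M N x R.one_closed N' w])
  show "?g ` N' = carrier (quot_module (regular_module R) \<pp>)"
  proof
    show "?g ` N' \<subseteq> carrier (quot_module (regular_module R) \<pp>)" using mod_hom_closed[OF h] by auto
    show "carrier (quot_module (regular_module R) \<pp>) \<subseteq> ?g ` N'"
    proof
      fix X assume "X \<in> carrier (quot_module (regular_module R) \<pp>)"
      then obtain r where r: "r \<in> carrier R" "X = \<pp> +>\<^bsub>regular_module R\<^esub> r" by (auto simp: q(3))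
      have "r \<odot>\<^bsub>M\<^esub> x \<in> N'"
        using r submodule_sum_right[OF N M cx(1)] by (auto simp: N'_def cyclic_def)
      moreover have "?g (r \<odot>\<^bsub>M\<^esub> x) = X"
        unfolding r(2) using r(1) x submodule_zero[OF N M] by (intro eq) (auto simp: M.minus_eq_zero_iff[THEN iffD2])
      ultimately show "X \<in> ?g ` N'" by blast
    qed
  qed
  have "?g y = \<pp> \<longleftrightarrow> y \<in> N" if y: "y \<in> N'" for y
  proof -
    obtain r where r: "r \<in> carrier R" "\<one>\<^bsub>R\<^esub> \<odot>\<^bsub>M\<^esub> y \<ominus>\<^bsub>M\<^esub> r \<odot>\<^bsub>M\<^esub> x \<in> N" using w[OF y] by blast
    have yM: "y \<in> carrier M" using y N'M by auto
    have "?g y = \<pp> \<longleftrightarrow> r \<in> \<pp>" using eq[OF yM r] q(5)[OF r(1)] by simp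
    also have "\<dots> \<longleftrightarrow> r \<odot>\<^bsub>M\<^esub> x \<in> N" using r(1) by (simp add: \<pp>_def colon_def)
    also have "\<dots> \<longleftrightarrow> y \<in> N"
    proof
      have e: "y = (\<one>\<^bsub>R\<^esub> \<odot>\<^bsub>M\<^esub> y \<ominus>\<^bsub>M\<^esub> r \<odot>\<^bsub>M\<^esub> x) \<oplus>\<^bsub>M\<^esub> r \<odot>\<^bsub>M\<^esub> x"
        using yM r(1) x by (simp add: a_minus_def M.a_assoc M.l_neg)
      assume "r \<odot>\<^bsub>M\<^esub> x \<in> N"
      then show "y \<in> N" using submodule_add[OF N M r(2)] e by metis
    next
      have e: "r \<odot>\<^bsub>M\<^esub> x = y \<ominus>\<^bsub>M\<^esub> (\<one>\<^bsub>R\<^esub> \<odot>\<^bsub>M\<^esub> y \<ominus>\<^bsub>M\<^esub> r \<odot>\<^bsub>M\<^esub> x)"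
        using yM r(1) x by (simp add: a_minus_def M.minus_add M.r_neg2 M.a_ac M.r_neg1)
      assume "y \<in> N"
      then show "r \<odot>\<^bsub>M\<^esub> x \<in> N" using submodule_minus[OF N M _ r(2)] e by metis
    qed
    finally show ?thesis .
  qed
  moreover have "N \<subseteq> N'" unfolding N'_def by (rule submodule_sum_left[OF N M cx(1)])
  ultimately show "N = {y \<in> N'. ?g y = \<zero>\<^bsub>quot_module (regular_module R) \<pp>\<^esub>}" by (auto simp: q(4))
qed

text \<open>\<open>M\<close> localized at \<open>\<pp>\<close> is nonzero and finitely generated, so
  it maps onto the residue field of \<open>\<pp>\<close>. Since \<open>M\<close> is Noetherian, one
  denominator clears all values, and the map from \<open>M\<close> lands in
  \<open>R / \<pp>\<close>. The proof builds this inside \<open>M\<close>, with \<open>N\<close> as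
  kernel and \<open>x0\<close> as the element with value 1.\<close>

lemma supp_functional:
  assumes nM: "noetherian_module R M" and \<pp>: "\<pp> \<in> supp R M"
  obtains h x where "h \<in> mod_hom R M (quot_module (regular_module R) \<pp>)" "x \<in> carrier M"
    "h x \<noteq> \<zero>\<^bsub>quot_module (regular_module R) \<pp>\<^esub>"
proof -
  note M = noetherian_moduleD[OF nM]
  interpret module R M by (rule M)
  interpret P: primeideal \<pp> R by (rule suppD[OF \<pp>])
  define S where "S = carrier R - \<pp>"
  have S: "mult_closed R S" unfolding S_def by (rule prime_complement_mult_closed[OF suppD[OF \<pp>]])
  have SR: "s \<in> S \<Longrightarrow> s \<in> carrier R" and S1: "\<one>\<^bsub>R\<^esub> \<in> S" and Sm: "\<lbrakk>s \<in> S; t \<in> S\<rbrakk> \<Longrightarrow> s \<otimes>\<^bsub>R\<^esub> t \<in> S" for s t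
    using S by (auto simp: mult_closed_def)
  \<comment> \<open>The localization of \<open>M / N\<close> at \<open>\<pp>\<close> is nonzero. A
    maximal \<open>N\<close> of this kind leaves a simple localization.\<close>
  let ?P = "\<lambda>N. \<exists>x\<in>carrier M. \<forall>s\<in>S. s \<odot>\<^bsub>M\<^esub> x \<notin> N"
  have "?P {\<zero>\<^bsub>M\<^esub>}" using \<pp> by (auto simp: supp_iff[OF M] S_def)
  with submodule_zero_submodule[OF M] obtain N where N: "submodule N R M" and PN: "?P N"
    and max: "\<forall>H'. submodule H' R M \<longrightarrow> ?P H' \<longrightarrow> N \<subseteq> H' \<longrightarrow> H' = N"
    by (rule noetherian_module_maximal[OF nM, where P = ?P])
  note NM = submodule_subset[OF N M]
  obtain x0 where x0: "x0 \<in> carrier M" "\<And>s. s \<in> S \<Longrightarrow> s \<odot>\<^bsub>M\<^esub> x0 \<notin> N" using PN by blast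
  have x0N: "x0 \<notin> N" using x0(2)[OF S1] x0(1) by simp
  \<comment> \<open>\<open>N\<close> is saturated: multiplying elements into \<open>N\<close> by
    something outside \<open>\<pp>\<close> defines a larger submodule with the same property, so it
    equals \<open>N\<close>.\<close>
  have closed: "y \<in> N" if y: "y \<in> carrier M" and s: "s \<in> S" "s \<odot>\<^bsub>M\<^esub> y \<in> N" for y s
  proof -
    let ?N = "{y \<in> carrier M. \<exists>s\<in>S. s \<odot>\<^bsub>M\<^esub> y \<in> N}"
    have sub: "submodule ?N R M"
    proof (rule submoduleI'[OF M])
      fix y z assume "y \<in> ?N" "z \<in> ?N"
      then obtain s t where *: "y \<in> carrier M" "z \<in> carrier M" "s \<in> S" "t \<in> S" "s \<odot>\<^bsub>M\<^esub> y \<in> N" "t \<odot>\<^bsub>M\<^esub> z \<in> N"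
        by blast
      have "(s \<otimes>\<^bsub>R\<^esub> t) \<odot>\<^bsub>M\<^esub> (y \<oplus>\<^bsub>M\<^esub> z) = t \<odot>\<^bsub>M\<^esub> (s \<odot>\<^bsub>M\<^esub> y) \<oplus>\<^bsub>M\<^esub> s \<odot>\<^bsub>M\<^esub> (t \<odot>\<^bsub>M\<^esub> z)"
        using * by (simp add: SR smult_r_distr R.m_comm flip: smult_assoc1)
      also have "\<dots> \<in> N"
        by (rule submodule_add[OF N M submodule_smult[OF N M SR[OF *(4)] *(5)] submodule_smult[OF N M SR[OF *(3)] *(6)]])
      finally show "y \<oplus>\<^bsub>M\<^esub> z \<in> ?N" using * Sm by blast
    next
      fix r y assume r: "r \<in> carrier R" and "y \<in> ?N"
      then obtain s where *: "y \<in> carrier M" "s \<in> S" "s \<odot>\<^bsub>M\<^esub> y \<in> N" by blast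
      have "s \<odot>\<^bsub>M\<^esub> (r \<odot>\<^bsub>M\<^esub> y) = r \<odot>\<^bsub>M\<^esub> (s \<odot>\<^bsub>M\<^esub> y)"
        using * r by (simp add: SR R.m_comm flip: smult_assoc1)
      also have "\<dots> \<in> N" using * by (intro submodule_smult[OF N M r])
      finally show "r \<odot>\<^bsub>M\<^esub> y \<in> ?N" using * r by blast
    next
      have "\<one>\<^bsub>R\<^esub> \<odot>\<^bsub>M\<^esub> \<zero>\<^bsub>M\<^esub> \<in> N" using submodule_zero[OF N M] by simp
      then show "\<zero>\<^bsub>M\<^esub> \<in> ?N" using S1 by blast
    qed blast
    have "s \<odot>\<^bsub>M\<^esub> x0 \<notin> ?N" if s: "s \<in> S" for s
    proof
      assume "s \<odot>\<^bsub>M\<^esub> x0 \<in> ?N"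
      then obtain t where t: "t \<in> S" "t \<odot>\<^bsub>M\<^esub> (s \<odot>\<^bsub>M\<^esub> x0) \<in> N" by blast
      then have "(t \<otimes>\<^bsub>R\<^esub> s) \<odot>\<^bsub>M\<^esub> x0 \<in> N" using s x0(1) by (simp add: SR smult_assoc1)
      then show False using x0(2)[OF Sm[OF t(1) s]] by simp
    qed
    then have "?P ?N" using x0(1) by blast
    moreover have "N \<subseteq> ?N"
    proof
      fix y assume y: "y \<in> N"
      then have "\<one>\<^bsub>R\<^esub> \<odot>\<^bsub>M\<^esub> y \<in> N" using NM by auto
      then show "y \<in> ?N" using y NM S1 by blast
    qed
    ultimately have "?N = N" using max[rule_format, OF sub] by blast
    then show ?thesis using y s by blast
  qed
  \<comment> \<open>After localization \<open>M / N\<close> is one-dimensional: every class is a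
    fraction times any given nonzero class, because adding that class to \<open>N\<close> destroys
    the property.\<close>
  have span: "\<exists>s\<in>S. \<exists>r\<in>carrier R. s \<odot>\<^bsub>M\<^esub> x \<ominus>\<^bsub>M\<^esub> r \<odot>\<^bsub>M\<^esub> y \<in> N"
    if x: "x \<in> carrier M" and y: "y \<in> carrier M" "y \<notin> N" for x y
  proof -
    note cy = cyclic_submodule[OF M y(1)]
    let ?N = "submodule_sum M N (cyclic R M y)"
    have "?N \<noteq> N" using submodule_sum_right[OF N M cy(1)] cy(2) y(2) by blast
    then have "\<not> ?P ?N"
      using max[rule_format, OF submodule_sum_submodule[OF N M cy(1)] _ submodule_sum_left[OF N M cy(1)]] by blast
    then obtain s where s: "s \<in> S" "s \<odot>\<^bsub>M\<^esub> x \<in> ?N" using x by blast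
    then obtain n r where nr: "n \<in> N" "r \<in> carrier R" "s \<odot>\<^bsub>M\<^esub> x = n \<oplus>\<^bsub>M\<^esub> r \<odot>\<^bsub>M\<^esub> y"
      by (auto simp: submodule_sum_def cyclic_def)
    then have "s \<odot>\<^bsub>M\<^esub> x \<ominus>\<^bsub>M\<^esub> r \<odot>\<^bsub>M\<^esub> y = n"
      using NM y M.add_minus_cancel[of "r \<odot>\<^bsub>M\<^esub> y" n] by (auto simp: M.a_comm subset_iff)
    then show ?thesis using s nr by blast
  qed
  \<comment> \<open>If \<open>a x\<close> were outside \<open>N\<close>, it would span, giving
    \<open>(s - r a) x\<close> in \<open>N\<close>. As \<open>a\<close> is in \<open>\<pp>\<close>,
    the factor \<open>s - r a\<close> is outside \<open>\<pp>\<close>, and saturation puts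
    \<open>x\<close> into \<open>N\<close>.\<close>
  have pN: "a \<odot>\<^bsub>M\<^esub> x \<in> N" if a: "a \<in> \<pp>" and x: "x \<in> carrier M" for a x
  proof (rule ccontr)
    assume ax: "a \<odot>\<^bsub>M\<^esub> x \<notin> N"
    have aR: "a \<in> carrier R" using a by (rule P.Icarr)
    have axM: "a \<odot>\<^bsub>M\<^esub> x \<in> carrier M" using aR x by simp
    obtain s r where sr: "s \<in> S" "r \<in> carrier R" "s \<odot>\<^bsub>M\<^esub> x \<ominus>\<^bsub>M\<^esub> r \<odot>\<^bsub>M\<^esub> (a \<odot>\<^bsub>M\<^esub> x) \<in> N"
      using span[OF x axM ax] by blast
    have e: "(s \<ominus>\<^bsub>R\<^esub> r \<otimes>\<^bsub>R\<^esub> a) \<odot>\<^bsub>M\<^esub> x = s \<odot>\<^bsub>M\<^esub> x \<ominus>\<^bsub>M\<^esub> r \<odot>\<^bsub>M\<^esub> (a \<odot>\<^bsub>M\<^esub> x)"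
      using sr(1,2) aR x by (simp add: SR a_minus_def smult_l_distr smult_l_minus smult_assoc1)
    have "s \<ominus>\<^bsub>R\<^esub> r \<otimes>\<^bsub>R\<^esub> a \<in> S"
    proof -
      have ra: "r \<otimes>\<^bsub>R\<^esub> a \<in> \<pp>" by (rule P.I_l_closed[OF a sr(2)])
      have "s \<in> \<pp>" if "s \<ominus>\<^bsub>R\<^esub> r \<otimes>\<^bsub>R\<^esub> a \<in> \<pp>"
      proof -
        have "(s \<ominus>\<^bsub>R\<^esub> r \<otimes>\<^bsub>R\<^esub> a) \<oplus>\<^bsub>R\<^esub> r \<otimes>\<^bsub>R\<^esub> a \<in> \<pp>" by (rule P.a_closed[OF that ra])
        then show ?thesis using sr(1,2) aR by (simp add: SR a_minus_def R.a_assoc R.l_neg)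
      qed
      then show ?thesis using sr(1,2) aR by (auto simp: S_def)
    qed
    then have "x \<in> N" using closed[OF x] sr(3) e by metis
    then show False using ax submodule_smult[OF N M aR] by blast
  qed
  have colon: "colon R M N x0 = \<pp>"
  proof
    show "\<pp> \<subseteq> colon R M N x0" using pN x0(1) P.Icarr by (auto simp: colon_def)
    show "colon R M N x0 \<subseteq> \<pp>" using x0(2) by (auto simp: colon_def S_def)
  qed
  \<comment> \<open>\<open>D s\<close> collects the elements whose coefficient with respect to
    \<open>x0\<close> can be written with denominator \<open>s\<close>. These submodules grow with
    multiples of \<open>s\<close>, so a maximal one is all of \<open>M\<close> and \<open>s\<close>
    is a common denominator.\<close>
  define D where "D s = {y \<in> carrier M. \<exists>r\<in>carrier R. s \<odot>\<^bsub>M\<^esub> y \<ominus>\<^bsub>M\<^esub> r \<odot>\<^bsub>M\<^esub> x0 \<in> N}" for s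
  have D: "submodule (D s) R M" if s: "s \<in> carrier R" for s
  proof (rule submoduleI'[OF M])
    fix y z assume "y \<in> D s" "z \<in> D s"
    then obtain r r' where *: "y \<in> carrier M" "z \<in> carrier M" "r \<in> carrier R" "r' \<in> carrier R"
      "s \<odot>\<^bsub>M\<^esub> y \<ominus>\<^bsub>M\<^esub> r \<odot>\<^bsub>M\<^esub> x0 \<in> N" "s \<odot>\<^bsub>M\<^esub> z \<ominus>\<^bsub>M\<^esub> r' \<odot>\<^bsub>M\<^esub> x0 \<in> N"
      unfolding D_def by blast
    have "s \<odot>\<^bsub>M\<^esub> (y \<oplus>\<^bsub>M\<^esub> z) \<ominus>\<^bsub>M\<^esub> (r \<oplus>\<^bsub>R\<^esub> r') \<odot>\<^bsub>M\<^esub> x0 =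
        (s \<odot>\<^bsub>M\<^esub> y \<ominus>\<^bsub>M\<^esub> r \<odot>\<^bsub>M\<^esub> x0) \<oplus>\<^bsub>M\<^esub> (s \<odot>\<^bsub>M\<^esub> z \<ominus>\<^bsub>M\<^esub> r' \<odot>\<^bsub>M\<^esub> x0)"
      using s x0(1) *(1-4) by (simp add: a_minus_def smult_l_distr smult_r_distr M.minus_add M.a_ac)
    then have "s \<odot>\<^bsub>M\<^esub> (y \<oplus>\<^bsub>M\<^esub> z) \<ominus>\<^bsub>M\<^esub> (r \<oplus>\<^bsub>R\<^esub> r') \<odot>\<^bsub>M\<^esub> x0 \<in> N"
      using submodule_add[OF N M *(5,6)] by simp
    moreover have "y \<oplus>\<^bsub>M\<^esub> z \<in> carrier M" "r \<oplus>\<^bsub>R\<^esub> r' \<in> carrier R" using * by simp_all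
    ultimately show "y \<oplus>\<^bsub>M\<^esub> z \<in> D s" unfolding D_def by blast
  next
    fix a y assume a: "a \<in> carrier R" and "y \<in> D s"
    then obtain r where *: "y \<in> carrier M" "r \<in> carrier R" "s \<odot>\<^bsub>M\<^esub> y \<ominus>\<^bsub>M\<^esub> r \<odot>\<^bsub>M\<^esub> x0 \<in> N"
      unfolding D_def by blast
    have "s \<odot>\<^bsub>M\<^esub> (a \<odot>\<^bsub>M\<^esub> y) \<ominus>\<^bsub>M\<^esub> (a \<otimes>\<^bsub>R\<^esub> r) \<odot>\<^bsub>M\<^esub> x0 = a \<odot>\<^bsub>M\<^esub> (s \<odot>\<^bsub>M\<^esub> y \<ominus>\<^bsub>M\<^esub> r \<odot>\<^bsub>M\<^esub> x0)"
      using s x0(1) *(1,2) a by (simp add: a_minus_def smult_r_distr smult_r_minus R.m_comm flip: smult_assoc1)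
    then have "s \<odot>\<^bsub>M\<^esub> (a \<odot>\<^bsub>M\<^esub> y) \<ominus>\<^bsub>M\<^esub> (a \<otimes>\<^bsub>R\<^esub> r) \<odot>\<^bsub>M\<^esub> x0 \<in> N"
      using submodule_smult[OF N M a *(3)] by simp
    moreover have "a \<odot>\<^bsub>M\<^esub> y \<in> carrier M" "a \<otimes>\<^bsub>R\<^esub> r \<in> carrier R" using * a by simp_all
    ultimately show "a \<odot>\<^bsub>M\<^esub> y \<in> D s" unfolding D_def by blast
  next
    have "s \<odot>\<^bsub>M\<^esub> \<zero>\<^bsub>M\<^esub> \<ominus>\<^bsub>M\<^esub> \<zero>\<^bsub>R\<^esub> \<odot>\<^bsub>M\<^esub> x0 \<in> N" using s x0(1) submodule_zero[OF N M] by simp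
    then show "\<zero>\<^bsub>M\<^esub> \<in> D s" unfolding D_def by blast
  qed (auto simp: D_def)
  have Dmult: "D s \<subseteq> D (t \<otimes>\<^bsub>R\<^esub> s)" if s: "s \<in> carrier R" and t: "t \<in> carrier R" for s t
  proof
    fix y assume "y \<in> D s"
    then obtain r where *: "y \<in> carrier M" "r \<in> carrier R" "s \<odot>\<^bsub>M\<^esub> y \<ominus>\<^bsub>M\<^esub> r \<odot>\<^bsub>M\<^esub> x0 \<in> N"
      unfolding D_def by blast
    have "(t \<otimes>\<^bsub>R\<^esub> s) \<odot>\<^bsub>M\<^esub> y \<ominus>\<^bsub>M\<^esub> (t \<otimes>\<^bsub>R\<^esub> r) \<odot>\<^bsub>M\<^esub> x0 = t \<odot>\<^bsub>M\<^esub> (s \<odot>\<^bsub>M\<^esub> y \<ominus>\<^bsub>M\<^esub> r \<odot>\<^bsub>M\<^esub> x0)"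
      using s t x0(1) *(1,2) by (simp add: a_minus_def smult_r_distr smult_r_minus smult_assoc1)
    then have "(t \<otimes>\<^bsub>R\<^esub> s) \<odot>\<^bsub>M\<^esub> y \<ominus>\<^bsub>M\<^esub> (t \<otimes>\<^bsub>R\<^esub> r) \<odot>\<^bsub>M\<^esub> x0 \<in> N"
      using submodule_smult[OF N M t *(3)] by simp
    moreover have "t \<otimes>\<^bsub>R\<^esub> r \<in> carrier R" using t * by simp
    ultimately show "y \<in> D (t \<otimes>\<^bsub>R\<^esub> s)" unfolding D_def using *(1) by blast
  qed
  have "\<exists>s\<in>S. D \<one>\<^bsub>R\<^esub> = D s" using S1 by blast
  with D[OF R.one_closed] obtain H where "submodule H R M" "\<exists>s\<in>S. H = D s"
    and maxD: "\<forall>H'. submodule H' R M \<longrightarrow> (\<exists>s\<in>S. H' = D s) \<longrightarrow> H \<subseteq> H' \<longrightarrow> H' = H"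
    by (rule noetherian_module_maximal[OF nM, where P = "\<lambda>H. \<exists>s\<in>S. H = D s"])
  then obtain s where s: "s \<in> S" "H = D s" by blast
  have "y \<in> D s" if y: "y \<in> carrier M" for y
  proof -
    obtain t r where tr: "t \<in> S" "r \<in> carrier R" "t \<odot>\<^bsub>M\<^esub> y \<ominus>\<^bsub>M\<^esub> r \<odot>\<^bsub>M\<^esub> x0 \<in> N"
      using span[OF y x0(1) x0N] by blast
    have ts: "t \<otimes>\<^bsub>R\<^esub> s \<in> S" by (rule Sm[OF tr(1) s(1)])
    have "D (t \<otimes>\<^bsub>R\<^esub> s) = D s"
      using maxD[rule_format, of "D (t \<otimes>\<^bsub>R\<^esub> s)"] D[OF SR[OF ts]] ts Dmult[OF SR[OF s(1)] SR[OF tr(1)]]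
      unfolding s(2) by blast
    moreover have "y \<in> D t" unfolding D_def using y tr by blast
    moreover have "D t \<subseteq> D (t \<otimes>\<^bsub>R\<^esub> s)"
      using Dmult[OF SR[OF tr(1)] SR[OF s(1)]] R.m_comm[OF SR[OF s(1)] SR[OF tr(1)]] by simp
    ultimately show ?thesis by blast
  qed
  then have w: "\<exists>r\<in>carrier R. s \<odot>\<^bsub>M\<^esub> y \<ominus>\<^bsub>M\<^esub> r \<odot>\<^bsub>M\<^esub> x0 \<in> N" if "y \<in> carrier M" for y
    using that unfolding D_def by blast
  have MM: "M\<lparr>carrier := carrier M\<rparr> = M" by (cases M) simp
  have h: "quotient_map R M N s x0 \<in> mod_hom R M (quot_module (regular_module R) \<pp>)"
    using quotient_map_hom[OF M N x0(1) SR[OF s(1)] carrier_is_submodule w] by (simp add: colon MM)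
  have "quotient_map R M N s x0 x0 = \<pp> +>\<^bsub>regular_module R\<^esub> s"
    using quotient_map_eq[OF M N x0(1) SR[OF s(1)] x0(1) SR[OF s(1)]] submodule_zero[OF N M] SR[OF s(1)] x0(1)
    by (simp add: colon a_minus_def M.r_neg)
  then have "quotient_map R M N s x0 x0 \<noteq> \<zero>\<^bsub>quot_module (regular_module R) \<pp>\<^esub>"
    using regular_quot(4,5)[OF R.is_cring P.is_ideal] s(1) by (auto simp: S_def)
  then show thesis using that[OF h x0(1)] by blast
qed

section \<open>Nakayama's lemma\<close>

text \<open>A non-unit \<open>u\<close> lies in an ideal maximal among those avoiding 1; such an
  ideal is a maximal ideal and therefore equals \<open>\<mm>\<close>.\<close>

lemma local_ring_unit:
  assumes R: "noetherian_ring R" and loc: "local_ring R \<mm>" and u: "u \<in> carrier R" "u \<notin> \<mm>"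
  shows "\<exists>v\<in>carrier R. v \<otimes>\<^bsub>R\<^esub> u = \<one>\<^bsub>R\<^esub>"
proof (rule ccontr)
  assume no: "\<not> ?thesis"
  interpret cring R using loc by (simp add: local_ring_def)
  note m = regular_module_module[OF is_cring]
  have uM: "u \<in> carrier (regular_module R)" using u by (simp add: regular_module_simps)
  let ?P = "\<lambda>I. \<one>\<^bsub>R\<^esub> \<notin> I \<and> u \<in> I"
  have "\<one>\<^bsub>R\<^esub> \<notin> cyclic R (regular_module R) u"
  proof
    assume "\<one>\<^bsub>R\<^esub> \<in> cyclic R (regular_module R) u"
    then obtain v where "v \<in> carrier R" "v \<otimes>\<^bsub>R\<^esub> u = \<one>\<^bsub>R\<^esub>"
      unfolding cyclic_def regular_module_simps by (metis imageE)
    then show False using no by blast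
  qed
  then have "?P (cyclic R (regular_module R) u)" using cyclic_submodule[OF m uM] by auto
  with cyclic_submodule(1)[OF m uM] obtain I where I: "submodule I R (regular_module R)" "?P I"
    and max: "\<forall>H'. submodule H' R (regular_module R) \<longrightarrow> ?P H' \<longrightarrow> I \<subseteq> H' \<longrightarrow> H' = I"
    by (rule noetherian_module_maximal[OF regular_noetherian[OF R is_cring], where P = ?P])
  have "maximalideal I R"
  proof (rule maximalidealI)
    show "ideal I R" using I(1) by (simp add: regular_submodule_iff[OF is_cring])
    show "carrier R \<noteq> I" using I(2) by auto
    fix H assume H: "ideal H R" "I \<subseteq> H" "H \<subseteq> carrier R"
    show "H = I \<or> H = carrier R"
    proof (cases "\<one>\<^bsub>R\<^esub> \<in> H")
      case True
      then show ?thesis using ideal.one_imp_carrier[OF H(1)] by simp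
    next
      case False
      then show ?thesis using max[rule_format, of H] H I(2) by (auto simp: regular_submodule_iff[OF is_cring])
    qed
  qed
  then have "I = \<mm>" using loc by (simp add: local_ring_def)
  then show False using I(2) u(2) by simp
qed

text \<open>Divisibility by a single \<open>y\<close> in \<open>\<mm>\<close> removes generators one
  at a time: \<open>a = y (k + r a)\<close> with \<open>k\<close> in the span of the others gives
  \<open>(1 - y r) a = y k\<close>, and \<open>1 - y r\<close> is a unit.\<close>

lemma nakayama:
  assumes R: "noetherian_ring R" and loc: "local_ring R \<mm>" and H: "module R H" "fin_gen_module R H"
    and y: "y \<in> \<mm>" and div: "\<And>h. h \<in> carrier H \<Longrightarrow> \<exists>h'\<in>carrier H. h = y \<odot>\<^bsub>H\<^esub> h'"
  shows "trivial_module H"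
proof -
  interpret module R H by (rule H(1))
  interpret m: maximalideal \<mm> R using loc by (simp add: local_ring_def)
  have yR: "y \<in> carrier R" using y by (rule m.Icarr)
  have "carrier H = {\<zero>\<^bsub>H\<^esub>}" if "finite A" "A \<subseteq> carrier H" "submodule_gen R H A = carrier H" for A
    using that
  proof (induction A)
    case empty
    then show ?case
      using submodule_gen_least[OF submodule_zero_submodule[OF H(1)], of "{}"] by auto
  next
    case (insert a A)
    then have A: "A \<subseteq> carrier H" and a: "a \<in> carrier H" by auto
    note g = submodule_gen_submodule[OF H(1) A]
    obtain h' where h': "h' \<in> carrier H" "a = y \<odot>\<^bsub>H\<^esub> h'" using div[OF a] by blast
    have "h' \<in> submodule_sum H (submodule_gen R H A) (cyclic R H a)"
      using h'(1) insert.prems(2) submodule_gen_insert[OF H(1) a A] by simp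
    then obtain k r where kr: "k \<in> submodule_gen R H A" "r \<in> carrier R" "h' = k \<oplus>\<^bsub>H\<^esub> r \<odot>\<^bsub>H\<^esub> a"
      unfolding submodule_sum_def cyclic_def by blast
    have kH: "k \<in> carrier H" using kr(1) submodule_subset[OF g H(1)] by auto
    let ?u = "\<one>\<^bsub>R\<^esub> \<ominus>\<^bsub>R\<^esub> y \<otimes>\<^bsub>R\<^esub> r"
    have uR: "?u \<in> carrier R" using yR kr(2) by simp
    have "?u \<notin> \<mm>"
    proof
      assume "?u \<in> \<mm>"
      moreover have "y \<otimes>\<^bsub>R\<^esub> r \<in> \<mm>" by (rule m.I_r_closed[OF y kr(2)])
      ultimately have "?u \<oplus>\<^bsub>R\<^esub> y \<otimes>\<^bsub>R\<^esub> r \<in> \<mm>" by (rule m.a_closed)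
      then have "\<one>\<^bsub>R\<^esub> \<in> \<mm>" using yR kr(2) by (simp add: a_minus_def R.a_assoc R.l_neg)
      then show False using m.one_imp_carrier m.I_notcarr by simp
    qed
    then obtain v where v: "v \<in> carrier R" "v \<otimes>\<^bsub>R\<^esub> ?u = \<one>\<^bsub>R\<^esub>"
      using local_ring_unit[OF R loc uR] by blast
    have ay: "a = y \<odot>\<^bsub>H\<^esub> k \<oplus>\<^bsub>H\<^esub> (y \<otimes>\<^bsub>R\<^esub> r) \<odot>\<^bsub>H\<^esub> a"
      using h'(2) kr kH a yR by (simp add: smult_r_distr smult_assoc1)
    have "?u \<odot>\<^bsub>H\<^esub> a = a \<ominus>\<^bsub>H\<^esub> (y \<otimes>\<^bsub>R\<^esub> r) \<odot>\<^bsub>H\<^esub> a"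
      using a yR kr(2) by (simp add: a_minus_def smult_l_distr smult_l_minus)
    also have "\<dots> = y \<odot>\<^bsub>H\<^esub> k"
      using M.add_minus_cancel[of "(y \<otimes>\<^bsub>R\<^esub> r) \<odot>\<^bsub>H\<^esub> a" "y \<odot>\<^bsub>H\<^esub> k"] ay a kH yR kr(2) M.a_comm by simp
    finally have "?u \<odot>\<^bsub>H\<^esub> a = y \<odot>\<^bsub>H\<^esub> k" .
    then have "a = v \<odot>\<^bsub>H\<^esub> (y \<odot>\<^bsub>H\<^esub> k)"
      using v a uR smult_assoc1[OF v(1) uR a] by simp
    then have "a \<in> submodule_gen R H A"
      using submodule_smult[OF g H(1) v(1) submodule_smult[OF g H(1) yR kr(1)]] by simp
    then have "submodule_gen R H (insert a A) \<subseteq> submodule_gen R H A"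
      using submodule_gen_subset[OF H(1) A] by (intro submodule_gen_least[OF g]) simp
    then have "submodule_gen R H A = carrier H"
      using insert.prems(2) submodule_subset[OF g H(1)] by auto
    then show ?case using insert.IH A by simp
  qed
  then show ?thesis using H(2) by (auto simp: fin_gen_module_def trivial_module_def)
qed

section \<open>Vanishing of formal cohomology over a local ring\<close>

lemma restrict_carrier [simp]:
  "(M :: ('a, 'b) module)\<lparr>carrier := carrier M\<rparr> = M"
  by (cases M) simp

text \<open>The locality condition \<open>meets\<close> concerns positive degrees only, which is why
  the vanishing results below are stated for successors or for degrees at least
  \<open>Suc t\<close>. The bound \<open>b\<close> is where descending inductions start.\<close>

locale local_formal_cochain = formal_cochain R C E T S u \<aa>
  for R :: "('a, 'm) ring_scheme" (structure) and C :: "('a, 'e \<Rightarrow> 'c) cochain"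
    and E :: "nat \<Rightarrow> 'e set" and T :: "'e \<Rightarrow> ('a, 'c) module" and S :: "'e \<Rightarrow> 'a set" and u :: "'e \<Rightarrow> 'c"
    and \<aa> :: "'a set" +
  fixes \<mm> :: "'a set" and b :: nat
  assumes noeth: "noetherian_ring R" and loc: "local_ring R \<mm>"
    and meets: "\<And>i e. \<lbrakk>e \<in> E (Suc i)\<rbrakk> \<Longrightarrow> \<exists>s\<in>S e. s \<in> \<mm>"
    and bounded: "\<And>i e. \<lbrakk>e \<in> E i; b < i\<rbrakk> \<Longrightarrow> \<zero> \<in> S e"
begin

abbreviation "ac i M \<equiv> acyclic_at (FC M) i"
abbreviation "quo \<pp> \<equiv> quot_module (regular_module R) \<pp>"

lemma ses:
  assumes nM: "noetherian_module R M" and N: "module R N" and f: "f \<in> mod_hom R M N"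
    and surj: "f ` carrier M = carrier N" and K: "K = {x \<in> carrier M. f x = \<zero>\<^bsub>N\<^esub>}"
  shows "formal_ses R C E T S u \<aa> M N f K"
proof (intro formal_ses.intro formal_ses_axioms.intro)
  note M = noetherian_moduleD[OF nM]
  have "submodule K R M" unfolding K by (rule mod_hom_ker[OF f M N])
  then show "\<exists>m\<ge>n. K \<inter> A M m \<subseteq> A (M\<lparr>carrier := K\<rparr>) n" for n
    by (rule artin_rees[OF noeth \<aa> nM])
qed (fact formal_cochain_axioms noetherian_moduleD[OF nM] N f surj K)+

lemma ac_middle:
  assumes "noetherian_module R M" "module R N" "f \<in> mod_hom R M N" "f ` carrier M = carrier N"
    and "K = {x \<in> carrier M. f x = \<zero>\<^bsub>N\<^esub>}" "ac (Suc j) (M\<lparr>carrier := K\<rparr>)" "ac (Suc j) N"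
  shows "ac (Suc j) M"
proof -
  interpret formal_ses R C E T S u \<aa> M N f K by (rule ses[OF assms(1-5)])
  show ?thesis by (rule ses.acyclic_middle[OF assms(6,7)])
qed

lemma ac_right:
  assumes "noetherian_module R M" "module R N" "f \<in> mod_hom R M N" "f ` carrier M = carrier N"
    and "K = {x \<in> carrier M. f x = \<zero>\<^bsub>N\<^esub>}" "ac (Suc (Suc j)) (M\<lparr>carrier := K\<rparr>)" "ac (Suc j) M"
  shows "ac (Suc j) N"
proof -
  interpret formal_ses R C E T S u \<aa> M N f K by (rule ses[OF assms(1-5)])
  show ?thesis by (rule ses.acyclic_right[OF assms(7,6)])
qed

lemma fin_gen_right:
  assumes "noetherian_module R M" "module R N" "f \<in> mod_hom R M N" "f ` carrier M = carrier N"
    and "K = {x \<in> carrier M. f x = \<zero>\<^bsub>N\<^esub>}" "ac (Suc (Suc j)) (M\<lparr>carrier := K\<rparr>)"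
    and "fin_gen_module R (cohomology (FC M) (Suc j))"
  shows "fin_gen_module R (cohomology (FC N) (Suc j))"
proof -
  interpret formal_ses R C E T S u \<aa> M N f K by (rule ses[OF assms(1-5)])
  show ?thesis by (rule ses.fin_gen_right[OF assms(6,7)])
qed

lemma ac_zero:
  assumes M: "module R M"
  shows "ac i (M\<lparr>carrier := {\<zero>\<^bsub>M\<^esub>}\<rparr>)"
proof -
  interpret module R M by fact
  note s = submodule_module[OF submodule_zero_submodule[OF M] M]
  show ?thesis
  proof (rule acyclic_trivial[OF s])
    fix e assume "e \<in> E i"
    then have "\<one> \<in> S e" using locs by (auto simp: is_loc_def mult_closed_def)
    then show "\<exists>s\<in>S e. \<forall>x\<in>carrier (M\<lparr>carrier := {\<zero>\<^bsub>M\<^esub>}\<rparr>). s \<odot>\<^bsub>M\<lparr>carrier := {\<zero>\<^bsub>M\<^esub>}\<rparr>\<^esub> x = \<zero>\<^bsub>M\<lparr>carrier := {\<zero>\<^bsub>M\<^esub>}\<rparr>\<^esub>"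
      by (intro bexI[of _ \<one>]) auto
  qed
qed

lemma ac_beyond:
  assumes M: "module R M" and "b < i"
  shows "ac i M"
proof -
  interpret module R M by fact
  show ?thesis
    using bounded[OF _ assms(2)] by (intro acyclic_trivial[OF M]) (auto intro!: bexI[of _ \<zero>])
qed

text \<open>The multiplicative set of each summand contains an element of \<open>\<mm>\<close>,
  which kills \<open>M\<close>.\<close>

lemma ac_killed:
  assumes M: "module R M" and "\<And>r x. \<lbrakk>r \<in> \<mm>; x \<in> carrier M\<rbrakk> \<Longrightarrow> r \<odot>\<^bsub>M\<^esub> x = \<zero>\<^bsub>M\<^esub>"
  shows "ac (Suc j) M"
  using meets assms(2) by (intro acyclic_trivial[OF M]) blast

text \<open>Each step of the filtration is a short exact sequence with factor
  \<open>R / \<pp>\<close>, and vanishing at both ends passes to the middle in the same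
  degree.\<close>

lemma ac_filtration:
  assumes nM: "noetherian_module R M" and pr: "\<And>\<pp>. \<pp> \<in> supp R M \<Longrightarrow> ac (Suc j) (quo \<pp>)"
  shows "ac (Suc j) M"
proof -
  note M = noetherian_moduleD[OF nM]
  have "ac (Suc j) (M\<lparr>carrier := carrier M\<rparr>)"
  proof (rule prime_filtration[OF noeth nM, where P = "\<lambda>N. ac (Suc j) (M\<lparr>carrier := N\<rparr>)"])
    show "ac (Suc j) (M\<lparr>carrier := {\<zero>\<^bsub>M\<^esub>}\<rparr>)" by (rule ac_zero[OF M])
    fix N x assume N: "submodule N R M" and x: "x \<in> carrier M" "x \<notin> N"
      and p: "primeideal (colon R M N x) R" and acN: "ac (Suc j) (M\<lparr>carrier := N\<rparr>)"
    let ?N = "submodule_sum M N (cyclic R M x)" and ?p = "colon R M N x"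
    have sN: "submodule ?N R M" by (rule submodule_sum_submodule[OF N M cyclic_submodule(1)[OF M x(1)]])
    obtain g where g: "g \<in> mod_hom R (M\<lparr>carrier := ?N\<rparr>) (quo ?p)" "g ` ?N = carrier (quo ?p)"
      "N = {y \<in> ?N. g y = \<zero>\<^bsub>quo ?p\<^esub>}"
      by (rule cyclic_extension[OF M N x(1)])
    \<comment> \<open>A prime occurring in the filtration lies in the support: an \<open>s\<close>
      outside it does not send \<open>x\<close> into \<open>N\<close>, so in particular not to
      zero.\<close>
    have "\<forall>s\<in>carrier R - ?p. s \<odot>\<^bsub>M\<^esub> x \<noteq> \<zero>\<^bsub>M\<^esub>"
    proof
      fix s assume "s \<in> carrier R - ?p"
      then have "s \<odot>\<^bsub>M\<^esub> x \<notin> N" unfolding colon_def by blast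
      then show "s \<odot>\<^bsub>M\<^esub> x \<noteq> \<zero>\<^bsub>M\<^esub>" using submodule_zero[OF N M] by metis
    qed
    then have "?p \<in> supp R M" unfolding supp_iff[OF M] using p x(1) by blast
    then have q: "ac (Suc j) (quo ?p)" by (rule pr)
    show "ac (Suc j) (M\<lparr>carrier := ?N\<rparr>)"
    proof (rule ac_middle[OF noetherian_submodule[OF nM sN] _ g(1)])
      show "module R (quo ?p)" by (rule regular_quot(1)[OF is_cring colon_ideal[OF M N x(1)]])
      show "g ` carrier (M\<lparr>carrier := ?N\<rparr>) = carrier (quo ?p)" using g(2) by simp
      show "N = {x \<in> carrier (M\<lparr>carrier := ?N\<rparr>). g x = \<zero>\<^bsub>quo ?p\<^esub>}" using g(3) by simp
      show "ac (Suc j) (M\<lparr>carrier := ?N, carrier := N\<rparr>)" using acN by simp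
    qed (rule q)
  qed
  then show ?thesis by simp
qed

text \<open>Vanishing for \<open>M\<close> alone says nothing about its submodules; vanishing for
  all primes in the support does, and this is how the kernels in the steps below are
  controlled.\<close>

lemma ac_submodule:
  assumes nM: "noetherian_module R M" and K: "submodule K R M"
    and pr: "\<And>\<pp>. \<pp> \<in> supp R M \<Longrightarrow> ac (Suc j) (quo \<pp>)"
  shows "ac (Suc j) (M\<lparr>carrier := K\<rparr>)"
  by (rule ac_filtration[OF noetherian_submodule[OF nM K]])
     (rule pr, rule subsetD[OF supp_submodule[OF noetherian_moduleD[OF nM] K]])

lemma quo_noetherian: "ideal \<pp> R \<Longrightarrow> noetherian_module R (quo \<pp>)"
  by (rule quot_module_noetherian[OF regular_noetherian[OF noeth is_cring]])
     (simp add: regular_submodule_iff[OF is_cring])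

text \<open>
  At a maximal \<open>\<pp>\<close> where vanishing fails, a nonzero map \<open>M \<rightarrow> R / \<pp>\<close> has vanishing cohomology on its image
  by right exactness and on its cokernel by maximality.
\<close>

lemma ac_primes_step:
  assumes nM: "noetherian_module R M" and acM: "ac (Suc j) M"
    and next_ac: "\<And>\<pp>. \<pp> \<in> supp R M \<Longrightarrow> ac (Suc (Suc j)) (quo \<pp>)"
    and \<pp>: "\<pp> \<in> supp R M"
  shows "ac (Suc j) (quo \<pp>)"
proof (rule ccontr)
  assume contr: "\<not> ac (Suc j) (quo \<pp>)"
  note M = noetherian_moduleD[OF nM]
  let ?P = "\<lambda>\<qq>. \<qq> \<in> supp R M \<and> \<not> ac (Suc j) (quo \<qq>)"
  have "submodule \<pp> R (regular_module R)"
    using suppD[OF \<pp>] by (simp add: regular_submodule_iff[OF is_cring] primeideal_def)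
  moreover have "?P \<pp>" using \<pp> contr by blast
  ultimately obtain \<qq> where "submodule \<qq> R (regular_module R)" and \<qq>: "?P \<qq>"
    and max: "\<forall>H'. submodule H' R (regular_module R) \<longrightarrow> ?P H' \<longrightarrow> \<qq> \<subseteq> H' \<longrightarrow> H' = \<qq>"
    by (rule noetherian_module_maximal[OF regular_noetherian[OF noeth is_cring], where P = ?P])
  interpret P: primeideal \<qq> R using \<qq> by (intro suppD) blast
  note q = regular_quot[OF is_cring P.is_ideal]
  note nX = quo_noetherian[OF P.is_ideal]
  interpret X: module R "quo \<qq>" by (rule q(1))
  obtain h x where h: "h \<in> mod_hom R M (quo \<qq>)" "x \<in> carrier M" "h x \<noteq> \<zero>\<^bsub>quo \<qq>\<^esub>"
    by (rule supp_functional[OF nM conjunct1[OF \<qq>]])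
  let ?K = "{x \<in> carrier M. h x = \<zero>\<^bsub>quo \<qq>\<^esub>}" and ?I = "h ` carrier M"
  have K: "submodule ?K R M" by (rule mod_hom_ker[OF h(1) M q(1)])
  have I: "submodule ?I R (quo \<qq>)"
    by (rule mod_hom_image[OF h(1) M q(1) module.carrier_is_submodule[OF M]])
  note mI = submodule_module[OF I q(1)]
  \<comment> \<open>The kernel is known only through its support, so the hypothesis for the next
    degree is applied to all primes of \<open>supp R M\<close>, not only to
    \<open>\<qq>\<close>.\<close>
  have acK: "ac (Suc (Suc j)) (M\<lparr>carrier := ?K\<rparr>)"
    by (rule ac_submodule[OF nM K next_ac])
  have hI: "h \<in> mod_hom R M ((quo \<qq>)\<lparr>carrier := ?I\<rparr>)"
    by (rule mod_homI) (auto simp: mod_hom_add[OF h(1)] mod_hom_smult[OF h(1)])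
  have acI: "ac (Suc j) ((quo \<qq>)\<lparr>carrier := ?I\<rparr>)"
    by (rule ac_right[OF nM mI hI _ _ acK acM]) simp_all
  let ?Y = "quot_module (quo \<qq>) ?I"
  note Y = quot_module_module[OF q(1) I] and pY = quot_module_proj[OF q(1) I] and cY = quot_module_carrier[OF q(1) I]
    and zY = quot_module_zero[OF q(1) I]
  obtain c where c: "c \<in> carrier R" "h x = \<qq> +>\<^bsub>regular_module R\<^esub> c"
    using mod_hom_closed[OF h(1,2)] by (auto simp: q(3))
  have cq: "c \<notin> \<qq>" using h(3) c q(4,5) by auto
  \<comment> \<open>A ring element that multiplies \<open>R / \<qq>\<close> into the image of
    \<open>h\<close> annihilates the cokernel, and so lies in every prime of its support.\<close>
  have kill: "r \<odot>\<^bsub>?Y\<^esub> y = \<zero>\<^bsub>?Y\<^esub>"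
    if r: "r \<in> carrier R" and ri: "\<And>s. s \<in> carrier R \<Longrightarrow> \<qq> +>\<^bsub>regular_module R\<^esub> (r \<otimes> s) \<in> ?I"
      and y: "y \<in> carrier ?Y" for r y
  proof -
    obtain z where z: "z \<in> carrier (quo \<qq>)" "y = ?I +>\<^bsub>quo \<qq>\<^esub> z" using y by (auto simp: cY)
    obtain s where s: "s \<in> carrier R" "z = \<qq> +>\<^bsub>regular_module R\<^esub> s" using z(1) by (auto simp: q(3))
    have "r \<odot>\<^bsub>quo \<qq>\<^esub> z = \<qq> +>\<^bsub>regular_module R\<^esub> (r \<otimes> s)"
      using mod_hom_smult[OF q(2) r, of s] s by (simp add: regular_module_simps)
    then have "r \<odot>\<^bsub>quo \<qq>\<^esub> z \<in> ?I" using ri[OF s(1)] by simp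
    moreover have "r \<odot>\<^bsub>?Y\<^esub> y = ?I +>\<^bsub>quo \<qq>\<^esub> (r \<odot>\<^bsub>quo \<qq>\<^esub> z)"
      using mod_hom_smult[OF pY r z(1)] z(2) by simp
    ultimately show ?thesis
      using coset_zero_iff[OF q(1) I, of "r \<odot>\<^bsub>quo \<qq>\<^esub> z"] r z(1) by (simp add: zY)
  qed
  have acY: "ac (Suc j) ?Y"
  proof (rule ac_filtration[OF quot_module_noetherian[OF nX I]])
    fix \<rr> assume r: "\<rr> \<in> supp R ?Y"
    interpret r: primeideal \<rr> R using r by (rule suppD)
    have sub: "\<qq> \<subseteq> \<rr>"
    proof
      fix a assume a: "a \<in> \<qq>"
      then have aR: "a \<in> carrier R" by (rule P.Icarr)
      have "\<qq> +>\<^bsub>regular_module R\<^esub> (a \<otimes> s) \<in> ?I" if s: "s \<in> carrier R" for s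
        using q(5)[of "a \<otimes> s"] P.I_r_closed[OF a s] aR s submodule_zero[OF I q(1)] q(4) by auto
      then show "a \<in> \<rr>" using kill[OF aR] by (intro supp_annihilator[OF Y r aR]) blast
    qed
    \<comment> \<open>The value \<open>h x\<close>, represented by \<open>c\<close>, generates a
      submodule of the image. Hence \<open>c\<close> kills the cokernel, and as \<open>c\<close> is
      not in \<open>\<qq>\<close>, the primes in the support of the cokernel strictly contain
      \<open>\<qq>\<close>.\<close>
    have "\<qq> +>\<^bsub>regular_module R\<^esub> (c \<otimes> s) \<in> ?I" if s: "s \<in> carrier R" for s
    proof -
      have "\<qq> +>\<^bsub>regular_module R\<^esub> (c \<otimes> s) = s \<odot>\<^bsub>quo \<qq>\<^esub> h x"
        using mod_hom_smult[OF q(2) s, of c] c s by (simp add: regular_module_simps m_comm)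
      then show ?thesis using submodule_smult[OF I q(1) s, of "h x"] h(2) by simp
    qed
    then have "c \<in> \<rr>" using kill[OF c(1)] by (intro supp_annihilator[OF Y r c(1)]) blast
    then have ne: "\<rr> \<noteq> \<qq>" using cq by auto
    have rM: "\<rr> \<in> supp R M" using \<qq> by (intro supp_upward[OF M _ r.primeideal sub]) blast
    have "submodule \<rr> R (regular_module R)" by (simp add: regular_submodule_iff[OF is_cring] r.is_ideal)
    then show "ac (Suc j) (quo \<rr>)" using max[rule_format, of \<rr>] rM sub ne by blast
  qed
  have "ac (Suc j) (quo \<qq>)"
  proof (rule ac_middle[OF nX Y pY _ _ acI acY])
    show "(\<lambda>x. ?I +>\<^bsub>quo \<qq>\<^esub> x) ` carrier (quo \<qq>) = carrier ?Y" by (simp add: cY)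
    show "?I = {x \<in> carrier (quo \<qq>). ?I +>\<^bsub>quo \<qq>\<^esub> x = \<zero>\<^bsub>?Y\<^esub>}"
      using coset_zero_iff[OF q(1) I] submodule_subset[OF I q(1)] by (auto simp: zY)
  qed
  then show False using \<qq> by blast
qed

text \<open>Descending induction on the degree, for all primes of the support simultaneously, since
  the step for one prime uses the next degree for every prime of the support. Above \<open>b\<close>
  all cohomology vanishes.\<close>

theorem ac_primes:
  assumes nM: "noetherian_module R M" and acM: "\<And>i. Suc t \<le> i \<Longrightarrow> ac i M"
    and i: "Suc t \<le> i" and \<pp>: "\<pp> \<in> supp R M"
  shows "ac i (quo \<pp>)"
proof -
  have id: "ideal \<qq> R" if "\<qq> \<in> supp R M" for \<qq>
    using suppD[OF that] by (simp add: primeideal_def)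
  have beyond: "\<forall>\<qq>\<in>supp R M. ac k (quo \<qq>)" if "b < k" for k
    using ac_beyond[OF regular_quot(1)[OF is_cring id] that] by blast
  show ?thesis
  proof (cases "b < i")
    case True
    then show ?thesis using beyond \<pp> by blast
  next
    case False
    then have "i \<le> Suc b" by simp
    then have "\<forall>\<qq>\<in>supp R M. ac i (quo \<qq>)"
    proof (induction i rule: inc_induct)
      case base
      show ?case by (rule beyond) simp
    next
      case (step n)
      then obtain j where n: "n = Suc j" "t \<le> j" using i by (cases n) auto
      show ?case
      proof
        fix \<qq> assume q: "\<qq> \<in> supp R M"
        have acj: "ac (Suc j) M" using acM n by simp
        have "ac (Suc (Suc j)) (quo \<rr>)" if "\<rr> \<in> supp R M" for \<rr> using step.IH n that by simp
        then show "ac n (quo \<qq>)" unfolding n(1) by (rule ac_primes_step[OF nM acj _ q])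
      qed
    qed
    then show ?thesis using \<pp> by blast
  qed
qed

text \<open>
  Top nonvanishing finitely generated cohomology of a quotient \<open>X\<close> of \<open>M\<close>, chosen minimal, is divisible
  by some \<open>y \<in> \<mm>\<close>, by right exactness applied to \<open>y : X \<rightarrow> X\<close>.
\<close>

lemma ac_divisible:
  assumes nX: "noetherian_module R X" and y: "y \<in> \<mm>"
    and acK: "ac (Suc (Suc j)) (X\<lparr>carrier := {x \<in> carrier X. y \<odot>\<^bsub>X\<^esub> x = \<zero>\<^bsub>X\<^esub>}\<rparr>)"
    and N: "module R N" and g: "g \<in> mod_hom R X N" "g ` carrier X = carrier N"
    and ker: "(\<lambda>x. y \<odot>\<^bsub>X\<^esub> x) ` carrier X = {x \<in> carrier X. g x = \<zero>\<^bsub>N\<^esub>}" and acN: "ac (Suc j) N"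
    and fg: "fin_gen_module R (cohomology (FC X) (Suc j))"
  shows "ac (Suc j) X"
proof -
  note X = noetherian_moduleD[OF nX]
  interpret X: module R X by (rule X)
  have yR: "y \<in> carrier R"
    using loc y by (auto simp: local_ring_def maximalideal_def intro: ideal.Icarr)
  let ?m = "\<lambda>x. y \<odot>\<^bsub>X\<^esub> x" and ?I = "(\<lambda>x. y \<odot>\<^bsub>X\<^esub> x) ` carrier X"
  note mh = mod_hom_scale[OF mod_hom_id X yR]
  have I: "submodule ?I R X" by (rule mod_hom_image[OF mh X X X.carrier_is_submodule])
  let ?Y = "X\<lparr>carrier := ?I\<rparr>"
  note Y = submodule_module[OF I X]
  have mY: "?m \<in> mod_hom R X ?Y"
    by (rule mod_homI) (auto simp: mod_hom_add[OF mh] mod_hom_smult[OF mh])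
  \<comment> \<open>Multiplication by \<open>y\<close> is split into the surjection
    \<open>X \<rightarrow> y X\<close>, whose kernel vanishes one degree up, and the inclusion of
    \<open>y X\<close>, whose cokernel \<open>N\<close> vanishes in the present degree.\<close>
  interpret s1: formal_ses R C E T S u \<aa> X ?Y ?m "{x \<in> carrier X. y \<odot>\<^bsub>X\<^esub> x = \<zero>\<^bsub>X\<^esub>}"
    by (rule ses[OF nX Y mY]) auto
  interpret s2: formal_ses R C E T S u \<aa> X N g ?I
    by (rule ses[OF nX N g ker])
  let ?H = "cohomology (FC X) (Suc j)" and ?Z = "(obj (FC X) (Suc j))\<lparr>carrier := cocycles (FC X) (Suc j)\<rparr>"
    and ?B = "coboundaries (FC X) (Suc j)"
  note cX = FC_is_cochain[OF X]
  note Zm = cocycles_module[OF cX, of "Suc j"] and Bs = coboundaries_sub[OF cX, of "Suc j"]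
  interpret O: module R "obj (FC X) (Suc j)" by (rule FC_module[OF X])
  have "trivial_module ?H"
  proof (rule nakayama[OF noeth loc cohomology_module[OF cX] fg y])
    fix h assume "h \<in> carrier ?H"
    then obtain z where z: "z \<in> cocycles (FC X) (Suc j)" "h = ?B +>\<^bsub>?Z\<^esub> z"
      unfolding cohomology_def quot_module_carrier[OF Zm Bs] by auto
    \<comment> \<open>A cocycle of \<open>X\<close> comes from \<open>y X\<close> up to a coboundary
      by the second sequence, and from there it is lifted to \<open>X\<close> by the first
      one.\<close>
    obtain w c where w: "w \<in> cocycles (FC ?Y) (Suc j)" and c: "c \<in> carrier (obj (FC X) j)"
      and zw: "z = Fm (Suc j) X (\<lambda>x. x) w \<oplus>\<^bsub>obj (FC X) (Suc j)\<^esub> diff (FC X) j c"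
      using s2.ses.cocycle_decompose[OF acN z(1)] by blast
    obtain v where v: "v \<in> cocycles (FC X) (Suc j)" "Fm (Suc j) ?Y ?m v = w"
      using s1.ses.lift_cocycle[OF acK w] by blast
    have vc: "v \<in> carrier (obj (FC X) (Suc j))" using v(1) by (simp add: cocycles_def)
    \<comment> \<open>The composite \<open>X \<rightarrow> y X \<rightarrow> X\<close> is
      multiplication by \<open>y\<close>, on modules and hence on the complex.\<close>
    have "Fm (Suc j) X (\<lambda>x. x) w = Fm (Suc j) X ?m v"
      unfolding v(2)[symmetric] by (rule Fm_comp[OF X Y X mY s2.incl vc mh]) simp
    also have "\<dots> = y \<odot>\<^bsub>obj (FC X) (Suc j)\<^esub> v" by (rule Fm_smult[OF X yR vc])
    finally have zv: "z = y \<odot>\<^bsub>obj (FC X) (Suc j)\<^esub> v \<oplus>\<^bsub>obj (FC X) (Suc j)\<^esub> diff (FC X) j c" using zw by simp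
    have dc: "diff (FC X) j c \<in> ?B" using c by (auto simp: coboundaries_Suc)
    have dcZ: "diff (FC X) j c \<in> carrier ?Z" using coboundaries_subset_cocycles[OF cX] dc by auto
    have yvZ: "y \<odot>\<^bsub>?Z\<^esub> v \<in> carrier ?Z" using module.smult_closed[OF Zm yR, of v] v(1) by simp
    interpret H: module R ?H by (rule cohomology_module[OF cX])
    note p = quot_module_proj[OF Zm Bs, folded cohomology_def]
    have "h = ?B +>\<^bsub>?Z\<^esub> (y \<odot>\<^bsub>?Z\<^esub> v \<oplus>\<^bsub>?Z\<^esub> diff (FC X) j c)" using z(2) zv by simp
    also have "\<dots> = (?B +>\<^bsub>?Z\<^esub> (y \<odot>\<^bsub>?Z\<^esub> v)) \<oplus>\<^bsub>?H\<^esub> (?B +>\<^bsub>?Z\<^esub> diff (FC X) j c)"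
      by (rule mod_hom_add[OF p yvZ dcZ])
    also have "?B +>\<^bsub>?Z\<^esub> diff (FC X) j c = \<zero>\<^bsub>?H\<^esub>"
      using coset_zero_iff[OF Zm Bs dcZ] dc quot_module_zero[OF Zm Bs] by (simp add: cohomology_def)
    also have "(?B +>\<^bsub>?Z\<^esub> (y \<odot>\<^bsub>?Z\<^esub> v)) \<oplus>\<^bsub>?H\<^esub> \<zero>\<^bsub>?H\<^esub> = ?B +>\<^bsub>?Z\<^esub> (y \<odot>\<^bsub>?Z\<^esub> v)"
      by (rule H.M.r_zero[OF mod_hom_closed[OF p yvZ]])
    also have "\<dots> = y \<odot>\<^bsub>?H\<^esub> (?B +>\<^bsub>?Z\<^esub> v)" using v(1) by (intro mod_hom_smult[OF p yR]) simp
    finally have "h = y \<odot>\<^bsub>?H\<^esub> (?B +>\<^bsub>?Z\<^esub> v)" .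
    moreover have "?B +>\<^bsub>?Z\<^esub> v \<in> carrier ?H" using v(1) by (intro mod_hom_closed[OF p]) simp
    ultimately show "\<exists>h'\<in>carrier ?H. h = y \<odot>\<^bsub>?H\<^esub> h'" by blast
  qed
  then show ?thesis by (simp add: trivial_cohomology_iff[OF cX])
qed

text \<open>Take \<open>N\<close> maximal such that \<open>M / N\<close> still has cohomology, and
  put \<open>X = M / N\<close>. Finite generation descends to \<open>X\<close> by right exactness.
  For \<open>y\<close> not killing \<open>X\<close>, the quotient
  \<open>X / y X = M / (N + y M)\<close> is strictly smaller and hence acyclic in this degree, so
  divisibility and Nakayama apply.\<close>

lemma ac_fin_gen_step:
  assumes nM: "noetherian_module R M" and fg: "fin_gen_module R (cohomology (FC M) (Suc j))"
    and next_ac: "\<And>\<pp>. \<pp> \<in> supp R M \<Longrightarrow> ac (Suc (Suc j)) (quo \<pp>)"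
  shows "ac (Suc j) M"
proof (rule ccontr)
  assume contr: "\<not> ac (Suc j) M"
  note M = noetherian_moduleD[OF nM]
  interpret M: module R M by (rule M)
  let ?P = "\<lambda>N. \<not> ac (Suc j) (quot_module M N)"
  have pk: "K = {x \<in> carrier M. K +>\<^bsub>M\<^esub> x = \<zero>\<^bsub>quot_module M K\<^esub>}" if K: "submodule K R M" for K
    using coset_zero_iff[OF M K] submodule_subset[OF K M] by (auto simp: quot_module_zero[OF M K])
  note qc = quot_module_carrier[OF M] and qm = quot_module_module[OF M] and qp = quot_module_proj[OF M]
  note z = submodule_zero_submodule[OF M]
  \<comment> \<open>\<open>M\<close> and its quotient by zero are different objects, even of
    different types; vanishing is transferred by the exact sequence with zero kernel.\<close>
  have "?P {\<zero>\<^bsub>M\<^esub>}"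
    using ac_middle[OF nM qm[OF z] qp[OF z] qc[OF z, symmetric] pk[OF z] ac_zero[OF M]] contr by blast
  with z obtain N where N: "submodule N R M" "?P N"
    and max: "\<forall>H'. submodule H' R M \<longrightarrow> ?P H' \<longrightarrow> N \<subseteq> H' \<longrightarrow> H' = N"
    by (rule noetherian_module_maximal[OF nM, where P = ?P])
  let ?X = "quot_module M N"
  note X = qm[OF N(1)] and nX = quot_module_noetherian[OF nM N(1)] and pX = qp[OF N(1)]
  interpret X: module R ?X by (rule X)
  have "ac (Suc (Suc j)) (M\<lparr>carrier := N\<rparr>)"
    by (rule ac_submodule[OF nM N(1) next_ac])
  then have fgX: "fin_gen_module R (cohomology (FC ?X) (Suc j))"
    by (rule fin_gen_right[OF nM X pX qc[OF N(1), symmetric] pk[OF N(1)] _ fg])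
  have sX: "supp R ?X \<subseteq> supp R M" by (rule supp_image[OF M X pX qc[OF N(1), symmetric]])
  \<comment> \<open>If all of \<open>\<mm>\<close> killed \<open>X\<close>, its cohomology in
    positive degree would vanish, against the choice of \<open>N\<close>.\<close>
  have "\<exists>y\<in>\<mm>. \<exists>x\<in>carrier ?X. y \<odot>\<^bsub>?X\<^esub> x \<noteq> \<zero>\<^bsub>?X\<^esub>"
    using ac_killed[OF X] N(2) by blast
  then obtain y x where y: "y \<in> \<mm>" and x: "x \<in> carrier ?X" "y \<odot>\<^bsub>?X\<^esub> x \<noteq> \<zero>\<^bsub>?X\<^esub>" by blast
  have yR: "y \<in> carrier R"
    using loc y by (auto simp: local_ring_def maximalideal_def intro: ideal.Icarr)
  note mh = mod_hom_scale[OF mod_hom_id M yR]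
  let ?Y = "(\<lambda>x. y \<odot>\<^bsub>M\<^esub> x) ` carrier M"
  have Y: "submodule ?Y R M" by (rule mod_hom_image[OF mh M M M.carrier_is_submodule])
  let ?N = "submodule_sum M N ?Y"
  have N': "submodule ?N R M" and NN': "N \<subseteq> ?N" and YN': "?Y \<subseteq> ?N"
    using submodule_sum_submodule[OF N(1) M Y] submodule_sum_left[OF N(1) M Y] submodule_sum_right[OF N(1) M Y]
    by blast+
  obtain x' where x': "x' \<in> carrier M" "x = N +>\<^bsub>M\<^esub> x'" using x(1) by (auto simp: qc[OF N(1)])
  have "y \<odot>\<^bsub>M\<^esub> x' \<notin> N"
  proof
    assume "y \<odot>\<^bsub>M\<^esub> x' \<in> N"
    then have "N +>\<^bsub>M\<^esub> (y \<odot>\<^bsub>M\<^esub> x') = \<zero>\<^bsub>?X\<^esub>"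
      using coset_zero_iff[OF M N(1), of "y \<odot>\<^bsub>M\<^esub> x'"] x'(1) yR quot_module_zero[OF M N(1)] by simp
    then show False using x(2) mod_hom_smult[OF pX yR x'(1)] x'(2) by simp
  qed
  then have "?N \<noteq> N" using YN' x'(1) by blast
  \<comment> \<open>\<open>M / (N + y M)\<close> stands in for \<open>X / y X\<close>: the
    maximality of \<open>N\<close> speaks of quotients of \<open>M\<close>, not of quotients of
    \<open>X\<close>.\<close>
  then have acN': "ac (Suc j) (quot_module M ?N)" using max[rule_format, OF N' _ NN'] by blast
  let ?g = "quot_map M ?N (\<lambda>x. x)"
  have NI: "(\<lambda>x. x) ` N \<subseteq> ?N" using NN' by simp
  note g = quot_map_hom[OF M N(1) M N' mod_hom_id NI]
    and gc = quot_map_coset[OF M N(1) M N' mod_hom_id NI]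
  have "ac (Suc j) ?X"
  proof (rule ac_divisible[OF nX y _ qm[OF N'] g _ _ acN' fgX])
    let ?K = "{x \<in> carrier ?X. y \<odot>\<^bsub>?X\<^esub> x = \<zero>\<^bsub>?X\<^esub>}"
    have K: "submodule ?K R ?X" by (rule mod_hom_ker[OF mod_hom_scale[OF mod_hom_id X yR] X X])
    show "ac (Suc (Suc j)) (?X\<lparr>carrier := ?K\<rparr>)"
      by (rule ac_submodule[OF nX K]) (rule next_ac, rule subsetD[OF sX])
    show "?g ` carrier ?X = carrier (quot_module M ?N)"
      unfolding qc[OF N(1)] qc[OF N'] by (simp add: image_image gc)
    show "(\<lambda>x. y \<odot>\<^bsub>?X\<^esub> x) ` carrier ?X = {x \<in> carrier ?X. ?g x = \<zero>\<^bsub>quot_module M ?N\<^esub>}"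
    proof
      show "(\<lambda>x. y \<odot>\<^bsub>?X\<^esub> x) ` carrier ?X \<subseteq> {x \<in> carrier ?X. ?g x = \<zero>\<^bsub>quot_module M ?N\<^esub>}"
      proof
        fix w assume "w \<in> (\<lambda>x. y \<odot>\<^bsub>?X\<^esub> x) ` carrier ?X"
        then obtain v where v: "v \<in> carrier M" "w = y \<odot>\<^bsub>?X\<^esub> (N +>\<^bsub>M\<^esub> v)" by (auto simp: qc[OF N(1)])
        then have w: "w = N +>\<^bsub>M\<^esub> (y \<odot>\<^bsub>M\<^esub> v)" using mod_hom_smult[OF pX yR v(1)] by simp
        have yv: "y \<odot>\<^bsub>M\<^esub> v \<in> ?N" using YN' v(1) by blast
        have yvM: "y \<odot>\<^bsub>M\<^esub> v \<in> carrier M" using yR v(1) by simp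
        show "w \<in> {x \<in> carrier ?X. ?g x = \<zero>\<^bsub>quot_module M ?N\<^esub>}"
          using yvM yv coset_zero_iff[OF M N' yvM]
          by (simp add: w gc[OF yvM] quot_module_zero[OF M N'] qc[OF N(1)])
      qed
      show "{x \<in> carrier ?X. ?g x = \<zero>\<^bsub>quot_module M ?N\<^esub>} \<subseteq> (\<lambda>x. y \<odot>\<^bsub>?X\<^esub> x) ` carrier ?X"
      proof
        fix w assume "w \<in> {x \<in> carrier ?X. ?g x = \<zero>\<^bsub>quot_module M ?N\<^esub>}"
        then obtain v where v: "v \<in> carrier M" "w = N +>\<^bsub>M\<^esub> v" "?g w = \<zero>\<^bsub>quot_module M ?N\<^esub>"
          by (auto simp: qc[OF N(1)])
        then have "v \<in> ?N"
          using gc[OF v(1)] coset_zero_iff[OF M N' v(1)] by (simp add: quot_module_zero[OF M N'])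
        then obtain n m where nm: "n \<in> N" "m \<in> carrier M" "v = n \<oplus>\<^bsub>M\<^esub> y \<odot>\<^bsub>M\<^esub> m"
          by (auto simp: submodule_sum_def)
        have nM': "n \<in> carrier M" using nm(1) submodule_subset[OF N(1) M] by auto
        have ym: "y \<odot>\<^bsub>M\<^esub> m \<in> carrier M" using yR nm(2) by simp
        have "v \<ominus>\<^bsub>M\<^esub> y \<odot>\<^bsub>M\<^esub> m = n"
          using M.M.add_minus_cancel[OF ym nM'] nm(3) M.M.a_comm[OF nM' ym] by simp
        then have "w = N +>\<^bsub>M\<^esub> (y \<odot>\<^bsub>M\<^esub> m)"
          using v(1,2) ym nm(1) by (simp add: coset_eq_iff[OF M N(1)])
        also have "\<dots> = y \<odot>\<^bsub>?X\<^esub> (N +>\<^bsub>M\<^esub> m)" by (rule mod_hom_smult[OF pX yR nm(2)])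
        finally show "w \<in> (\<lambda>x. y \<odot>\<^bsub>?X\<^esub> x) ` carrier ?X" using nm(2) by (auto simp: qc[OF N(1)])
      qed
    qed
  qed
  then show False using N(2) by blast
qed

text \<open>Descending from \<open>b + 1\<close>. Vanishing for \<open>M\<close> above the current
  degree is first turned into vanishing for all primes of the support, which is the hypothesis that
  the step needs.\<close>

theorem ac_fin_gen:
  assumes nM: "noetherian_module R M"
    and fg: "\<And>i. Suc t \<le> i \<Longrightarrow> fin_gen_module R (cohomology (FC M) i)"
    and i: "Suc t \<le> i"
  shows "ac i M"
proof -
  note M = noetherian_moduleD[OF nM]
  \<comment> \<open>The claim covers all degrees from \<open>n\<close> on because
    \<open>ac_primes\<close> asks for vanishing in every higher degree, not only in the next
    one.\<close>
  have "\<forall>k\<ge>n. ac k M" if "Suc t \<le> n" "n \<le> Suc b" for n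
    using that(2,1)
  proof (induction n rule: inc_induct)
    case base
    then show ?case using ac_beyond[OF M] by simp
  next
    case (step n)
    then obtain j where n: "n = Suc j" "t \<le> j" by (cases n) auto
    have up: "ac k M" if "Suc n \<le> k" for k using step.IH step.prems that by simp
    have "ac (Suc j) M"
    proof (rule ac_fin_gen_step[OF nM])
      show "fin_gen_module R (cohomology (FC M) (Suc j))" using fg n by simp
      show "ac (Suc (Suc j)) (quo \<pp>)" if "\<pp> \<in> supp R M" for \<pp>
        by (rule ac_primes[OF nM _ _ that, of "Suc j"]) (use up n in simp_all)
    qed
    then show ?case using up n by (metis le_antisym not_less_eq_eq)
  qed
  from this[of "Suc t"] have "\<forall>k\<ge>Suc t. ac k M" using ac_beyond[OF M] by (cases "t \<le> b") auto
  then show ?thesis using i by blast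
qed

text \<open>The converse is that a zero module is generated by the empty set. The equivalence is
  later applied to \<open>M\<close> and to each \<open>R / \<pp>\<close>, which is Noetherian
  too.\<close>

theorem fin_gen_iff:
  assumes nM: "noetherian_module R M"
  shows "(\<forall>i\<ge>Suc t. fin_gen_module R (cohomology (FC M) i)) \<longleftrightarrow> (\<forall>i\<ge>Suc t. ac i M)"
proof
  show "\<forall>i\<ge>Suc t. ac i M" if "\<forall>i\<ge>Suc t. fin_gen_module R (cohomology (FC M) i)"
    using that ac_fin_gen[OF nM] by blast
next
  note cM = FC_is_cochain[OF noetherian_moduleD[OF nM]]
  assume a: "\<forall>i\<ge>Suc t. ac i M"
  show "\<forall>i\<ge>Suc t. fin_gen_module R (cohomology (FC M) i)"
  proof (intro allI impI)
    fix i assume "Suc t \<le> i"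
    then have "trivial_module (cohomology (FC M) i)" using a by (simp add: trivial_cohomology_iff[OF cM])
    then have c: "carrier (cohomology (FC M) i) = {\<zero>\<^bsub>cohomology (FC M) i\<^esub>}" by (simp add: trivial_module_def)
    note H = cohomology_module[OF cM, of i]
    have "submodule_gen R (cohomology (FC M) i) {} = {\<zero>\<^bsub>cohomology (FC M) i\<^esub>}"
      using submodule_gen_least[OF submodule_zero_submodule[OF H], of "{}"]
        submodule_zero[OF submodule_gen_submodule[OF H, of "{}"] H] by auto
    then show "fin_gen_module R (cohomology (FC M) i)"
      unfolding fin_gen_module_def c by (intro exI[of _ "{}"]) simp
  qed
qed

text \<open>From primes to \<open>M\<close> the prime filtration works in each degree separately;
  from \<open>M\<close> to primes all higher degrees are involved.\<close>

theorem primes_iff: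
  assumes nM: "noetherian_module R M"
  shows "(\<forall>i\<ge>Suc t. ac i M) \<longleftrightarrow> (\<forall>i\<ge>Suc t. \<forall>\<pp>\<in>supp R M. ac i (quo \<pp>))"
proof
  show "\<forall>i\<ge>Suc t. \<forall>\<pp>\<in>supp R M. ac i (quo \<pp>)" if "\<forall>i\<ge>Suc t. ac i M"
    using that ac_primes[OF nM] by blast
  assume a: "\<forall>i\<ge>Suc t. \<forall>\<pp>\<in>supp R M. ac i (quo \<pp>)"
  show "\<forall>i\<ge>Suc t. ac i M"
  proof (intro allI impI)
    fix i assume i: "Suc t \<le> i"
    then obtain j where j: "i = Suc j" by (cases i) auto
    show "ac i M" unfolding j by (rule ac_filtration[OF nM]) (use a i j in blast)
  qed
qed

end

section \<open>The Cech-formal complex\<close>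

text \<open>Two observations on multidegrees: a positive total degree has a positive slot, whose set
  contains \<open>xs ! k\<close> or 0, both in \<open>\<mm>\<close>; a total degree above the number
  of slots has a slot of degree at least 2, whose set contains 0.\<close>

lemma cech_local_formal_cochain:
  fixes R :: "('a, 'm) ring_scheme"
  assumes R: "noetherian_ring R" and loc: "local_ring R \<mm>" and \<aa>: "ideal \<aa> R" and J: "ideal J R"
    and xs: "generates_up_to_radical R xs \<mm>"
  defines "F \<equiv> \<lambda>k. cech_factor R (xs ! k) J"
  shows "local_formal_cochain R (cech_complex R xs J) (multidegrees (length xs))
    (tensor_part R (length xs) F)
    (\<lambda>e. prod_sets R (\<lambda>k. cech_set R (xs ! k) J (e k)) (length xs))
    (\<lambda>e. pure_tensor_family R {..<length xs} (\<lambda>k. obj (F k) (e k))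
       (\<lambda>k\<in>{..<length xs}. cech_unit R (xs ! k) J (e k)))
    \<aa> \<mm> (length xs)"
proof -
  interpret cring R using loc by (simp add: local_ring_def)
  interpret m: maximalideal \<mm> R using loc by (simp add: local_ring_def)
  interpret p: primeideal \<mm> R by (rule maximalideal_prime[OF m.is_maximalideal])
  have xc: "xs ! k \<in> carrier R" if "k < length xs" for k
    using xs that by (auto simp: generates_up_to_radical_def)
  have pow: "x \<in> \<mm>" if "x \<in> carrier R" "x [^]\<^bsub>R\<^esub> (n::nat) \<in> \<mm>" for x n
    using that(2)
  proof (induction n)
    case 0
    then show ?case using m.one_imp_carrier m.I_notcarr by simp
  next
    case (Suc n)
    then show ?case using p.I_prime[of "x [^]\<^bsub>R\<^esub> n" x] that(1) by auto
  qed
  \<comment> \<open>Each entry lies in the radical of the ideal generated by \<open>xs\<close>,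
    which is the radical of \<open>\<mm>\<close>; a prime ideal contains every element of its
    radical.\<close>
  have xm: "xs ! k \<in> \<mm>" if k: "k < length xs" for k
  proof -
    have "xs ! k \<in> Idl\<^bsub>R\<^esub> (set xs)"
      using genideal_self[of "set xs"] xs k by (auto simp: generates_up_to_radical_def)
    moreover have "xs ! k [^]\<^bsub>R\<^esub> (1::nat) = xs ! k" using xc[OF k] by simp
    ultimately have "xs ! k \<in> radical R (Idl\<^bsub>R\<^esub> (set xs))"
      using xc[OF k] unfolding radical_def by (metis (mono_tags, lifting) mem_Collect_eq)
    then have "xs ! k \<in> radical R \<mm>" using xs by (simp add: generates_up_to_radical_def)
    then show ?thesis using pow[OF xc[OF k]] by (auto simp: radical_def)
  qed
  have fam: "cochain_family R (length xs) F"
    unfolding F_def cochain_family_def cochain_family_axioms_def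
    using cech_factor_is_cochain[OF is_cring J xc] is_cring by blast
  have lf: "localized_family R (length xs) (\<lambda>k. obj (F k) (e k))
      (\<lambda>k. cech_set R (xs ! k) J (e k)) (\<lambda>k. cech_unit R (xs ! k) J (e k))" for e
    unfolding F_def localized_family_def localized_family_axioms_def
    using cech_factor_is_loc[OF is_cring J xc] is_cring by blast
  have mc: "mult_closed R (cech_set R (xs ! k) J (e k))" if "k < length xs" for e k
    by (rule localized_family.Sk[OF lf that])
  have mem: "cech_set R (xs ! k) J (e k) \<subseteq> prod_sets R (\<lambda>k. cech_set R (xs ! k) J (e k)) (length xs)"
    if "k < length xs" for e k
    by (rule prod_sets_member[where S = "\<lambda>k. cech_set R (xs ! k) J (e k)", OF is_cring _ that]) (rule mc)
  show ?thesis
  proof (intro local_formal_cochain.intro local_formal_cochain_axioms.intro formal_cochain.intro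
      formal_cochain_axioms.intro loc_cochain.intro loc_cochain_axioms.intro)
    show "cring R" by (rule is_cring)
    show "is_cochain R (cech_complex R xs J)"
      unfolding cech_complex_def using cochain_family.tensor_cochain_is_cochain[OF fam] by (simp add: F_def)
    show "obj (cech_complex R xs J) i = direct_sum (multidegrees (length xs) i) (tensor_part R (length xs) F)" for i
      by (simp add: cech_complex_def tensor_cochain_def tensor_cochain_obj_def F_def)
    show "finite (multidegrees (length xs) i)" for i
      by (rule cochain_family.E_finite[OF fam])
    show "is_loc R (prod_sets R (\<lambda>k. cech_set R (xs ! k) J (e k)) (length xs))
        (tensor_part R (length xs) F e)
        (pure_tensor_family R {..<length xs} (\<lambda>k. obj (F k) (e k))
          (\<lambda>k\<in>{..<length xs}. cech_unit R (xs ! k) J (e k)))" for e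
      unfolding tensor_part_def by (rule localized_family.family_is_loc[OF lf])
    show "ideal \<aa> R" by fact
    show "noetherian_ring R" by fact
    show "local_ring R \<mm>" by fact
    fix i and e :: "nat \<Rightarrow> nat"
    let ?P = "prod_sets R (\<lambda>k. cech_set R (xs ! k) J (e k)) (length xs)"
    show "\<exists>s\<in>?P. s \<in> \<mm>" if e: "e \<in> multidegrees (length xs) (Suc i)"
    proof -
      have "(\<Sum>k<length xs. e k) = Suc i" using e by (simp add: multidegrees_def)
      then have "(\<Sum>k<length xs. e k) \<noteq> 0" by simp
      then obtain k where k: "k < length xs" "e k \<noteq> 0" by (rule sum.not_neutral_contains_not_neutral) simp
      have "\<zero>\<^bsub>R\<^esub> \<in> J" using J by (intro additive_subgroup.zero_closed ideal.axioms(1))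
      \<comment> \<open>The exponent 1 with \<open>j = 0\<close> exhibits \<open>xs ! k\<close> in
        its own multiplicative set.\<close>
      moreover have "xs ! k = xs ! k [^]\<^bsub>R\<^esub> (1::nat) \<oplus>\<^bsub>R\<^esub> \<zero>\<^bsub>R\<^esub>" using xc[OF k(1)] by simp
      ultimately have "xs ! k \<in> mult_set R (xs ! k) J" unfolding mult_set_def by blast
      then have "\<exists>s\<in>cech_set R (xs ! k) J (e k). s \<in> \<mm>"
        using k xm[OF k(1)] m.zero_closed by (auto simp: cech_set_def)
      then show ?thesis using mem[OF k(1)] by blast
    qed
    show "\<zero>\<^bsub>R\<^esub> \<in> ?P" if e: "e \<in> multidegrees (length xs) i" "length xs < i"
    proof -
      \<comment> \<open>Pigeonhole: if all slots were at most 1, the total degree could not exceed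
        the number of slots.\<close>
      have "\<exists>k<length xs. 1 < e k"
      proof (rule ccontr)
        assume "\<not> ?thesis"
        then have "(\<Sum>k<length xs. e k) \<le> (\<Sum>k<length xs. 1)" by (intro sum_mono) (simp, meson not_less)
        then show False using e by (simp add: multidegrees_def)
      qed
      then obtain k where k: "k < length xs" "1 < e k" by blast
      then have "\<zero>\<^bsub>R\<^esub> \<in> cech_set R (xs ! k) J (e k)" by (simp add: cech_set_def)
      then show ?thesis using mem[OF k(1)] by blast
    qed
  qed
qed

text \<open>All four conditions are rewritten with \<open>acyclic_at\<close>. Finite generation
  becomes vanishing by \<open>fin_gen_iff\<close>, once for \<open>M\<close> and once for each prime
  of the support; \<open>primes_iff\<close> connects the two vanishing conditions.\<close>

theorem theorem6p1:
  fixes R :: "('a, 'm) ring_scheme" and M :: "('a, 'b) module"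
    and \<mm> \<aa> J :: "'a set" and xs :: "'a list" and t :: nat
  assumes "noetherian_ring R" and "local_ring R \<mm>"
    and "ideal \<aa> R" and "ideal J R"
    and "module R M" and "fin_gen_module R M" and "\<not> trivial_module M"
    and "generates_up_to_radical R xs \<mm>"
    and "t \<ge> 1"
  shows
    "((\<forall>i\<ge>t. trivial_module (cech_formal_cohomology R \<aa> xs J i M)) \<longleftrightarrow>
      (\<forall>i\<ge>t. fin_gen_module R (cech_formal_cohomology R \<aa> xs J i M))) \<and>
     ((\<forall>i\<ge>t. fin_gen_module R (cech_formal_cohomology R \<aa> xs J i M)) \<longleftrightarrow>
      (\<forall>i\<ge>t. \<forall>\<pp>\<in>supp R M. trivial_module
         (cech_formal_cohomology R \<aa> xs J i (quot_module (regular_module R) \<pp>)))) \<and>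
     ((\<forall>i\<ge>t. \<forall>\<pp>\<in>supp R M. trivial_module
         (cech_formal_cohomology R \<aa> xs J i (quot_module (regular_module R) \<pp>))) \<longleftrightarrow>
      (\<forall>i\<ge>t. \<forall>\<pp>\<in>supp R M. fin_gen_module R
         (cech_formal_cohomology R \<aa> xs J i (quot_module (regular_module R) \<pp>))))"
proof -
  interpret lf: local_formal_cochain R "cech_complex R xs J" "multidegrees (length xs)"
    "tensor_part R (length xs) (\<lambda>k. cech_factor R (xs ! k) J)"
    "\<lambda>e. prod_sets R (\<lambda>k. cech_set R (xs ! k) J (e k)) (length xs)"
    "\<lambda>e. pure_tensor_family R {..<length xs} (\<lambda>k. obj (cech_factor R (xs ! k) J) (e k))
       (\<lambda>k\<in>{..<length xs}. cech_unit R (xs ! k) J (e k))" \<aa> \<mm> "length xs"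
    by (rule cech_local_formal_cochain[OF assms(1-4,8)])
  \<comment> \<open>The identification with \<open>FC\<close> is needed at two types, since elements
    of \<open>R / \<pp>\<close> are cosets in \<open>R\<close> while those of \<open>M\<close> are
    arbitrary.\<close>
  have FC': "cech_formal_cohomology R \<aa> xs J i X = cohomology (lf.FC X) i" for i and X :: "('a, 'a set) module"
    by (simp add: cech_formal_cohomology_def cech_formal_complex_def lf.FC_def)
  have FCM: "cech_formal_cohomology R \<aa> xs J i M = cohomology (lf.FC M) i" for i
    by (simp add: cech_formal_cohomology_def cech_formal_complex_def lf.FC_def)
  note nM = fin_gen_noetherian[OF assms(1,5,6)]
  have np: "noetherian_module R (lf.quo \<pp>)" if "\<pp> \<in> supp R M" for \<pp>
    using suppD[OF that] by (intro lf.quo_noetherian) (simp add: primeideal_def)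
  have tM: "trivial_module (cohomology (lf.FC M) i) \<longleftrightarrow> lf.ac i M" for i
    by (rule trivial_cohomology_iff[OF lf.FC_is_cochain[OF assms(5)]])
  have tp: "trivial_module (cohomology (lf.FC (lf.quo \<pp>)) i) \<longleftrightarrow> lf.ac i (lf.quo \<pp>)" if "\<pp> \<in> supp R M" for \<pp> i
    by (rule trivial_cohomology_iff[OF lf.FC_is_cochain[OF noetherian_moduleD[OF np[OF that]]]])
  \<comment> \<open>With \<open>t\<close> a successor, all degrees in question are positive, as the
    results on \<open>acyclic_at\<close> require.\<close>
  obtain t' where t': "t = Suc t'" using assms(9) by (cases t) auto
  have 1: "(\<forall>i\<ge>t. fin_gen_module R (cohomology (lf.FC M) i)) \<longleftrightarrow> (\<forall>i\<ge>t. lf.ac i M)"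
    unfolding t' by (rule lf.fin_gen_iff[OF nM])
  have 2: "(\<forall>i\<ge>t. lf.ac i M) \<longleftrightarrow> (\<forall>i\<ge>t. \<forall>\<pp>\<in>supp R M. lf.ac i (lf.quo \<pp>))"
    unfolding t' by (rule lf.primes_iff[OF nM])
  have 3: "(\<forall>i\<ge>t. fin_gen_module R (cohomology (lf.FC (lf.quo \<pp>)) i)) \<longleftrightarrow> (\<forall>i\<ge>t. lf.ac i (lf.quo \<pp>))"
    if "\<pp> \<in> supp R M" for \<pp>
    unfolding t' by (rule lf.fin_gen_iff[OF np[OF that]])
  show ?thesis
    unfolding FCM FC' using 1 2 3 by (simp add: tM tp) blast
qed

end
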